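(* Let $j$ be a fixed integer with $0\le j\le d$, and let $(P,\gamma)$ be an instance of $j$-dimensional flat fitting with outliers, $P\subset\mathbb{R}^d$, $|P|=n$, $\gamma\in(0,1)$. Let $\epsilon,\delta,\eta_1,\eta_2\in(0,1)$. There exists a randomized algorithm that outputs a $(1+\epsilon,1-\delta)$-approximation with probability at least $(1-\gamma)\big((1-\eta_1)(1-\eta_2)\frac{\delta}{3(\gamma+\delta)}\big)^{g(j,\epsilon)}$, where $g(j,\epsilon)=\mathrm{poly}(e^{O(j^2)},\frac1{\epsilon^j})$, and whose running time is $O(2^{g'(j,\epsilon,\delta,\gamma)}d)$ with $g'(j,\epsilon,\delta,\gamma)=\mathrm{poly}(e^{O(j^2)},\frac1{\epsilon^j},\frac1\delta,\frac1\gamma)$. Moreover, if one repeatedly runs the algorithm $N=O\Big(\frac{1}{1-\gamma}\big(\frac{1}{1-\eta_1}\cdot\frac{3(\gamma+\delta)}{\delta}\big)^{g(j,\epsilon)}\Big)$ times with $\eta_2=O\big(\frac{1}{2^{g(j,\epsilon)}N}\big)$, then with constant probability it outputs a $(1+\epsilon,1-\delta)$-approximation.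
   Context: For a $j$-dimensional affine flat $\mathcal F\subset\mathbb{R}^d$ and $p\in\mathbb{R}^d$, $\mathrm{dist}(\mathcal F,p)$ is the Euclidean distance from $p$ to its orthogonal projection onto $\mathcal F$. Flat fitting with outliers: given $n$ points $P\subset\mathbb{R}^d$ and $\gamma\in(0,1)$, find a subset $P'\subset P$ with $|P'|=(1-\gamma)n$ and a $j$-flat $\mathcal F$ minimizing $\max_{p\in P'}\mathrm{dist}(\mathcal F,p)$; let $w^*$ be the optimal value. A $(1+\epsilon,1-\delta)$-approximation is a $j$-flat $\mathcal F$ such that at least $(1-\delta-\gamma)n$ points of $P$ satisfy $\mathrm{dist}(\mathcal F,p)\le(1+\epsilon)w^*$. Model: unit-cost RAM with constant-time coordinate access and uniform random sampling of input points.
   Formalization: For j = 0 the bounds on g and g' use 1/ε in place of 1/ε^j = 1, since without dependence on ε the claim is false for enclosing balls in high dimension; |P'| = (1−γ)n is rounded up when it is not an integer, and n, d ≥ 1 is assumed. *)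

theory Defs
  imports "HOL-Probability.Probability" "Jordan_Normal_Form.VS_Connect"
begin

type_synonym rvec = "real Matrix.vec"

section \<open>Flat fitting with outliers\<close>

abbreviation euclid :: "nat \<Rightarrow> (real, rvec) module" where
  "euclid d \<equiv> module_vec TYPE(real) d"

definition is_flat :: "nat \<Rightarrow> nat \<Rightarrow> rvec set \<Rightarrow> bool" where
  "is_flat d j F \<longleftrightarrow> (\<exists>b W. b \<in> carrier_vec d \<and>
     VectorSpace.subspace class_ring W (euclid d) \<and>
     vectorspace.dim class_ring ((euclid d)\<lparr>carrier := W\<rparr>) = j \<and>
     F = {b + w | w. w \<in> W})"

definition orth_proj :: "rvec set \<Rightarrow> rvec \<Rightarrow> rvec" where
  "orth_proj F p = (THE q. q \<in> F \<and> (\<forall>x\<in>F. scalar_prod (p - q) (x - q) = 0))"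

definition flat_dist :: "rvec set \<Rightarrow> rvec \<Rightarrow> real" where
  "flat_dist F p = (let v = p - orth_proj F p in sqrt (scalar_prod v v))"

text \<open>If \<open>(1 - \<gamma>) n\<close> is not an integer, the number of inliers is rounded up.\<close>

definition opt_width :: "nat \<Rightarrow> nat \<Rightarrow> rvec set \<Rightarrow> real \<Rightarrow> real" where
  "opt_width d j P \<gamma> = Inf {Max (flat_dist F ` P') | F P'.
     is_flat d j F \<and> P' \<subseteq> P \<and> card P' = nat \<lceil>(1 - \<gamma>) * real (card P)\<rceil>}"

text \<open>\<open>is_approx d j P \<gamma> \<epsilon> \<delta> F\<close>: the set \<open>F\<close> is a \<open>(1 + \<epsilon>, 1 - \<delta>)\<close>-approximation.\<close>

definition is_approx ::
  "nat \<Rightarrow> nat \<Rightarrow> rvec set \<Rightarrow> real \<Rightarrow> real \<Rightarrow> real \<Rightarrow> rvec set \<Rightarrow> bool" where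
  "is_approx d j P \<gamma> \<epsilon> \<delta> F \<longleftrightarrow> is_flat d j F \<and>
     real (card {p \<in> P. flat_dist F p \<le> (1 + \<epsilon>) * opt_width d j P \<gamma>})
       \<ge> (1 - \<delta> - \<gamma>) * real (card P)"

section \<open>A unit-cost RAM with random sampling of input points\<close>

text \<open>
  The memory has a part for natural numbers (counters, addresses, point indices) and a part for
  real numbers, both with indirect addressing.  Programs contain no real constants (an arbitrary
  real constant could hard-wire unbounded advice) and reals cannot be rounded to integers.
  Jump targets are absolute positions in the program; a program halts when it runs off its end.
\<close>

datatype nat_op = NPlus | NMinus | NTimes | NDiv

datatype real_op = RPlus | RMinus | RTimes | RDiv

datatype instr =
    NConst nat nat           \<comment> \<open>\<open>n[a] := c\<close>\<close>
  | NOp nat_op nat nat nat   \<comment> \<open>\<open>n[a] := n[b] op n[c]\<close>\<close>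
  | NLoad nat nat            \<comment> \<open>\<open>n[a] := n[n[b]]\<close>\<close>
  | NStore nat nat           \<comment> \<open>\<open>n[n[a]] := n[b]\<close>\<close>
  | ROfNat nat nat           \<comment> \<open>\<open>r[a] := n[b]\<close>\<close>
  | ROp real_op nat nat nat  \<comment> \<open>\<open>r[a] := r[b] op r[c]\<close>\<close>
  | RSqrt nat nat            \<comment> \<open>\<open>r[a] := sqrt r[b]\<close>\<close>
  | RLoad nat nat            \<comment> \<open>\<open>r[a] := r[n[b]]\<close>\<close>
  | RStore nat nat           \<comment> \<open>\<open>r[n[a]] := r[b]\<close>\<close>
  | Coord nat nat nat        \<comment> \<open>\<open>r[a] :=\<close> coordinate \<open>n[c]\<close> of input point \<open>n[b]\<close>\<close>
  | Sample nat               \<comment> \<open>\<open>n[a] :=\<close> uniformly random index of an input point\<close>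
  | Jump nat
  | JumpNLess nat nat nat    \<comment> \<open>jump to the third argument if \<open>n[a] < n[b]\<close>\<close>
  | JumpRLess nat nat nat    \<comment> \<open>jump to the third argument if \<open>r[a] < r[b]\<close>\<close>

type_synonym program = "instr list"

record state =
  pc :: nat
  nmem :: "nat \<Rightarrow> nat"
  rmem :: "nat \<Rightarrow> real"

fun nat_fun :: "nat_op \<Rightarrow> nat \<Rightarrow> nat \<Rightarrow> nat" where
  "nat_fun NPlus x y = x + y"
| "nat_fun NMinus x y = x - y"
| "nat_fun NTimes x y = x * y"
| "nat_fun NDiv x y = x div y"

fun real_fun :: "real_op \<Rightarrow> real \<Rightarrow> real \<Rightarrow> real" where
  "real_fun RPlus x y = x + y"
| "real_fun RMinus x y = x - y"
| "real_fun RTimes x y = x * y"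
| "real_fun RDiv x y = x / y"

definition coord :: "rvec list \<Rightarrow> nat \<Rightarrow> nat \<Rightarrow> real" where
  "coord ps i k = (if i < length ps \<and> k < dim_vec (ps ! i) then vec_index (ps ! i) k else 0)"

definition set_n :: "nat \<Rightarrow> nat \<Rightarrow> state \<Rightarrow> state" where
  "set_n a x s = s\<lparr>pc := Suc (pc s), nmem := (nmem s)(a := x)\<rparr>"

definition set_r :: "nat \<Rightarrow> real \<Rightarrow> state \<Rightarrow> state" where
  "set_r a x s = s\<lparr>pc := Suc (pc s), rmem := (rmem s)(a := x)\<rparr>"

definition jump_if :: "bool \<Rightarrow> nat \<Rightarrow> state \<Rightarrow> state" where
  "jump_if b l s = s\<lparr>pc := (if b then l else Suc (pc s))\<rparr>"

fun exec :: "rvec list \<Rightarrow> instr \<Rightarrow> state \<Rightarrow> state pmf" where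
  "exec ps (NConst a c) s = return_pmf (set_n a c s)"
| "exec ps (NOp f a b c) s = return_pmf (set_n a (nat_fun f (nmem s b) (nmem s c)) s)"
| "exec ps (NLoad a b) s = return_pmf (set_n a (nmem s (nmem s b)) s)"
| "exec ps (NStore a b) s = return_pmf (set_n (nmem s a) (nmem s b) s)"
| "exec ps (ROfNat a b) s = return_pmf (set_r a (real (nmem s b)) s)"
| "exec ps (ROp f a b c) s = return_pmf (set_r a (real_fun f (rmem s b) (rmem s c)) s)"
| "exec ps (RSqrt a b) s = return_pmf (set_r a (sqrt (rmem s b)) s)"
| "exec ps (RLoad a b) s = return_pmf (set_r a (rmem s (nmem s b)) s)"
| "exec ps (RStore a b) s = return_pmf (set_r (nmem s a) (rmem s b) s)"
| "exec ps (Coord a b c) s = return_pmf (set_r a (coord ps (nmem s b) (nmem s c)) s)"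
| "exec ps (Sample a) s = map_pmf (\<lambda>i. set_n a i s) (pmf_of_set {..<length ps})"
| "exec ps (Jump l) s = return_pmf (jump_if True l s)"
| "exec ps (JumpNLess a b l) s = return_pmf (jump_if (nmem s a < nmem s b) l s)"
| "exec ps (JumpRLess a b l) s = return_pmf (jump_if (rmem s a < rmem s b) l s)"

definition halted :: "program \<Rightarrow> state \<Rightarrow> bool" where
  "halted A s \<longleftrightarrow> length A \<le> pc s"

definition step :: "program \<Rightarrow> rvec list \<Rightarrow> state \<Rightarrow> state pmf" where
  "step A ps s = (if halted A s then return_pmf s else exec ps (A ! pc s) s)"

text \<open>Input parameters, in this order: \<open>n, d, j\<close> and \<open>\<gamma>, \<epsilon>, \<delta>, \<eta>\<^sub>1, \<eta>\<^sub>2\<close>.\<close>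

definition init_state :: "nat list \<Rightarrow> real list \<Rightarrow> state" where
  "init_state ns rs = \<lparr>pc = 0,
     nmem = (\<lambda>a. if a < length ns then ns ! a else 0),
     rmem = (\<lambda>a. if a < length rs then rs ! a else 0)\<rparr>"

definition run :: "program \<Rightarrow> rvec list \<Rightarrow> state \<Rightarrow> nat \<Rightarrow> state pmf" where
  "run A ps s t = ((\<lambda>q. bind_pmf q (step A ps)) ^^ t) (return_pmf s)"

definition halts_within :: "program \<Rightarrow> rvec list \<Rightarrow> state \<Rightarrow> nat \<Rightarrow> bool" where
  "halts_within A ps s t \<longleftrightarrow> (\<forall>s' \<in> set_pmf (run A ps s t). halted A s')"

text \<open>The worst case over all random choices; meaningful only if some \<open>t\<close> exists.\<close>

definition running_time :: "program \<Rightarrow> rvec list \<Rightarrow> state \<Rightarrow> nat" where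
  "running_time A ps s = (LEAST t. halts_within A ps s t)"

text \<open>
  The output is a base point followed by \<open>j\<close> direction vectors, stored consecutively in the real
  memory from address \<open>n[0]\<close> on.
\<close>

definition output_flat :: "nat \<Rightarrow> nat \<Rightarrow> state \<Rightarrow> rvec set" where
  "output_flat d j s =
     (let v = (\<lambda>i. Matrix.vec d (\<lambda>k. rmem s (nmem s 0 + i * d + k)))
      in {v 0 + w | w. w \<in> module.span class_ring (euclid d) (v ` {1..j})})"

definition output_pmf ::
  "program \<Rightarrow> nat \<Rightarrow> nat \<Rightarrow> rvec list \<Rightarrow> state \<Rightarrow> rvec set pmf" where
  "output_pmf A d j ps s = map_pmf (output_flat d j) (run A ps s (running_time A ps s))"

section \<open>Repetition\<close>

text \<open>
  Repeated runs return the best of the flats found: the one for which the smallest radius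
  covering at least \<open>\<alpha> n\<close> points is minimal, where \<open>\<alpha> = 1 - \<delta> - \<gamma>\<close>.
\<close>

definition cover_width :: "rvec set \<Rightarrow> real \<Rightarrow> rvec set \<Rightarrow> real" where
  "cover_width P \<alpha> F =
     Inf {w. 0 \<le> w \<and> real (card {p \<in> P. flat_dist F p \<le> w}) \<ge> \<alpha> * real (card P)}"

definition best_flat ::
  "nat \<Rightarrow> nat \<Rightarrow> rvec set \<Rightarrow> real \<Rightarrow> rvec set list \<Rightarrow> rvec set" where
  "best_flat d j P \<alpha> Fs = arg_min (cover_width P \<alpha>) (\<lambda>F. F \<in> set Fs \<and> is_flat d j F)"

end

theory Submission
  imports Defs "Jordan_Normal_Form.DL_Rank"
begin

text \<open>
  The algorithm starts from a random input point and guesses: whenever it needs an inlier far away from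
  the current flat, it takes the farthest of about \<open>1 / (2 (\<gamma> + \<delta>))\<close> random points, and whenever it has to
  make a discrete choice, it tosses a coin. Only runs in which all guesses are right are analysed, and
  the number of guesses is bounded in terms of \<open>j\<close> and \<open>\<epsilon>\<close>.

  A greedy phase collects residual directions that grow geometrically in comparison with the optimal
  width \<open>w\<close>; hence they can be turned into an orthonormal basis of the optimal flat with an error of
  order \<open>5\<^sup>j w\<close>, and every inlier has coordinates of bounded size with respect to it. Starting from
  this frame, a perceptron argument repairs the flat: as long as \<open>F\<close> is not an approximation, a sampled
  inlier \<open>p\<close> at distance more than \<open>(1 + \<epsilon>) w\<close> is found, its coordinates in the optimal frame
  are guessed on a grid of mesh \<open>\<sigma> / H\<close>, and the frame is moved along the residual of \<open>p\<close>. Each such step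
  decreases the squared distance to the optimal frame by a fixed fraction of \<open>w\<^sup>2\<close>, so that \<open>H\<^sup>3\<close> steps
  are enough.

  The infimum \<open>w\<^sup>*\<close> need not be attained. The analysis is carried out for every \<open>w > w\<^sup>*\<close>, and since the
  program does not know \<open>w\<close>, letting \<open>w\<close> tend to \<open>w\<^sup>*\<close> gives the bound for \<open>w\<^sup>*\<close> itself.
\<close>

section \<open>Orthonormal systems and projections\<close>

text \<open>The program can check neither that a sampled point is an inlier nor that the current
  flat is good enough. So every round first tosses a coin whether to stop, and correctness is an
  expected-value calculus: a function \<open>v k s\<close> bounds from below the probability of
  success from state \<open>s\<close> on after \<open>k\<close> rounds, and it may drop to 0 as soon
  as a guess goes wrong. With a single input point the coin is constant; but then the first flat is
  already an approximation.

  With unit vectors as frame, the coordinates of the inliers would be unbounded in terms of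
  \<open>w\<close>, and so would be the number of correction steps. The perceptron therefore works
  on frame vectors scaled by their greedy lengths \<open>L i\<close>: in this scale the inlier
  coordinates are bounded in terms of \<open>j\<close>, and the distance to the ideal frame is
  \<open>w\<close> times a constant depending on \<open>j\<close>. This makes the number of steps
  independent of \<open>n\<close>, \<open>d\<close> and the spread of the data.

  The single number \<open>H = scale_param j \<epsilon>\<close> is the range of the grid, the
  inverse of its mesh and of the step size, and its cube is the number of rounds.\<close>

declare One_nat_def [simp del]

text \<open>Indices start at 1 because index 0 of a frame is reserved for its base point.\<close>

definition ons :: "(nat \<Rightarrow> 'a::real_inner) \<Rightarrow> nat \<Rightarrow> bool" where
  "ons u m \<longleftrightarrow> (\<forall>i\<in>{1..m}. \<forall>k\<in>{1..m}. inner (u i) (u k) = (if i = k then 1 else 0))"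

lemma ons_norm: "ons u m \<Longrightarrow> i \<in> {1..m} \<Longrightarrow> norm (u i) = 1"
  by (auto simp: ons_def norm_eq_sqrt_inner)

lemma inner_span_zero:
  assumes "\<And>y. y \<in> B \<Longrightarrow> inner (r :: 'a::real_inner) y = 0" "y \<in> span B"
  shows "inner r y = 0"
  using assms(2)
proof (induction rule: span_induct_alt)
  case (step c x y)
  then show ?case by (simp add: inner_add_right assms(1))
qed auto

lemma ons_sum_inner:
  assumes "ons u m" "k \<in> {1..m}"
  shows "inner (\<Sum>i=1..m. c i *\<^sub>R u i) (u k) = c k"
proof -
  have "inner (\<Sum>i=1..m. c i *\<^sub>R u i) (u k) = (\<Sum>i=1..m. if i = k then c i else 0)"
    unfolding inner_sum_left using assms by (intro sum.cong) (auto simp: ons_def)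
  also have "\<dots> = c k" using assms(2) by simp
  finally show ?thesis .
qed

lemma ons_residual_orthogonal:
  assumes "ons u m" "y \<in> span (u ` {1..m})"
  shows "inner (x - (\<Sum>i=1..m. inner x (u i) *\<^sub>R u i)) y = 0"
  using assms(2)
  by (rule inner_span_zero[rotated]) (auto simp: inner_diff_left ons_sum_inner[OF assms(1)])

lemma ons_sum_in_span: "(\<Sum>i=1..m. c i *\<^sub>R u i) \<in> span (u ` {1..m::nat})"
  by (intro span_sum span_scale span_base) auto

lemma ons_extend:
  fixes u :: "nat \<Rightarrow> 'a::real_inner"
  assumes "ons u m" "r \<noteq> 0" "\<And>i. i \<in> {1..m} \<Longrightarrow> inner r (u i) = 0"
  shows "ons (u(Suc m := (1 / norm r) *\<^sub>R r)) (Suc m)"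
proof -
  have "inner ((1 / norm r) *\<^sub>R r) ((1 / norm r) *\<^sub>R r) = 1"
    using assms(2) by (simp add: power2_norm_eq_inner[symmetric] power2_eq_square)
  then show ?thesis
    using assms(1,3) unfolding ons_def
    by (auto simp: inner_commute le_Suc_eq)
qed

lemma span_ons_extend:
  fixes u :: "nat \<Rightarrow> 'a::real_inner"
  assumes "span (u ` {1..m}) = span B" "b - r \<in> span B" "r \<noteq> 0"
  shows "span ((u(Suc m := (1 / norm r) *\<^sub>R r)) ` {1..Suc m}) = span (insert b B)"
proof -
  have im: "(u(Suc m := (1 / norm r) *\<^sub>R r)) ` {1..Suc m} = insert ((1 / norm r) *\<^sub>R r) (u ` {1..m})"
    by (auto simp: image_iff le_Suc_eq)
  have r: "r \<in> span (insert b B)"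
    using span_diff[of b "insert b B" "b - r"] assms(2) span_mono[of B "insert b B"]
    by (auto intro: span_base)
  have sub: "span B \<subseteq> span (insert b B)" by (rule span_mono) auto
  have 1: "insert ((1 / norm r) *\<^sub>R r) (u ` {1..m}) \<subseteq> span (insert b B)"
    using r sub assms(1) span_superset[of "u ` {1..m}"] by (auto intro!: span_scale)
  let ?I = "insert ((1 / norm r) *\<^sub>R r) (u ` {1..m})"
  have sub2: "span B \<subseteq> span ?I" unfolding assms(1)[symmetric] by (rule span_mono) auto
  have "norm r *\<^sub>R ((1 / norm r) *\<^sub>R r) \<in> span ?I" by (intro span_scale span_base) auto
  then have "r \<in> span ?I" using assms(3) by simp
  then have "b \<in> span ?I" using span_add[of "b - r" ?I r] assms(2) sub2 by auto
  then have 2: "insert b B \<subseteq> span ?I" using sub2 span_superset[of B] by auto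
  show ?thesis unfolding im using 1 2
    by (metis span_mono span_span subset_antisym)
qed

lemma gram_schmidt_exists:
  fixes B :: "'a::real_inner set"
  assumes "finite B"
  shows "\<exists>E m. ons E m \<and> span (E ` {1..m}) = span B \<and> m \<le> card B"
  using assms
proof (induction B)
  case empty
  show ?case by (intro exI[of _ "\<lambda>_. 0"] exI[of _ 0]) (auto simp: ons_def)
next
  case (insert b B)
  then obtain E m where E: "ons E m" "span (E ` {1..m}) = span B" "m \<le> card B" by blast
  define r where "r = b - (\<Sum>i=1..m. inner b (E i) *\<^sub>R E i)"
  have br: "b - r \<in> span B" unfolding r_def E(2)[symmetric] by (simp add: ons_sum_in_span)
  show ?case
  proof (cases "r = 0")
    case True
    then have "span (insert b B) = span B" using br by (simp add: span_redundant)
    then show ?thesis using E insert(1,2) by (intro exI[of _ E] exI[of _ m]) auto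
  next
    case False
    have "ons (E(Suc m := (1 / norm r) *\<^sub>R r)) (Suc m)"
      by (rule ons_extend[OF E(1) False])
        (unfold r_def, rule ons_residual_orthogonal[OF E(1)], auto intro: span_base)
    with span_ons_extend[OF E(2) br False] E(3) insert(1,2) show ?thesis
      by (intro exI[of _ "E(Suc m := (1 / norm r) *\<^sub>R r)"] exI[of _ "Suc m"]) (auto simp del: fun_upd_apply)
  qed
qed

text \<open>The residual of \<open>x\<close> after orthogonal projection onto \<open>W\<close>.
  Without completeness it need not exist; here \<open>W\<close> is always the span of a finite set,
  for which Gram-Schmidt provides it.\<close>

definition perp :: "'a::real_inner set \<Rightarrow> 'a \<Rightarrow> 'a" where
  "perp W x = (THE r. x - r \<in> W \<and> (\<forall>y\<in>W. inner r y = 0))"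

lemma perp_eqI:
  assumes "x - r \<in> span B" "\<And>y. y \<in> span B \<Longrightarrow> inner r y = 0"
  shows "perp (span B) x = r"
  unfolding perp_def
proof (rule the_equality)
  fix r' assume r': "x - r' \<in> span B \<and> (\<forall>y\<in>span B. inner r' y = 0)"
  have "(x - r) - (x - r') \<in> span B" using span_diff[OF assms(1) conjunct1[OF r']] .
  then have d: "r' - r \<in> span B" by simp
  then have "inner (r' - r) (r' - r) = 0" using r' assms(2) by (simp add: inner_diff_left)
  then show "r' = r" by simp
qed (use assms in auto)

lemma perp_ons:
  assumes "ons E m"
  shows "perp (span (E ` {1..m})) x = x - (\<Sum>i=1..m. inner x (E i) *\<^sub>R E i)"
  by (rule perp_eqI) (auto simp: ons_sum_in_span ons_residual_orthogonal[OF assms])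

lemma perp_span:
  assumes "finite B"
  shows "x - perp (span B) x \<in> span B" "y \<in> span B \<Longrightarrow> inner (perp (span B) x) y = 0"
proof -
  obtain E m where E: "ons E m" "span (E ` {1..m}) = span B"
    using gram_schmidt_exists[OF assms] by blast
  show "x - perp (span B) x \<in> span B"
    using perp_ons[OF E(1), of x] E(2) ons_sum_in_span[of "\<lambda>i. inner x (E i)" E m] by simp
  show "inner (perp (span B) x) y = 0" if "y \<in> span B"
    using perp_ons[OF E(1), of x] E(2) ons_residual_orthogonal[OF E(1), of y x] that by simp
qed

lemma perp_zero: "finite B \<Longrightarrow> y \<in> span B \<Longrightarrow> perp (span B) y = 0"
  by (rule perp_eqI) auto

lemma perp_add:
  assumes "finite B"
  shows "perp (span B) (x + y) = perp (span B) x + perp (span B) y"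
proof (rule perp_eqI)
  have "(x - perp (span B) x) + (y - perp (span B) y) \<in> span B"
    by (intro span_add perp_span assms)
  then show "x + y - (perp (span B) x + perp (span B) y) \<in> span B" by (simp add: algebra_simps)
qed (auto simp: inner_add_left perp_span[OF assms])

lemma perp_scale:
  assumes "finite B"
  shows "perp (span B) (c *\<^sub>R x) = c *\<^sub>R perp (span B) x"
proof (rule perp_eqI)
  have "c *\<^sub>R (x - perp (span B) x) \<in> span B"
    by (intro span_scale perp_span assms)
  then show "c *\<^sub>R x - c *\<^sub>R perp (span B) x \<in> span B" by (simp add: algebra_simps)
qed (auto simp: perp_span[OF assms])

lemma perp_diff:
  assumes "finite B"
  shows "perp (span B) (x - y) = perp (span B) x - perp (span B) y"
  using perp_add[OF assms, of x "(-1) *\<^sub>R y"] perp_scale[OF assms, of "-1" y] by simp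

lemma perp_sum:
  assumes "finite B"
  shows "perp (span B) (\<Sum>i\<in>A. f i) = (\<Sum>i\<in>A. perp (span B) (f i))"
proof (induction A rule: infinite_finite_induct)
  case (insert x F)
  then show ?case by (simp add: perp_add[OF assms])
qed (simp_all add: perp_zero[OF assms] span_zero)

text \<open>Pythagoras: the residual is the shortest vector from the subspace to \<open>x\<close>.
  Upper bounds on distances are obtained below by exhibiting one vector of the subspace.\<close>

lemma norm_perp_le:
  assumes "finite B" "y \<in> span B"
  shows "norm (perp (span B) x) \<le> norm (x - y)"
proof -
  define r c where "r = perp (span B) x" and "c = x - perp (span B) x - y"
  have "c \<in> span B" unfolding c_def by (intro span_diff perp_span assms)
  then have "inner r c = 0" unfolding r_def by (rule perp_span(2)[OF assms(1)])
  then have "(norm (r + c))\<^sup>2 = (norm r)\<^sup>2 + (norm c)\<^sup>2"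
    by (simp add: power2_norm_eq_inner inner_add_left inner_add_right inner_commute)
  moreover have "x - y = r + c" by (simp add: r_def c_def)
  ultimately have "(norm r)\<^sup>2 \<le> (norm (x - y))\<^sup>2" by simp
  then show ?thesis unfolding r_def by (rule power2_le_imp_le) simp
qed

text \<open>The reflection exchanging \<open>u (Suc l)\<close> and \<open>g\<close> maps one orthonormal basis to the other.\<close>

lemma ons_exchange:
  fixes u :: "nat \<Rightarrow> 'a::real_inner"
  assumes u: "ons u j" and l: "l < j" and g: "g \<in> span (u ` {1..j})" "norm g = 1"
    and perp: "\<And>i. i \<in> {1..l} \<Longrightarrow> inner g (u i) = 0"
  obtains u' where "ons u' j" "span (u' ` {1..j}) = span (u ` {1..j})"
    "\<And>i. i \<in> {1..l} \<Longrightarrow> u' i = u i" "u' (Suc l) = g"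
proof (cases "u (Suc l) = g")
  case True
  then show ?thesis using that[of u] u by auto
next
  case False
  define n where "n = u (Suc l) - g"
  define N where "N = inner n n"
  have N: "N \<noteq> 0" using False by (simp add: N_def n_def)
  define h where "h x = x - (2 * inner x n / N) *\<^sub>R n" for x
  have Sl: "Suc l \<in> {1..j}" using l by simp
  have gg: "inner g g = 1" using g(2) by (simp add: norm_eq_sqrt_inner)
  have uu: "inner (u (Suc l)) (u (Suc l)) = 1" using u Sl by (simp add: ons_def)
  have inner_h: "inner (h x) (h y) = inner x y" for x y
  proof -
    have "inner (h x) (h y) = inner x y - 2 * (2 * inner x n * inner y n / N)
        + (2 * inner x n / N) * (2 * inner y n / N) * N"
      by (simp add: h_def inner_diff_left inner_diff_right inner_commute N_def)
    then show ?thesis using N by (simp add: field_simps)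
  qed
  have hh: "h (h x) = x" for x
  proof -
    have "inner (h x) n = - inner x n"
      using N by (simp add: h_def inner_diff_left N_def[symmetric])
    then have "h (h x) = h x + (2 * inner x n / N) *\<^sub>R n"
      by (subst (1) h_def) simp
    then show ?thesis by (simp add: h_def)
  qed
  have nspan: "n \<in> span (u ` {1..j})" unfolding n_def using Sl g(1)
    by (intro span_diff) (auto intro: span_base)
  have ons': "ons (h \<circ> u) j" using u by (simp add: ons_def inner_h)
  have sub1: "(h \<circ> u) ` {1..j} \<subseteq> span (u ` {1..j})"
    using nspan by (auto simp: h_def intro!: span_diff span_scale intro: span_base)
  have hspan: "h x \<in> span ((h \<circ> u) ` {1..j})" if "x \<in> span (u ` {1..j})" for x
    using that
  proof (induction rule: span_induct_alt)
    case base
    then show ?case by (simp add: h_def span_zero)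
  next
    case (step c x y)
    have "h (c *\<^sub>R x + y) = c *\<^sub>R h x + h y"
      using N by (simp add: h_def inner_add_left algebra_simps add_divide_distrib)
    moreover have "h x \<in> span ((h \<circ> u) ` {1..j})" using step(1) by (auto intro: span_base)
    ultimately show ?case using step by (auto intro!: span_add span_scale)
  qed
  have eq: "span ((h \<circ> u) ` {1..j}) = span (u ` {1..j})"
  proof
    show "span ((h \<circ> u) ` {1..j}) \<subseteq> span (u ` {1..j})"
      using span_mono[OF sub1] by (simp add: span_span)
    show "span (u ` {1..j}) \<subseteq> span ((h \<circ> u) ` {1..j})"
    proof
      fix x assume x: "x \<in> span (u ` {1..j})"
      have "h x \<in> span (u ` {1..j})" unfolding h_def using x nspan by (intro span_diff span_scale) auto
      from hspan[OF this] show "x \<in> span ((h \<circ> u) ` {1..j})" by (simp add: hh)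
    qed
  qed
  have fix1: "(h \<circ> u) i = u i" if "i \<in> {1..l}" for i
  proof -
    have "inner (u i) n = 0" using that u l perp[OF that] Sl
      by (auto simp: n_def inner_diff_right ons_def inner_commute)
    then show ?thesis by (simp add: h_def)
  qed
  have "N = 2 * inner (u (Suc l)) n"
    by (simp add: N_def n_def inner_diff_left inner_diff_right gg uu inner_commute)
  then have "(h \<circ> u) (Suc l) = g" using N by (simp add: h_def n_def)
  then show ?thesis using that[OF ons' eq fix1] by auto
qed

text \<open>State of the greedy phase after \<open>l\<close> vectors; \<open>S\<close> are the
  inliers kept, \<open>v\<^sub>0\<close> is the start point. Every kept inlier has coordinates at
  most 1 along each \<open>f i\<close>, and its residual is no longer than any \<open>f i\<close>.
  The hidden basis \<open>g\<close> of \<open>U\<close> matches the \<open>f i\<close> up to an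
  absolute error \<open>5 ^ i * w\<close>, so the direction of a longer \<open>f i\<close> is
  matched more accurately.\<close>

definition frame_inv ::
  "nat \<Rightarrow> real \<Rightarrow> 'a::real_inner set \<Rightarrow> 'a \<Rightarrow> (nat \<Rightarrow> 'a) \<Rightarrow> nat \<Rightarrow> 'a set \<Rightarrow> bool" where
  "frame_inv j w U v\<^sub>0 f l S \<longleftrightarrow> l \<le> j \<and>
     (\<forall>i\<in>{1..l}. \<forall>k\<in>{1..l}. i \<noteq> k \<longrightarrow> inner (f i) (f k) = 0) \<and> (\<forall>i\<in>{1..l}. f i \<noteq> 0) \<and>
     (\<forall>p\<in>S. \<forall>i\<in>{1..l}. \<bar>inner (p - v\<^sub>0) (f i)\<bar> \<le> (norm (f i))\<^sup>2 \<and>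
        norm (perp (span (f ` {1..l})) (p - v\<^sub>0)) \<le> norm (f i)) \<and>
     (\<exists>g. ons g j \<and> span (g ` {1..j}) = U \<and>
        (\<forall>i\<in>{1..l}. norm (norm (f i) *\<^sub>R g i - f i) \<le> 5 ^ i * w))"

lemma perp_orthogonal_family:
  fixes f :: "nat \<Rightarrow> 'a::real_inner"
  assumes "\<forall>i\<in>{1..l}. \<forall>k\<in>{1..l}. i \<noteq> k \<longrightarrow> inner (f i) (f k) = 0"
  shows "perp (span (f ` {1..l})) x = x - (\<Sum>i=1..l. (inner x (f i) / (norm (f i))\<^sup>2) *\<^sub>R f i)"
proof (rule perp_eqI)
  show "x - (x - (\<Sum>i=1..l. (inner x (f i) / (norm (f i))\<^sup>2) *\<^sub>R f i)) \<in> span (f ` {1..l})"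
    by (simp add: ons_sum_in_span)
next
  fix y assume "y \<in> span (f ` {1..l})"
  then show "inner (x - (\<Sum>i=1..l. (inner x (f i) / (norm (f i))\<^sup>2) *\<^sub>R f i)) y = 0"
  proof (rule inner_span_zero[rotated])
    fix y assume "y \<in> f ` {1..l}"
    then obtain k where k: "k \<in> {1..l}" "y = f k" by auto
    have "inner (\<Sum>i=1..l. (inner x (f i) / (norm (f i))\<^sup>2) *\<^sub>R f i) (f k)
        = (\<Sum>i=1..l. if i = k then inner x (f k) else 0)"
      unfolding inner_sum_left using assms k(1)
      by (intro sum.cong) (auto simp: power2_norm_eq_inner)
    then show "inner (x - (\<Sum>i=1..l. (inner x (f i) / (norm (f i))\<^sup>2) *\<^sub>R f i)) y = 0"
      using k by (simp add: inner_diff_left)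
  qed
qed

text \<open>Origin of the base 5: in \<open>frame_inv_step\<close> a new vector has an error of at
  most \<open>4 * w\<close> plus four times the sum of the earlier error bounds.\<close>

lemma sum_pow5: "4 + 4 * (\<Sum>i=1..l. 5 ^ i) = (5 ^ Suc l - 1 :: real)"
  by (induction l) auto

lemma frame_inv_0:
  assumes "ons u j" "U = span (u ` {1..j})"
  shows "frame_inv j w U v\<^sub>0 f 0 S"
  using assms by (auto simp: frame_inv_def)

text \<open>The new vector \<open>r\<close> is close to \<open>U\<close> and almost orthogonal to
  \<open>g 1, \<dots>, g l\<close>. Removing both defects gives \<open>a\<close>, and
  \<open>ons_exchange\<close> provides a basis of \<open>U\<close> that keeps
  \<open>g 1, \<dots>, g l\<close> and continues with the direction of \<open>a\<close>. The length
  of \<open>r\<close> exceeds the accumulated error, which makes \<open>a\<close> nonzero. This also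
  bounds the number of vectors: for \<open>l = j\<close> the vector \<open>a\<close> would be
  orthogonal to all of \<open>U\<close>.\<close>

lemma frame_inv_step:
  fixes U :: "'a::real_inner set"
  assumes inv: "frame_inv j w U v\<^sub>0 f l S" and w: "0 \<le> w"
    and near: "norm (perp U (v\<^sub>0 - b)) \<le> w" "norm (perp U (q - b)) \<le> w"
    and q: "q \<in> S" and r: "r = perp (span (f ` {1..l})) (q - v\<^sub>0)"
    and long: "5 ^ Suc l * w < norm r"
  shows "frame_inv j w U v\<^sub>0 (f(Suc l := r)) (Suc l)
           {p \<in> S. norm (perp (span (f ` {1..l})) (p - v\<^sub>0)) \<le> norm r}"
proof -
  obtain g where g: "ons g j" "span (g ` {1..j}) = U"
    and gf: "\<And>i. i \<in> {1..l} \<Longrightarrow> norm (norm (f i) *\<^sub>R g i - f i) \<le> 5 ^ i * w"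
    using inv by (auto simp: frame_inv_def)
  have lj: "l \<le> j" and f0: "\<And>i. i \<in> {1..l} \<Longrightarrow> f i \<noteq> 0"
    and orth: "\<forall>i\<in>{1..l}. \<forall>k\<in>{1..l}. i \<noteq> k \<longrightarrow> inner (f i) (f k) = 0"
    using inv by (auto simp: frame_inv_def)
  have Sf: "\<And>p i. p \<in> S \<Longrightarrow> i \<in> {1..l} \<Longrightarrow> \<bar>inner (p - v\<^sub>0) (f i)\<bar> \<le> (norm (f i))\<^sup>2"
    "\<And>p i. p \<in> S \<Longrightarrow> i \<in> {1..l} \<Longrightarrow> norm (perp (span (f ` {1..l})) (p - v\<^sub>0)) \<le> norm (f i)"
    using inv by (auto simp: frame_inv_def)
  let ?P = "perp U" and ?W = "span (f ` {1..l})"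
  have finU: "finite (g ` {1..j})" and finW: "finite (f ` {1..l})" by auto
  note pU = perp_span[OF finU, unfolded g(2)] and PU_diff = perp_diff[OF finU, unfolded g(2)]
    and PU_sum = perp_sum[OF finU, unfolded g(2)] and PU_scale = perp_scale[OF finU, unfolded g(2)]
    and PU_le = norm_perp_le[OF finU, unfolded g(2)]
  have gU: "g i \<in> U" if "i \<in> {1..j}" for i using that g(2) by (auto intro: span_base)
  have rf: "inner r (f i) = 0" if "i \<in> {1..l}" for i
    using perp_span(2)[OF finW span_base[of "f i"], of "q - v\<^sub>0"] that unfolding r by auto
  have Lf: "norm r \<le> norm (f i)" if "i \<in> {1..l}" for i using Sf(2)[OF q that] by (simp add: r)
  have r0: "0 < norm r" using long w by (meson le_less_trans mult_nonneg_nonneg zero_le_numeral zero_le_power)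
  have Pf: "norm (?P (f i)) \<le> 5 ^ i * w" if "i \<in> {1..l}" for i
  proof -
    have "norm (?P (f i)) \<le> norm (f i - norm (f i) *\<^sub>R g i)"
    proof (rule PU_le)
      have "g i \<in> U" using gU that lj by auto
      then show "norm (f i) *\<^sub>R g i \<in> U" using g(2) by (metis span_scale)
    qed
    also have "\<dots> \<le> 5 ^ i * w" using gf[OF that] by (simp add: norm_minus_commute)
    finally show ?thesis .
  qed
  define c where "c i = inner (q - v\<^sub>0) (f i) / (norm (f i))\<^sup>2" for i
  have c1: "\<bar>c i\<bar> \<le> 1" if "i \<in> {1..l}" for i
    using Sf(1)[OF q that] f0[OF that] by (simp add: c_def divide_le_eq_1)
  have Pq: "norm (?P (q - v\<^sub>0)) \<le> 2 * w"
  proof -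
    have "?P (q - v\<^sub>0) = ?P (q - b) - ?P (v\<^sub>0 - b)" by (simp flip: PU_diff)
    then show ?thesis using near norm_triangle_ineq4[of "?P (q - b)" "?P (v\<^sub>0 - b)"] by simp
  qed
  \<comment> \<open>\<open>r\<close> arises from \<open>q - v\<^sub>0\<close>, both ends of which
    are within \<open>w\<close> of the optimal flat, by subtracting the \<open>f i\<close> with
    coefficients of modulus at most 1.\<close>
  have Pr: "norm (?P r) \<le> 2 * w + (\<Sum>i=1..l. 5 ^ i * w)"
  proof -
    have "?P r = ?P (q - v\<^sub>0) - (\<Sum>i=1..l. c i *\<^sub>R ?P (f i))"
      unfolding r perp_orthogonal_family[OF orth] PU_diff[of "q - v\<^sub>0"] PU_sum PU_scale c_def ..
    then have "norm (?P r) \<le> norm (?P (q - v\<^sub>0)) + norm (\<Sum>i=1..l. c i *\<^sub>R ?P (f i))"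
      by (simp add: norm_triangle_ineq4)
    moreover have "norm (\<Sum>i=1..l. c i *\<^sub>R ?P (f i)) \<le> (\<Sum>i=1..l. 5 ^ i * w)"
    proof (rule sum_norm_le)
      fix i assume i: "i \<in> {1..l}"
      have "\<bar>c i\<bar> * norm (?P (f i)) \<le> 1 * (5 ^ i * w)"
        by (intro mult_mono c1 Pf i) auto
      then show "norm (c i *\<^sub>R ?P (f i)) \<le> 5 ^ i * w" by simp
    qed
    ultimately show ?thesis using Pq by linarith
  qed
  \<comment> \<open>As \<open>r\<close> is orthogonal to \<open>f i\<close>, only the mismatch
    between \<open>f i\<close> and \<open>norm (f i) *\<^sub>R g i\<close> counts. No factor is lost
    because \<open>r\<close> is no longer than \<open>f i\<close>.\<close>
  have rg: "\<bar>inner r (g i)\<bar> \<le> 5 ^ i * w" if i: "i \<in> {1..l}" for i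
  proof -
    have n0: "norm (f i) > 0" using f0[OF i] by simp
    have "norm (f i) * inner r (g i) = inner r (norm (f i) *\<^sub>R g i - f i)"
      using rf[OF i] by (simp add: inner_diff_right)
    then have "norm (f i) * \<bar>inner r (g i)\<bar> = \<bar>inner r (norm (f i) *\<^sub>R g i - f i)\<bar>"
      by (metis abs_mult abs_norm_cancel)
    also have "\<dots> \<le> norm r * norm (norm (f i) *\<^sub>R g i - f i)" by (rule Cauchy_Schwarz_ineq2)
    also have "\<dots> \<le> norm (f i) * (5 ^ i * w)" using Lf[OF i] gf[OF i] by (intro mult_mono) auto
    finally show ?thesis using n0 by (simp add: mult_le_cancel_left_pos)
  qed
  define a where "a = (r - ?P r) - (\<Sum>i=1..l. inner r (g i) *\<^sub>R g i)"
  have aU: "a \<in> U"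
  proof -
    have "(\<Sum>i=1..l. inner r (g i) *\<^sub>R g i) \<in> span (g ` {1..l})" by (rule ons_sum_in_span)
    then have "(\<Sum>i=1..l. inner r (g i) *\<^sub>R g i) \<in> U"
      using span_mono[of "g ` {1..l}" "g ` {1..j}"] lj g(2) by fastforce
    then show ?thesis unfolding a_def using pU(1)[of r] g(2) by (metis span_diff)
  qed
  have onl: "ons g l" using g(1) lj by (auto simp: ons_def)
  have ag: "inner a (g i) = 0" if "i \<in> {1..l}" for i
    using ons_sum_inner[OF onl that, of "\<lambda>i. inner r (g i)"] pU(2)[of "g i" r] gU[of i] that lj
    by (simp add: a_def inner_diff_left)
  have ar: "2 * norm (a - r) \<le> 5 ^ Suc l * w"
  proof -
    have "norm (a - r) \<le> norm (?P r) + norm (\<Sum>i=1..l. inner r (g i) *\<^sub>R g i)"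
      using norm_triangle_ineq[of "?P r" "\<Sum>i=1..l. inner r (g i) *\<^sub>R g i"]
      norm_minus_cancel[of "?P r + (\<Sum>i=1..l. inner r (g i) *\<^sub>R g i)"]
      by (simp add: a_def)
    moreover have "norm (\<Sum>i=1..l. inner r (g i) *\<^sub>R g i) \<le> (\<Sum>i=1..l. 5 ^ i * w)"
      using rg ons_norm[OF onl] by (intro sum_norm_le) auto
    moreover have "(\<Sum>i=1..l. 5 ^ i * w) = (\<Sum>i=1..l. 5 ^ i) * w" by (rule sum_distrib_right[symmetric])
    ultimately have "2 * norm (a - r) \<le> 4 * w + 4 * ((\<Sum>i=1..l. 5 ^ i) * w)"
      using Pr by linarith
    also have "\<dots> = (4 + 4 * (\<Sum>i=1..l. 5 ^ i)) * w" by (simp add: distrib_right)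
    also have "\<dots> \<le> 5 ^ Suc l * w" unfolding sum_pow5 using w by (simp add: algebra_simps)
    finally show ?thesis .
  qed
  have a0: "a \<noteq> 0"
  proof
    assume "a = 0"
    then have "2 * norm r \<le> 5 ^ Suc l * w" using ar by simp
    then show False using long r0 by linarith
  qed
  have "l \<noteq> j"
  proof
    assume lj: "l = j"
    have "inner a a = 0"
      by (rule inner_span_zero[of "g ` {1..j}"]) (use ag aU g(2) lj in auto)
    then show False using a0 by simp
  qed
  then have lj': "l < j" using lj by simp
  obtain g' where g': "ons g' j" "span (g' ` {1..j}) = U"
    "\<And>i. i \<in> {1..l} \<Longrightarrow> g' i = g i" "g' (Suc l) = (1 / norm a) *\<^sub>R a"
  proof (rule ons_exchange[OF g(1) lj', of "(1 / norm a) *\<^sub>R a"])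
    show "(1 / norm a) *\<^sub>R a \<in> span (g ` {1..j})" using aU g(2) by (metis span_scale)
    show "norm ((1 / norm a) *\<^sub>R a) = 1" using a0 by simp
  qed (use ag g(2) in auto)
  \<comment> \<open>Passing from \<open>a\<close> to its multiple of length \<open>norm r\<close>
    costs \<open>norm (a - r)\<close> once more, whence the factor 2 in \<open>ar\<close>.\<close>
  have new: "norm (norm r *\<^sub>R g' (Suc l) - r) \<le> 5 ^ Suc l * w"
  proof -
    have "norm r *\<^sub>R g' (Suc l) - a = ((norm r - norm a) / norm a) *\<^sub>R a"
      using a0 by (simp add: g'(4) algebra_simps diff_divide_distrib)
    then have "norm (norm r *\<^sub>R g' (Suc l) - a) = \<bar>norm r - norm a\<bar>" using a0 by simp
    also have "\<dots> \<le> norm (a - r)" using norm_triangle_ineq3[of r a] by (simp add: norm_minus_commute)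
    finally have "norm (norm r *\<^sub>R g' (Suc l) - a) \<le> norm (a - r)" .
    then show ?thesis
      using ar norm_triangle_ineq[of "norm r *\<^sub>R g' (Suc l) - a" "a - r"] by simp
  qed
  let ?f = "f(Suc l := r)"
  have fim: "?f ` {1..l} = f ` {1..l}" by auto
  have perp_mono: "norm (perp (span (?f ` {1..Suc l})) x) \<le> norm (perp ?W x)" for x
  proof -
    have "x - perp ?W x \<in> span (f ` {1..l})" by (rule perp_span(1)[OF finW])
    then have "x - perp ?W x \<in> span (?f ` {1..Suc l})"
      by (rule subsetD[OF span_mono, rotated]) (subst fim[symmetric], rule image_mono, simp)
    from norm_perp_le[OF _ this, of x] show ?thesis by simp
  qed
  have inr: "\<bar>inner (p - v\<^sub>0) r\<bar> \<le> (norm r)\<^sup>2"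
    if "norm (perp ?W (p - v\<^sub>0)) \<le> norm r" for p
  proof -
    have "inner ((p - v\<^sub>0) - perp ?W (p - v\<^sub>0)) r = 0"
      using perp_span(2)[OF finW perp_span(1)[OF finW, of "p - v\<^sub>0"], of "q - v\<^sub>0"]
      by (simp add: r inner_commute)
    then have "\<bar>inner (p - v\<^sub>0) r\<bar> = \<bar>inner (perp ?W (p - v\<^sub>0)) r\<bar>" by (simp add: inner_diff_left)
    also have "\<dots> \<le> norm (perp ?W (p - v\<^sub>0)) * norm r" by (rule Cauchy_Schwarz_ineq2)
    also have "\<dots> \<le> norm r * norm r" using that by (intro mult_right_mono) auto
    finally show ?thesis by (simp add: power2_eq_square)
  qed
  show ?thesis
    unfolding frame_inv_def
  proof (intro conjI ballI impI)
    show "Suc l \<le> j" using lj' by simp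
    show "inner (?f i) (?f k) = 0" if "i \<in> {1..Suc l}" "k \<in> {1..Suc l}" "i \<noteq> k" for i k
      using that orth rf by (auto simp: le_Suc_eq inner_commute)
    show "?f i \<noteq> 0" if "i \<in> {1..Suc l}" for i using that f0 r0 by (auto simp: le_Suc_eq)
    fix p i assume p: "p \<in> {p \<in> S. norm (perp ?W (p - v\<^sub>0)) \<le> norm r}" and i: "i \<in> {1..Suc l}"
    show "\<bar>inner (p - v\<^sub>0) (?f i)\<bar> \<le> (norm (?f i))\<^sup>2"
      using p i Sf(1)[of p i] inr[of p] by (auto simp: le_Suc_eq)
    show "norm (perp (span (?f ` {1..Suc l})) (p - v\<^sub>0)) \<le> norm (?f i)"
      using p i Lf[of i] perp_mono[of "p - v\<^sub>0"] by (auto simp: le_Suc_eq)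
  next
    show "\<exists>g. ons g j \<and> span (g ` {1..j}) = U \<and>
        (\<forall>i\<in>{1..Suc l}. norm (norm (?f i) *\<^sub>R g i - ?f i) \<le> 5 ^ i * w)"
      using g' gf new by (intro exI[of _ g']) (auto simp: le_Suc_eq)
  qed
qed

text \<open>The program knows \<open>f\<close> but needs coordinates with respect to the hidden
  \<open>g\<close>. For a kept inlier the two differ by a bounded multiple of
  \<open>\<sigma>\<close>, however long the frame vectors are, because the error of
  \<open>g i\<close> is absolute and the coordinates along the \<open>f i\<close> are at most 1. So
  the correction can be guessed on a grid with mesh \<open>\<sigma> / H\<close> whose number of
  points depends on \<open>H\<close> only. Directions not found by the greedy phase have
  \<open>f i = 0\<close> and get the length \<open>\<sigma>\<close>.\<close>

lemma frame_coordinates: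
  fixes U :: "'a::real_inner set" and H :: nat
  assumes inv: "frame_inv j w U v\<^sub>0 f k S" and f0: "\<And>i. i \<in> {k<..j} \<Longrightarrow> f i = 0"
    and w: "0 < w" and \<sigma>: "w \<le> \<sigma>" "\<And>p. p \<in> S \<Longrightarrow> norm (perp (span (f ` {1..k})) (p - v\<^sub>0)) \<le> \<sigma>"
    "\<And>i. i \<in> {1..k} \<Longrightarrow> \<sigma> \<le> norm (f i)"
    and near: "\<And>p. p \<in> S \<Longrightarrow> norm (perp U (p - b)) \<le> w"
    and L: "\<And>i. L i = (if f i = 0 then \<sigma> else norm (f i))"
    and H: "real j * 5 ^ j + 2 \<le> real H"
  obtains g where "ons g j" "span (g ` {1..j}) = U"
    "\<And>i. i \<in> {1..k} \<Longrightarrow> norm (norm (f i) *\<^sub>R g i - f i) \<le> 5 ^ i * w"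
    "\<And>p. p \<in> S \<Longrightarrow> \<exists>c::nat \<Rightarrow> nat. \<exists>x. (\<forall>i. c i \<le> 2 * H\<^sup>2) \<and>
       (\<forall>i. x i = inner (p - v\<^sub>0) (f i) / (L i)\<^sup>2 + \<sigma> / L i * (real (c i) / H - H)) \<and>
       (\<forall>i\<in>{1..j}. \<bar>x i\<bar> \<le> real j * 5 ^ j + 4) \<and>
       norm (p - (v\<^sub>0 - perp U (v\<^sub>0 - b)) - (\<Sum>i=1..j. x i *\<^sub>R (L i *\<^sub>R g i))) \<le> w + j * (\<sigma> / H)"
proof -
  obtain g where g: "ons g j" "span (g ` {1..j}) = U"
    and gf: "\<And>i. i \<in> {1..k} \<Longrightarrow> norm (norm (f i) *\<^sub>R g i - f i) \<le> 5 ^ i * w"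
    using inv by (auto simp: frame_inv_def)
  have kj: "k \<le> j" and fk: "\<And>i. i \<in> {1..k} \<Longrightarrow> f i \<noteq> 0"
    and orth: "\<forall>i\<in>{1..k}. \<forall>l\<in>{1..k}. i \<noteq> l \<longrightarrow> inner (f i) (f l) = 0"
    and Sf: "\<And>p i. p \<in> S \<Longrightarrow> i \<in> {1..k} \<Longrightarrow> \<bar>inner (p - v\<^sub>0) (f i)\<bar> \<le> (norm (f i))\<^sup>2"
    using inv by (auto simp: frame_inv_def)
  have \<sigma>0: "0 < \<sigma>" using w \<sigma>(1) by simp
  have L\<sigma>: "\<sigma> \<le> L i" if "i \<in> {1..j}" for i
    using that \<sigma>(3)[of i] f0[of i] by (cases "i \<le> k") (auto simp: L)
  have L0: "0 < L i" for i using \<sigma>0 by (simp add: L)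
  have H1: "1 \<le> real H" using H by (smt (verit) mult_nonneg_nonneg of_nat_0_le_iff zero_le_power)
  define B where "B = real j * 5 ^ j + 2"
  \<comment> \<open>The central estimate; \<open>z\<close> is the mismatch of directions. The part
    of \<open>p - v\<^sub>0\<close> outside the frame has length at most \<open>\<sigma>\<close> and
    \<open>z\<close> has length at most 2; each frame vector contributes at most
    \<open>5 ^ j * w\<close>.\<close>
  have key: "\<bar>inner (p - v\<^sub>0) (g i - (1 / L i) *\<^sub>R f i)\<bar> \<le> B * \<sigma>" if p: "p \<in> S" and i: "i \<in> {1..j}" for p i
  proof -
    define z where "z = g i - (1 / L i) *\<^sub>R f i"
    define \<rho> where "\<rho> = perp (span (f ` {1..k})) (p - v\<^sub>0)"
    define c where "c a = inner (p - v\<^sub>0) (f a) / (norm (f a))\<^sup>2" for a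
    have dec: "p - v\<^sub>0 = \<rho> + (\<Sum>a=1..k. c a *\<^sub>R f a)"
      unfolding \<rho>_def perp_orthogonal_family[OF orth] c_def by simp
    have c1: "\<bar>c a\<bar> \<le> 1" if "a \<in> {1..k}" for a
      using Sf[OF p that] fk[OF that] by (simp add: c_def divide_le_eq_1)
    have nz: "norm z \<le> 2"
    proof -
      have "norm ((1 / L i) *\<^sub>R f i) \<le> 1" using \<sigma>0 by (simp add: L)
      moreover have "norm (g i) = 1" by (rule ons_norm[OF g(1) i])
      ultimately show ?thesis unfolding z_def by (smt (verit) norm_triangle_ineq4)
    qed
    have fz: "\<bar>inner (f a) z\<bar> \<le> 5 ^ j * w" if a: "a \<in> {1..k}" for a
    proof -
      have "\<bar>inner (f a) z\<bar> \<le> 5 ^ a * w"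
      proof (cases "a = i")
        case True
        have "\<bar>inner (f a) z\<bar> \<le> norm (f a) * norm z" by (rule Cauchy_Schwarz_ineq2)
        also have "\<dots> = norm (norm (f a) *\<^sub>R z)" by simp
        also have "norm (f a) *\<^sub>R z = norm (f a) *\<^sub>R g a - f a"
          using fk[OF a] True by (simp add: z_def L algebra_simps)
        finally show ?thesis using gf[OF a] by simp
      next
        case False
        have "inner (f a) (f i) = 0"
          using orth a False i f0[of i] by (cases "i \<le> k") auto
        moreover have "inner (g a) (g i) = 0" using g(1) a i kj False by (auto simp: ons_def)
        ultimately have "inner (f a) z = - inner (norm (f a) *\<^sub>R g a - f a) (g i)"
          by (simp add: z_def inner_diff_left inner_diff_right)
        then have "\<bar>inner (f a) z\<bar> \<le> norm (norm (f a) *\<^sub>R g a - f a) * norm (g i)"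
          using Cauchy_Schwarz_ineq2[of "norm (f a) *\<^sub>R g a - f a" "g i"] by simp
        then show ?thesis using gf[OF a] ons_norm[OF g(1) i] by simp
      qed
      also have "\<dots> \<le> 5 ^ j * w" using a kj w by (intro mult_right_mono power_increasing) auto
      finally show ?thesis .
    qed
    have "inner (p - v\<^sub>0) z = inner \<rho> z + (\<Sum>a=1..k. c a * inner (f a) z)"
      by (subst dec) (simp add: inner_add_left inner_sum_left)
    then have "\<bar>inner (p - v\<^sub>0) z\<bar> \<le> \<bar>inner \<rho> z\<bar> + \<bar>\<Sum>a=1..k. c a * inner (f a) z\<bar>" by simp
    moreover have "\<bar>inner \<rho> z\<bar> \<le> \<sigma> * 2"
    proof -
      have "\<bar>inner \<rho> z\<bar> \<le> norm \<rho> * norm z" by (rule Cauchy_Schwarz_ineq2)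
      also have "\<dots> \<le> \<sigma> * 2" using nz \<sigma>(2)[OF p] \<sigma>0 by (intro mult_mono) (auto simp: \<rho>_def)
      finally show ?thesis .
    qed
    moreover have "\<bar>\<Sum>a=1..k. c a * inner (f a) z\<bar> \<le> (\<Sum>a=1..k. 5 ^ j * w)"
    proof (rule order_trans[OF sum_abs], rule sum_mono)
      fix a assume a: "a \<in> {1..k}"
      have "\<bar>c a\<bar> * \<bar>inner (f a) z\<bar> \<le> 1 * (5 ^ j * w)" by (intro mult_mono c1 fz a) auto
      then show "\<bar>c a * inner (f a) z\<bar> \<le> 5 ^ j * w" by (simp add: abs_mult)
    qed
    moreover have "(\<Sum>a=1..k. 5 ^ j * w) \<le> real j * 5 ^ j * \<sigma>"
    proof -
      have "(\<Sum>a=1..k. 5 ^ j * w) = real k * (5 ^ j * w)" by simp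
      also have "\<dots> \<le> real j * (5 ^ j * \<sigma>)" using kj \<sigma> w by (intro mult_mono) auto
      finally show ?thesis by simp
    qed
    ultimately have "\<bar>inner (p - v\<^sub>0) z\<bar> \<le> \<sigma> * 2 + real j * 5 ^ j * \<sigma>" by linarith
    then show ?thesis unfolding z_def[symmetric] B_def by (simp add: algebra_simps)
  qed
  have ex: "\<exists>c::nat \<Rightarrow> nat. \<exists>x. (\<forall>i. c i \<le> 2 * H\<^sup>2) \<and>
       (\<forall>i. x i = inner (p - v\<^sub>0) (f i) / (L i)\<^sup>2 + \<sigma> / L i * (real (c i) / H - H)) \<and>
       (\<forall>i\<in>{1..j}. \<bar>x i\<bar> \<le> real j * 5 ^ j + 4) \<and>
       norm (p - (v\<^sub>0 - perp U (v\<^sub>0 - b)) - (\<Sum>i=1..j. x i *\<^sub>R (L i *\<^sub>R g i))) \<le> w + j * (\<sigma> / H)"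
    if p: "p \<in> S" for p
  proof -
    define a where "a i = inner (p - v\<^sub>0) (g i - (1 / L i) *\<^sub>R f i) / \<sigma>" for i
    have a: "\<bar>a i\<bar> \<le> B" if "i \<in> {1..j}" for i
      using key[OF p that] \<sigma>0 by (simp add: a_def field_simps)
    \<comment> \<open>Shifted by \<open>H\<close> and rounded down, so that grid indices are natural
      numbers between 0 and \<open>2 * H\<^sup>2\<close>.\<close>
    define c where "c i = (if i \<in> {1..j} then nat \<lfloor>(a i + H) * H\<rfloor> else 0)" for i
    have cb: "c i \<le> 2 * H\<^sup>2" "\<bar>real (c i) / H - H - a i\<bar> \<le> 1 / H" if i: "i \<in> {1..j}" for i
    proof -
      have aH: "\<bar>a i\<bar> \<le> real H" using a[OF i] H by (simp add: B_def)
      have nn: "0 \<le> (a i + H) * H" using aH by (intro mult_nonneg_nonneg) auto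
      have "(a i + H) * H \<le> (real H + real H) * real H" using aH by (intro mult_right_mono) auto
      then have "(a i + H) * H \<le> real (2 * H\<^sup>2)" by (simp add: power2_eq_square)
      then show "c i \<le> 2 * H\<^sup>2" using i unfolding c_def by (simp add: nat_le_iff floor_le_iff)
      have rc: "real (c i) = of_int \<lfloor>(a i + H) * H\<rfloor>" using i nn by (simp add: c_def)
      have "\<bar>real (c i) - (a i + H) * H\<bar> \<le> 1" unfolding rc by linarith
      then have "\<bar>real (c i) - (a i + H) * H\<bar> / H \<le> 1 / H" using H1 by (intro divide_right_mono) auto
      moreover have "real (c i) / H - H - a i = (real (c i) - (a i + H) * H) / H"
        using H1 by (simp add: field_simps)
      ultimately show "\<bar>real (c i) / H - H - a i\<bar> \<le> 1 / H" by simp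
    qed
    define x where "x i = inner (p - v\<^sub>0) (f i) / (L i)\<^sup>2 + \<sigma> / L i * (real (c i) / H - H)" for i
    have xb: "\<bar>x i\<bar> \<le> real j * 5 ^ j + 4" if i: "i \<in> {1..j}" for i
    proof -
      have 1: "\<bar>inner (p - v\<^sub>0) (f i) / (L i)\<^sup>2\<bar> \<le> 1"
      proof (cases "f i = 0")
        case False
        then have "i \<in> {1..k}" using i f0[of i] by (cases "i \<le> k") auto
        then show ?thesis using Sf[OF p, of i] False by (simp add: L divide_le_eq_1)
      qed simp
      have "1 / real H \<le> 1" using H1 by simp
      then have 2: "\<bar>real (c i) / H - H\<bar> \<le> B + 1" using cb(2)[OF i] a[OF i] by linarith
      have "\<bar>\<sigma> / L i\<bar> \<le> 1" using L\<sigma>[OF i] \<sigma>0 by simp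
      then have "\<bar>\<sigma> / L i\<bar> * \<bar>real (c i) / H - H\<bar> \<le> 1 * (B + 1)" using 2 by (intro mult_mono) auto
      then have "\<bar>\<sigma> / L i * (real (c i) / H - H)\<bar> \<le> B + 1" by (simp add: abs_mult)
      then show ?thesis using 1 unfolding x_def B_def by linarith
    qed
    have xL: "\<bar>inner (p - v\<^sub>0) (g i) - x i * L i\<bar> \<le> \<sigma> / H" if i: "i \<in> {1..j}" for i
    proof -
      have "x i * L i = inner (p - v\<^sub>0) (f i) / L i + \<sigma> * (real (c i) / H - H)"
        using L0[of i] by (simp add: x_def field_simps power2_eq_square)
      moreover have "inner (p - v\<^sub>0) (g i) = inner (p - v\<^sub>0) (f i) / L i + \<sigma> * a i"
        using \<sigma>0 by (simp add: a_def inner_diff_right)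
      ultimately have "inner (p - v\<^sub>0) (g i) - x i * L i = - \<sigma> * (real (c i) / H - H - a i)"
        by (simp add: algebra_simps)
      then have "\<bar>inner (p - v\<^sub>0) (g i) - x i * L i\<bar> = \<sigma> * \<bar>real (c i) / H - H - a i\<bar>"
        using \<sigma>0 by (simp add: abs_mult)
      also have "\<dots> \<le> \<sigma> * (1 / H)" using cb(2)[OF i] \<sigma>0 by (intro mult_left_mono) auto
      finally show ?thesis by simp
    qed
    \<comment> \<open>The ideal base point is the projection of \<open>v\<^sub>0\<close> to the
      optimal flat. Measured from there, the exact coordinates of \<open>p\<close> along
      \<open>g\<close> leave precisely the residual of \<open>p\<close> with respect to that
      flat.\<close>
    let ?G = "\<Sum>i=1..j. inner (p - v\<^sub>0) (g i) *\<^sub>R g i"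
    have finU: "finite (g ` {1..j})" by simp
    have "p - (v\<^sub>0 - perp U (v\<^sub>0 - b)) - ?G = perp U (p - v\<^sub>0) + perp U (v\<^sub>0 - b)"
      using perp_ons[OF g(1), of "p - v\<^sub>0"] g(2) by simp
    also have "\<dots> = perp U (p - b)"
      using perp_add[OF finU, of "p - v\<^sub>0" "v\<^sub>0 - b"] g(2) by simp
    finally have 1: "norm (p - (v\<^sub>0 - perp U (v\<^sub>0 - b)) - ?G) \<le> w" using near[OF p] by simp
    have "?G - (\<Sum>i=1..j. x i *\<^sub>R (L i *\<^sub>R g i)) = (\<Sum>i=1..j. (inner (p - v\<^sub>0) (g i) - x i * L i) *\<^sub>R g i)"
      by (simp add: sum_subtractf algebra_simps sum.distrib)
    also have "norm \<dots> \<le> (\<Sum>i=1..j. \<sigma> / H)"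
      using xL ons_norm[OF g(1)] by (intro sum_norm_le) auto
    finally have 2: "norm (?G - (\<Sum>i=1..j. x i *\<^sub>R (L i *\<^sub>R g i))) \<le> j * (\<sigma> / H)" by simp
    have "norm (p - (v\<^sub>0 - perp U (v\<^sub>0 - b)) - (\<Sum>i=1..j. x i *\<^sub>R (L i *\<^sub>R g i)))
       \<le> norm (p - (v\<^sub>0 - perp U (v\<^sub>0 - b)) - ?G) + norm (?G - (\<Sum>i=1..j. x i *\<^sub>R (L i *\<^sub>R g i)))"
      by (rule order_trans[OF _ norm_triangle_ineq]) simp
    then have "norm (p - (v\<^sub>0 - perp U (v\<^sub>0 - b)) - (\<Sum>i=1..j. x i *\<^sub>R (L i *\<^sub>R g i))) \<le> w + j * (\<sigma> / H)"
      using 1 2 by linarith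
    moreover have "\<forall>i. c i \<le> 2 * H\<^sup>2" using cb(1) by (auto simp: c_def)
    ultimately show ?thesis using xb x_def by (intro exI[of _ c] exI[of _ x]) auto
  qed
  show ?thesis using that[OF g gf ex] by blast
qed

text \<open>The residual \<open>r\<close> of \<open>p\<close> for the current frame is long; the
  residual \<open>s\<close> for the ideal frame is shorter by a factor
  \<open>1 - 3 * \<epsilon> / 8\<close>. Since the errors of the frame vectors, weighted by
  \<open>x\<close>, add up to \<open>s - r\<close>, moving along \<open>r\<close> changes the
  squared distance to first order by at most \<open>- 3 * \<mu> * \<epsilon> / 4\<close> times the
  square of \<open>norm r\<close>. The bound on \<open>\<mu>\<close> keeps the quadratic term at no
  more than a third of that.\<close>

lemma perceptron_step:
  fixes \<Phi> \<Phi>' \<Psi> :: "nat \<Rightarrow> 'a::real_inner"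
  assumes r: "r = p - (\<Sum>i\<le>j. x i *\<^sub>R \<Phi> i)" and upd: "\<And>i. i \<le> j \<Longrightarrow> \<Phi>' i = \<Phi> i + (\<mu> * x i) *\<^sub>R r"
    and near: "norm (p - (\<Sum>i\<le>j. x i *\<^sub>R \<Psi> i)) \<le> (1 + \<epsilon> / 4) * w" and far: "(1 + \<epsilon>) * w \<le> norm r"
    and \<epsilon>: "0 < \<epsilon>" "\<epsilon> < 1" and w: "0 < w" and \<mu>: "0 < \<mu>" "\<mu> * (\<Sum>i\<le>j. (x i)\<^sup>2) \<le> \<epsilon> / 4"
  shows "(\<Sum>i\<le>j. (norm (\<Phi>' i - \<Psi> i))\<^sup>2) \<le> (\<Sum>i\<le>j. (norm (\<Phi> i - \<Psi> i))\<^sup>2) - \<mu> * \<epsilon> / 2 * w\<^sup>2"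
proof -
  define s where "s = p - (\<Sum>i\<le>j. x i *\<^sub>R \<Psi> i)"
  let ?X = "\<Sum>i\<le>j. (x i)\<^sup>2"
  have "(\<Sum>i\<le>j. (norm (\<Phi>' i - \<Psi> i))\<^sup>2) = (\<Sum>i\<le>j. (norm (\<Phi> i - \<Psi> i))\<^sup>2
      + 2 * \<mu> * inner (x i *\<^sub>R (\<Phi> i - \<Psi> i)) r + \<mu>\<^sup>2 * (x i)\<^sup>2 * (norm r)\<^sup>2)"
  proof (rule sum.cong[OF refl])
    fix i assume "i \<in> {..j}"
    then have "\<Phi>' i - \<Psi> i = (\<Phi> i - \<Psi> i) + (\<mu> * x i) *\<^sub>R r" by (simp add: upd)
    then show "(norm (\<Phi>' i - \<Psi> i))\<^sup>2 = (norm (\<Phi> i - \<Psi> i))\<^sup>2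
      + 2 * \<mu> * inner (x i *\<^sub>R (\<Phi> i - \<Psi> i)) r + \<mu>\<^sup>2 * (x i)\<^sup>2 * (norm r)\<^sup>2"
      unfolding power2_norm_eq_inner
      by (simp add: inner_add_left inner_add_right inner_commute power2_eq_square algebra_simps)
  qed
  also have "\<dots> = (\<Sum>i\<le>j. (norm (\<Phi> i - \<Psi> i))\<^sup>2) + 2 * \<mu> * inner (\<Sum>i\<le>j. x i *\<^sub>R (\<Phi> i - \<Psi> i)) r
      + \<mu>\<^sup>2 * ?X * (norm r)\<^sup>2"
    by (simp add: sum.distrib inner_sum_left sum_distrib_left sum_distrib_right)
  also have "(\<Sum>i\<le>j. x i *\<^sub>R (\<Phi> i - \<Psi> i)) = s - r"
    by (simp add: r s_def scaleR_diff_right sum_subtractf)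
  also have "inner (s - r) r = inner s r - (norm r)\<^sup>2" by (simp add: inner_diff_left power2_norm_eq_inner)
  finally have eq: "(\<Sum>i\<le>j. (norm (\<Phi>' i - \<Psi> i))\<^sup>2) = (\<Sum>i\<le>j. (norm (\<Phi> i - \<Psi> i))\<^sup>2)
      + 2 * \<mu> * (inner s r - (norm r)\<^sup>2) + \<mu>\<^sup>2 * ?X * (norm r)\<^sup>2" .
  have sr: "inner s r \<le> (1 - 3 * \<epsilon> / 8) * (norm r)\<^sup>2"
  proof -
    \<comment> \<open>The difference of the sides is
      \<open>3 * \<epsilon> * (1 - \<epsilon>) / 8\<close>; the fraction \<open>3 / 8\<close> is the
      largest one that works for all \<open>\<epsilon> < 1\<close>.\<close>
    have "(1 + \<epsilon> / 4) \<le> (1 - 3 * \<epsilon> / 8) * (1 + \<epsilon>)" using \<epsilon> by (simp add: field_simps) 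
    then have "(1 + \<epsilon> / 4) * w \<le> (1 - 3 * \<epsilon> / 8) * ((1 + \<epsilon>) * w)" using w by simp
    also have "\<dots> \<le> (1 - 3 * \<epsilon> / 8) * norm r" using far \<epsilon> by (intro mult_left_mono) auto
    finally have "norm s \<le> (1 - 3 * \<epsilon> / 8) * norm r" using near by (simp add: s_def)
    then have "norm s * norm r \<le> (1 - 3 * \<epsilon> / 8) * norm r * norm r" by (intro mult_right_mono) auto
    then show ?thesis using norm_cauchy_schwarz[of s r] by (simp add: power2_eq_square)
  qed
  have wr: "w\<^sup>2 \<le> (norm r)\<^sup>2"
    using far w \<epsilon> by (intro power_mono) (auto intro: order_trans[OF _ far] simp: algebra_simps)
  have "2 * \<mu> * (inner s r - (norm r)\<^sup>2) \<le> 2 * \<mu> * (- (3 * \<epsilon> / 8) * (norm r)\<^sup>2)"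
    using sr \<mu> by (intro mult_left_mono) (auto simp: algebra_simps)
  moreover have "\<mu>\<^sup>2 * ?X * (norm r)\<^sup>2 \<le> \<mu> * (\<epsilon> / 4) * (norm r)\<^sup>2"
    using mult_left_mono[OF \<mu>(2), of \<mu>] \<mu>(1)
    by (intro mult_right_mono) (auto simp: power2_eq_square algebra_simps)
  ultimately have "2 * \<mu> * (inner s r - (norm r)\<^sup>2) + \<mu>\<^sup>2 * ?X * (norm r)\<^sup>2 \<le> - (\<mu> * \<epsilon> / 2 * (norm r)\<^sup>2)"
    by (simp add: algebra_simps)
  also have "\<dots> \<le> - (\<mu> * \<epsilon> / 2 * w\<^sup>2)" using wr \<mu> \<epsilon> by (intro le_imp_neg_le mult_left_mono) auto
  finally show ?thesis unfolding eq by linarith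
qed

section \<open>Finitely supported sequences as one inner product space for all dimensions\<close>

typedef fvec = "{f :: nat \<Rightarrow> real. finite {k. f k \<noteq> 0}}"
  morphisms fv_nth Abs_fvec
  by (rule exI[of _ "\<lambda>_. 0"]) simp

setup_lifting type_definition_fvec

lemma finite_fv_support: "finite {k. fv_nth x k \<noteq> 0}"
  using fv_nth[of x] by simp

instantiation fvec :: real_vector
begin

lift_definition zero_fvec :: fvec is "\<lambda>_. 0" by simp

lift_definition plus_fvec :: "fvec \<Rightarrow> fvec \<Rightarrow> fvec" is "\<lambda>f g k. f k + g k"
  subgoal for f g by (rule finite_subset[of _ "{k. f k \<noteq> 0} \<union> {k. g k \<noteq> 0}"]) auto
  done

lift_definition minus_fvec :: "fvec \<Rightarrow> fvec \<Rightarrow> fvec" is "\<lambda>f g k. f k - g k"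
  subgoal for f g by (rule finite_subset[of _ "{k. f k \<noteq> 0} \<union> {k. g k \<noteq> 0}"]) auto
  done

lift_definition uminus_fvec :: "fvec \<Rightarrow> fvec" is "\<lambda>f k. - f k" by simp

lift_definition scaleR_fvec :: "real \<Rightarrow> fvec \<Rightarrow> fvec" is "\<lambda>c f k. c * f k"
  subgoal for c f by (rule finite_subset[of _ "{k. f k \<noteq> 0}"]) auto
  done

instance
  by standard (transfer, simp add: algebra_simps)+

end

instantiation fvec :: real_inner
begin

definition inner_fvec :: "fvec \<Rightarrow> fvec \<Rightarrow> real" where
  "inner_fvec x y = (\<Sum>k\<in>{k. fv_nth x k \<noteq> 0}. fv_nth x k * fv_nth y k)"

definition norm_fvec :: "fvec \<Rightarrow> real" where "norm_fvec x = sqrt (inner x x)"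

definition dist_fvec :: "fvec \<Rightarrow> fvec \<Rightarrow> real" where "dist_fvec x y = norm (x - y)"

definition sgn_fvec :: "fvec \<Rightarrow> fvec" where "sgn_fvec x = scaleR (inverse (norm x)) x"

definition uniformity_fvec :: "(fvec \<times> fvec) filter" where
  "uniformity_fvec = (INF e\<in>{0<..}. principal {(x, y). dist x y < e})"

definition open_fvec :: "fvec set \<Rightarrow> bool" where
  "open_fvec S \<longleftrightarrow> (\<forall>x\<in>S. \<forall>\<^sub>F (x', y) in uniformity. x' = x \<longrightarrow> y \<in> S)"

lemma inner_fvec_superset:
  assumes "finite A" "{k. fv_nth x k \<noteq> 0} \<subseteq> A"
  shows "inner x y = (\<Sum>k\<in>A. fv_nth x k * fv_nth y k)"
  unfolding inner_fvec_def using assms by (intro sum.mono_neutral_left) auto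

instance
proof
  fix x y z :: fvec and a :: real
  show "dist x y = norm (x - y)" "sgn x = x /\<^sub>R norm x"
    "(uniformity :: (fvec \<times> fvec) filter) = (INF e\<in>{0<..}. principal {(x, y). dist x y < e})"
    "norm x = sqrt (inner x x)"
    by (simp_all add: dist_fvec_def sgn_fvec_def uniformity_fvec_def norm_fvec_def)
  show "open U = (\<forall>x\<in>U. \<forall>\<^sub>F (x', y) in uniformity. x' = x \<longrightarrow> y \<in> U)" for U :: "fvec set"
    by (rule open_fvec_def)
  let ?A = "{k. fv_nth x k \<noteq> 0} \<union> {k. fv_nth y k \<noteq> 0}"
  have fin: "finite ?A" using finite_fv_support by simp
  show "inner x y = inner y x"
    by (subst (1 2) inner_fvec_superset[OF fin]) (auto simp: mult.commute)
  show "inner (x + y) z = inner x z + inner y z"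
    by (subst (1 2 3) inner_fvec_superset[OF fin])
      (auto simp: plus_fvec.rep_eq sum.distrib algebra_simps)
  show "inner (a *\<^sub>R x) y = a * inner x y"
    by (subst (1 2) inner_fvec_superset[OF fin])
      (auto simp: scaleR_fvec.rep_eq sum_distrib_left algebra_simps)
  show "0 \<le> inner x x" unfolding inner_fvec_def by (intro sum_nonneg) auto
  show "(inner x x = 0) = (x = 0)"
  proof
    assume "inner x x = 0"
    then have "\<forall>k\<in>{k. fv_nth x k \<noteq> 0}. fv_nth x k * fv_nth x k = 0"
      unfolding inner_fvec_def by (subst (asm) sum_nonneg_eq_0_iff) (auto simp: finite_fv_support)
    then show "x = 0" by (auto simp: fv_nth_inject[symmetric] zero_fvec.rep_eq fun_eq_iff)
  qed (simp add: inner_fvec_def zero_fvec.rep_eq)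
qed

end

lift_definition mkv :: "nat \<Rightarrow> (nat \<Rightarrow> real) \<Rightarrow> fvec" is "\<lambda>d f k. if k < d then f k else 0"
  subgoal for d f by (rule finite_subset[of _ "{..<d}"]) auto
  done

lemma inner_mkv: "inner (mkv d f) (mkv d g) = (\<Sum>k<d. f k * g k)"
  by (subst inner_fvec_superset[of "{..<d}"]) (auto simp: mkv.rep_eq)

lemma mkv_cong: "(\<And>k. k < d \<Longrightarrow> f k = g k) \<Longrightarrow> mkv d f = mkv d g"
  by transfer auto

lemma mkv_eq_iff: "mkv d f = mkv d g \<longleftrightarrow> (\<forall>k<d. f k = g k)"
  by transfer (auto simp: fun_eq_iff)

lemma mkv_add: "mkv d f + mkv d g = mkv d (\<lambda>k. f k + g k)"
  and mkv_diff: "mkv d f - mkv d g = mkv d (\<lambda>k. f k - g k)"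
  and mkv_scale: "c *\<^sub>R mkv d f = mkv d (\<lambda>k. c * f k)"
  and mkv_zero: "mkv d (\<lambda>k. 0) = 0"
  by (transfer, auto)+

definition axis_fv :: "nat \<Rightarrow> fvec" where
  "axis_fv t = mkv (Suc t) (\<lambda>k. if k = t then 1 else 0)"

lemma fv_nth_axis: "fv_nth (axis_fv t) k = (if k = t then 1 else 0)"
  by (simp add: axis_fv_def mkv.rep_eq)

lemma inner_axis: "inner x (axis_fv t) = fv_nth x t"
proof -
  have "inner (axis_fv t) x = (\<Sum>k\<in>{t}. fv_nth (axis_fv t) k * fv_nth x k)"
    by (rule inner_fvec_superset) (auto simp: fv_nth_axis)
  then show ?thesis by (simp add: fv_nth_axis inner_commute)
qed

section \<open>Transfer of flats and distances to this space\<close>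

definition vf :: "rvec \<Rightarrow> fvec" where
  "vf v = mkv (dim_vec v) (vec_index v)"

lemma vf_mkv: "v \<in> carrier_vec d \<Longrightarrow> vf v = mkv d (vec_index v)"
  by (auto simp: vf_def)

lemma vf_add:
  assumes "v \<in> carrier_vec d" "w \<in> carrier_vec d"
  shows "vf (v + w) = vf v + vf w"
proof -
  have "v + w \<in> carrier_vec d" using assms by simp
  then show ?thesis using assms by (auto simp: vf_mkv[of _ d] mkv_add intro!: mkv_cong)
qed

lemma vf_diff:
  assumes "v \<in> carrier_vec d" "w \<in> carrier_vec d"
  shows "vf (v - w) = vf v - vf w"
proof -
  have "v - w \<in> carrier_vec d" using assms by simp
  then show ?thesis using assms by (auto simp: vf_mkv[of _ d] mkv_diff intro!: mkv_cong)
qed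

lemma vf_smult: "vf (c \<cdot>\<^sub>v v) = c *\<^sub>R vf v"
  by (auto simp: vf_def mkv_scale intro!: mkv_cong)

lemma inner_vf:
  assumes "v \<in> carrier_vec d" "w \<in> carrier_vec d"
  shows "inner (vf v) (vf w) = scalar_prod v w"
  using assms by (simp add: vf_mkv[of _ d] inner_mkv scalar_prod_def atLeast0LessThan)

lemma vf_inj: "v \<in> carrier_vec d \<Longrightarrow> w \<in> carrier_vec d \<Longrightarrow> vf v = vf w \<longleftrightarrow> v = w"
  by (auto simp: vf_mkv[of _ d] mkv_eq_iff)

lemma vf_zero: "vf (0\<^sub>v d) = 0"
  by (auto simp: vf_def mkv_zero[of d, symmetric] intro!: mkv_cong)

lemma vf_vec: "vf (Matrix.vec d f) = mkv d f"
  by (auto simp: vf_def intro!: mkv_cong)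

lemma vf_translate:
  assumes b: "b \<in> carrier_vec d" and W: "W \<subseteq> carrier_vec d"
  shows "vf ` {b + w | w. w \<in> W} = {vf b + y | y. y \<in> vf ` W}"
proof -
  have "vf ` {b + w | w. w \<in> W} = (\<lambda>w. vf (b + w)) ` W" by (auto simp: image_def)
  also have "\<dots> = (\<lambda>w. vf b + vf w) ` W" using W by (intro image_cong) (auto simp: vf_add[OF b])
  finally show ?thesis by auto
qed

text \<open>Since \<open>vf\<close> is injective and preserves inner products, the foot of the
  perpendicular can be computed in \<open>fvec\<close> and pulled back; its uniqueness resolves the
  description operator in \<open>orth_proj\<close>.\<close>

lemma flat_dist_perp:
  assumes F: "F \<subseteq> carrier_vec d" "vf ` F = {b + y | y. y \<in> span B}" and B: "finite B"
    and p: "p \<in> carrier_vec d"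
  shows "flat_dist F p = norm (perp (span B) (vf p - b))"
proof -
  let ?r = "perp (span B) (vf p - b)"
  have "vf p - ?r = b + ((vf p - b) - ?r)" by simp
  then have "vf p - ?r \<in> vf ` F" using perp_span(1)[OF B, of "vf p - b"] F(2) by blast
  then obtain q where q: "q \<in> F" "vf q = vf p - ?r" by (metis imageE)
  have qc: "q \<in> carrier_vec d" using q F by auto
  have memF: "vf x - b \<in> span B" if "x \<in> F" for x
  proof -
    have "vf x \<in> {b + y | y. y \<in> span B}" using that F(2) by blast
    then show ?thesis by auto
  qed
  have sp: "scalar_prod (p - q') (x - q') = inner (vf p - vf q') (vf x - vf q')"
    if "q' \<in> F" "x \<in> F" for q' x
  proof -
    have "q' \<in> carrier_vec d" "x \<in> carrier_vec d" using that F by auto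
    then show ?thesis using p by (simp add: inner_vf[of _ d] vf_diff[of _ d, symmetric])
  qed
  have "orth_proj F p = q"
    unfolding orth_proj_def
  proof (rule the_equality)
    show "q \<in> F \<and> (\<forall>x\<in>F. scalar_prod (p - q) (x - q) = 0)"
    proof (intro conjI ballI q(1))
      fix x assume x: "x \<in> F"
      have "(vf x - b) - (vf q - b) \<in> span B" using memF[OF x] memF[OF q(1)] by (rule span_diff)
      then have "inner ?r (vf x - vf q) = 0" using perp_span(2)[OF B] by simp
      then show "scalar_prod (p - q) (x - q) = 0" unfolding sp[OF q(1) x] using q(2) by simp
    qed
  next
    fix q' assume q': "q' \<in> F \<and> (\<forall>x\<in>F. scalar_prod (p - q') (x - q') = 0)"
    have "perp (span B) (vf p - b) = vf p - vf q'"
    proof (rule perp_eqI)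
      show "vf p - b - (vf p - vf q') \<in> span B" using memF[of q'] q' by simp
    next
      fix y assume y: "y \<in> span B"
      have "(vf q' - b) + y \<in> span B" using memF[OF conjunct1[OF q']] y by (rule span_add)
      moreover have "vf q' + y = b + ((vf q' - b) + y)" by simp
      ultimately have "vf q' + y \<in> vf ` F" unfolding F(2) by blast
      then obtain x where x: "x \<in> F" "vf x = vf q' + y" by (metis imageE)
      have "inner (vf p - vf q') (vf x - vf q') = 0" using q' x(1) sp[of q' x] by auto
      then show "inner (vf p - vf q') y = 0" using x(2) by simp
    qed
    then have "vf q' = vf q" using q(2) by simp
    then show "q' = q" using vf_inj[of q' d q] q' qc F by auto
  qed
  then have "flat_dist F p = sqrt (inner (vf (p - q)) (vf (p - q)))"
    unfolding flat_dist_def Let_def using p qc by (simp add: inner_vf[of _ d])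
  also have "vf (p - q) = ?r" using p qc q(2) by (simp add: vf_diff[of _ d])
  finally show ?thesis by (simp add: norm_eq_sqrt_inner)
qed

lemma vf_lincomb:
  assumes "finite A" "A \<subseteq> carrier_vec d"
  shows "vf (module.lincomb (euclid d) a A) = (\<Sum>v\<in>A. a v *\<^sub>R vf v) \<and>
    module.lincomb (euclid d) a A \<in> carrier_vec d"
proof -
  interpret vec_space "TYPE(real)" d .
  show ?thesis using assms
  proof (induction A)
    case empty
    then show ?case by (simp add: lincomb_def vf_zero)
  next
    case (insert v A)
    then have "lincomb a (insert v A) = a v \<cdot>\<^sub>v v + lincomb a A"
      by (subst lincomb_insert2) auto
    moreover have "a v \<cdot>\<^sub>v v \<in> carrier_vec d" using insert by auto
    ultimately show ?case using insert by (simp add: vf_add[of _ d] vf_smult)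
  qed
qed

lemma vf_span:
  assumes "finite S" "S \<subseteq> carrier_vec d"
  shows "vf ` module.span class_ring (euclid d) S = span (vf ` S)"
proof -
  interpret vec_space "TYPE(real)" d .
  have inj: "inj_on vf S" using assms(2) vf_inj[of _ d] by (auto simp: inj_on_def)
  have "span S = {lincomb a S | a. True}"
    using finite_span[OF assms(1)] assms(2) by auto
  then have "vf ` span S = {\<Sum>v\<in>S. a v *\<^sub>R vf v | a. True}"
    using vf_lincomb[OF assms] by (auto simp: image_iff) metis
  also have "\<dots> = range (\<lambda>u. \<Sum>v\<in>vf ` S. u v *\<^sub>R v)"
  proof (intro equalityI subsetI)
    fix x assume "x \<in> {\<Sum>v\<in>S. a v *\<^sub>R vf v | a. True}"
    then obtain a where "x = (\<Sum>v\<in>S. a v *\<^sub>R vf v)" by auto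
    also have "\<dots> = (\<Sum>v\<in>vf ` S. a (inv_into S vf v) *\<^sub>R v)"
      by (subst sum.reindex[OF inj]) (simp add: inj)
    finally show "x \<in> range (\<lambda>u. \<Sum>v\<in>vf ` S. u v *\<^sub>R v)"
      by (intro range_eqI[of _ _ "\<lambda>v. a (inv_into S vf v)"])
  next
    fix x assume "x \<in> range (\<lambda>u. \<Sum>v\<in>vf ` S. u v *\<^sub>R v)"
    then obtain u where "x = (\<Sum>v\<in>vf ` S. u v *\<^sub>R v)" by auto
    then have "x = (\<Sum>v\<in>S. u (vf v) *\<^sub>R vf v)" by (simp add: sum.reindex[OF inj])
    then show "x \<in> {\<Sum>v\<in>S. a v *\<^sub>R vf v | a. True}"
      by (intro CollectI exI[of _ "\<lambda>v. u (vf v)"]) simp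
  qed
  also have "\<dots> = real_vector.span (vf ` S)"
    using assms(1) by (simp add: real_vector.span_finite)
  finally show ?thesis .
qed

text \<open>The dimension is that of \<open>W\<close> as a space of its own, in which a finite basis
  is not given in advance. It exists because independent subsets of \<open>W\<close> are independent
  in the whole space and hence of bounded size.\<close>

lemma subspace_generators:
  assumes W: "VectorSpace.subspace class_ring W (euclid d)"
    and dim: "vectorspace.dim class_ring ((euclid d)\<lparr>carrier := W\<rparr>) = j"
  obtains A where "finite A" "card A = j" "A \<subseteq> carrier_vec d"
    "W = module.span class_ring (euclid d) A"
proof -
  interpret V: vec_space "TYPE(real)" d .
  interpret W: vectorspace class_ring "(euclid d)\<lparr>carrier := W\<rparr>"
    by (rule V.subspace_is_vs[OF W])
  have sub: "submodule class_ring W (euclid d)" using W by (simp add: VectorSpace.subspace_def)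
  then have Wc: "W \<subseteq> carrier_vec d" by (auto simp: submodule_def)
  have "W.fin_dim"
  proof -
    have bd: "finite S \<and> card S \<le> V.dim" if "S \<subseteq> W" "W.lin_indpt S" for S
      using V.li_le_dim[of S] that V.span_li_not_depend(2)[OF that(1) sub] Wc by auto
    have "\<exists>A. finite A \<and> maximal A (\<lambda>S. S \<subseteq> carrier (V.vs W) \<and> W.lin_indpt S)"
      by (rule maximal_exists[where N = "V.dim" and B = "{}"]) (use bd in \<open>auto simp: W.lin_dep_def\<close>)
    then obtain A where "finite A" "maximal A (\<lambda>S. S \<subseteq> carrier (V.vs W) \<and> W.lin_indpt S)" by blast
    then have "W.basis A" by (intro W.max_li_is_basis)
    then show ?thesis using \<open>finite A\<close> by (auto simp: W.fin_dim_def W.basis_def)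
  qed
  then obtain A where A: "finite A" "W.basis A" using W.finite_basis_exists by blast
  then have "card A = j" using W.dim_basis dim by auto
  moreover have AW: "A \<subseteq> W" and "W.span A = W" using A(2) by (auto simp: W.basis_def)
  then have "W = V.span A" using V.span_li_not_depend(1)[OF AW sub] by simp
  ultimately show ?thesis using that[of A] A(1) AW Wc by auto
qed

text \<open>Only finitely many axes meet the supports of the given vectors, and any other axis is
  orthogonal to all of them.\<close>

lemma ons_enlarge:
  fixes E :: "nat \<Rightarrow> fvec"
  assumes "ons E m" "m \<le> j"
  obtains u where "ons u j" "span (E ` {1..m}) \<subseteq> span (u ` {1..j})"
proof -
  have "\<exists>u. ons u j \<and> span (E ` {1..m}) \<subseteq> span (u ` {1..j})" using assms(2)
  proof (induction j rule: dec_induct)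
    case base
    then show ?case using assms(1) by auto
  next
    case (step l)
    then obtain u where u: "ons u l" "span (E ` {1..m}) \<subseteq> span (u ` {1..l})" by auto
    have "finite (\<Union>i\<in>{1..l}. {k. fv_nth (u i) k \<noteq> 0})" by (auto intro: finite_fv_support)
    from ex_new_if_finite[OF _ this] obtain t where t: "t \<notin> (\<Union>i\<in>{1..l}. {k. fv_nth (u i) k \<noteq> 0})"
      by auto
    have "axis_fv t \<noteq> 0" by (metis fv_nth_axis zero_fvec.rep_eq zero_neq_one)
    moreover have "inner (axis_fv t) (u i) = 0" if "i \<in> {1..l}" for i
      using t that by (auto simp: inner_commute[of "axis_fv t"] inner_axis)
    ultimately have "ons (u(Suc l := (1 / norm (axis_fv t)) *\<^sub>R axis_fv t)) (Suc l)"
      using ons_extend[OF u(1)] by blast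
    moreover have "span (u ` {1..l}) \<subseteq> span ((u(Suc l := (1 / norm (axis_fv t)) *\<^sub>R axis_fv t)) ` {1..Suc l})"
      by (rule span_mono) (auto simp: image_iff)
    ultimately show ?case using u(2) by blast
  qed
  then show ?thesis using that by blast
qed

text \<open>The orthonormal system may leave \<open>\<real>\<^sup>d\<close>: only an upper bound for the distance is needed.\<close>

lemma is_flat_orthonormal:
  assumes "is_flat d j F"
  obtains b u where "ons u j"
    "\<And>p. p \<in> carrier_vec d \<Longrightarrow> norm (perp (span (u ` {1..j})) (vf p - b)) \<le> flat_dist F p"
proof -
  interpret V: vec_space "TYPE(real)" d .
  obtain b W where b: "b \<in> carrier_vec d" and W: "VectorSpace.subspace class_ring W (euclid d)"
    "vectorspace.dim class_ring ((euclid d)\<lparr>carrier := W\<rparr>) = j" and F: "F = {b + w | w. w \<in> W}"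
    using assms by (auto simp: is_flat_def)
  obtain A where A: "finite A" "card A = j" "A \<subseteq> carrier_vec d" "W = V.span A"
    using subspace_generators[OF W] by metis
  obtain E m where E: "ons E m" "real_vector.span (E ` {1..m}) = real_vector.span (vf ` A)" "m \<le> card (vf ` A)"
    using gram_schmidt_exists[of "vf ` A"] A(1) by blast
  have "m \<le> j" using E(3) card_image_le[OF A(1), of vf] A(2) by simp
  then obtain u where u: "ons u j" "real_vector.span (E ` {1..m}) \<subseteq> real_vector.span (u ` {1..j})"
    using ons_enlarge[OF E(1)] by metis
  have Wc: "W \<subseteq> carrier_vec d" using A V.span_is_subset2[of A] by auto
  have Fc: "F \<subseteq> carrier_vec d" using F b Wc by auto
  have vfF: "vf ` F = {vf b + y | y. y \<in> real_vector.span (vf ` A)}"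
    unfolding F vf_translate[OF b Wc] using vf_span[OF A(1,3)] A(4) by simp
  have "norm (perp (real_vector.span (u ` {1..j})) (vf p - vf b)) \<le> flat_dist F p" if p: "p \<in> carrier_vec d" for p
  proof -
    let ?r = "perp (real_vector.span (vf ` A)) (vf p - vf b)"
    have fin: "finite (vf ` A)" using A(1) by simp
    have "vf p - vf b - ?r \<in> real_vector.span (u ` {1..j})"
      using perp_span(1)[OF fin, of "vf p - vf b"] E(2) u(2) by auto
    from norm_perp_le[OF _ this, of "vf p - vf b"]
    have "norm (perp (real_vector.span (u ` {1..j})) (vf p - vf b)) \<le> norm ?r" by simp
    also have "\<dots> = flat_dist F p" using flat_dist_perp[OF Fc vfF fin p] by simp
    finally show ?thesis .
  qed
  then show ?thesis using that[OF u(1)] by blast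
qed

text \<open>Meant for the output of the program: orthonormality of the embedded vectors forces
  independence, so that the dimension is exactly \<open>j\<close>.\<close>

lemma orthonormal_is_flat:
  assumes v: "\<And>i. i \<le> j \<Longrightarrow> v i \<in> carrier_vec d" and on: "ons (\<lambda>i. vf (v i)) j"
    and F: "F = {v 0 + w | w. w \<in> module.span class_ring (euclid d) (v ` {1..j})}"
  shows "is_flat d j F"
    "\<And>p. p \<in> carrier_vec d \<Longrightarrow>
       flat_dist F p = norm (perp (span ((\<lambda>i. vf (v i)) ` {1..j})) (vf p - vf (v 0)))"
proof -
  interpret V: vec_space "TYPE(real)" d .
  let ?S = "v ` {1..j}"
  have Sc: "?S \<subseteq> carrier_vec d" using v by auto
  have inj: "inj_on v {1..j}"
  proof (rule inj_onI)
    fix i k assume ik: "i \<in> {1..j}" "k \<in> {1..j}" "v i = v k"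
    then have "inner (vf (v i)) (vf (v k)) = 1" using on by (auto simp: ons_def)
    then show "i = k" using on ik(1,2) unfolding ons_def by (metis zero_neq_one)
  qed
  have li: "V.lin_indpt ?S"
  proof
    assume "V.lin_dep ?S"
    then obtain A a x where A: "finite A" "A \<subseteq> ?S" "V.lincomb a A = 0\<^sub>v d" "x \<in> A" "a x \<noteq> 0"
      unfolding V.lin_dep_def by (auto simp: class_ring_simps)
    have "0 = (\<Sum>y\<in>A. a y *\<^sub>R vf y)"
      using vf_lincomb[of A d a] A Sc by (auto simp: vf_zero)
    then have "0 = (\<Sum>y\<in>A. a y * inner (vf y) (vf x))"
      by (metis (mono_tags, lifting) inner_scaleR_left inner_sum_left inner_zero_left sum.cong)
    also have "\<dots> = (\<Sum>y\<in>A. if y = x then a y else 0)"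
    proof (rule sum.cong[OF refl])
      fix y assume "y \<in> A"
      then obtain i k where ik: "i \<in> {1..j}" "k \<in> {1..j}" "y = v i" "x = v k"
        using A by (meson imageE subsetD)
      have "inner (vf (v i)) (vf (v k)) = (if i = k then 1 else 0)"
        using on ik(1,2) by (simp only: ons_def)
      then show "a y * inner (vf y) (vf x) = (if y = x then a y else 0)"
        using inj_on_eq_iff[OF inj ik(1,2)] ik(3,4) by simp
    qed
    also have "\<dots> = a x" using A by simp
    finally show False using A by simp
  qed
  have "maximal ?S (\<lambda>T. T \<subseteq> ?S \<and> V.lin_indpt T)" using li by (auto simp: maximal_def)
  then have "vectorspace.dim class_ring (V.span_vs ?S) = j"
    using V.dim_span[of ?S ?S] Sc inj by (auto simp: card_image)
  moreover have "VectorSpace.subspace class_ring (V.span ?S) (euclid d)"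
    using V.span_is_subspace Sc by auto
  ultimately show "is_flat d j F" unfolding is_flat_def F using v[of 0] by blast
  fix p :: rvec assume p: "p \<in> carrier_vec d"
  have Wc: "V.span ?S \<subseteq> carrier_vec d" using Sc V.span_is_subset2[of ?S] by auto
  have Fc: "F \<subseteq> carrier_vec d" using F v[of 0] Wc by auto
  have "vf ` F = {vf (v 0) + y | y. y \<in> real_vector.span ((\<lambda>i. vf (v i)) ` {1..j})}"
    unfolding F vf_translate[OF v[OF le0] Wc] using vf_span[OF _ Sc] by (simp add: image_image)
  then show "flat_dist F p = norm (perp (real_vector.span ((\<lambda>i. vf (v i)) ` {1..j})) (vf p - vf (v 0)))"
    by (intro flat_dist_perp[OF Fc _ _ p]) auto
qed

section \<open>Structured commands\<close>

datatype 'b com =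
    Skip
  | Bas 'b
  | Seq "'b com" "'b com"  (infixr ";;" 60)
  | IfN nat nat "'b com"
  | IfR nat nat "'b com"
  | WhileN nat nat "'b com"
  | WhileR nat nat "'b com"

text \<open>\<open>bs sem gn gr c s D T\<close>: started in \<open>s\<close>, the command \<open>c\<close> terminates within cost \<open>T\<close>
  on every random choice, and the final state has distribution \<open>D\<close>.\<close>

inductive bs :: "('b \<Rightarrow> 's \<Rightarrow> 's pmf) \<Rightarrow> ('s \<Rightarrow> nat \<Rightarrow> nat) \<Rightarrow> ('s \<Rightarrow> nat \<Rightarrow> real) \<Rightarrow>
    'b com \<Rightarrow> 's \<Rightarrow> 's pmf \<Rightarrow> nat \<Rightarrow> bool"
  for sem gn gr where
  bs_weaken: "bs sem gn gr c s D T \<Longrightarrow> T \<le> T' \<Longrightarrow> bs sem gn gr c s D T'"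
| bs_skip: "bs sem gn gr Skip s (return_pmf s) 0"
| bs_bas: "bs sem gn gr (Bas b) s (sem b s) 1"
| bs_seq: "bs sem gn gr c1 s D1 T1 \<Longrightarrow> (\<And>s'. s' \<in> set_pmf D1 \<Longrightarrow> bs sem gn gr c2 s' (D2 s') T2) \<Longrightarrow>
    bs sem gn gr (c1 ;; c2) s (bind_pmf D1 D2) (T1 + T2)"
| bs_ifN: "(gn s a < gn s b \<Longrightarrow> bs sem gn gr c s D T) \<Longrightarrow> (\<not> gn s a < gn s b \<Longrightarrow> D = return_pmf s) \<Longrightarrow>
    bs sem gn gr (IfN a b c) s D (T + 2)"
| bs_ifR: "(gr s a < gr s b \<Longrightarrow> bs sem gn gr c s D T) \<Longrightarrow> (\<not> gr s a < gr s b \<Longrightarrow> D = return_pmf s) \<Longrightarrow>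
    bs sem gn gr (IfR a b c) s D (T + 2)"
| bs_whileN_False: "\<not> gn s a < gn s b \<Longrightarrow> bs sem gn gr (WhileN a b c) s (return_pmf s) 2"
| bs_whileN: "gn s a < gn s b \<Longrightarrow> bs sem gn gr c s D1 T1 \<Longrightarrow>
    (\<And>s'. s' \<in> set_pmf D1 \<Longrightarrow> bs sem gn gr (WhileN a b c) s' (D2 s') T2) \<Longrightarrow>
    bs sem gn gr (WhileN a b c) s (bind_pmf D1 D2) (T1 + T2 + 2)"
| bs_whileR_False: "\<not> gr s a < gr s b \<Longrightarrow> bs sem gn gr (WhileR a b c) s (return_pmf s) 2"
| bs_whileR: "gr s a < gr s b \<Longrightarrow> bs sem gn gr c s D1 T1 \<Longrightarrow>
    (\<And>s'. s' \<in> set_pmf D1 \<Longrightarrow> bs sem gn gr (WhileR a b c) s' (D2 s') T2) \<Longrightarrow>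
    bs sem gn gr (WhileR a b c) s (bind_pmf D1 D2) (T1 + T2 + 2)"

section \<open>Compilation to the random access machine\<close>

type_synonym mem = "(nat \<Rightarrow> nat) \<times> (nat \<Rightarrow> real)"

definition at_pc :: "nat \<Rightarrow> mem \<Rightarrow> state" where
  "at_pc p m = \<lparr>pc = p, nmem = fst m, rmem = snd m\<rparr>"

fun dex :: "rvec list \<Rightarrow> instr \<Rightarrow> mem \<Rightarrow> mem" where
  "dex ps (NConst a c) (n, r) = (n(a := c), r)"
| "dex ps (NOp f a b c) (n, r) = (n(a := nat_fun f (n b) (n c)), r)"
| "dex ps (NLoad a b) (n, r) = (n(a := n (n b)), r)"
| "dex ps (NStore a b) (n, r) = (n(n a := n b), r)"
| "dex ps (ROfNat a b) (n, r) = (n, r(a := real (n b)))"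
| "dex ps (ROp f a b c) (n, r) = (n, r(a := real_fun f (r b) (r c)))"
| "dex ps (RSqrt a b) (n, r) = (n, r(a := sqrt (r b)))"
| "dex ps (RLoad a b) (n, r) = (n, r(a := r (n b)))"
| "dex ps (RStore a b) (n, r) = (n, r(n a := r b))"
| "dex ps (Coord a b c) (n, r) = (n, r(a := coord ps (n b) (n c)))"
| "dex ps _ m = m"

fun nojump :: "instr \<Rightarrow> bool" where
  "nojump (Jump _) = False"
| "nojump (JumpNLess _ _ _) = False"
| "nojump (JumpRLess _ _ _) = False"
| "nojump _ = True"

definition sem0 :: "rvec list \<Rightarrow> instr \<Rightarrow> mem \<Rightarrow> mem pmf" where
  "sem0 ps i m = (case i of
     Sample a \<Rightarrow> map_pmf (\<lambda>x. ((fst m)(a := x), snd m)) (pmf_of_set {..<length ps})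
   | _ \<Rightarrow> return_pmf (dex ps i m))"

lemma exec_sem0: "nojump i \<Longrightarrow> exec ps i (at_pc p m) = map_pmf (at_pc (Suc p)) (sem0 ps i m)"
  by (cases i; cases m)
    (simp_all add: sem0_def at_pc_def set_n_def set_r_def pmf.map_comp comp_def)

fun clen :: "instr com \<Rightarrow> nat" where
  "clen Skip = 0"
| "clen (Bas i) = 1"
| "clen (c1 ;; c2) = clen c1 + clen c2"
| "clen (IfN a b c) = clen c + 2"
| "clen (IfR a b c) = clen c + 2"
| "clen (WhileN a b c) = clen c + 3"
| "clen (WhileR a b c) = clen c + 3"

text \<open>A conditional jump is taken when the test succeeds, whereas a body has to be skipped
  when it fails; hence the test jumps over an unconditional jump to the end. A test costs at most
  two steps, or one plus the jump back, which is the surcharge 2 in \<open>bs\<close>.\<close>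

fun compile :: "nat \<Rightarrow> instr com \<Rightarrow> instr list" where
  "compile p Skip = []"
| "compile p (Bas i) = [i]"
| "compile p (c1 ;; c2) = compile p c1 @ compile (p + clen c1) c2"
| "compile p (IfN a b c) = [JumpNLess a b (p + 2), Jump (p + 2 + clen c)] @ compile (p + 2) c"
| "compile p (IfR a b c) = [JumpRLess a b (p + 2), Jump (p + 2 + clen c)] @ compile (p + 2) c"
| "compile p (WhileN a b c) = [JumpNLess a b (p + 2), Jump (p + 3 + clen c)] @ compile (p + 2) c @ [Jump p]"
| "compile p (WhileR a b c) = [JumpRLess a b (p + 2), Jump (p + 3 + clen c)] @ compile (p + 2) c @ [Jump p]"

lemma length_compile: "length (compile p c) = clen c"
  by (induction c arbitrary: p) auto

fun wfc :: "instr com \<Rightarrow> bool" where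
  "wfc Skip = True"
| "wfc (Bas i) = nojump i"
| "wfc (c1 ;; c2) = (wfc c1 \<and> wfc c2)"
| "wfc (IfN a b c) = wfc c"
| "wfc (IfR a b c) = wfc c"
| "wfc (WhileN a b c) = wfc c"
| "wfc (WhileR a b c) = wfc c"

definition code_at :: "program \<Rightarrow> nat \<Rightarrow> instr list \<Rightarrow> bool" where
  "code_at A p is \<longleftrightarrow> (\<forall>i<length is. p + i < length A \<and> A ! (p + i) = is ! i)"

lemma code_at_append:
  "code_at A p (is @ js) \<longleftrightarrow> code_at A p is \<and> code_at A (p + length is) js"
proof
  assume c: "code_at A p (is @ js)"
  have "p + (length is + i) < length A \<and> A ! (p + (length is + i)) = js ! i" if "i < length js" for i
    using c that unfolding code_at_def by (metis add_less_cancel_left length_append nth_append_length_plus)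
  moreover have "p + i < length A \<and> A ! (p + i) = is ! i" if "i < length is" for i
    using c that unfolding code_at_def by (metis length_append nth_append trans_less_add1)
  ultimately show "code_at A p is \<and> code_at A (p + length is) js"
    by (simp add: code_at_def add.assoc)
next
  assume c: "code_at A p is \<and> code_at A (p + length is) js"
  show "code_at A p (is @ js)"
    unfolding code_at_def
  proof (intro allI impI)
    fix i assume i: "i < length (is @ js)"
    show "p + i < length A \<and> A ! (p + i) = (is @ js) ! i"
    proof (cases "i < length is")
      case True
      then show ?thesis using c by (auto simp: code_at_def nth_append)
    next
      case False
      then have "i - length is < length js" using i by auto
      then have "p + length is + (i - length is) < length A \<and>
          A ! (p + length is + (i - length is)) = js ! (i - length is)"
        using c by (auto simp: code_at_def)
      then show ?thesis using False by (simp add: nth_append)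
    qed
  qed
qed

lemma code_at_Cons: "code_at A p (i # is) \<longleftrightarrow> p < length A \<and> A ! p = i \<and> code_at A (Suc p) is"
proof -
  have "code_at A p ([i] @ is) \<longleftrightarrow> code_at A p [i] \<and> code_at A (p + length [i]) is"
    by (rule code_at_append)
  then show ?thesis by (auto simp: code_at_def)
qed

section \<open>Runs of the machine and composition of code fragments\<close>

lemma run_0: "run A ps s 0 = return_pmf s"
  by (simp add: run_def)

lemma run_Suc: "run A ps s (Suc t) = bind_pmf (step A ps s) (\<lambda>s'. run A ps s' t)"
proof (induction t)
  case 0
  show ?case by (simp add: run_def bind_return_pmf bind_return_pmf')
next
  case (Suc t)
  have "run A ps s (Suc (Suc t)) = bind_pmf (run A ps s (Suc t)) (step A ps)" by (simp add: run_def)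
  also have "\<dots> = bind_pmf (step A ps s) (\<lambda>s'. bind_pmf (run A ps s' t) (step A ps))"
    by (simp add: Suc bind_assoc_pmf)
  finally show ?case by (simp add: run_def)
qed

lemma run_add: "run A ps s (t + k) = bind_pmf (run A ps s t) (\<lambda>s'. run A ps s' k)"
proof (induction t arbitrary: s)
  case 0
  show ?case by (simp add: run_0 bind_return_pmf)
next
  case (Suc t)
  then show ?case by (simp add: run_Suc bind_assoc_pmf)
qed

lemma run_halted: "halted A s \<Longrightarrow> run A ps s t = return_pmf s"
  by (induction t) (simp_all add: run_0 run_Suc step_def bind_return_pmf)

lemma run_stable:
  assumes "halts_within A ps s t" "t \<le> t'"
  shows "run A ps s t' = run A ps s t"
proof -
  have "run A ps s (t + (t' - t)) = bind_pmf (run A ps s t) return_pmf"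
    unfolding run_add using assms(1)
    by (intro bind_pmf_cong) (auto simp: halts_within_def run_halted)
  then show ?thesis using assms(2) by (simp add: bind_return_pmf')
qed

lemma halts_mono: "halts_within A ps s t \<Longrightarrow> t \<le> t' \<Longrightarrow> halts_within A ps s t'"
  using run_stable unfolding halts_within_def by metis

text \<open>Branches of a random computation may take different times, while \<open>run\<close>
  executes a fixed number of steps. The definition therefore speaks about the whole remaining run:
  if every continuation from the end of the fragment halts within \<open>t\<close> steps, surplus
  steps do no harm, and \<open>T + t\<close> steps amount to \<open>D\<close> followed by the
  continuation.\<close>

definition frag :: "program \<Rightarrow> rvec list \<Rightarrow> nat \<Rightarrow> nat \<Rightarrow> mem \<Rightarrow> mem pmf \<Rightarrow> nat \<Rightarrow> bool" where
  "frag A ps p p' m D T \<longleftrightarrow> (\<forall>t. (\<forall>m'\<in>set_pmf D. halts_within A ps (at_pc p' m') t) \<longrightarrow>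
     run A ps (at_pc p m) (T + t) = bind_pmf D (\<lambda>m'. run A ps (at_pc p' m') t))"

lemma frag_weaken:
  assumes "frag A ps p p' m D T" "T \<le> T'"
  shows "frag A ps p p' m D T'"
  unfolding frag_def
proof (intro allI impI)
  fix t assume t: "\<forall>m'\<in>set_pmf D. halts_within A ps (at_pc p' m') t"
  then have "\<forall>m'\<in>set_pmf D. halts_within A ps (at_pc p' m') (T' - T + t)"
    using halts_mono by (metis le_add2)
  then have "run A ps (at_pc p m) (T + (T' - T + t)) =
      bind_pmf D (\<lambda>m'. run A ps (at_pc p' m') (T' - T + t))"
    using assms(1) unfolding frag_def by blast
  also have "\<dots> = bind_pmf D (\<lambda>m'. run A ps (at_pc p' m') t)"
    using t by (intro bind_pmf_cong refl run_stable) auto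
  finally show "run A ps (at_pc p m) (T' + t) = bind_pmf D (\<lambda>m'. run A ps (at_pc p' m') t)"
    using assms(2) by simp
qed

lemma frag_refl: "frag A ps p p m (return_pmf m) 0"
  by (simp add: frag_def bind_return_pmf)

lemma frag_seq:
  assumes "frag A ps p p1 m D1 T1" "\<And>m'. m' \<in> set_pmf D1 \<Longrightarrow> frag A ps p1 p2 m' (D2 m') T2"
  shows "frag A ps p p2 m (bind_pmf D1 D2) (T1 + T2)"
  unfolding frag_def
proof (intro allI impI)
  fix t assume t: "\<forall>m'\<in>set_pmf (bind_pmf D1 D2). halts_within A ps (at_pc p2 m') t"
  have 2: "run A ps (at_pc p1 m') (T2 + t) = bind_pmf (D2 m') (\<lambda>m''. run A ps (at_pc p2 m'') t)"
    if "m' \<in> set_pmf D1" for m'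
    using assms(2)[OF that] t that unfolding frag_def by auto
  have "\<forall>m'\<in>set_pmf D1. halts_within A ps (at_pc p1 m') (T2 + t)"
    unfolding halts_within_def using 2 t by (auto simp: halts_within_def)
  then have "run A ps (at_pc p m) (T1 + (T2 + t)) = bind_pmf D1 (\<lambda>m'. run A ps (at_pc p1 m') (T2 + t))"
    using assms(1) unfolding frag_def by blast
  also have "\<dots> = bind_pmf D1 (\<lambda>m'. bind_pmf (D2 m') (\<lambda>m''. run A ps (at_pc p2 m'') t))"
    using 2 by (intro bind_pmf_cong) auto
  finally show "run A ps (at_pc p m) (T1 + T2 + t) = bind_pmf (bind_pmf D1 D2) (\<lambda>m'. run A ps (at_pc p2 m') t)"
    by (simp add: bind_assoc_pmf add.assoc)
qed

lemma frag_jump: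
  assumes "p < length A" "exec ps (A ! p) (at_pc p m) = return_pmf (at_pc p1 m)" "frag A ps p1 p2 m D T"
  shows "frag A ps p p2 m D (Suc T)"
  using assms unfolding frag_def
  by (simp add: run_Suc step_def halted_def at_pc_def bind_return_pmf not_le)

lemma frag_basic:
  assumes "p < length A" "A ! p = i" "nojump i"
  shows "frag A ps p (Suc p) m (sem0 ps i m) 1"
proof -
  have "step A ps (at_pc p m) = map_pmf (at_pc (Suc p)) (sem0 ps i m)"
    using assms by (simp add: step_def halted_def exec_sem0[symmetric]) (simp add: at_pc_def)
  then show ?thesis by (simp add: frag_def run_Suc bind_map_pmf One_nat_def)
qed

lemma compile_correct:
  assumes "bs (sem0 ps) fst snd c m D T" "code_at A p (compile p c)" "wfc c"
  shows "frag A ps p (p + clen c) m D T"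
  using assms
proof (induction arbitrary: p rule: bs.induct)
  case (bs_weaken c s D T T')
  then show ?case using frag_weaken by blast
next
  case (bs_skip s)
  then show ?case by (simp add: frag_refl)
next
  case (bs_bas b s)
  then show ?case using frag_basic[of p A b ps s] by (simp add: code_at_Cons One_nat_def)
next
  case (bs_seq c1 s D1 T1 c2 D2 T2)
  have "frag A ps p (p + clen c1) s D1 T1" using bs_seq by (simp add: code_at_append)
  moreover have "frag A ps (p + clen c1) (p + clen c1 + clen c2) s' (D2 s') T2" if "s' \<in> set_pmf D1" for s'
    using bs_seq that by (simp add: code_at_append length_compile)
  ultimately show ?case using frag_seq by (simp add: add.assoc)
next
  case (bs_ifN s a b c D T)
  have code: "p < length A" "A ! p = JumpNLess a b (p + 2)" "Suc p < length A"
    "A ! Suc p = Jump (p + 2 + clen c)" "code_at A (p + 2) (compile (p + 2) c)"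
    using bs_ifN.prems by (auto simp: code_at_Cons)
  show ?case
  proof (cases "fst s a < fst s b")
    case True
    then have "frag A ps (p + 2) (p + 2 + clen c) s D T" using bs_ifN.IH[OF True code(5)] bs_ifN.prems by simp
    then have "frag A ps p (p + 2 + clen c) s D (Suc T)"
      by (rule frag_jump[OF code(1), rotated]) (simp add: code True jump_if_def at_pc_def)
    then show ?thesis by (auto elim!: frag_weaken simp: algebra_simps)
  next
    case False
    then have "D = return_pmf s" using bs_ifN by simp
    then have "frag A ps (p + 2 + clen c) (p + 2 + clen c) s D 0" by (simp add: frag_refl)
    then have "frag A ps (Suc p) (p + 2 + clen c) s D (Suc 0)"
      by (rule frag_jump[OF code(3), rotated]) (simp add: code jump_if_def at_pc_def)
    then have "frag A ps p (p + 2 + clen c) s D (Suc (Suc 0))"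
      by (rule frag_jump[OF code(1), rotated]) (simp add: code False jump_if_def at_pc_def)
    then show ?thesis by (auto elim!: frag_weaken simp: algebra_simps)
  qed
next
  case (bs_ifR s a b c D T)
  have code: "p < length A" "A ! p = JumpRLess a b (p + 2)" "Suc p < length A"
    "A ! Suc p = Jump (p + 2 + clen c)" "code_at A (p + 2) (compile (p + 2) c)"
    using bs_ifR.prems by (auto simp: code_at_Cons)
  show ?case
  proof (cases "snd s a < snd s b")
    case True
    then have "frag A ps (p + 2) (p + 2 + clen c) s D T" using bs_ifR.IH[OF True code(5)] bs_ifR.prems by simp
    then have "frag A ps p (p + 2 + clen c) s D (Suc T)"
      by (rule frag_jump[OF code(1), rotated]) (simp add: code True jump_if_def at_pc_def)
    then show ?thesis by (auto elim!: frag_weaken simp: algebra_simps)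
  next
    case False
    then have "D = return_pmf s" using bs_ifR by simp
    then have "frag A ps (p + 2 + clen c) (p + 2 + clen c) s D 0" by (simp add: frag_refl)
    then have "frag A ps (Suc p) (p + 2 + clen c) s D (Suc 0)"
      by (rule frag_jump[OF code(3), rotated]) (simp add: code jump_if_def at_pc_def)
    then have "frag A ps p (p + 2 + clen c) s D (Suc (Suc 0))"
      by (rule frag_jump[OF code(1), rotated]) (simp add: code False jump_if_def at_pc_def)
    then show ?thesis by (auto elim!: frag_weaken simp: algebra_simps)
  qed
next
  case (bs_whileN_False s a b c)
  have code: "p < length A" "A ! p = JumpNLess a b (p + 2)" "Suc p < length A"
    "A ! Suc p = Jump (p + 3 + clen c)"
    using bs_whileN_False.prems by (auto simp: code_at_Cons)
  have "frag A ps (p + 3 + clen c) (p + 3 + clen c) s (return_pmf s) 0" by (rule frag_refl)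
  then have "frag A ps (Suc p) (p + 3 + clen c) s (return_pmf s) (Suc 0)"
    by (rule frag_jump[OF code(3), rotated]) (simp add: code jump_if_def at_pc_def)
  then have "frag A ps p (p + 3 + clen c) s (return_pmf s) (Suc (Suc 0))"
    by (rule frag_jump[OF code(1), rotated])
      (use bs_whileN_False in \<open>simp add: code jump_if_def at_pc_def\<close>)
  then show ?case by (auto elim!: frag_weaken simp: algebra_simps)
next
  case (bs_whileN s a b c D1 T1 D2 T2)
  let ?e = "p + 2 + clen c"
  have code: "p < length A" "A ! p = JumpNLess a b (p + 2)" "code_at A (p + 2) (compile (p + 2) c)"
    "?e < length A" "A ! ?e = Jump p"
    using bs_whileN.prems by (auto simp: code_at_Cons code_at_append length_compile)
  have 1: "frag A ps (p + 2) ?e s D1 T1" using bs_whileN.IH(1)[OF code(3)] bs_whileN.prems by simp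
  have 2: "frag A ps ?e (p + clen (WhileN a b c)) s' (D2 s') (Suc T2)" if "s' \<in> set_pmf D1" for s'
    by (rule frag_jump[OF code(4), of _ _ p])
      (use bs_whileN that code(5) in \<open>auto simp: jump_if_def at_pc_def\<close>)
  have "frag A ps (p + 2) (p + clen (WhileN a b c)) s (bind_pmf D1 D2) (T1 + Suc T2)"
    by (rule frag_seq[OF 1 2])
  then have "frag A ps p (p + clen (WhileN a b c)) s (bind_pmf D1 D2) (Suc (T1 + Suc T2))"
    by (rule frag_jump[OF code(1), rotated])
      (use bs_whileN(1) in \<open>simp add: code jump_if_def at_pc_def\<close>)
  then show ?case by simp
next
  case (bs_whileR_False s a b c)
  have code: "p < length A" "A ! p = JumpRLess a b (p + 2)" "Suc p < length A"
    "A ! Suc p = Jump (p + 3 + clen c)"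
    using bs_whileR_False.prems by (auto simp: code_at_Cons)
  have "frag A ps (p + 3 + clen c) (p + 3 + clen c) s (return_pmf s) 0" by (rule frag_refl)
  then have "frag A ps (Suc p) (p + 3 + clen c) s (return_pmf s) (Suc 0)"
    by (rule frag_jump[OF code(3), rotated]) (simp add: code jump_if_def at_pc_def)
  then have "frag A ps p (p + 3 + clen c) s (return_pmf s) (Suc (Suc 0))"
    by (rule frag_jump[OF code(1), rotated])
      (use bs_whileR_False in \<open>simp add: code jump_if_def at_pc_def\<close>)
  then show ?case by (auto elim!: frag_weaken simp: algebra_simps)
next
  case (bs_whileR s a b c D1 T1 D2 T2)
  let ?e = "p + 2 + clen c"
  have code: "p < length A" "A ! p = JumpRLess a b (p + 2)" "code_at A (p + 2) (compile (p + 2) c)"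
    "?e < length A" "A ! ?e = Jump p"
    using bs_whileR.prems by (auto simp: code_at_Cons code_at_append length_compile)
  have 1: "frag A ps (p + 2) ?e s D1 T1" using bs_whileR.IH(1)[OF code(3)] bs_whileR.prems by simp
  have 2: "frag A ps ?e (p + clen (WhileR a b c)) s' (D2 s') (Suc T2)" if "s' \<in> set_pmf D1" for s'
    by (rule frag_jump[OF code(4), of _ _ p])
      (use bs_whileR that code(5) in \<open>auto simp: jump_if_def at_pc_def\<close>)
  have "frag A ps (p + 2) (p + clen (WhileR a b c)) s (bind_pmf D1 D2) (T1 + Suc T2)"
    by (rule frag_seq[OF 1 2])
  then have "frag A ps p (p + clen (WhileR a b c)) s (bind_pmf D1 D2) (Suc (T1 + Suc T2))"
    by (rule frag_jump[OF code(1), rotated])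
      (use bs_whileR(1) in \<open>simp add: code jump_if_def at_pc_def\<close>)
  then show ?case by simp
qed

section \<open>A program logic for expected values\<close>

fun blk :: "'b list \<Rightarrow> 'b com" where
  "blk [] = Skip"
| "blk (b # xs) = Bas b ;; blk xs"

locale prog =
  fixes sem :: "'b \<Rightarrow> 's \<Rightarrow> 's pmf" and gn :: "'s \<Rightarrow> nat \<Rightarrow> nat" and gr :: "'s \<Rightarrow> nat \<Rightarrow> real"
begin

text \<open>Every outcome satisfies \<open>Q\<close>, and the expectation of \<open>f\<close> in the final state is at least \<open>p\<close>.\<close>

definition J :: "'b com \<Rightarrow> 's \<Rightarrow> nat \<Rightarrow> ('s \<Rightarrow> bool) \<Rightarrow> ('s \<Rightarrow> real) \<Rightarrow> real \<Rightarrow> bool" where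
  "J c s T Q f p \<longleftrightarrow> (\<exists>D. bs sem gn gr c s D T \<and> (\<forall>s'\<in>set_pmf D. Q s') \<and>
     ennreal p \<le> (\<integral>\<^sup>+ s'. ennreal (f s') \<partial>measure_pmf D))"

text \<open>With value 0 only termination within \<open>T\<close> and the postcondition
  remain.\<close>

abbreviation tot :: "'b com \<Rightarrow> 's \<Rightarrow> nat \<Rightarrow> ('s \<Rightarrow> bool) \<Rightarrow> bool" where
  "tot c s T Q \<equiv> J c s T Q (\<lambda>_. 0) 0"

lemma J_conseq:
  assumes "J c s T Q f p" "T \<le> T'" "\<And>s'. Q s' \<Longrightarrow> Q' s'" "\<And>s'. Q s' \<Longrightarrow> f s' \<le> f' s'" "p' \<le> p"
  shows "J c s T' Q' f' p'"
proof -
  obtain D where D: "bs sem gn gr c s D T" "\<forall>s'\<in>set_pmf D. Q s'"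
    "ennreal p \<le> (\<integral>\<^sup>+ s'. ennreal (f s') \<partial>measure_pmf D)"
    using assms(1) by (auto simp: J_def)
  have "ennreal p' \<le> ennreal p" using assms(5) by (rule ennreal_leI)
  also have "\<dots> \<le> (\<integral>\<^sup>+ s'. ennreal (f' s') \<partial>measure_pmf D)"
    using D assms(4) by (intro order_trans[OF D(3)] nn_integral_mono_AE)
      (auto simp: AE_measure_pmf_iff intro: ennreal_leI)
  finally show ?thesis using D assms(2,3) unfolding J_def
    by (intro exI[of _ D]) (auto intro: bs_weaken)
qed

lemma J_const:
  assumes "tot c s T Q" "\<And>s'. Q s' \<Longrightarrow> p \<le> f s'"
  shows "J c s T Q f p"
proof -
  obtain D where D: "bs sem gn gr c s D T" "\<forall>s'\<in>set_pmf D. Q s'"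
    using assms(1) by (auto simp: J_def)
  have "ennreal p = (\<integral>\<^sup>+ s'. ennreal p \<partial>measure_pmf D)" by simp
  also have "\<dots> \<le> (\<integral>\<^sup>+ s'. ennreal (f s') \<partial>measure_pmf D)"
    using D assms(2) by (intro nn_integral_mono_AE) (auto simp: AE_measure_pmf_iff intro: ennreal_leI)
  finally show ?thesis using D unfolding J_def by blast
qed

lemma J_tot: "J c s T Q f p \<Longrightarrow> tot c s T Q"
  by (auto simp: J_def)

lemma J_skip: "Q s \<Longrightarrow> p \<le> f s \<Longrightarrow> J Skip s 0 Q f p"
  unfolding J_def by (intro exI[of _ "return_pmf s"]) (auto intro: bs_skip ennreal_leI)

lemma J_bas:
  assumes "\<And>s'. s' \<in> set_pmf (sem b s) \<Longrightarrow> Q s'"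
    "ennreal p \<le> (\<integral>\<^sup>+ s'. ennreal (f s') \<partial>measure_pmf (sem b s))"
  shows "J (Bas b) s 1 Q f p"
  unfolding J_def using assms by (auto intro!: exI[of _ "sem b s"] bs_bas)

text \<open>The law of total expectation. The second command need only be understood on states in
  the support of \<open>D\<close>, and a distribution is chosen for each of them separately.\<close>

lemma bind_values:
  assumes D: "\<forall>s'\<in>set_pmf D. Q1 s'" "ennreal p \<le> (\<integral>\<^sup>+ s'. ennreal (f s') \<partial>measure_pmf D)"
    and c2: "\<And>s'. Q1 s' \<Longrightarrow> J c2 s' T2 Q g (f s')"
  obtains D2 where "\<And>s'. s' \<in> set_pmf D \<Longrightarrow> bs sem gn gr c2 s' (D2 s') T2"
    "\<forall>s'\<in>set_pmf (bind_pmf D D2). Q s'" "ennreal p \<le> (\<integral>\<^sup>+ s'. ennreal (g s') \<partial>measure_pmf (bind_pmf D D2))"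
proof -
  have "\<forall>s'\<in>set_pmf D. \<exists>D2. bs sem gn gr c2 s' D2 T2 \<and> (\<forall>s'\<in>set_pmf D2. Q s') \<and>
     ennreal (f s') \<le> (\<integral>\<^sup>+ s'. ennreal (g s') \<partial>measure_pmf D2)"
    using c2 D(1) by (auto simp: J_def)
  then obtain D2 where D2: "\<forall>s'\<in>set_pmf D. bs sem gn gr c2 s' (D2 s') T2 \<and> (\<forall>s''\<in>set_pmf (D2 s'). Q s'') \<and>
     ennreal (f s') \<le> (\<integral>\<^sup>+ s''. ennreal (g s'') \<partial>measure_pmf (D2 s'))"
    by metis
  have "ennreal p \<le> (\<integral>\<^sup>+ s'. (\<integral>\<^sup>+ s''. ennreal (g s'') \<partial>measure_pmf (D2 s')) \<partial>measure_pmf D)"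
    using D2 by (intro order_trans[OF D(2)] nn_integral_mono_AE) (auto simp: AE_measure_pmf_iff)
  then have "ennreal p \<le> (\<integral>\<^sup>+ s'. ennreal (g s') \<partial>measure_pmf (bind_pmf D D2))"
    by (simp add: nn_integral_bind_pmf)
  then show ?thesis using that[of D2] D2 by auto
qed

lemma J_seq:
  assumes "J c1 s T1 Q1 f p" "\<And>s'. Q1 s' \<Longrightarrow> J c2 s' T2 Q g (f s')"
  shows "J (c1 ;; c2) s (T1 + T2) Q g p"
proof -
  obtain D where D: "bs sem gn gr c1 s D T1" "\<forall>s'\<in>set_pmf D. Q1 s'"
    "ennreal p \<le> (\<integral>\<^sup>+ s'. ennreal (f s') \<partial>measure_pmf D)"
    using assms(1) by (auto simp: J_def)
  obtain D2 where "\<And>s'. s' \<in> set_pmf D \<Longrightarrow> bs sem gn gr c2 s' (D2 s') T2"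
    "\<forall>s'\<in>set_pmf (bind_pmf D D2). Q s'" "ennreal p \<le> (\<integral>\<^sup>+ s'. ennreal (g s') \<partial>measure_pmf (bind_pmf D D2))"
    using bind_values[OF D(2,3) assms(2)] by metis
  then show ?thesis using D(1) unfolding J_def by (blast intro: bs_seq)
qed

lemma J_seq_tot:
  assumes "tot c1 s T1 Q1" "\<And>s'. Q1 s' \<Longrightarrow> J c2 s' T2 Q g p"
  shows "J (c1 ;; c2) s (T1 + T2) Q g p"
  using J_seq[OF J_const[OF assms(1), of p "\<lambda>_. p"] assms(2)] by simp

lemma J_ifN:
  assumes "gn s a < gn s b \<Longrightarrow> J c s T Q f p" "\<not> gn s a < gn s b \<Longrightarrow> Q s \<and> p \<le> f s"
  shows "J (IfN a b c) s (T + 2) Q f p"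
proof (cases "gn s a < gn s b")
  case True
  then show ?thesis using assms(1) unfolding J_def by (meson bs_ifN)
next
  case False
  then have "bs sem gn gr (IfN a b c) s (return_pmf s) (T + 2)" by (intro bs_ifN) auto
  then show ?thesis using assms(2)[OF False] unfolding J_def
    by (intro exI[of _ "return_pmf s"]) (auto intro: ennreal_leI)
qed

lemma J_ifR:
  assumes "gr s a < gr s b \<Longrightarrow> J c s T Q f p" "\<not> gr s a < gr s b \<Longrightarrow> Q s \<and> p \<le> f s"
  shows "J (IfR a b c) s (T + 2) Q f p"
proof (cases "gr s a < gr s b")
  case True
  then show ?thesis using assms(1) unfolding J_def by (meson bs_ifR)
next
  case False
  then have "bs sem gn gr (IfR a b c) s (return_pmf s) (T + 2)" by (intro bs_ifR) auto
  then show ?thesis using assms(2)[OF False] unfolding J_def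
    by (intro exI[of _ "return_pmf s"]) (auto intro: ennreal_leI)
qed

text \<open>\<open>v k s\<close> is a lower bound for the expected final value in state
  \<open>s\<close> after \<open>k\<close> rounds: no round may lower it on average, and on exit it
  must be covered by \<open>f\<close>. The bound \<open>K\<close> on the number of rounds makes the
  induction finite and yields the time.\<close>

lemma J_whileN:
  assumes "I 0 s" and "v 0 s = p"
    and step: "\<And>k s. k < K \<Longrightarrow> I k s \<Longrightarrow> gn s a < gn s b \<Longrightarrow> J c s T (I (Suc k)) (v (Suc k)) (v k s)"
    and exit: "\<And>k s. k \<le> K \<Longrightarrow> I k s \<Longrightarrow> \<not> gn s a < gn s b \<Longrightarrow> Q s \<and> v k s \<le> f s"
    and last: "\<And>s. I K s \<Longrightarrow> \<not> gn s a < gn s b"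
  shows "J (WhileN a b c) s (K * (T + 2) + 2) Q f p"
proof -
  have "J (WhileN a b c) s ((K - k) * (T + 2) + 2) Q f (v k s)" if "k \<le> K" "I k s" for k s
    using that
  proof (induction "K - k" arbitrary: k s)
    case 0
    then have "k = K" by simp
    then have nt: "\<not> gn s a < gn s b" using last 0 by simp
    then show ?case using exit[OF _ _ nt, of k] 0 unfolding J_def
      by (intro exI[of _ "return_pmf s"])
        (auto intro: ennreal_leI bs_weaken bs_whileN_False)
  next
    case (Suc x)
    show ?case
    proof (cases "gn s a < gn s b")
      case True
      have kK: "k < K" using Suc by simp
      obtain D where D: "bs sem gn gr c s D T" "\<forall>s'\<in>set_pmf D. I (Suc k) s'"
        "ennreal (v k s) \<le> (\<integral>\<^sup>+ s'. ennreal (v (Suc k) s') \<partial>measure_pmf D)"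
        using step[OF kK Suc(4) True] by (auto simp: J_def)
      have IH: "J (WhileN a b c) s' ((K - Suc k) * (T + 2) + 2) Q f (v (Suc k) s')" if "I (Suc k) s'" for s'
        using Suc(1)[of "Suc k" s'] Suc(2) kK that by simp
      obtain D2 where D2: "\<And>s'. s' \<in> set_pmf D \<Longrightarrow>
          bs sem gn gr (WhileN a b c) s' (D2 s') ((K - Suc k) * (T + 2) + 2)"
        "\<forall>s'\<in>set_pmf (bind_pmf D D2). Q s'"
        "ennreal (v k s) \<le> (\<integral>\<^sup>+ s'. ennreal (f s') \<partial>measure_pmf (bind_pmf D D2))"
        using bind_values[OF D(2,3) IH] by metis
      have "bs sem gn gr (WhileN a b c) s (bind_pmf D D2) (T + ((K - Suc k) * (T + 2) + 2) + 2)"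
        by (rule bs_whileN[where gn = gn]) (use True D D2 in auto)
      moreover have "T + ((K - Suc k) * (T + 2) + 2) + 2 \<le> (K - k) * (T + 2) + 2"
        using kK by (cases "K - k") (auto simp: Suc_diff_Suc[symmetric] algebra_simps)
      ultimately show ?thesis using D2 unfolding J_def by (blast intro: bs_weaken)
    next
      case False
      then show ?thesis using exit[OF _ _ False, of k] Suc unfolding J_def
        by (intro exI[of _ "return_pmf s"])
          (auto intro: ennreal_leI bs_weaken bs_whileN_False)
    qed
  qed
  from this[of 0 s] show ?thesis using assms(1,2) by simp
qed

lemma J_whileR:
  assumes "I 0 s" and "v 0 s = p"
    and step: "\<And>k s. k < K \<Longrightarrow> I k s \<Longrightarrow> gr s a < gr s b \<Longrightarrow> J c s T (I (Suc k)) (v (Suc k)) (v k s)"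
    and exit: "\<And>k s. k \<le> K \<Longrightarrow> I k s \<Longrightarrow> \<not> gr s a < gr s b \<Longrightarrow> Q s \<and> v k s \<le> f s"
    and last: "\<And>s. I K s \<Longrightarrow> \<not> gr s a < gr s b"
  shows "J (WhileR a b c) s (K * (T + 2) + 2) Q f p"
proof -
  have "J (WhileR a b c) s ((K - k) * (T + 2) + 2) Q f (v k s)" if "k \<le> K" "I k s" for k s
    using that
  proof (induction "K - k" arbitrary: k s)
    case 0
    then have "k = K" by simp
    then have nt: "\<not> gr s a < gr s b" using last 0 by simp
    then show ?case using exit[OF _ _ nt, of k] 0 unfolding J_def
      by (intro exI[of _ "return_pmf s"])
        (auto intro: ennreal_leI bs_weaken bs_whileR_False)
  next
    case (Suc x)
    show ?case
    proof (cases "gr s a < gr s b")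
      case True
      have kK: "k < K" using Suc by simp
      obtain D where D: "bs sem gn gr c s D T" "\<forall>s'\<in>set_pmf D. I (Suc k) s'"
        "ennreal (v k s) \<le> (\<integral>\<^sup>+ s'. ennreal (v (Suc k) s') \<partial>measure_pmf D)"
        using step[OF kK Suc(4) True] by (auto simp: J_def)
      have IH: "J (WhileR a b c) s' ((K - Suc k) * (T + 2) + 2) Q f (v (Suc k) s')" if "I (Suc k) s'" for s'
        using Suc(1)[of "Suc k" s'] Suc(2) kK that by simp
      obtain D2 where D2: "\<And>s'. s' \<in> set_pmf D \<Longrightarrow>
          bs sem gn gr (WhileR a b c) s' (D2 s') ((K - Suc k) * (T + 2) + 2)"
        "\<forall>s'\<in>set_pmf (bind_pmf D D2). Q s'"
        "ennreal (v k s) \<le> (\<integral>\<^sup>+ s'. ennreal (f s') \<partial>measure_pmf (bind_pmf D D2))"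
        using bind_values[OF D(2,3) IH] by metis
      have "bs sem gn gr (WhileR a b c) s (bind_pmf D D2) (T + ((K - Suc k) * (T + 2) + 2) + 2)"
        by (rule bs_whileR[where gr = gr]) (use True D D2 in auto)
      moreover have "T + ((K - Suc k) * (T + 2) + 2) + 2 \<le> (K - k) * (T + 2) + 2"
        using kK by (cases "K - k") (auto simp: Suc_diff_Suc[symmetric] algebra_simps)
      ultimately show ?thesis using D2 unfolding J_def by (blast intro: bs_weaken)
    next
      case False
      then show ?thesis using exit[OF _ _ False, of k] Suc unfolding J_def
        by (intro exI[of _ "return_pmf s"])
          (auto intro: ennreal_leI bs_weaken bs_whileR_False)
    qed
  qed
  from this[of 0 s] show ?thesis using assms(1,2) by simp
qed

lemma J_blk:
  assumes "\<And>b s. b \<in> set xs \<Longrightarrow> sem b s = return_pmf (de b s)" "Q (fold de xs s)" "p \<le> f (fold de xs s)"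
  shows "J (blk xs) s (length xs) Q f p"
  using assms
proof (induction xs arbitrary: s)
  case Nil
  then show ?case by (auto intro: J_skip)
next
  case (Cons b xs)
  have "tot (Bas b) s 1 (\<lambda>s'. s' = de b s)" using Cons(2)[of b s] by (intro J_bas) auto
  from J_seq_tot[OF this, of "blk xs" "length xs" Q f p] show ?case
    using Cons by (simp add: One_nat_def)
qed

end

section \<open>Vector programs\<close>

text \<open>The operand \<open>(c\<^sub>1, a, c\<^sub>2)\<close> denotes the vector slot number \<open>c\<^sub>1 * n[a] + c\<^sub>2\<close>.\<close>

type_synonym slot = "nat \<times> nat \<times> nat"

datatype bop =
    BNat nat nat
  | BNOp nat_op nat nat nat
  | BROf nat nat
  | BROp real_op nat nat nat
  | BSqrt nat nat
  | BSmp nat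
  | BLin slot nat slot slot
  | BPt slot nat
  | BDot nat slot slot
  | BUnit slot nat nat

record vst =
  vn :: "nat \<Rightarrow> nat"
  vr :: "nat \<Rightarrow> real"
  vv :: "nat \<Rightarrow> fvec"

fun slotno :: "(nat \<Rightarrow> nat) \<Rightarrow> slot \<Rightarrow> nat" where
  "slotno n (c1, a, c2) = c1 * n a + c2"

fun bsem :: "nat \<Rightarrow> (nat \<Rightarrow> fvec) \<Rightarrow> bop \<Rightarrow> vst \<Rightarrow> vst" where
  "bsem d pts (BNat a c) s = s\<lparr>vn := (vn s)(a := c)\<rparr>"
| "bsem d pts (BNOp f a b c) s = s\<lparr>vn := (vn s)(a := nat_fun f (vn s b) (vn s c))\<rparr>"
| "bsem d pts (BROf a b) s = s\<lparr>vr := (vr s)(a := real (vn s b))\<rparr>"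
| "bsem d pts (BROp f a b c) s = s\<lparr>vr := (vr s)(a := real_fun f (vr s b) (vr s c))\<rparr>"
| "bsem d pts (BSqrt a b) s = s\<lparr>vr := (vr s)(a := sqrt (vr s b))\<rparr>"
| "bsem d pts (BSmp a) s = s"
| "bsem d pts (BLin a r b c) s = s\<lparr>vv := (vv s)(slotno (vn s) a :=
     vr s r *\<^sub>R vv s (slotno (vn s) b) + vv s (slotno (vn s) c))\<rparr>"
| "bsem d pts (BPt a i) s = s\<lparr>vv := (vv s)(slotno (vn s) a := pts (vn s i))\<rparr>"
| "bsem d pts (BDot r a b) s = s\<lparr>vr := (vr s)(r := inner (vv s (slotno (vn s) a)) (vv s (slotno (vn s) b)))\<rparr>"
| "bsem d pts (BUnit a t r) s = (if vn s t < d then s\<lparr>vv := (vv s)(slotno (vn s) a :=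
     mkv d ((fv_nth (vv s (slotno (vn s) a)))(vn s t := vr s r)))\<rparr> else s)"

definition sem2 :: "nat \<Rightarrow> (nat \<Rightarrow> fvec) \<Rightarrow> nat \<Rightarrow> bop \<Rightarrow> vst \<Rightarrow> vst pmf" where
  "sem2 d pts n b s = (case b of
     BSmp a \<Rightarrow> map_pmf (\<lambda>i. s\<lparr>vn := (vn s)(a := i)\<rparr>) (pmf_of_set {..<n})
   | _ \<Rightarrow> return_pmf (bsem d pts b s))"

text \<open>Registers from 100 on serve as scratch space of the compiled vector operations; the vector
  slots start at address 128.\<close>

definition absm :: "nat \<Rightarrow> mem \<Rightarrow> vst" where
  "absm d m = \<lparr>vn = (\<lambda>i. if i < 100 then fst m i else 0), vr = (\<lambda>i. if i < 100 then snd m i else 0),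
     vv = (\<lambda>s. mkv d (\<lambda>k. snd m (128 + s * d + k)))\<rparr>"

fun oks :: "slot \<Rightarrow> bool" where "oks (c1, a, c2) \<longleftrightarrow> a < 100"

text \<open>Register 1 holds the dimension, which the compiled address computations and loops read,
  so nothing may overwrite it. Everything from 100 on is reserved for these computations.\<close>

fun okb :: "bop \<Rightarrow> bool" where
  "okb (BNat a c) \<longleftrightarrow> a < 100 \<and> a \<noteq> 1"
| "okb (BNOp f a b c) \<longleftrightarrow> a < 100 \<and> a \<noteq> 1 \<and> b < 100 \<and> c < 100"
| "okb (BROf a b) \<longleftrightarrow> a < 100 \<and> b < 100"
| "okb (BROp f a b c) \<longleftrightarrow> a < 100 \<and> b < 100 \<and> c < 100"
| "okb (BSqrt a b) \<longleftrightarrow> a < 100 \<and> b < 100"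
| "okb (BSmp a) \<longleftrightarrow> a < 100 \<and> a \<noteq> 1"
| "okb (BLin a r b c) \<longleftrightarrow> oks a \<and> oks b \<and> oks c \<and> r < 100"
| "okb (BPt a i) \<longleftrightarrow> oks a \<and> i < 100"
| "okb (BDot r a b) \<longleftrightarrow> oks a \<and> oks b \<and> r < 100"
| "okb (BUnit a t r) \<longleftrightarrow> oks a \<and> t < 100 \<and> r < 100"

fun okc :: "bop com \<Rightarrow> bool" where
  "okc Skip = True"
| "okc (Bas b) = okb b"
| "okc (c1 ;; c2) = (okc c1 \<and> okc c2)"
| "okc (IfN a b c) = (a < 100 \<and> b < 100 \<and> okc c)"
| "okc (IfR a b c) = (a < 100 \<and> b < 100 \<and> okc c)"
| "okc (WhileN a b c) = (a < 100 \<and> b < 100 \<and> okc c)"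
| "okc (WhileR a b c) = (a < 100 \<and> b < 100 \<and> okc c)"

fun adr :: "nat \<Rightarrow> slot \<Rightarrow> instr list" where
  "adr k (c1, a, c2) = [NConst k c1, NOp NTimes k k a, NConst 109 c2, NOp NPlus k k 109,
     NOp NTimes k k 1, NConst 109 128, NOp NPlus k k 109]"

text \<open>In \<open>BDot\<close> the real register 103 is kept at 0: there is no direct copy
  between real registers, so the sum is moved by adding zero.\<close>

fun macro :: "bop \<Rightarrow> instr com" where
  "macro (BNat a c) = Bas (NConst a c)"
| "macro (BNOp f a b c) = Bas (NOp f a b c)"
| "macro (BROf a b) = Bas (ROfNat a b)"
| "macro (BROp f a b c) = Bas (ROp f a b c)"
| "macro (BSqrt a b) = Bas (RSqrt a b)"
| "macro (BSmp a) = Bas (Sample a)"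
| "macro (BLin a r b c) =
     blk (adr 100 a @ adr 101 b @ adr 102 c @ [NConst 104 1, NConst 105 0]) ;;
     WhileN 105 1 (blk [RLoad 100 101, ROp RTimes 100 r 100, RLoad 101 102, ROp RPlus 100 100 101,
       RStore 100 100, NOp NPlus 100 100 104, NOp NPlus 101 101 104, NOp NPlus 102 102 104,
       NOp NPlus 105 105 104])"
| "macro (BPt a i) =
     blk (adr 100 a @ [NConst 104 1, NConst 105 0]) ;;
     WhileN 105 1 (blk [Coord 100 i 105, RStore 100 100, NOp NPlus 100 100 104, NOp NPlus 105 105 104])"
| "macro (BDot r a b) =
     blk (adr 101 a @ adr 102 b @ [NConst 104 1, NConst 105 0, ROfNat 102 105, ROfNat 103 105]) ;;
     WhileN 105 1 (blk [RLoad 100 101, RLoad 101 102, ROp RTimes 100 100 101, ROp RPlus 102 102 100,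
       NOp NPlus 101 101 104, NOp NPlus 102 102 104, NOp NPlus 105 105 104]) ;;
     Bas (ROp RPlus r 102 103)"
| "macro (BUnit a t r) =
     blk (adr 100 a @ [NOp NPlus 100 100 t]) ;; IfN t 1 (Bas (RStore 100 r))"

fun tr :: "bop com \<Rightarrow> instr com" where
  "tr Skip = Skip"
| "tr (Bas b) = macro b"
| "tr (c1 ;; c2) = tr c1 ;; tr c2"
| "tr (IfN a b c) = IfN a b (tr c)"
| "tr (IfR a b c) = IfR a b (tr c)"
| "tr (WhileN a b c) = WhileN a b (tr c)"
| "tr (WhileR a b c) = WhileR a b (tr c)"

lemma wfc_blk: "wfc (blk xs) \<longleftrightarrow> (\<forall>i\<in>set xs. nojump i)"
  by (induction xs) auto

lemma wfc_macro: "wfc (macro b)"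
  by (cases b rule: macro.cases) (auto simp: wfc_blk)

lemma wfc_tr: "wfc (tr c)"
  by (induction c) (auto simp: wfc_macro)

locale machine =
  fixes ps :: "rvec list" and d :: nat
begin

sublocale m: prog "sem0 ps" fst snd .

lemma tot_blk0:
  assumes "\<forall>i\<in>set xs. nojump i \<and> (\<forall>a. i \<noteq> Sample a)" "Q (fold (dex ps) xs m)" "length xs \<le> T"
  shows "m.tot (blk xs) m T Q"
proof -
  have "m.tot (blk xs) m (length xs) Q"
    by (rule m.J_blk[where de = "dex ps"]) (use assms in \<open>auto simp: sem0_def split: instr.split\<close>)
  then show ?thesis by (rule m.J_conseq) (use assms in auto)
qed

lemma slotno_absm: "oks op \<Longrightarrow> slotno (vn (absm d m)) op = slotno (fst m) op"
  by (cases op) (auto simp: absm_def)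

lemma fold_adr:
  assumes "oks op" "100 \<le> k" "k \<noteq> 109" "n 1 = d"
  shows "fold (dex ps) (adr k op) (n, r) = (n(109 := 128, k := 128 + slotno n op * d), r)"
  using assms by (cases op) (auto simp: fun_eq_iff)

lemma slot_address_eq:
  assumes "k < d" "k' < d"
  shows "s * d + k = s' * d + k' \<longleftrightarrow> s = s' \<and> k = k'"
proof
  assume eq: "s * d + k = s' * d + k'"
  have "(s * d + k) div d = s" "(s' * d + k') div d = s'" using assms by simp_all
  then have "s = s'" using eq by simp
  then show "s = s' \<and> k = k'" using eq by simp
qed simp

definition simulates :: "instr com \<Rightarrow> mem \<Rightarrow> vst \<Rightarrow> bool" where
  "simulates c m s' \<longleftrightarrow> m.tot c m (50 * d) (\<lambda>m'. absm d m' = s' \<and> fst m' 1 = d)"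

lemma absm_upd_n: "a < 100 \<Longrightarrow> absm d (n(a := x), r) = (absm d (n, r))\<lparr>vn := (vn (absm d (n, r)))(a := x)\<rparr>"
  by (auto simp: absm_def fun_eq_iff)

lemma absm_upd_r: "a < 100 \<Longrightarrow> absm d (n, r(a := x)) = (absm d (n, r))\<lparr>vr := (vr (absm d (n, r)))(a := x)\<rparr>"
  by (auto simp: absm_def fun_eq_iff intro!: mkv_cong)

lemma absm_get: "a < 100 \<Longrightarrow> vn (absm d (n, r)) a = n a" "a < 100 \<Longrightarrow> vr (absm d (n, r)) a = r a"
  by (auto simp: absm_def)

lemma simulates_bas:
  assumes "absm d (dex ps i m) = s'" "fst (dex ps i m) 1 = d" "\<And>a. i \<noteq> Sample a" "1 \<le> d"
  shows "simulates (Bas i) m s'"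
proof -
  have "sem0 ps i m = return_pmf (dex ps i m)" using assms(3) by (auto simp: sem0_def split: instr.split)
  then have "m.tot (Bas i) m 1 (\<lambda>m'. absm d m' = s' \<and> fst m' 1 = d)"
    using assms(1,2) by (intro m.J_bas) auto
  then show ?thesis unfolding simulates_def by (rule m.J_conseq) (use assms(4) in auto)
qed

lemma simulates_lin:
  assumes ok: "oks a" "oks b" "oks c" "r < 100" and m: "fst m 1 = d" and d: "1 \<le> d"
  shows "simulates (macro (BLin a r b c)) m (bsem d pts (BLin a r b c) (absm d m))"
proof -
  obtain n0 r0 where m0: "m = (n0, r0)" by (cases m)
  define sa sb sc where "sa = slotno n0 a" and "sb = slotno n0 b" and "sc = slotno n0 c"
  define n1 where "n1 = (((n0(109 := 128, 100 := 128 + sa * d))(109 := 128, 101 := 128 + sb * d))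
    (109 := 128, 102 := 128 + sc * d))(104 := 1, 105 := 0)"
  have slot_upd: "slotno (n(x := y)) s = slotno n s" if "oks s" "100 \<le> x" for n x y s
    using that by (cases s) auto
  \<comment> \<open>The destination may coincide with an operand: coordinate \<open>i\<close> is
    overwritten only in its own round, after both operands have been read at
    \<open>i\<close>.\<close>
  define I where "I k m' \<longleftrightarrow> fst m' 100 = 128 + sa * d + k \<and> fst m' 101 = 128 + sb * d + k \<and>
     fst m' 102 = 128 + sc * d + k \<and> fst m' 104 = 1 \<and> fst m' 105 = k \<and>
     (\<forall>i<100. fst m' i = n0 i) \<and> (\<forall>i<100. snd m' i = r0 i) \<and>
     (\<forall>s. \<forall>i<d. snd m' (128 + s * d + i) =
       (if s = sa \<and> i < k then r0 r * r0 (128 + sb * d + i) + r0 (128 + sc * d + i)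
        else r0 (128 + s * d + i)))" for k :: nat and m' :: mem
  have init: "m.tot (blk (adr 100 a @ adr 101 b @ adr 102 c @ [NConst 104 1, NConst 105 0])) m 23 (I 0)"
  proof (rule tot_blk0)
    have n01: "n0 1 = d" using m m0 by simp
    have "fold (dex ps) (adr 100 a @ adr 101 b @ adr 102 c @ [NConst 104 1, NConst 105 0]) m = (n1, r0)"
      using ok n01 by (simp add: m0 fold_adr slot_upd n1_def sa_def sb_def sc_def del: adr.simps)
    moreover have "I 0 (n1, r0)" by (auto simp: I_def n1_def)
    ultimately show "I 0 (fold (dex ps) (adr 100 a @ adr 101 b @ adr 102 c @ [NConst 104 1, NConst 105 0]) m)"
      by simp
  qed (use ok in \<open>cases a; cases b; cases c; auto\<close>)+
  have step: "m.tot (blk [RLoad 100 101, ROp RTimes 100 r 100, RLoad 101 102, ROp RPlus 100 100 101,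
       RStore 100 100, NOp NPlus 100 100 104, NOp NPlus 101 101 104, NOp NPlus 102 102 104,
       NOp NPlus 105 105 104]) m' 9 (I (Suc k))" if k: "k < d" and I: "I k m'" for k m'
  proof (rule tot_blk0)
    obtain n' r' where m': "m' = (n', r')" by (cases m')
    have vb: "r' (128 + sb * d + k) = r0 (128 + sb * d + k)"
      and vc: "r' (128 + sc * d + k) = r0 (128 + sc * d + k)" using I k by (auto simp: I_def m')
    have rr: "r' r = r0 r" using I ok by (auto simp: I_def m')
    show "I (Suc k) (fold (dex ps) [RLoad 100 101, ROp RTimes 100 r 100, RLoad 101 102, ROp RPlus 100 100 101,
       RStore 100 100, NOp NPlus 100 100 104, NOp NPlus 101 101 104, NOp NPlus 102 102 104,
       NOp NPlus 105 105 104] m')"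
      using I ok(4) vb vc rr k unfolding I_def m'
      by (auto simp: less_Suc_eq slot_address_eq)
  qed auto
  have "m.tot (macro (BLin a r b c)) m (23 + (d * (9 + 2) + 2)) (I d)"
    unfolding macro.simps
  proof (rule m.J_seq_tot[OF init])
    fix m1 assume "I 0 m1"
    then show "m.tot (WhileN 105 1 (blk [RLoad 100 101, ROp RTimes 100 r 100, RLoad 101 102, ROp RPlus 100 100 101,
       RStore 100 100, NOp NPlus 100 100 104, NOp NPlus 101 101 104, NOp NPlus 102 102 104,
       NOp NPlus 105 105 104])) m1 (d * (9 + 2) + 2) (I d)"
      by (rule m.J_whileN[where v = "\<lambda>_ _. 0" and I = I and K = d])
        (use step m in \<open>auto simp: I_def m0\<close>)
  qed
  then show ?thesis
    unfolding simulates_def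
  proof (rule m.J_conseq)
    show "23 + (d * (9 + 2) + 2) \<le> 50 * d" using d by simp
    fix m' assume I: "I d m'"
    have "mkv d (\<lambda>k. snd m' (128 + s * d + k)) =
        (if s = sa then r0 r *\<^sub>R mkv d (\<lambda>k. r0 (128 + sb * d + k)) + mkv d (\<lambda>k. r0 (128 + sc * d + k))
         else mkv d (\<lambda>k. r0 (128 + s * d + k)))" for s
      using I by (auto simp: I_def mkv_scale mkv_add intro!: mkv_cong)
    then show "absm d m' = bsem d pts (BLin a r b c) (absm d m) \<and> fst m' 1 = d"
      unfolding bsem.simps slotno_absm[OF ok(1)] slotno_absm[OF ok(2)] slotno_absm[OF ok(3)]
      using I ok m by (auto simp: absm_def I_def m0 fun_eq_iff sa_def sb_def sc_def)
  qed auto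
qed

lemma simulates_pt:
  assumes ok: "oks a" "i < 100" and m: "fst m 1 = d" and d: "1 \<le> d"
    and pts: "\<And>i. pts i = mkv d (coord ps i)"
  shows "simulates (macro (BPt a i)) m (bsem d pts (BPt a i) (absm d m))"
proof -
  obtain n0 r0 where m0: "m = (n0, r0)" by (cases m)
  define sa where "sa = slotno n0 a"
  define n1 where "n1 = (n0(109 := 128, 100 := 128 + sa * d))(104 := 1, 105 := 0)"
  define I where "I k m' \<longleftrightarrow> fst m' 100 = 128 + sa * d + k \<and> fst m' 104 = 1 \<and> fst m' 105 = k \<and>
     (\<forall>i<100. fst m' i = n0 i) \<and> (\<forall>i<100. snd m' i = r0 i) \<and>
     (\<forall>s. \<forall>x<d. snd m' (128 + s * d + x) =
       (if s = sa \<and> x < k then coord ps (n0 i) x else r0 (128 + s * d + x)))" for k :: nat and m' :: mem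
  have init: "m.tot (blk (adr 100 a @ [NConst 104 1, NConst 105 0])) m 9 (I 0)"
  proof (rule tot_blk0)
    have "fold (dex ps) (adr 100 a @ [NConst 104 1, NConst 105 0]) m = (n1, r0)"
      using ok m by (simp add: m0 fold_adr n1_def sa_def del: adr.simps)
    moreover have "I 0 (n1, r0)" by (auto simp: I_def n1_def)
    ultimately show "I 0 (fold (dex ps) (adr 100 a @ [NConst 104 1, NConst 105 0]) m)" by simp
  qed (use ok in \<open>cases a; auto\<close>)+
  have step: "m.tot (blk [Coord 100 i 105, RStore 100 100, NOp NPlus 100 100 104, NOp NPlus 105 105 104])
      m' 4 (I (Suc k))" if k: "k < d" and I: "I k m'" for k m'
  proof (rule tot_blk0)
    obtain n' r' where m': "m' = (n', r')" by (cases m')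
    have ni: "n' i = n0 i" using I ok by (auto simp: I_def m')
    show "I (Suc k) (fold (dex ps) [Coord 100 i 105, RStore 100 100, NOp NPlus 100 100 104,
        NOp NPlus 105 105 104] m')"
      using I ok ni k unfolding I_def m'
      by (auto simp: less_Suc_eq slot_address_eq)
  qed auto
  have "m.tot (macro (BPt a i)) m (9 + (d * (4 + 2) + 2)) (I d)"
    unfolding macro.simps
  proof (rule m.J_seq_tot[OF init])
    fix m1 assume "I 0 m1"
    then show "m.tot (WhileN 105 1 (blk [Coord 100 i 105, RStore 100 100, NOp NPlus 100 100 104,
        NOp NPlus 105 105 104])) m1 (d * (4 + 2) + 2) (I d)"
      by (rule m.J_whileN[where v = "\<lambda>_ _. 0" and I = I and K = d])
        (use step m in \<open>auto simp: I_def m0\<close>)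
  qed
  then show ?thesis
    unfolding simulates_def
  proof (rule m.J_conseq)
    show "9 + (d * (4 + 2) + 2) \<le> 50 * d" using d by simp
    fix m' assume I: "I d m'"
    have "mkv d (\<lambda>k. snd m' (128 + s * d + k)) =
        (if s = sa then pts (n0 i) else mkv d (\<lambda>k. r0 (128 + s * d + k)))" for s
      using I by (auto simp: I_def pts intro!: mkv_cong)
    then show "absm d m' = bsem d pts (BPt a i) (absm d m) \<and> fst m' 1 = d"
      unfolding bsem.simps slotno_absm[OF ok(1)]
      using I ok m by (auto simp: absm_def I_def m0 fun_eq_iff sa_def)
  qed auto
qed

lemma simulates_dot:
  assumes ok: "oks a" "oks b" "r < 100" and m: "fst m 1 = d" and d: "1 \<le> d"
  shows "simulates (macro (BDot r a b)) m (bsem d pts (BDot r a b) (absm d m))"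
proof -
  obtain n0 r0 where m0: "m = (n0, r0)" by (cases m)
  define sa sb where "sa = slotno n0 a" and "sb = slotno n0 b"
  define n1 where "n1 = ((n0(109 := 128, 101 := 128 + sa * d))(109 := 128, 102 := 128 + sb * d))(104 := 1, 105 := 0)"
  have slot_upd: "slotno (n(x := y)) s = slotno n s" if "oks s" "100 \<le> x" for n x y s
    using that by (cases s) auto
  define I where "I k m' \<longleftrightarrow> fst m' 101 = 128 + sa * d + k \<and> fst m' 102 = 128 + sb * d + k \<and>
     fst m' 104 = 1 \<and> fst m' 105 = k \<and> (\<forall>i<100. fst m' i = n0 i) \<and> (\<forall>i<100. snd m' i = r0 i) \<and>
     (\<forall>x\<ge>128. snd m' x = r0 x) \<and> snd m' 103 = 0 \<and>
     snd m' 102 = (\<Sum>x<k. r0 (128 + sa * d + x) * r0 (128 + sb * d + x))" for k :: nat and m' :: mem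
  have init: "m.tot (blk (adr 101 a @ adr 102 b @ [NConst 104 1, NConst 105 0, ROfNat 102 105, ROfNat 103 105])) m 18 (I 0)"
  proof (rule tot_blk0)
    have "fold (dex ps) (adr 101 a @ adr 102 b @ [NConst 104 1, NConst 105 0, ROfNat 102 105, ROfNat 103 105]) m
        = (n1, r0(102 := 0, 103 := 0))"
      using ok m by (simp add: m0 fold_adr slot_upd n1_def sa_def sb_def del: adr.simps)
    moreover have "I 0 (n1, r0(102 := 0, 103 := 0))" by (auto simp: I_def n1_def)
    ultimately show "I 0 (fold (dex ps) (adr 101 a @ adr 102 b @
        [NConst 104 1, NConst 105 0, ROfNat 102 105, ROfNat 103 105]) m)" by simp
  qed (use ok in \<open>cases a; cases b; auto\<close>)+
  let ?body = "[RLoad 100 101, RLoad 101 102, ROp RTimes 100 100 101, ROp RPlus 102 102 100,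
       NOp NPlus 101 101 104, NOp NPlus 102 102 104, NOp NPlus 105 105 104]"
  have step: "m.tot (blk ?body) m' 7 (I (Suc k))" if k: "k < d" and I: "I k m'" for k m'
  proof (rule tot_blk0)
    obtain n' r' where m': "m' = (n', r')" by (cases m')
    show "I (Suc k) (fold (dex ps) ?body m')"
      using I k unfolding I_def m' by auto
  qed auto
  have "m.tot (macro (BDot r a b)) m (18 + ((d * (7 + 2) + 2) + 1))
     (\<lambda>m'. (\<forall>i<100. fst m' i = n0 i) \<and> (\<forall>x\<ge>128. snd m' x = r0 x) \<and>
       (\<forall>i<100. snd m' i = (if i = r then \<Sum>x<d. r0 (128 + sa * d + x) * r0 (128 + sb * d + x) else r0 i)))"
    unfolding macro.simps
  proof (rule m.J_seq_tot[OF init], rule m.J_seq_tot)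
    fix m1 assume "I 0 m1"
    then show "m.tot (WhileN 105 1 (blk ?body)) m1 (d * (7 + 2) + 2) (I d)"
      by (rule m.J_whileN[where v = "\<lambda>_ _. 0" and I = I and K = d])
        (use step m in \<open>auto simp: I_def m0\<close>)
  next
    fix m2 assume "I d m2"
    then show "m.tot (Bas (ROp RPlus r 102 103)) m2 1 (\<lambda>m'. (\<forall>i<100. fst m' i = n0 i) \<and> (\<forall>x\<ge>128. snd m' x = r0 x) \<and>
       (\<forall>i<100. snd m' i = (if i = r then \<Sum>x<d. r0 (128 + sa * d + x) * r0 (128 + sb * d + x) else r0 i)))"
      using ok(3) by (intro m.J_bas; cases m2) (auto simp: sem0_def I_def)
  qed
  then show ?thesis
    unfolding simulates_def
  proof (rule m.J_conseq)
    show "18 + ((d * (7 + 2) + 2) + 1) \<le> 50 * d" using d by simp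
    fix m' assume Q: "(\<forall>i<100. fst m' i = n0 i) \<and> (\<forall>x\<ge>128. snd m' x = r0 x) \<and>
       (\<forall>i<100. snd m' i = (if i = r then \<Sum>x<d. r0 (128 + sa * d + x) * r0 (128 + sb * d + x) else r0 i))"
    then show "absm d m' = bsem d pts (BDot r a b) (absm d m) \<and> fst m' 1 = d"
      unfolding bsem.simps slotno_absm[OF ok(1)] slotno_absm[OF ok(2)]
      using ok m by (auto simp: absm_def m0 fun_eq_iff sa_def sb_def inner_mkv)
  qed auto
qed

lemma simulates_unit:
  assumes ok: "oks a" "t < 100" "r < 100" and m: "fst m 1 = d" and d: "1 \<le> d"
  shows "simulates (macro (BUnit a t r)) m (bsem d pts (BUnit a t r) (absm d m))"
proof -
  obtain n0 r0 where m0: "m = (n0, r0)" by (cases m)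
  define sa where "sa = slotno n0 a"
  define n1 where "n1 = n0(109 := 128, 100 := 128 + sa * d + n0 t)"
  have init: "m.tot (blk (adr 100 a @ [NOp NPlus 100 100 t])) m 8 (\<lambda>m'. m' = (n1, r0))"
  proof (rule tot_blk0)
    show "fold (dex ps) (adr 100 a @ [NOp NPlus 100 100 t]) m = (n1, r0)"
      using ok m by (simp add: m0 fold_adr n1_def sa_def del: adr.simps)
  qed (use ok in \<open>cases a; auto\<close>)+
  let ?m' = "if n0 t < d then (n1, r0(128 + sa * d + n0 t := r0 r)) else (n1, r0)"
  have "m.tot (macro (BUnit a t r)) m (8 + (1 + 2)) (\<lambda>m'. m' = ?m')"
    unfolding macro.simps
  proof (rule m.J_seq_tot[OF init])
    fix m1 :: mem assume m1: "m1 = (n1, r0)"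
    show "m.tot (IfN t 1 (Bas (RStore 100 r))) m1 (1 + 2) (\<lambda>m'. m' = ?m')"
      using ok m by (intro m.J_ifN m.J_bas) (auto simp: m1 n1_def m0 sem0_def)
  qed
  then show ?thesis
    unfolding simulates_def
  proof (rule m.J_conseq)
    show "8 + (1 + 2) \<le> 50 * d" using d by simp
    fix m' assume m': "m' = ?m'"
    have "mkv d (\<lambda>k. (r0(128 + sa * d + n0 t := r0 r)) (128 + s * d + k)) =
        (if s = sa then mkv d ((fv_nth (mkv d (\<lambda>k. r0 (128 + sa * d + k))))(n0 t := r0 r))
         else mkv d (\<lambda>k. r0 (128 + s * d + k)))" if "n0 t < d" for s
      using that by (auto simp: mkv.rep_eq slot_address_eq intro!: mkv_cong)
    then show "absm d m' = bsem d pts (BUnit a t r) (absm d m) \<and> fst m' 1 = d"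
      unfolding bsem.simps slotno_absm[OF ok(1)]
      using ok m unfolding m' by (auto simp: absm_def m0 fun_eq_iff sa_def n1_def)
  qed auto
qed

lemma macro_simulates:
  assumes ok: "okb b" and m: "fst m 1 = d" and d: "1 \<le> d" and pts: "\<And>i. pts i = mkv d (coord ps i)"
  shows "\<exists>D'. bs (sem0 ps) fst snd (macro b) m D' (50 * d) \<and>
    map_pmf (absm d) D' = sem2 d pts (length ps) b (absm d m) \<and> (\<forall>m'\<in>set_pmf D'. fst m' 1 = d)"
proof (cases "\<exists>a. b = BSmp a")
  case True
  then obtain a where a: "b = BSmp a" by auto
  let ?D = "sem0 ps (Sample a) m"
  have "bs (sem0 ps) fst snd (macro b) m ?D (50 * d)"
    using d by (auto simp: a intro: bs_weaken[OF bs_bas])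
  moreover have "map_pmf (absm d) ?D = sem2 d pts (length ps) b (absm d m)"
    using ok by (auto simp: a sem0_def sem2_def pmf.map_comp comp_def absm_def fun_eq_iff
      intro!: map_pmf_cong)
  moreover have "\<forall>m'\<in>set_pmf ?D. fst m' 1 = d" using ok m by (auto simp: a sem0_def)
  ultimately show ?thesis by blast
next
  case False
  have "simulates (macro b) m (bsem d pts b (absm d m))"
  proof (cases b)
    case (BLin a r b c)
    then show ?thesis using ok m d simulates_lin by simp
  next
    case (BPt a i)
    then show ?thesis using ok m d pts simulates_pt by simp
  next
    case (BDot r a b)
    then show ?thesis using ok m d simulates_dot by simp
  next
    case (BUnit a t r)
    then show ?thesis using ok m d simulates_unit by simp
  next
    case (BNat a c)
    then show ?thesis using ok m
      by (cases m, simp, intro simulates_bas[OF _ _ _ d]) (simp_all add: absm_upd_n)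
  next
    case (BNOp f a b c)
    then show ?thesis using ok m
      by (cases m, simp, intro simulates_bas[OF _ _ _ d]) (simp_all add: absm_upd_n absm_get)
  next
    case (BROf a b)
    then show ?thesis using ok m
      by (cases m, simp, intro simulates_bas[OF _ _ _ d]) (simp_all add: absm_upd_r absm_get)
  next
    case (BROp f a b c)
    then show ?thesis using ok m
      by (cases m, simp, intro simulates_bas[OF _ _ _ d]) (simp_all add: absm_upd_r absm_get)
  next
    case (BSqrt a b)
    then show ?thesis using ok m
      by (cases m, simp, intro simulates_bas[OF _ _ _ d]) (simp_all add: absm_upd_r absm_get)
  next
    case (BSmp a)
    then show ?thesis using False by simp
  qed
  then obtain D' where D': "bs (sem0 ps) fst snd (macro b) m D' (50 * d)"
    "\<forall>m'\<in>set_pmf D'. absm d m' = bsem d pts b (absm d m) \<and> fst m' 1 = d"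
    by (auto simp: simulates_def m.J_def)
  then have "map_pmf (absm d) D' = map_pmf (\<lambda>_. bsem d pts b (absm d m)) D'"
    by (intro map_pmf_cong) auto
  also have "\<dots> = sem2 d pts (length ps) b (absm d m)"
    using False by (cases b) (auto simp: sem2_def)
  finally show ?thesis using D' by blast
qed

text \<open>Induction on the derivation. The abstract continuation \<open>D2\<close> is pulled back
  along \<open>absm\<close>; control flow agrees because the tests read registers below 100 only. A
  basic operation costs at most \<open>50 * d\<close> machine steps, and as \<open>d\<close> is at
  least 1 the surcharge 2 of a test is covered by the same factor.\<close>

lemma simulation:
  assumes "bs (sem2 d pts (length ps)) vn vr c s D T" "okc c" "absm d m = s" "fst m 1 = d" "1 \<le> d"
    "\<And>i. pts i = mkv d (coord ps i)"
  shows "\<exists>D'. bs (sem0 ps) fst snd (tr c) m D' (50 * d * T) \<and> map_pmf (absm d) D' = D \<and>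
    (\<forall>m'\<in>set_pmf D'. fst m' 1 = d)"
  using assms
proof (induction arbitrary: m rule: bs.induct)
  case (bs_weaken c s D T T')
  obtain D' where D': "bs (sem0 ps) fst snd (tr c) m D' (50 * d * T)" "map_pmf (absm d) D' = D"
    "\<forall>m'\<in>set_pmf D'. fst m' 1 = d"
    using bs_weaken.IH[of m] bs_weaken.prems by auto
  have "bs (sem0 ps) fst snd (tr c) m D' (50 * d * T')"
    by (rule bs.bs_weaken[OF D'(1)]) (use bs_weaken.hyps in auto)
  then show ?case using D' by blast
next
  case (bs_skip s)
  then show ?case by (intro exI[of _ "return_pmf m"]) (auto intro: bs.bs_skip)
next
  case (bs_bas b s)
  then show ?case using macro_simulates[of b m pts] by simp
next
  case (bs_seq c1 s D1 T1 c2 D2 T2)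
  obtain D1' where D1': "bs (sem0 ps) fst snd (tr c1) m D1' (50 * d * T1)" "map_pmf (absm d) D1' = D1"
    "\<forall>m'\<in>set_pmf D1'. fst m' 1 = d"
    using bs_seq.IH(1)[of m] bs_seq.prems by auto
  have "\<exists>D'. bs (sem0 ps) fst snd (tr c2) m' D' (50 * d * T2) \<and> map_pmf (absm d) D' = D2 (absm d m') \<and>
    (\<forall>m'\<in>set_pmf D'. fst m' 1 = d)" if "m' \<in> set_pmf D1'" for m'
    using bs_seq.IH(2)[of "absm d m'" m'] that D1' bs_seq.prems by auto
  then obtain D2' where D2': "\<And>m'. m' \<in> set_pmf D1' \<Longrightarrow> bs (sem0 ps) fst snd (tr c2) m' (D2' m') (50 * d * T2)
     \<and> map_pmf (absm d) (D2' m') = D2 (absm d m') \<and> (\<forall>m''\<in>set_pmf (D2' m'). fst m'' 1 = d)"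
    by metis
  have "map_pmf (absm d) (bind_pmf D1' D2') = bind_pmf D1' (\<lambda>m'. D2 (absm d m'))"
    unfolding map_bind_pmf using D2' by (intro bind_pmf_cong) auto
  also have "\<dots> = bind_pmf D1 D2" unfolding D1'(2)[symmetric] by (simp add: bind_map_pmf)
  finally have "map_pmf (absm d) (bind_pmf D1' D2') = bind_pmf D1 D2" .
  moreover have "bs (sem0 ps) fst snd (tr (c1 ;; c2)) m (bind_pmf D1' D2') (50 * d * T1 + 50 * d * T2)"
    unfolding tr.simps by (rule bs.bs_seq[OF D1'(1)]) (use D2' in auto)
  ultimately show ?case using D2' by (intro exI[of _ "bind_pmf D1' D2'"]) (auto simp: algebra_simps)
next
  case (bs_ifN s a b c D T)
  have g: "fst m a = vn s a" "fst m b = vn s b" using bs_ifN.prems by (auto simp: absm_def)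
  have le: "50 * d * T + 2 \<le> 50 * d * (T + 2)" using bs_ifN.prems(4) by (simp add: algebra_simps)
  show ?case
  proof (cases "vn s a < vn s b")
    case True
    then obtain D' where D': "bs (sem0 ps) fst snd (tr c) m D' (50 * d * T)" "map_pmf (absm d) D' = D"
      "\<forall>m'\<in>set_pmf D'. fst m' 1 = d" using bs_ifN.IH[OF True, of m] bs_ifN.prems by auto
    have "bs (sem0 ps) fst snd (tr (IfN a b c)) m D' (50 * d * T + 2)"
      unfolding tr.simps by (rule bs.bs_ifN) (use D' g True in auto)
    from bs.bs_weaken[OF this le] show ?thesis using D' by auto
  next
    case False
    have "bs (sem0 ps) fst snd (tr (IfN a b c)) m (return_pmf m) (50 * d * T + 2)"
      unfolding tr.simps by (rule bs.bs_ifN) (use g False in auto)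
    from bs.bs_weaken[OF this le] show ?thesis using bs_ifN.hyps bs_ifN.prems False
      by (intro exI[of _ "return_pmf m"]) auto
  qed
next
  case (bs_ifR s a b c D T)
  have g: "snd m a = vr s a" "snd m b = vr s b" using bs_ifR.prems by (auto simp: absm_def)
  have le: "50 * d * T + 2 \<le> 50 * d * (T + 2)" using bs_ifR.prems(4) by (simp add: algebra_simps)
  show ?case
  proof (cases "vr s a < vr s b")
    case True
    then obtain D' where D': "bs (sem0 ps) fst snd (tr c) m D' (50 * d * T)" "map_pmf (absm d) D' = D"
      "\<forall>m'\<in>set_pmf D'. fst m' 1 = d" using bs_ifR.IH[OF True, of m] bs_ifR.prems by auto
    have "bs (sem0 ps) fst snd (tr (IfR a b c)) m D' (50 * d * T + 2)"
      unfolding tr.simps by (rule bs.bs_ifR) (use D' g True in auto)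
    from bs.bs_weaken[OF this le] show ?thesis using D' by auto
  next
    case False
    have "bs (sem0 ps) fst snd (tr (IfR a b c)) m (return_pmf m) (50 * d * T + 2)"
      unfolding tr.simps by (rule bs.bs_ifR) (use g False in auto)
    from bs.bs_weaken[OF this le] show ?thesis using bs_ifR.hyps bs_ifR.prems False
      by (intro exI[of _ "return_pmf m"]) auto
  qed
next
  case (bs_whileN_False s a b c)
  have "\<not> fst m a < fst m b" using bs_whileN_False by (auto simp: absm_def)
  then have "bs (sem0 ps) fst snd (tr (WhileN a b c)) m (return_pmf m) 2"
    unfolding tr.simps by (rule bs.bs_whileN_False)
  then show ?case using bs_whileN_False
    by (intro exI[of _ "return_pmf m"]) (auto elim!: bs.bs_weaken)
next
  case (bs_whileN s a b c D1 T1 D2 T2)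
  have test: "fst m a < fst m b" using bs_whileN by (auto simp: absm_def)
  obtain D1' where D1': "bs (sem0 ps) fst snd (tr c) m D1' (50 * d * T1)" "map_pmf (absm d) D1' = D1"
    "\<forall>m'\<in>set_pmf D1'. fst m' 1 = d"
    using bs_whileN.IH(1)[of m] bs_whileN.prems by auto
  have "\<exists>D'. bs (sem0 ps) fst snd (tr (WhileN a b c)) m' D' (50 * d * T2) \<and>
    map_pmf (absm d) D' = D2 (absm d m') \<and> (\<forall>m'\<in>set_pmf D'. fst m' 1 = d)" if "m' \<in> set_pmf D1'" for m'
    using bs_whileN.IH(2)[of "absm d m'" m'] that D1' bs_whileN.prems by auto
  then obtain D2' where D2': "\<And>m'. m' \<in> set_pmf D1' \<Longrightarrow>
     bs (sem0 ps) fst snd (tr (WhileN a b c)) m' (D2' m') (50 * d * T2)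
     \<and> map_pmf (absm d) (D2' m') = D2 (absm d m') \<and> (\<forall>m''\<in>set_pmf (D2' m'). fst m'' 1 = d)"
    by metis
  have "map_pmf (absm d) (bind_pmf D1' D2') = bind_pmf D1' (\<lambda>m'. D2 (absm d m'))"
    unfolding map_bind_pmf using D2' by (intro bind_pmf_cong) auto
  also have "\<dots> = bind_pmf D1 D2" unfolding D1'(2)[symmetric] by (simp add: bind_map_pmf)
  finally have "map_pmf (absm d) (bind_pmf D1' D2') = bind_pmf D1 D2" .
  moreover have "bs (sem0 ps) fst snd (tr (WhileN a b c)) m (bind_pmf D1' D2')
      (50 * d * T1 + 50 * d * T2 + 2)"
    unfolding tr.simps by (rule bs.bs_whileN) (use D1' D2' test in auto)
  then have "bs (sem0 ps) fst snd (tr (WhileN a b c)) m (bind_pmf D1' D2') (50 * d * (T1 + T2 + 2))"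
    by (rule bs.bs_weaken) (use bs_whileN.prems(4) in \<open>simp add: algebra_simps\<close>)
  ultimately show ?case using D2' by (intro exI[of _ "bind_pmf D1' D2'"]) auto
next
  case (bs_whileR_False s a b c)
  have "\<not> snd m a < snd m b" using bs_whileR_False by (auto simp: absm_def)
  then have "bs (sem0 ps) fst snd (tr (WhileR a b c)) m (return_pmf m) 2"
    unfolding tr.simps by (rule bs.bs_whileR_False)
  then show ?case using bs_whileR_False
    by (intro exI[of _ "return_pmf m"]) (auto elim!: bs.bs_weaken)
next
  case (bs_whileR s a b c D1 T1 D2 T2)
  have test: "snd m a < snd m b" using bs_whileR by (auto simp: absm_def)
  obtain D1' where D1': "bs (sem0 ps) fst snd (tr c) m D1' (50 * d * T1)" "map_pmf (absm d) D1' = D1"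
    "\<forall>m'\<in>set_pmf D1'. fst m' 1 = d"
    using bs_whileR.IH(1)[of m] bs_whileR.prems by auto
  have "\<exists>D'. bs (sem0 ps) fst snd (tr (WhileR a b c)) m' D' (50 * d * T2) \<and>
    map_pmf (absm d) D' = D2 (absm d m') \<and> (\<forall>m'\<in>set_pmf D'. fst m' 1 = d)" if "m' \<in> set_pmf D1'" for m'
    using bs_whileR.IH(2)[of "absm d m'" m'] that D1' bs_whileR.prems by auto
  then obtain D2' where D2': "\<And>m'. m' \<in> set_pmf D1' \<Longrightarrow>
     bs (sem0 ps) fst snd (tr (WhileR a b c)) m' (D2' m') (50 * d * T2)
     \<and> map_pmf (absm d) (D2' m') = D2 (absm d m') \<and> (\<forall>m''\<in>set_pmf (D2' m'). fst m'' 1 = d)"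
    by metis
  have "map_pmf (absm d) (bind_pmf D1' D2') = bind_pmf D1' (\<lambda>m'. D2 (absm d m'))"
    unfolding map_bind_pmf using D2' by (intro bind_pmf_cong) auto
  also have "\<dots> = bind_pmf D1 D2" unfolding D1'(2)[symmetric] by (simp add: bind_map_pmf)
  finally have "map_pmf (absm d) (bind_pmf D1' D2') = bind_pmf D1 D2" .
  moreover have "bs (sem0 ps) fst snd (tr (WhileR a b c)) m (bind_pmf D1' D2')
      (50 * d * T1 + 50 * d * T2 + 2)"
    unfolding tr.simps by (rule bs.bs_whileR) (use D1' D2' test in auto)
  then have "bs (sem0 ps) fst snd (tr (WhileR a b c)) m (bind_pmf D1' D2') (50 * d * (T1 + T2 + 2))"
    by (rule bs.bs_weaken) (use bs_whileR.prems(4) in \<open>simp add: algebra_simps\<close>)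
  ultimately show ?case using D2' by (intro exI[of _ "bind_pmf D1' D2'"]) auto
qed

end

section \<open>The algorithm\<close>

text \<open>
  Slots: \<open>sE i\<close> holds the orthonormalised vectors, \<open>sP i\<close> the current frame (base point \<open>sP0\<close>; the slots
  \<open>j + 1, \<dots>, 2 j\<close> contain unit vectors that complete a degenerate frame), \<open>sG i\<close> the frame of the greedy
  phase, \<open>sX i\<close> the guessed coordinates as multiples of the unit vector \<open>sI\<close>, and \<open>sZ\<close> is zero.
  Natural registers: 1 to 3 hold \<open>d, j, n\<close>; 4 and 5 hold 0 and 1; 6 holds \<open>H\<close>, 7 holds \<open>2 H\<^sup>2\<close>, 8 the number of
  rounds; 9 and 11 are the loop counters of the two phases, 17 is the index of the point found by
  \<open>far_cmd\<close>.  Real registers: 5 to 7 hold \<open>0, 1, -1\<close>; 8 holds \<open>2 (\<gamma> + \<delta>)\<close>, 12 holds \<open>\<sigma>\<close>, 13 holds \<open>1 / H\<close>.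
\<close>

abbreviation (input) "sE a \<equiv> (8, a, 0)"
abbreviation (input) "sP a \<equiv> (8, a, 1)"
abbreviation (input) "sG a \<equiv> (8, a, 2)"
abbreviation (input) "sX a \<equiv> (8, a, 3)"
abbreviation (input) "sP0 \<equiv> (0, 0, 1)"
abbreviation (input) "sG0 \<equiv> (0, 0, 2)"
abbreviation (input) "sZ \<equiv> (0, 0, 4)"
abbreviation (input) "sT \<equiv> (0, 0, 5)"
abbreviation (input) "sU \<equiv> (0, 0, 6)"
abbreviation (input) "sI \<equiv> (0, 0, 7)"

text \<open>For \<open>n \<ge> 2\<close> both outcomes of the test whether twice a random index is less than \<open>n\<close> have
  probability at least \<open>1 / 3\<close>.\<close>

definition coin :: "bop com" where
  "coin = Bas (BSmp 18) ;; blk [BNOp NPlus 18 18 18]"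

definition proj_cmd :: "bop com" where
  "proj_cmd = blk [BNat 15 0] ;; WhileN 15 14 (blk [BNOp NPlus 15 15 5, BDot 10 sT (sE 15),
     BROp RMinus 10 5 10, BLin sT 10 (sE 15) sT])"

definition gs_cmd :: "bop com" where
  "gs_cmd = blk [BNat 14 0, BNat 13 0] ;; WhileN 13 12 (
     blk [BNOp NPlus 13 13 5, BLin sT 6 (sP 13) sZ] ;; proj_cmd ;; blk [BDot 10 sT sT, BSqrt 11 10] ;;
     IfR 5 11 (blk [BNOp NPlus 14 14 5, BROp RDiv 11 6 11, BLin (sE 14) 11 sT sZ]))"

definition res_cmd :: "nat \<Rightarrow> bop com" where
  "res_cmd a = blk [BPt sT a, BLin sT 7 sP0 sT] ;; proj_cmd"

text \<open>Real register 14 is the number of draws times \<open>2 * (\<gamma> + \<delta>)\<close>.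
  Comparing it with 1 makes the number of draws the ceiling of
  \<open>1 / (2 * (\<gamma> + \<delta>))\<close> without rounding a real.\<close>

definition draw_cmd :: "bop com" where
  "draw_cmd = Bas (BSmp 16) ;; res_cmd 16 ;; blk [BDot 10 sT sT] ;;
     IfR 9 10 (blk [BROp RPlus 9 10 5, BNOp NPlus 17 16 4]) ;;
     blk [BNOp NPlus 19 19 5, BROf 14 19, BROp RTimes 14 14 8]"

text \<open>The record in real register 9 starts at -1, below every squared distance, so the first
  point drawn is always accepted.\<close>

definition far_cmd :: "bop com" where
  "far_cmd = blk [BNOp NPlus 12 2 4] ;; gs_cmd ;;
     blk [BROp RMinus 9 5 6, BNat 19 0, BROf 14 4] ;; WhileR 14 6 draw_cmd ;; res_cmd 17"

text \<open>Stopping means setting the loop bound to 0, which makes the guards of the round and of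
  the loop fail; \<open>refine_cmd\<close> proceeds in the same way.\<close>

definition greedy_cmd :: "bop com" where
  "greedy_cmd = blk [BNat 9 0, BNOp NPlus 10 2 4] ;; WhileN 9 10 (
     coin ;; IfN 18 3 (blk [BNat 10 0]) ;;
     IfN 9 10 (far_cmd ;; blk [BNOp NPlus 9 9 5, BLin (sP 9) 6 sT sZ, BLin (sG 9) 6 sT sZ]))"

definition sigma_cmd :: "bop com" where
  "sigma_cmd = far_cmd ;; blk [BDot 10 sT sT, BSqrt 12 10]"

text \<open>Reals cannot be rounded, so the grid point is guessed by \<open>2 H\<^sup>2\<close> coin tosses, each of which adds the mesh width or not.\<close>

definition coord_cmd :: "bop com" where
  "coord_cmd = blk [BNOp NPlus 20 20 5, BDot 10 (sG 20) (sG 20), BSqrt 15 10] ;;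
     IfR 15 12 (blk [BROp RPlus 15 12 5]) ;;
     blk [BDot 16 sU (sG 20), BROp RDiv 16 16 15, BROp RDiv 16 16 15, BROp RDiv 17 12 15, BROf 18 6,
       BROp RTimes 18 18 17, BROp RMinus 16 16 18, BROp RTimes 17 17 13, BNat 21 0] ;;
     WhileN 21 7 (coin ;; blk [BNOp NPlus 21 21 5] ;; IfN 18 3 (blk [BROp RPlus 16 16 17])) ;;
     blk [BLin (sX 20) 16 sI sZ]"

text \<open>Coordinates are guessed relative to the greedy frame \<open>sG\<close>, which stays
  fixed while \<open>sP\<close> is corrected. So one analysis of the grid is valid for all
  rounds.\<close>

definition update_cmd :: "bop com" where
  "update_cmd = blk [BPt sU 17, BLin sU 7 sG0 sU, BNat 20 0] ;; WhileN 20 2 coord_cmd ;;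
     blk [BPt sT 17, BLin sT 7 sP0 sT, BNat 20 0] ;;
     WhileN 20 2 (blk [BNOp NPlus 20 20 5, BDot 16 (sX 20) sI, BROp RMinus 16 5 16, BLin sT 16 (sP 20) sT]) ;;
     blk [BLin sP0 13 sT sP0, BNat 20 0] ;;
     WhileN 20 2 (blk [BNOp NPlus 20 20 5, BDot 16 (sX 20) sI, BROp RTimes 16 16 13, BLin (sP 20) 16 sT (sP 20)])"

definition refine_cmd :: "bop com" where
  "refine_cmd = blk [BNat 11 0] ;; WhileN 11 8 (
     coin ;; IfN 18 3 (blk [BNat 8 0]) ;;
     IfN 11 8 (blk [BNOp NPlus 11 11 5] ;; far_cmd ;; update_cmd))"

text \<open>The orthonormalised vectors lie eight slots apart, but the output has to be contiguous.
  Slot \<open>16 * j + 16\<close> lies beyond all slots of the frames, the last of which has number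
  \<open>16 * j + 1\<close>.\<close>

definition output_cmd :: "bop com" where
  "output_cmd = blk [BNOp NPlus 12 2 2] ;; gs_cmd ;;
     blk [BNat 23 16, BNOp NTimes 22 2 23, BNOp NPlus 22 22 23, BLin (1, 22, 0) 6 sP0 sZ, BNat 20 0] ;;
     WhileN 20 2 (blk [BNOp NPlus 20 20 5, BNOp NPlus 23 22 20, BLin (1, 23, 0) 6 (sE 20) sZ]) ;;
     blk [BNat 23 128, BNOp NTimes 0 22 1, BNOp NPlus 0 0 23]"

text \<open>The ceiling of \<open>1 / \<epsilon>\<close> is found by counting up in natural register
  21 until the count is no longer below \<open>1 / \<epsilon>\<close>.\<close>

definition init_cmd :: "bop com" where
  "init_cmd = blk [BNOp NPlus 3 0 4, BNat 5 1, BROf 6 5, BROp RMinus 7 5 6, BROp RPlus 8 0 2,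
       BROp RPlus 8 8 8, BUnit sI 4 6, BNat 6 200, BNat 23 200, BNat 20 0] ;;
     WhileN 20 2 (blk [BNOp NPlus 20 20 5, BNOp NTimes 6 6 23]) ;;
     blk [BROp RDiv 19 6 1] ;;
     WhileR 14 19 (blk [BNOp NPlus 21 21 5, BROf 14 21]) ;;
     blk [BNOp NTimes 6 6 21, BNOp NTimes 7 6 6, BNOp NTimes 8 7 6, BNOp NPlus 7 7 7,
       BROf 13 6, BROp RDiv 13 6 13, BNat 20 0] ;;
     WhileN 20 2 (blk [BNOp NPlus 23 20 2, BNOp NPlus 23 23 5, BUnit (sP 23) 20 6, BNOp NPlus 20 20 5]) ;;
     Bas (BSmp 16) ;; blk [BPt sP0 16, BPt sG0 16]"

definition flat_cmd :: "bop com" where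
  "flat_cmd = init_cmd ;; greedy_cmd ;; sigma_cmd ;; refine_cmd ;; output_cmd"

lemmas cmd_defs = coin_def proj_cmd_def gs_cmd_def res_cmd_def draw_cmd_def far_cmd_def greedy_cmd_def
  sigma_cmd_def coord_cmd_def update_cmd_def refine_cmd_def output_cmd_def init_cmd_def

lemma okc_flat_cmd: "okc flat_cmd"
  by (simp add: flat_cmd_def cmd_defs)

section \<open>Frame conditions and the layout of registers and slots\<close>

definition same :: "nat set \<Rightarrow> nat set \<Rightarrow> nat set \<Rightarrow> vst \<Rightarrow> vst \<Rightarrow> bool" where
  "same NS RS VS s s' \<longleftrightarrow> (\<forall>i. i \<notin> NS \<longrightarrow> vn s' i = vn s i) \<and> (\<forall>i. i \<notin> RS \<longrightarrow> vr s' i = vr s i) \<and>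
     (\<forall>i. i \<notin> VS \<longrightarrow> vv s' i = vv s i)"

lemma same_trans:
  "same NS RS VS s s' \<Longrightarrow> same NS' RS' VS' s' s'' \<Longrightarrow> NS \<subseteq> NS'' \<Longrightarrow> NS' \<subseteq> NS'' \<Longrightarrow>
   RS \<subseteq> RS'' \<Longrightarrow> RS' \<subseteq> RS'' \<Longrightarrow> VS \<subseteq> VS'' \<Longrightarrow> VS' \<subseteq> VS'' \<Longrightarrow> same NS'' RS'' VS'' s s''"
  unfolding same_def by (metis subsetD)

lemma same_mono:
  "same NS RS VS s s' \<Longrightarrow> NS \<subseteq> NS' \<Longrightarrow> RS \<subseteq> RS' \<Longrightarrow> VS \<subseteq> VS' \<Longrightarrow> same NS' RS' VS' s s'"
  unfolding same_def by blast

definition fE :: "vst \<Rightarrow> nat \<Rightarrow> fvec" where "fE s i = vv s (8 * i)"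
definition fP :: "vst \<Rightarrow> nat \<Rightarrow> fvec" where "fP s i = vv s (8 * i + 1)"
definition fG :: "vst \<Rightarrow> nat \<Rightarrow> fvec" where "fG s i = vv s (8 * i + 2)"
definition fX :: "vst \<Rightarrow> nat \<Rightarrow> fvec" where "fX s i = vv s (8 * i + 3)"

definition Eslots :: "nat set" where "Eslots = insert 5 (range ((*) 8))"

lemma Eslots_mem: "8 * i \<in> Eslots" "5 \<in> Eslots" "8 * i + 1 \<notin> Eslots" "8 * i + 2 \<notin> Eslots"
  "8 * i + 3 \<notin> Eslots" "4 \<notin> Eslots" "7 \<notin> Eslots" "6 \<notin> Eslots" "1 \<notin> Eslots" "2 \<notin> Eslots"
  unfolding Eslots_def by (auto, presburger+)

definition consts_ok :: "vst \<Rightarrow> bool" where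
  "consts_ok s \<longleftrightarrow> vn s 4 = 0 \<and> vn s 5 = 1 \<and> vr s 5 = 0 \<and> vr s 6 = 1 \<and> vr s 7 = -1 \<and> vv s 4 = 0"

lemma consts_ok_same:
  "consts_ok s \<Longrightarrow> same NS RS VS s s' \<Longrightarrow> {4, 5} \<inter> NS = {} \<Longrightarrow> {5, 6, 7} \<inter> RS = {} \<Longrightarrow> 4 \<notin> VS \<Longrightarrow> consts_ok s'"
  unfolding consts_ok_def same_def by auto

section \<open>Specifications of the projection and sampling commands\<close>

locale vprog =
  fixes d n :: nat and pts :: "nat \<Rightarrow> fvec"
  assumes n1: "1 \<le> n"
begin

sublocale prog "sem2 d pts n" vn vr .

abbreviation "ops xs \<equiv> fold (bsem d pts) xs"

fun nosmp :: "bop \<Rightarrow> bool" where "nosmp (BSmp a) = False" | "nosmp _ = True"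

lemma J_ops:
  assumes "list_all nosmp xs" "Q (ops xs s)" "p \<le> f (ops xs s)" "length xs \<le> T"
  shows "J (blk xs) s T Q f p"
proof -
  have "J (blk xs) s (length xs) Q f p"
  proof (rule J_blk[where de = "bsem d pts"])
    fix b s assume "b \<in> set xs"
    then have "nosmp b" using assms(1) by (auto simp: list_all_iff)
    then show "sem2 d pts n b s = return_pmf (bsem d pts b s)" by (cases b) (auto simp: sem2_def)
  qed (use assms in auto)
  then show ?thesis by (rule J_conseq) (use assms in auto)
qed

lemma J_smp:
  assumes "\<And>i. i < n \<Longrightarrow> Q (s\<lparr>vn := (vn s)(a := i)\<rparr>)"
    and "p \<le> (\<Sum>i<n. g i) / n" and "\<And>i. i < n \<Longrightarrow> 0 \<le> g i \<and> g i \<le> f (s\<lparr>vn := (vn s)(a := i)\<rparr>)"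
  shows "J (Bas (BSmp a)) s 1 Q f p"
proof (rule J_bas)
  have fin: "finite {..<n}" "{..<n} \<noteq> {}" using n1 by (auto simp: lessThan_empty_iff bot_nat_def)
  show "Q s'" if "s' \<in> set_pmf (sem2 d pts n (BSmp a) s)" for s'
    using that assms(1) fin by (auto simp: sem2_def set_pmf_of_set)
  have "ennreal p \<le> ennreal ((\<Sum>i<n. g i) / n)" using assms(2) by (rule ennreal_leI)
  also have "\<dots> = (\<Sum>i<n. ennreal (g i)) / n"
  proof -
    have "(\<Sum>i<n. ennreal (g i)) = ennreal (\<Sum>i<n. g i)" by (rule sum_ennreal) (use assms(3) in auto)
    moreover have "0 \<le> (\<Sum>i<n. g i)" by (intro sum_nonneg) (use assms(3) in auto)
    ultimately show ?thesis using n1 by (simp add: divide_ennreal ennreal_of_nat_eq_real_of_nat)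
  qed
  also have "\<dots> \<le> (\<Sum>i<n. ennreal (f (s\<lparr>vn := (vn s)(a := i)\<rparr>))) / n"
    using assms(3) by (intro divide_right_mono_ennreal sum_mono ennreal_leI) auto
  also have "\<dots> = (\<integral>\<^sup>+ s'. ennreal (f s') \<partial>measure_pmf (sem2 d pts n (BSmp a) s))"
    using fin by (simp add: sem2_def nn_integral_pmf_of_set)
  finally show "ennreal p \<le> (\<integral>\<^sup>+ s'. ennreal (f s') \<partial>measure_pmf (sem2 d pts n (BSmp a) s))" .
qed

lemma proj_spec:
  assumes c: "consts_ok s" and on: "ons (fE s) (vn s 14)" and m: "vn s 14 \<le> m"
  shows "tot proj_cmd s (6 * m + 3) (\<lambda>s'. same {15} {10} {5} s s' \<and>
    vv s' 5 = perp (span (fE s ` {1..vn s 14})) (vv s 5))"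
proof -
  define I where "I k s' \<longleftrightarrow> same {15} {10} {5} s s' \<and> vn s' 15 = k \<and>
    vv s' 5 = vv s 5 - (\<Sum>c=1..k. inner (vv s 5) (fE s c) *\<^sub>R fE s c)" for k s'
  let ?body = "[BNOp NPlus 15 15 5, BDot 10 sT (sE 15), BROp RMinus 10 5 10, BLin sT 10 (sE 15) sT]"
  have step: "tot (blk ?body) s' 4 (I (Suc k))" if k: "k < vn s 14" and I: "I k s'" for k s'
  proof (rule J_ops)
    have S: "vn s' 5 = 1" "vn s' 15 = k" "vr s' 5 = 0" "vv s' (8 * Suc k) = fE s (Suc k)"
      using I c by (auto simp: I_def same_def consts_ok_def fE_def)
    have S5: "vv s' (8 * k + 8) = fE s (Suc k)" using S(4) by (simp add: add.commute)
    have ne: "8 * Suc k \<noteq> 5" by presburger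
    have on': "ons (fE s) k" using on k by (auto simp: ons_def)
    have "inner (fE s i) (fE s (Suc k)) = 0" if "i \<in> {1..k}" for i
      using on k that by (auto simp: ons_def)
    then have "inner (\<Sum>c=1..k. inner (vv s 5) (fE s c) *\<^sub>R fE s c) (fE s (Suc k)) = 0"
      by (simp add: inner_sum_left)
    \<comment> \<open>The coefficient is taken from the partly reduced vector, but orthogonality
      makes it the coefficient of the original one.\<close>
    then have ip: "inner (vv s' 5) (fE s (Suc k)) = inner (vv s 5) (fE s (Suc k))"
      using I by (simp add: I_def inner_diff_left)
    have "vv (ops ?body s') 5 = vv s' 5 - inner (vv s 5) (fE s (Suc k)) *\<^sub>R fE s (Suc k)"
      using S(1-3) S5 ip ne by simp
    moreover have "same {15} {10} {5} s (ops ?body s')" using I S by (auto simp: I_def same_def)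
    ultimately show "I (Suc k) (ops ?body s')" using I S by (simp add: I_def)
  qed auto
  have 1: "tot (blk [BNat 15 0]) s 1 (I 0)"
    by (rule J_ops) (auto simp: I_def same_def One_nat_def)
  have 2: "tot (WhileN 15 14 (blk ?body)) s1 (vn s 14 * (4 + 2) + 2) (I (vn s 14))" if "I 0 s1" for s1
    by (rule J_whileN[where v = "\<lambda>_ _. 0" and I = I])
      (use that step in \<open>auto simp: I_def same_def\<close>)
  have "tot proj_cmd s (1 + (vn s 14 * (4 + 2) + 2)) (I (vn s 14))"
    unfolding proj_cmd_def by (rule J_seq_tot[OF 1 2])
  then show ?thesis
    by (rule J_conseq) (use m in \<open>auto simp: I_def perp_ons[OF on]\<close>)
qed

text \<open>The last clause is needed for the output, where only the first \<open>j\<close> of the vectors obtained from the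
  frame and \<open>j\<close> unit vectors are used.\<close>

lemma gs_spec:
  assumes c: "consts_ok s" and cnt: "vn s 12 \<le> m"
  shows "tot gs_cmd s ((6 * m + 20) * m + 4) (\<lambda>s'. same {13, 14, 15} {10, 11} Eslots s s' \<and>
    ons (fE s') (vn s' 14) \<and> span (fE s' ` {1..vn s' 14}) = span (fP s ` {1..vn s 12}) \<and> vn s' 14 \<le> m \<and>
    (\<forall>i\<le>vn s 12. \<exists>l\<le>i. l \<le> vn s' 14 \<and> span (fE s' ` {1..l}) = span (fP s ` {1..i})))"
proof -
  define I where "I k s' \<longleftrightarrow> same {13, 14, 15} {10, 11} Eslots s s' \<and> vn s' 13 = k \<and> vn s' 14 \<le> k \<and>
    ons (fE s') (vn s' 14) \<and> span (fE s' ` {1..vn s' 14}) = span (fP s ` {1..k}) \<and>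
    (\<forall>i\<le>k. \<exists>l\<le>i. l \<le> vn s' 14 \<and> span (fE s' ` {1..l}) = span (fP s ` {1..i}))" for k s'
  let ?body = "blk [BNOp NPlus 13 13 5, BLin sT 6 (sP 13) sZ] ;; proj_cmd ;; blk [BDot 10 sT sT, BSqrt 11 10] ;;
     IfR 5 11 (blk [BNOp NPlus 14 14 5, BROp RDiv 11 6 11, BLin (sE 14) 11 sT sZ])"
  have step: "tot ?body s0 (6 * m + 12) (I (Suc k))" if k: "k < vn s 12" and I: "I k s0" for k s0
  proof -
    have c0: "consts_ok s0"
      by (rule consts_ok_same[OF c, of "{13, 14, 15}" "{10, 11}" Eslots]) (use I in \<open>auto simp: I_def Eslots_mem\<close>)
    have E0: "ons (fE s0) (vn s0 14)" "vn s0 14 \<le> k" "span (fE s0 ` {1..vn s0 14}) = span (fP s ` {1..k})"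
      and same0: "same {13, 14, 15} {10, 11} Eslots s s0" using I by (auto simp: I_def)
    have pre0: "\<exists>l. l \<le> i \<and> l \<le> vn s0 14 \<and> span (fE s0 ` {1..l}) = span (fP s ` {1..i})" if "i \<le> k" for i
      using I that by (simp add: I_def)
    define x where "x = fP s (Suc k)"
    define W where "W = span (fE s0 ` {1..vn s0 14})"
    define r where "r = perp W x"
    define Q1 where "Q1 s' \<longleftrightarrow> same {13} {} {5} s0 s' \<and> vn s' 13 = Suc k \<and> vv s' 5 = x" for s'
    have 1: "tot (blk [BNOp NPlus 13 13 5, BLin sT 6 (sP 13) sZ]) s0 2 Q1"
    proof (rule J_ops)
      have "vv s0 (8 * Suc k + 1) = x"
        using same0 Eslots_mem(3)[of "Suc k"] by (simp add: same_def x_def fP_def)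
      then show "Q1 (ops [BNOp NPlus 13 13 5, BLin sT 6 (sP 13) sZ] s0)"
        using c0 I by (simp add: Q1_def same_def consts_ok_def I_def)
    qed auto
    define Q2 where "Q2 s' \<longleftrightarrow> same {13, 15} {10} {5} s0 s' \<and> vn s' 13 = Suc k \<and> vv s' 5 = r" for s'
    have 2: "tot proj_cmd s1 (6 * m + 3) Q2" if Q1: "Q1 s1" for s1
    proof (rule J_conseq[OF proj_spec[where m = m]])
      have e: "fE s1 = fE s0"
      proof
        fix i
        have "8 * i \<noteq> (5::nat)" by presburger
        then show "fE s1 i = fE s0 i" using Q1 by (simp add: Q1_def same_def fE_def)
      qed
      have m14: "vn s1 14 = vn s0 14" using Q1 by (simp add: Q1_def same_def)
      show "consts_ok s1" by (rule consts_ok_same[OF c0]) (use Q1 in \<open>auto simp: Q1_def\<close>)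
      show "ons (fE s1) (vn s1 14)" using E0 e m14 by simp
      show "vn s1 14 \<le> m" using E0 m14 k cnt by simp
      fix s' assume s': "same {15} {10} {5} s1 s' \<and> vv s' 5 = perp (span (fE s1 ` {1..vn s1 14})) (vv s1 5)"
      then show "Q2 s'" using Q1 e m14 by (auto simp: Q1_def Q2_def same_def r_def W_def)
    qed auto
    define Q3 where "Q3 s' \<longleftrightarrow> same {13, 15} {10, 11} {5} s0 s' \<and> vn s' 13 = Suc k \<and> vv s' 5 = r \<and> vr s' 11 = norm r" for s'
    have 3: "tot (blk [BDot 10 sT sT, BSqrt 11 10]) s2 2 Q3" if "Q2 s2" for s2
      by (rule J_ops) (use that in \<open>auto simp: Q2_def Q3_def same_def norm_eq_sqrt_inner\<close>)
    have fin: "finite (fP s ` {1..k})" by simp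
    have W: "W = span (fP s ` {1..k})" using E0 by (simp add: W_def)
    have xr: "x - r \<in> span (fP s ` {1..k})" unfolding r_def W by (rule perp_span(1)[OF fin])
    have im: "fP s ` {1..Suc k} = insert x (fP s ` {1..k})"
      by (simp add: x_def atLeastAtMostSuc_conv)
    have fE3: "fE s3 i = fE s0 i" if "Q3 s3" for s3 i
    proof -
      have "8 * i \<noteq> (5::nat)" by presburger
      then show ?thesis using that by (simp add: Q3_def same_def fE_def)
    qed
    have 4: "tot (IfR 5 11 (blk [BNOp NPlus 14 14 5, BROp RDiv 11 6 11, BLin (sE 14) 11 sT sZ])) s3 (3 + 2) (I (Suc k))"
      if Q3: "Q3 s3" for s3
    proof (rule J_ifR)
      have c3: "consts_ok s3" by (rule consts_ok_same[OF c0]) (use Q3 in \<open>auto simp: Q3_def\<close>)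
      have same3: "same {13, 14, 15} {10, 11} Eslots s s3"
        by (rule same_trans[OF same0, of "{13, 15}" "{10, 11}" "{5}"]) (use Q3 in \<open>auto simp: Q3_def Eslots_mem\<close>)
      have m3: "vn s3 14 = vn s0 14" using Q3 by (simp add: Q3_def same_def)
      show "tot (blk [BNOp NPlus 14 14 5, BROp RDiv 11 6 11, BLin (sE 14) 11 sT sZ]) s3 3 (I (Suc k))"
        if "vr s3 5 < vr s3 11"
      proof (rule J_ops)
        have r0: "r \<noteq> 0" using that c3 Q3 by (auto simp: Q3_def consts_ok_def)
        define s4 where "s4 = ops [BNOp NPlus 14 14 5, BROp RDiv 11 6 11, BLin (sE 14) 11 sT sZ] s3"
        let ?l = "vn s0 14"
        have s14: "vn s4 14 = Suc ?l" using c3 m3 by (simp add: s4_def consts_ok_def)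
        have E: "fE s4 = (fE s0)(Suc ?l := (1 / norm r) *\<^sub>R r)"
          using c3 m3 Q3 fE3[OF Q3] by (auto simp: s4_def fun_eq_iff fE_def consts_ok_def Q3_def)
        have on: "ons (fE s4) (Suc ?l)"
          unfolding E
        proof (rule ons_extend[OF E0(1) r0])
          fix i assume "i \<in> {1..?l}"
          then show "inner r (fE s0 i) = 0"
            unfolding r_def W_def by (intro perp_span(2) span_base) auto
        qed
        have sp: "span (fE s4 ` {1..Suc ?l}) = span (fP s ` {1..Suc k})"
          unfolding E im by (rule span_ons_extend[OF E0(3) xr r0])
        have pre: "fE s4 ` {1..l} = fE s0 ` {1..l}" if "l \<le> ?l" for l
          unfolding E using that by (intro image_cong) auto
        have sm: "same {13, 14, 15} {10, 11} Eslots s s4"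
          using same3 c3 c Eslots_mem(1)[of "vn s3 14 + 1"] by (auto simp: s4_def same_def consts_ok_def)
        have "\<exists>l\<le>i. l \<le> vn s4 14 \<and> span (fE s4 ` {1..l}) = span (fP s ` {1..i})" if "i \<le> Suc k" for i
        proof (cases "i = Suc k")
          case True
          then show ?thesis using sp s14 E0(2) by (intro exI[of _ "Suc ?l"]) simp
        next
          case False
          then have "i \<le> k" using that by simp
          from pre0[OF this] obtain l where "l \<le> i" "l \<le> ?l" "span (fE s0 ` {1..l}) = span (fP s ` {1..i})"
            by blast
          then show ?thesis using pre[of l] s14 by (intro exI[of _ l]) simp
        qed
        moreover have "vn s4 13 = Suc k" using Q3 by (simp add: s4_def Q3_def)
        ultimately have "I (Suc k) s4" unfolding I_def using sm on sp s14 E0(2) by simp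
        then show "I (Suc k) (ops [BNOp NPlus 14 14 5, BROp RDiv 11 6 11, BLin (sE 14) 11 sT sZ] s3)"
          by (simp only: s4_def)
      qed auto
      show "I (Suc k) s3 \<and> (0::real) \<le> 0" if "\<not> vr s3 5 < vr s3 11"
      proof -
        have r0: "r = 0" using that c3 Q3 by (auto simp: Q3_def consts_ok_def)
        have E: "fE s3 = fE s0" using fE3[OF Q3] by auto
        have sp: "span (fE s3 ` {1..vn s3 14}) = span (fP s ` {1..Suc k})"
          unfolding im E m3 E0(3) using xr r0 by (simp add: span_redundant)
        have "\<exists>l\<le>i. l \<le> vn s3 14 \<and> span (fE s3 ` {1..l}) = span (fP s ` {1..i})" if "i \<le> Suc k" for i
        proof (cases "i = Suc k")
          case True
          then show ?thesis using sp m3 E0(2) by (intro exI[of _ "vn s3 14"]) simp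
        next
          case False
          then have "i \<le> k" using that by simp
          from pre0[OF this] show ?thesis unfolding E m3 by blast
        qed
        moreover have "ons (fE s3) (vn s3 14)" unfolding E m3 by (rule E0(1))
        moreover have "vn s3 13 = Suc k" "vn s3 14 \<le> Suc k" using Q3 m3 E0(2) by (simp_all add: Q3_def)
        ultimately show ?thesis unfolding I_def using same3 sp by simp
      qed
    qed
    have "tot ?body s0 (2 + ((6 * m + 3) + (2 + (3 + 2)))) (I (Suc k))"
      by (rule J_seq_tot[OF 1 J_seq_tot[OF 2 J_seq_tot[OF 3 4]]])
    then show ?thesis by (rule J_conseq) auto
  qed
  have 1: "tot (blk [BNat 14 0, BNat 13 0]) s 2 (I 0)"
    by (rule J_ops) (auto simp: I_def same_def ons_def)
  have 2: "tot (WhileN 13 12 ?body) s1 (vn s 12 * (6 * m + 12 + 2) + 2) (I (vn s 12))" if "I 0 s1" for s1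
    by (rule J_whileN[where v = "\<lambda>_ _. 0" and I = I])
      (use that step in \<open>auto simp: I_def same_def\<close>)
  have 3: "tot gs_cmd s (2 + (vn s 12 * (6 * m + 12 + 2) + 2)) (I (vn s 12))"
    unfolding gs_cmd_def by (rule J_seq_tot[OF 1 2])
  have "vn s 12 * (6 * m + 12 + 2) \<le> m * (6 * m + 20)" by (intro mult_mono cnt) auto
  then have "2 + (vn s 12 * (6 * m + 12 + 2) + 2) \<le> (6 * m + 20) * m + 4"
    by (simp only: mult.commute[of m])
  from J_conseq[OF 3 this] show ?thesis using cnt by (auto simp: I_def)
qed

lemma res_spec:
  assumes c: "consts_ok s" and on: "ons (fE s) (vn s 14)" and m: "vn s 14 \<le> m"
  shows "tot (res_cmd a) s (6 * m + 5) (\<lambda>s'. same {15} {10} {5} s s' \<and>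
    vv s' 5 = perp (span (fE s ` {1..vn s 14})) (pts (vn s a) - fP s 0))"
proof -
  define Q1 where "Q1 s' \<longleftrightarrow> same {} {} {5} s s' \<and> vv s' 5 = pts (vn s a) - fP s 0" for s'
  have 1: "tot (blk [BPt sT a, BLin sT 7 sP0 sT]) s 2 Q1"
    by (rule J_ops) (use c in \<open>auto simp: Q1_def same_def consts_ok_def fP_def\<close>)
  have 2: "tot proj_cmd s1 (6 * m + 3) (\<lambda>s'. same {15} {10} {5} s s' \<and>
      vv s' 5 = perp (span (fE s ` {1..vn s 14})) (pts (vn s a) - fP s 0))" if Q1: "Q1 s1" for s1
  proof -
    have E: "fE s1 = fE s"
    proof
      fix i
      have "8 * i \<noteq> (5::nat)" by presburger
      then show "fE s1 i = fE s i" using Q1 by (simp add: Q1_def same_def fE_def)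
    qed
    have e: "vn s1 14 = vn s 14" using Q1 by (simp add: Q1_def same_def)
    have c1: "consts_ok s1" by (rule consts_ok_same[OF c]) (use Q1 in \<open>auto simp: Q1_def\<close>)
    have "tot proj_cmd s1 (6 * m + 3) (\<lambda>s'. same {15} {10} {5} s1 s' \<and>
      vv s' 5 = perp (span (fE s1 ` {1..vn s1 14})) (vv s1 5))"
      by (rule proj_spec[OF c1]) (use on m e E in auto)
    then show ?thesis
      by (rule J_conseq) (use Q1 E e in \<open>auto simp: Q1_def same_def\<close>)
  qed
  have "tot (res_cmd a) s (2 + (6 * m + 3)) (\<lambda>s'. same {15} {10} {5} s s' \<and>
      vv s' 5 = perp (span (fE s ` {1..vn s 14})) (pts (vn s a) - fP s 0))"
    unfolding res_cmd_def by (rule J_seq_tot[OF 1 2])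
  then show ?thesis by (rule J_conseq) auto
qed

text \<open>A lower bound for the probability that the record ends in \<open>Top\<close> when
  \<open>r\<close> draws remain and \<open>i\<close> is the record so far, any draw from
  \<open>Bad\<close> being counted as failure. In the last case it is the probability that no draw
  hits \<open>Bad\<close>, minus the probability that no draw hits \<open>Top\<close> or
  \<open>Bad\<close>.\<close>

definition best_value :: "nat set \<Rightarrow> nat set \<Rightarrow> nat \<Rightarrow> bool \<Rightarrow> nat \<Rightarrow> real" where
  "best_value Top Bad r started i = (let a = card Top / n; b = card Bad / n in
     if started \<and> i \<in> Top then (1 - b) ^ r
     else if started \<and> i \<in> Bad then 0 else (1 - b) ^ r - (1 - a - b) ^ r)"

lemma best_value_mono:
  assumes "Top \<subseteq> {..<n}" "Bad \<subseteq> {..<n}" "Top \<inter> Bad = {}"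
  shows "0 \<le> 1 - card Top / real n - card Bad / real n" "0 \<le> best_value Top Bad r st i"
    "\<not> (st' \<and> i' \<in> Bad) \<Longrightarrow> \<not> (st \<and> i \<in> Top) \<Longrightarrow> best_value Top Bad r st i \<le> best_value Top Bad r st' i'"
proof -
  have fin: "finite Top" "finite Bad" using assms(1,2) by (auto intro: finite_subset)
  have "card (Top \<union> Bad) \<le> card {..<n}" using assms by (intro card_mono) auto
  then have "card Top + card Bad \<le> n" using card_Un_disjoint[OF fin assms(3)] by simp
  then have "(card Top + card Bad) / real n \<le> 1" using n1 by (simp add: divide_le_eq_1)
  then show 1: "0 \<le> 1 - card Top / real n - card Bad / real n" by (simp add: add_divide_distrib)
  have a: "0 \<le> card Top / real n" by simp
  have 2: "(1 - card Top / real n - card Bad / real n) ^ r \<le> (1 - card Bad / real n) ^ r"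
    using 1 a by (intro power_mono) linarith+
  have 3: "0 \<le> (1 - card Top / real n - card Bad / real n) ^ r" "0 \<le> (1 - card Bad / real n) ^ r"
    using 1 a by (intro zero_le_power; linarith)+
  show "0 \<le> best_value Top Bad r st i" using 2 3 by (auto simp: best_value_def Let_def)
  show "best_value Top Bad r st i \<le> best_value Top Bad r st' i'"
    if "\<not> (st' \<and> i' \<in> Bad)" "\<not> (st \<and> i \<in> Top)"
    using 2 3 that by (auto simp: best_value_def Let_def)
qed

text \<open>One draw. In the last case it hits \<open>Top\<close> with probability \<open>a\<close>
  and is neutral with probability \<open>1 - a - b\<close>, and
  \<open>a y + (1 - a - b) (y - z) = (1 - b) y - (1 - a - b) z\<close> is the value with one more
  draw.\<close>

lemma best_value_average:
  assumes "Top \<subseteq> {..<n}" "Bad \<subseteq> {..<n}" "Top \<inter> Bad = {}"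
  shows "best_value Top Bad (Suc r) st i \<le>
    (\<Sum>x<n. if x \<in> Bad \<or> (st \<and> i \<in> Bad) then 0 else if st \<and> i \<in> Top then best_value Top Bad r True i
       else best_value Top Bad r True x) / n"
proof -
  define a b where "a = card Top / real n" and "b = card Bad / real n"
  define y z where "y = (1 - b) ^ r" and "z = (1 - a - b) ^ r"
  have fin: "finite Top" "finite Bad" using assms(1,2) by (auto intro: finite_subset)
  have cT: "real (card Top) = a * n" and cB: "real (card Bad) = b * n" using n1 by (auto simp: a_def b_def)
  have cR: "real (card ({..<n} - Top - Bad)) = (1 - a - b) * n"
  proof -
    have "card ({..<n} - Top - Bad) = card {..<n} - card Top - card Bad"
      using assms fin by (subst card_Diff_subset; (subst card_Diff_subset)?) auto
    moreover have "card Top + card Bad \<le> n"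
      using card_Un_disjoint[OF fin assms(3)] card_mono[of "{..<n}" "Top \<union> Bad"] assms by simp
    ultimately have "real (card ({..<n} - Top - Bad)) = real n - card Top - card Bad" by simp
    then show ?thesis using cT cB by (simp add: algebra_simps)
  qed
  have cNB: "real (card ({..<n} - Bad)) = (1 - b) * n"
  proof -
    have "card ({..<n} - Bad) = n - card Bad" "card Bad \<le> n"
      using assms fin card_mono[of "{..<n}" Bad] by (auto simp: card_Diff_subset)
    then show ?thesis using cB by (simp add: algebra_simps of_nat_diff)
  qed
  have sumA: "(\<Sum>x<n. if x \<in> A then c else 0) = card A * c" if "A \<subseteq> {..<n}" for A and c :: real
    using that by (simp add: sum.If_cases Int_absorb1)
  consider (bad) "st" "i \<in> Bad" | (top) "st" "i \<in> Top" "i \<notin> Bad" | (rest) "\<not> (st \<and> i \<in> Bad)" "\<not> (st \<and> i \<in> Top)"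
    by blast
  then show ?thesis
  proof cases
    case bad
    then have "i \<notin> Top" using assms by auto
    then show ?thesis using bad by (simp add: best_value_def)
  next
    case top
    have "(\<Sum>x<n. if x \<in> Bad \<or> (st \<and> i \<in> Bad) then 0 else if st \<and> i \<in> Top then best_value Top Bad r True i
       else best_value Top Bad r True x) = (\<Sum>x<n. if x \<in> {..<n} - Bad then y else 0)"
      using top by (intro sum.cong) (auto simp: best_value_def Let_def y_def b_def)
    also have "\<dots> = (1 - b) * n * y" by (subst sumA) (auto simp: cNB)
    finally have eq: "(\<Sum>x<n. if x \<in> Bad \<or> (st \<and> i \<in> Bad) then 0 else if st \<and> i \<in> Top then best_value Top Bad r True i
       else best_value Top Bad r True x) = (1 - b) * n * y" .
    have lhs: "best_value Top Bad (Suc r) st i = (1 - b) * y"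
      using top by (auto simp: best_value_def Let_def y_def b_def)
    show ?thesis unfolding eq lhs using n1 by simp
  next
    case rest
    have "(\<Sum>x<n. if x \<in> Bad \<or> (st \<and> i \<in> Bad) then 0 else if st \<and> i \<in> Top then best_value Top Bad r True i
       else best_value Top Bad r True x)
      = (\<Sum>x<n. (if x \<in> Top then y else 0) + (if x \<in> {..<n} - Top - Bad then y - z else 0))"
      using rest assms(3) by (intro sum.cong) (auto simp: best_value_def Let_def y_def z_def a_def b_def)
    also have "\<dots> = a * n * y + (1 - a - b) * n * (y - z)"
      unfolding sum.distrib
      by (subst sumA[OF assms(1)], subst sumA) (auto simp: cT cR)
    also have "\<dots> = n * ((1 - b) * y - (1 - a - b) * z)" by (simp add: algebra_simps)
    finally have eq: "(\<Sum>x<n. if x \<in> Bad \<or> (st \<and> i \<in> Bad) then 0 else if st \<and> i \<in> Top then best_value Top Bad r True i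
       else best_value Top Bad r True x) = n * ((1 - b) * y - (1 - a - b) * z)" .
    have lhs: "best_value Top Bad (Suc r) st i = (1 - b) * y - (1 - a - b) * z"
      using rest by (auto simp: best_value_def Let_def y_def z_def a_def b_def)
    show ?thesis unfolding eq lhs using n1 by simp
  qed
qed

definition draws :: "vst \<Rightarrow> nat" where "draws s = nat \<lceil>1 / vr s 8\<rceil>"

definition far_time :: "nat \<Rightarrow> nat \<Rightarrow> nat" where
  "far_time m K = (6 * m + 20) * m + (6 * m + 20) * (K + 1)"

text \<open>A point of \<open>Top\<close> is farther out than every point outside \<open>Top\<close>
  and \<open>Bad\<close>. So once \<open>Top\<close> has been drawn, the record leaves it only if a
  point of \<open>Bad\<close> shows up, and such runs have value 0.\<close>

lemma far_spec:
  fixes s :: vst and Top Bad :: "nat set"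
  defines "W \<equiv> span (fP s ` {1..vn s 2})"
  defines "h \<equiv> \<lambda>i. norm (perp W (pts i - fP s 0))"
  assumes c: "consts_ok s" and s8: "0 < vr s 8"
    and TB: "Top \<subseteq> {..<n}" "Bad \<subseteq> {..<n}" "Top \<inter> Bad = {}"
    and top: "\<And>i k. i \<in> Top \<Longrightarrow> k < n \<Longrightarrow> k \<notin> Top \<Longrightarrow> k \<notin> Bad \<Longrightarrow> h k < h i"
  shows "J far_cmd s (far_time (vn s 2) (draws s))
    (\<lambda>s'. same {12..19} {9, 10, 11, 14} Eslots s s' \<and> vn s' 17 < n \<and> vv s' 5 = perp W (pts (vn s' 17) - fP s 0))
    (\<lambda>s'. if vn s' 17 \<in> Top then 1 else 0) (best_value Top Bad (draws s) False 0)"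
proof -
  let ?m = "vn s 2" and ?K = "draws s" and ?x = "vr s 8"
  have Kless: "real k * ?x < 1 \<longleftrightarrow> k < ?K" for k
  proof -
    have "real k * ?x < 1 \<longleftrightarrow> real k < 1 / ?x" using s8 by (simp add: field_simps)
    also have "\<dots> \<longleftrightarrow> k < ?K" unfolding draws_def by (simp add: zless_nat_eq_int_zless less_ceiling_iff)
    finally show ?thesis .
  qed
  have K0: "0 < ?K" using Kless[of 0] by simp
  define P where "P s' \<longleftrightarrow> same {12..19} {9, 10, 11, 14} Eslots s s' \<and> consts_ok s' \<and>
    ons (fE s') (vn s' 14) \<and> span (fE s' ` {1..vn s' 14}) = W \<and> vn s' 14 \<le> ?m" for s'
  have P_same: "P s''" if "P s'" "same {15, 16, 17, 19} {9, 10, 14} {5} s' s''" for s' s''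
  proof -
    have "fE s'' i = fE s' i" for i
    proof -
      have "8 * i \<noteq> (5::nat)" by presburger
      then show ?thesis using that(2) by (simp add: same_def fE_def)
    qed
    then have E: "fE s'' = fE s'" by auto
    have e: "vn s'' 14 = vn s' 14" using that(2) by (simp add: same_def)
    have "consts_ok s''" by (rule consts_ok_same[OF _ that(2)]) (use that in \<open>auto simp: P_def\<close>)
    moreover have "same {12..19} {9, 10, 11, 14} Eslots s s''"
      by (rule same_trans[OF _ that(2)]) (use that in \<open>auto simp: P_def Eslots_mem\<close>)
    ultimately show ?thesis using that(1) E e by (simp add: P_def)
  qed
  have P0: "fP s' 0 = fP s 0" if "P s'" for s'
    using that Eslots_mem(9) by (simp add: P_def same_def fP_def)
  have res: "tot (res_cmd a) s' (6 * ?m + 5) (\<lambda>s''. same {15} {10} {5} s' s'' \<and>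
      vv s'' 5 = perp W (pts (vn s' a) - fP s 0))" if "P s'" for s' a
    using res_spec[of s' ?m a] that P0[OF that] by (simp add: P_def)
  define I where "I k s' \<longleftrightarrow> P s' \<and> vr s' 14 = real k * ?x \<and> vn s' 19 = k \<and>
    (k = 0 \<longrightarrow> vr s' 9 = -1) \<and> (0 < k \<longrightarrow> vn s' 17 < n \<and> vr s' 9 = (h (vn s' 17))\<^sup>2)" for k s'
  define v where "v k s' = best_value Top Bad (?K - k) (0 < k) (vn s' 17)" for k and s' :: vst
  have gs1: "tot (blk [BNOp NPlus 12 2 4]) s 1 (\<lambda>s'. same {12} {} {} s s' \<and> vn s' 12 = ?m)"
    by (rule J_ops) (use c in \<open>auto simp: same_def consts_ok_def One_nat_def\<close>)
  have gs2: "tot gs_cmd s1 ((6 * ?m + 20) * ?m + 4) P" if s1: "same {12} {} {} s s1 \<and> vn s1 12 = ?m" for s1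
  proof -
    have c1: "consts_ok s1" by (rule consts_ok_same[OF c conjunct1[OF s1]]) auto
    have fP1: "fP s1 = fP s" using s1 by (auto simp: same_def fP_def)
    show ?thesis
    proof (rule J_conseq[OF gs_spec[OF c1, of ?m]])
      show "vn s1 12 \<le> ?m" using s1 by simp
      fix s2 assume s2: "same {13, 14, 15} {10, 11} Eslots s1 s2 \<and>
        ons (fE s2) (vn s2 14) \<and> span (fE s2 ` {1..vn s2 14}) = span (fP s1 ` {1..vn s1 12}) \<and> vn s2 14 \<le> ?m \<and>
        (\<forall>i\<le>vn s1 12. \<exists>l\<le>i. l \<le> vn s2 14 \<and> span (fE s2 ` {1..l}) = span (fP s1 ` {1..i}))"
      have "consts_ok s2" by (rule consts_ok_same[OF c1 conjunct1[OF s2]]) (auto simp: Eslots_mem)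
      moreover have "same {12..19} {9, 10, 11, 14} Eslots s s2"
        by (rule same_trans[OF conjunct1[OF s1] conjunct1[OF s2]]) auto
      ultimately show "P s2" using s2 s1 fP1 by (simp add: P_def W_def)
    qed auto
  qed
  have start: "tot (blk [BROp RMinus 9 5 6, BNat 19 0, BROf 14 4]) s1 3 (I 0)" if P: "P s1" for s1
  proof (rule J_ops)
    let ?s = "ops [BROp RMinus 9 5 6, BNat 19 0, BROf 14 4] s1"
    have c1: "consts_ok s1" using P by (simp add: P_def)
    have "P ?s" by (rule P_same[OF P]) (auto simp: same_def)
    then show "I 0 ?s" using c1 unfolding I_def by (simp add: consts_ok_def)
  qed auto
  define rest_cmd where "rest_cmd = res_cmd 16 ;; blk [BDot 10 sT sT] ;;
     IfR 9 10 (blk [BROp RPlus 9 10 5, BNOp NPlus 17 16 4]) ;;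
     blk [BNOp NPlus 19 19 5, BROf 14 19, BROp RTimes 14 14 8]"
  have rest: "tot rest_cmd s1 (6 * ?m + 14) (\<lambda>s'. I (Suc k) s' \<and>
      vn s' 17 = (if k = 0 \<or> h (vn s0 17) < h x then x else vn s0 17))"
    if k: "k < ?K" and I: "I k s0" and x: "x < n" and s1: "s1 = s0\<lparr>vn := (vn s0)(16 := x)\<rparr>" for k s0 s1 x
  proof -
    have P1: "P s1" by (rule P_same[of s0]) (use I in \<open>auto simp: I_def s1 same_def\<close>)
    define Q1 where "Q1 s' \<longleftrightarrow> P s' \<and> vr s' 14 = real k * ?x \<and> vn s' 19 = k \<and> vn s' 16 = x \<and>
      vn s' 17 = vn s0 17 \<and> vr s' 9 = vr s0 9" for s'
    have Q1s1: "Q1 s1" using P1 I by (simp add: Q1_def I_def s1)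
    have Q1_same: "Q1 s''" if "Q1 s'" "same {15} {10} {5} s' s''" for s' s''
    proof -
      have "P s''" by (rule P_same[of s']) (use that in \<open>auto simp: Q1_def same_def\<close>)
      then show ?thesis using that by (simp add: Q1_def same_def)
    qed
    have 1: "tot (res_cmd 16) s1 (6 * ?m + 5) (\<lambda>s'. Q1 s' \<and> vv s' 5 = perp W (pts x - fP s 0))"
      by (rule J_conseq[OF res[OF P1, of 16]]) (use Q1_same[OF Q1s1] in \<open>auto simp: s1\<close>)
    have 2: "tot (blk [BDot 10 sT sT]) s2 1 (\<lambda>s'. Q1 s' \<and> vr s' 10 = (h x)\<^sup>2)"
      if "Q1 s2 \<and> vv s2 5 = perp W (pts x - fP s 0)" for s2
    proof (rule J_ops)
      have "Q1 (ops [BDot 10 sT sT] s2)" by (rule Q1_same[of s2]) (use that in \<open>auto simp: same_def\<close>)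
      then show "Q1 (ops [BDot 10 sT sT] s2) \<and> vr (ops [BDot 10 sT sT] s2) 10 = (h x)\<^sup>2"
        using that by (simp add: h_def power2_norm_eq_inner)
    qed (auto simp: One_nat_def)
    let ?nb = "if k = 0 \<or> h (vn s0 17) < h x then x else vn s0 17"
    define Q3 where "Q3 s' \<longleftrightarrow> P s' \<and> vn s' 19 = k \<and> vn s' 17 = ?nb \<and> vr s' 9 = (h ?nb)\<^sup>2" for s'
    have h0: "0 \<le> h i" for i by (simp add: h_def)
    have test: "vr s0 9 < (h x)\<^sup>2 \<longleftrightarrow> k = 0 \<or> h (vn s0 17) < h x"
    proof (cases "k = 0")
      case True
      then have "vr s0 9 = -1" using I by (simp add: I_def)
      then show ?thesis using True zero_le_power2[of "h x"] by linarith
    next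
      case False
      then have "vr s0 9 = (h (vn s0 17))\<^sup>2" using I by (simp add: I_def)
      then show ?thesis using False h0 power_strict_mono[of "h (vn s0 17)" "h x" 2]
          power2_less_imp_less[of "h (vn s0 17)" "h x"] by auto
    qed
    have 3: "tot (IfR 9 10 (blk [BROp RPlus 9 10 5, BNOp NPlus 17 16 4])) s3 (2 + 2) Q3"
      if Q: "Q1 s3 \<and> vr s3 10 = (h x)\<^sup>2" for s3
    proof (rule J_ifR)
      have c3: "consts_ok s3" using Q by (simp add: Q1_def P_def)
      assume "vr s3 9 < vr s3 10"
      then have nb: "?nb = x" using Q test by (simp add: Q1_def)
      show "tot (blk [BROp RPlus 9 10 5, BNOp NPlus 17 16 4]) s3 2 Q3"
      proof (rule J_ops)
        let ?s = "ops [BROp RPlus 9 10 5, BNOp NPlus 17 16 4] s3"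
        have "P ?s" by (rule P_same[of s3]) (use Q in \<open>auto simp: Q1_def same_def\<close>)
        then show "Q3 ?s" unfolding Q3_def nb using Q c3 by (simp add: Q1_def consts_ok_def)
      qed auto
    next
      assume "\<not> vr s3 9 < vr s3 10"
      then have nt: "\<not> (k = 0 \<or> h (vn s0 17) < h x)" using Q test by (simp add: Q1_def)
      then have nb: "?nb = vn s0 17" by simp
      have "vr s0 9 = (h (vn s0 17))\<^sup>2" using I nt by (simp add: I_def)
      then show "Q3 s3 \<and> (0::real) \<le> 0" unfolding Q3_def nb using Q by (simp add: Q1_def)
    qed
    have 4: "tot (blk [BNOp NPlus 19 19 5, BROf 14 19, BROp RTimes 14 14 8]) s4 3
        (\<lambda>s'. I (Suc k) s' \<and> vn s' 17 = ?nb)" if Q: "Q3 s4" for s4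
    proof (rule J_ops)
      define s5 where "s5 = ops [BNOp NPlus 19 19 5, BROf 14 19, BROp RTimes 14 14 8] s4"
      have c4: "consts_ok s4" and x4: "vr s4 8 = ?x" using Q by (auto simp: Q3_def P_def same_def)
      have Ps: "P s5" by (rule P_same[of s4]) (use Q in \<open>auto simp: Q3_def same_def s5_def\<close>)
      have nbn: "?nb < n" using x I by (auto simp: I_def)
      have e: "vr s5 14 = real (Suc k) * ?x" "vn s5 19 = Suc k" "vn s5 17 = ?nb" "vr s5 9 = (h ?nb)\<^sup>2"
        using Q c4 x4 by (simp_all add: Q3_def consts_ok_def s5_def)
      have "I (Suc k) s5 \<and> vn s5 17 = ?nb" unfolding I_def using Ps e nbn by simp
      then show "I (Suc k) (ops [BNOp NPlus 19 19 5, BROf 14 19, BROp RTimes 14 14 8] s4) \<and>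
          vn (ops [BNOp NPlus 19 19 5, BROf 14 19, BROp RTimes 14 14 8] s4) 17 = ?nb" by (simp only: s5_def)
    qed auto
    have "tot rest_cmd s1 (6 * ?m + 5 + (1 + (2 + 2 + 3))) (\<lambda>s'. I (Suc k) s' \<and> vn s' 17 = ?nb)"
      unfolding rest_cmd_def by (rule J_seq_tot[OF 1 J_seq_tot[OF 2 J_seq_tot[OF 3 4]]])
    then show ?thesis by (rule J_conseq) auto
  qed
  have draw: "J draw_cmd s0 (6 * ?m + 15) (I (Suc k)) (v (Suc k)) (v k s0)" if k: "k < ?K" and I: "I k s0" for k s0
  proof -
    define r where "r = ?K - Suc k"
    have Kr: "?K - k = Suc r" using k by (simp add: r_def)
    let ?i = "vn s0 17" and ?st = "0 < k"
    define g where "g x = (if x \<in> Bad \<or> (?st \<and> ?i \<in> Bad) then 0 else if ?st \<and> ?i \<in> Top then best_value Top Bad r True ?i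
       else best_value Top Bad r True x)" for x
    have g0: "0 \<le> g x" for x using best_value_mono(2)[OF TB] by (simp add: g_def)
    have vg: "g x \<le> best_value Top Bad r True (if k = 0 \<or> h ?i < h x then x else ?i)" (is "_ \<le> best_value _ _ _ _ ?nb")
      if x: "x < n" for x
    proof -
      have in': "?st \<Longrightarrow> ?i < n" using I by (simp add: I_def)
      consider (zero) "x \<in> Bad \<or> (?st \<and> ?i \<in> Bad)"
        | (top) "\<not> (x \<in> Bad \<or> (?st \<and> ?i \<in> Bad))" "?st \<and> ?i \<in> Top"
        | (rest) "\<not> (x \<in> Bad \<or> (?st \<and> ?i \<in> Bad))" "\<not> (?st \<and> ?i \<in> Top)" by blast
      then show ?thesis
      proof cases
        case zero
        then show ?thesis using best_value_mono(2)[OF TB] by (simp add: g_def)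
      next
        case top
        then have "?nb \<in> Top" using assms(8)[of ?i x] x by (cases "x \<in> Top") auto
        then show ?thesis using top by (simp add: g_def best_value_def)
      next
        case rest
        have gx: "g x = best_value Top Bad r True x" using rest by (auto simp: g_def)
        show ?thesis
        proof (cases "x \<in> Top")
          case True
          then have "?nb = x" using assms(8)[OF True, of ?i] rest in' by auto
          then show ?thesis using gx by simp
        next
          case False
          have "?nb \<notin> Bad" using rest by auto
          then show ?thesis unfolding gx using False by (intro best_value_mono(3)[OF TB]) auto
        qed
      qed
    qed
    have 1: "J (Bas (BSmp 16)) s0 1 (\<lambda>s'. \<exists>x<n. s' = s0\<lparr>vn := (vn s0)(16 := x)\<rparr>) (\<lambda>s'. g (vn s' 16)) (v k s0)"
    proof (rule J_smp[where g = g])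
      show "v k s0 \<le> (\<Sum>i<n. g i) / n"
        unfolding v_def Kr g_def by (rule best_value_average[OF TB])
    qed (use g0 in auto)
    have 2: "J rest_cmd s1 (6 * ?m + 14) (I (Suc k)) (v (Suc k)) (g (vn s1 16))"
      if ex: "\<exists>x<n. s1 = s0\<lparr>vn := (vn s0)(16 := x)\<rparr>" for s1
    proof -
      obtain x where x: "x < n" "s1 = s0\<lparr>vn := (vn s0)(16 := x)\<rparr>" using ex by blast
      have gx: "vn s1 16 = x" using x by simp
      have "J rest_cmd s1 (6 * ?m + 14) (\<lambda>s'. I (Suc k) s' \<and> vn s' 17 = (if k = 0 \<or> h ?i < h x then x else ?i))
        (v (Suc k)) (g (vn s1 16))"
        by (rule J_const[OF rest[OF k I x]])
          (use vg[OF x(1)] gx in \<open>simp add: v_def r_def\<close>)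
      then show ?thesis by (rule J_conseq) auto
    qed
    have "J draw_cmd s0 (1 + (6 * ?m + 14)) (I (Suc k)) (v (Suc k)) (v k s0)"
      using J_seq[OF 1 2] by (simp add: draw_cmd_def rest_cmd_def)
    then show ?thesis by (rule J_conseq) auto
  qed
  have loop: "J (WhileR 14 6 draw_cmd) s1 (?K * (6 * ?m + 15 + 2) + 2) (I ?K)
      (\<lambda>s'. if vn s' 17 \<in> Top then 1 else 0) (best_value Top Bad ?K False 0)" if "I 0 s1" for s1
  proof (rule J_whileR[where I = I and v = v and K = ?K])
    show "v 0 s1 = best_value Top Bad ?K False 0" by (simp add: v_def best_value_def)
    have test: "vr s' 14 < vr s' 6 \<longleftrightarrow> k < ?K" if "I k s'" for k s'
      using that Kless[of k] by (auto simp: I_def P_def consts_ok_def)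
    show "J draw_cmd s' (6 * ?m + 15) (I (Suc k)) (v (Suc k)) (v k s')"
      if "k < ?K" "I k s'" for k s' by (rule draw[OF that])
    show "\<not> vr s' 14 < vr s' 6" if "I ?K s'" for s' using test[OF that] by simp
    show "I ?K s' \<and> v k s' \<le> (if vn s' 17 \<in> Top then 1 else 0)"
      if "k \<le> ?K" "I k s'" "\<not> vr s' 14 < vr s' 6" for k s'
    proof -
      have "k = ?K" using that test[of k s'] by simp
      then show ?thesis using that K0 by (auto simp: v_def best_value_def Let_def)
    qed
  qed (rule that)
  define Q where "Q s' \<longleftrightarrow> same {12..19} {9, 10, 11, 14} Eslots s s' \<and> vn s' 17 < n \<and>
    vv s' 5 = perp W (pts (vn s' 17) - fP s 0)" for s'
  have fin: "J (res_cmd 17) s2 (6 * ?m + 5) Q (\<lambda>s'. if vn s' 17 \<in> Top then 1 else 0)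
      (if vn s2 17 \<in> Top then 1 else 0)" if I: "I ?K s2" for s2
  proof -
    have P2: "P s2" and n2: "vn s2 17 < n" using I K0 by (auto simp: I_def)
    have "tot (res_cmd 17) s2 (6 * ?m + 5) (\<lambda>s'. Q s' \<and> vn s' 17 = vn s2 17)"
    proof (rule J_conseq[OF res[OF P2, of 17]])
      fix s' assume s': "same {15} {10} {5} s2 s' \<and> vv s' 5 = perp W (pts (vn s2 17) - fP s 0)"
      have "P s'" by (rule P_same[OF P2]) (use s' in \<open>auto simp: same_def\<close>)
      then show "Q s' \<and> vn s' 17 = vn s2 17" using s' n2 by (simp add: P_def Q_def same_def)
    qed auto
    then have "J (res_cmd 17) s2 (6 * ?m + 5) (\<lambda>s'. Q s' \<and> vn s' 17 = vn s2 17) (\<lambda>s'. if vn s' 17 \<in> Top then 1 else 0)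
      (if vn s2 17 \<in> Top then 1 else 0)" by (rule J_const) auto
    then show ?thesis by (rule J_conseq) auto
  qed
  have A: "J (blk [BROp RMinus 9 5 6, BNat 19 0, BROf 14 4] ;; WhileR 14 6 draw_cmd ;; res_cmd 17) s1
      (3 + ((?K * (6 * ?m + 15 + 2) + 2) + (6 * ?m + 5))) Q (\<lambda>s'. if vn s' 17 \<in> Top then 1 else 0)
      (best_value Top Bad ?K False 0)" if "P s1" for s1
    by (rule J_seq_tot[OF start[OF that] J_seq[OF loop fin]])
  have "J far_cmd s (1 + (((6 * ?m + 20) * ?m + 4) + (3 + ((?K * (6 * ?m + 15 + 2) + 2) + (6 * ?m + 5))))) Q
      (\<lambda>s'. if vn s' 17 \<in> Top then 1 else 0) (best_value Top Bad ?K False 0)"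
    unfolding far_cmd_def by (rule J_seq_tot[OF gs1 J_seq_tot[OF gs2 A]])
  then show ?thesis unfolding Q_def
    by (rule J_conseq) (auto simp: far_time_def algebra_simps)
qed

end

text \<open>The mean value estimate for \<open>x ^ Suc k\<close>, whose derivative between
  \<open>v\<close> and \<open>u\<close> is smallest at \<open>v\<close>.\<close>

lemma power_diff_ge:
  fixes u v :: real
  assumes "0 \<le> v" "v \<le> u"
  shows "real (Suc k) * (u - v) * v ^ k \<le> u ^ Suc k - v ^ Suc k"
proof (induction k)
  case (Suc k)
  have "v * (real (Suc k) * (u - v) * v ^ k) \<le> u * (u ^ Suc k - v ^ Suc k)"
    using Suc assms by (intro mult_mono) auto
  then have "v * (real (Suc k) * (u - v) * v ^ k) + (u - v) * v ^ Suc k \<le> u ^ Suc (Suc k) - v ^ Suc (Suc k)"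
    by (simp add: algebra_simps)
  then show ?case by (simp add: algebra_simps)
qed auto

section \<open>Probabilities of samples and coin tosses; the output\<close>

context vprog
begin

text \<open>With \<open>Suc k\<close> draws, the ceiling of \<open>1 / (2 * x)\<close>, the mean
  value estimate yields \<open>Suc k * y * (1 - b - y) ^ k\<close>. The first factor is at least
  \<open>1 / (2 * x)\<close>, and by Bernoulli the last one is at least \<open>1 / 2\<close>, since
  \<open>k * x\<close> is at most \<open>1 / 2\<close>. This explains the number of draws and the 4
  in \<open>pf\<close>.\<close>

lemma best_value_ge:
  fixes x y :: real
  assumes TB: "Top \<subseteq> {..<n}" "Bad \<subseteq> {..<n}" "Top \<inter> Bad = {}"
    and x: "0 < x" "x < 1" and y: "0 < y" and top: "y * n \<le> card Top" and bad: "card Bad \<le> (x - y) * n"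
  shows "y / (4 * x) \<le> best_value Top Bad (nat \<lceil>1 / (2 * x)\<rceil>) False i"
proof -
  define a b where "a = card Top / real n" and "b = card Bad / real n"
  have a: "y \<le> a" using top n1 by (simp add: a_def field_simps)
  have b: "b \<le> x - y" using bad n1 by (simp add: b_def field_simps)
  have ab: "0 \<le> 1 - a - b" unfolding a_def b_def by (rule best_value_mono(1)[OF TB])
  obtain k where k: "nat \<lceil>1 / (2 * x)\<rceil> = Suc k" using x(1) by (cases "nat \<lceil>1 / (2 * x)\<rceil>") auto
  have K1: "1 / (2 * x) \<le> real (Suc k)" using k by linarith
  have K2: "real k < 1 / (2 * x)" using k by linarith
  have "(1 - a - b) ^ Suc k \<le> (1 - b - y) ^ Suc k" using ab a by (intro power_mono) auto
  moreover have "real (Suc k) * y * (1 - b - y) ^ k \<le> (1 - b) ^ Suc k - (1 - b - y) ^ Suc k"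
    using power_diff_ge[of "1 - b - y" "1 - b" k] b x y by simp
  ultimately have 1: "real (Suc k) * y * (1 - b - y) ^ k \<le> (1 - b) ^ Suc k - (1 - a - b) ^ Suc k" by linarith
  have "real k * x \<le> 1 / 2" using K2 x(1) by (simp add: field_simps)
  then have "1 / 2 \<le> 1 + real k * (- x)" by simp
  also have "\<dots> \<le> (1 + (- x)) ^ k" by (rule Bernoulli_inequality) (use x in auto)
  also have "\<dots> \<le> (1 - b - y) ^ k" using b x by (intro power_mono) auto
  finally have 2: "1 / 2 \<le> (1 - b - y) ^ k" .
  have "1 / (2 * x) * y * (1 / 2) \<le> real (Suc k) * y * (1 - b - y) ^ k"
    using K1 2 y x by (intro mult_mono) auto
  then show ?thesis using 1 unfolding k best_value_def a_def b_def by (simp add: Let_def)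
qed

text \<open>Which outcome is the right one depends on the state and is known to the analysis only.
  The disjunction allows it to count a single outcome; its last case is for states that are already
  lost. The factors differ because an odd number of indices does not split evenly, and for
  \<open>n = 1\<close> the second outcome is impossible.\<close>

lemma coin_J:
  assumes 3: "vn s 3 = n"
    and \<alpha>: "\<And>s'. same {18} {} {} s s' \<Longrightarrow> vn s' 18 < vn s' 3 \<Longrightarrow> \<alpha> \<le> f s'"
    and \<beta>: "\<And>s'. same {18} {} {} s s' \<Longrightarrow> \<not> vn s' 18 < vn s' 3 \<Longrightarrow> \<beta> \<le> f s'"
    and nn: "0 \<le> \<alpha>" "0 \<le> \<beta>"
    and p: "p \<le> \<alpha> / 2 \<or> (2 \<le> n \<and> p \<le> \<beta> / 3) \<or> p \<le> 0"
  shows "J coin s 2 (same {18} {} {} s) f p"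
proof -
  define g where "g i = (if 2 * i < n then \<alpha> else \<beta>)" for i :: nat
  \<comment> \<open>The number of indices with \<open>2 * i < n\<close>.\<close>
  let ?h = "(n + 1) div 2"
  have "(\<Sum>i<n. g i) = (\<Sum>i\<in>{..<?h} \<union> {?h..<n}. g i)"
    using n1 by (intro sum.cong) auto
  also have "\<dots> = (\<Sum>i<?h. g i) + (\<Sum>i\<in>{?h..<n}. g i)" by (rule sum.union_disjoint) auto
  also have "(\<Sum>i<?h. g i) = (\<Sum>i<?h. \<alpha>)" by (intro sum.cong) (auto simp: g_def)
  also have "(\<Sum>i\<in>{?h..<n}. g i) = (\<Sum>i\<in>{?h..<n}. \<beta>)" by (intro sum.cong) (auto simp: g_def)
  finally have sum: "(\<Sum>i<n. g i) = ?h * \<alpha> + (n - ?h) * \<beta>" by simp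
  have h1: "real n / 2 \<le> real ?h" by linarith
  have h2: "real n / 3 \<le> real (n - ?h)" if "2 \<le> n"
  proof -
    have "2 * ?h \<le> n + 1" by simp
    then have "n \<le> 3 * (n - ?h)" using that by (cases "n = 2") auto
    then show ?thesis by linarith
  qed
  have pg: "p \<le> (\<Sum>i<n. g i) / n"
  proof -
    have g0: "0 \<le> real ?h * \<alpha>" "0 \<le> real (n - ?h) * \<beta>" using nn by auto
    consider "p \<le> \<alpha> / 2" | "2 \<le> n" "p \<le> \<beta> / 3" | "p \<le> 0" using p by blast
    then have "p * n \<le> (\<Sum>i<n. g i)"
    proof cases
      case 1
      have "p * n \<le> \<alpha> / 2 * n" using 1 by (intro mult_right_mono) auto
      also have "\<dots> = real n / 2 * \<alpha>" by simp
      also have "\<dots> \<le> real ?h * \<alpha>" using h1 nn by (intro mult_right_mono) auto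
      finally show ?thesis using g0 by (simp add: sum)
    next
      case 2
      have "p * n \<le> \<beta> / 3 * n" using 2 by (intro mult_right_mono) auto
      also have "\<dots> = real n / 3 * \<beta>" by simp
      also have "\<dots> \<le> real (n - ?h) * \<beta>" using h2[OF 2(1)] nn by (intro mult_right_mono) auto
      finally show ?thesis using g0 by (simp add: sum)
    next
      case 3
      then have "p * n \<le> 0" by (intro mult_nonpos_nonneg) auto
      then show ?thesis using g0 by (simp add: sum)
    qed
    then show ?thesis using n1 by (simp add: le_divide_eq)
  qed
  have 1: "J (Bas (BSmp 18)) s 1 (\<lambda>s'. \<exists>i<n. s' = s\<lparr>vn := (vn s)(18 := i)\<rparr>) (\<lambda>s'. g (vn s' 18)) p"
    by (rule J_smp[where g = g]) (use pg nn in \<open>auto simp: g_def\<close>)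
  have 2: "J (blk [BNOp NPlus 18 18 18]) s1 1 (same {18} {} {} s) f (g (vn s1 18))"
    if ex: "\<exists>i<n. s1 = s\<lparr>vn := (vn s)(18 := i)\<rparr>" for s1
  proof (rule J_ops)
    obtain i where i: "i < n" "s1 = s\<lparr>vn := (vn s)(18 := i)\<rparr>" using ex by blast
    let ?s = "ops [BNOp NPlus 18 18 18] s1"
    show sm: "same {18} {} {} s ?s" by (auto simp: i same_def)
    have e: "vn ?s 18 = 2 * i" "vn ?s 3 = n" using 3 by (auto simp: i)
    have "g i \<le> f ?s" using \<alpha>[OF sm] \<beta>[OF sm] unfolding e g_def by auto
    then show "g (vn s1 18) \<le> f ?s" by (simp add: i)
  qed (auto simp: One_nat_def)
  have "J coin s (1 + 1) (same {18} {} {} s) f p" unfolding coin_def by (rule J_seq[OF 1 2])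
  then show ?thesis by (rule J_conseq) auto
qed

text \<open>The unit vectors behind the frame are \<open>j\<close> independent vectors in the span,
  so orthonormalisation produces at least \<open>j\<close> vectors. By the prefix clause of
  \<open>gs_spec\<close>, the first at most \<open>j\<close> of them span the frame directions.
  Hence the first \<open>j\<close> are a valid output: a larger direction space cannot increase
  distances.\<close>

lemma output_spec:
  fixes s :: vst
  defines "j \<equiv> vn s 2"
  assumes c: "consts_ok s" and dd: "vn s 1 = d" and units: "ons (\<lambda>i. fP s (j + i)) j"
  shows "tot output_cmd s (24 * j * j + 45 * j + 17) (\<lambda>s'. \<exists>E. ons E j \<and>
    span (fP s ` {1..j}) \<subseteq> span (E ` {1..j}) \<and> vn s' 0 = 128 + (16 * j + 16) * d \<and>
    vv s' (16 * j + 16) = fP s 0 \<and> (\<forall>i\<in>{1..j}. vv s' (16 * j + 16 + i) = E i))"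
proof -
  define P where "P s' \<longleftrightarrow> consts_ok s' \<and> vn s' 2 = j \<and> vn s' 1 = d \<and> fP s' 0 = fP s 0 \<and> ons (fE s') j \<and>
    span (fP s ` {1..j}) \<subseteq> span (fE s' ` {1..j})" for s'
  have 1: "tot (blk [BNOp NPlus 12 2 2]) s 1 (\<lambda>s'. same {12} {} {} s s' \<and> vn s' 12 = 2 * j)"
    by (rule J_ops) (auto simp: same_def j_def One_nat_def)
  have 2: "tot gs_cmd s1 ((6 * (2 * j) + 20) * (2 * j) + 4) P" if s1: "same {12} {} {} s s1 \<and> vn s1 12 = 2 * j" for s1
  proof -
    have c1: "consts_ok s1" by (rule consts_ok_same[OF c conjunct1[OF s1]]) auto
    have fP1: "fP s1 = fP s" using s1 by (auto simp: same_def fP_def)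
    show ?thesis
    proof (rule J_conseq[OF gs_spec[OF c1, of "2 * j"]])
      show "vn s1 12 \<le> 2 * j" using s1 by simp
      fix s2 assume s2: "same {13, 14, 15} {10, 11} Eslots s1 s2 \<and>
        ons (fE s2) (vn s2 14) \<and> span (fE s2 ` {1..vn s2 14}) = span (fP s1 ` {1..vn s1 12}) \<and> vn s2 14 \<le> 2 * j \<and>
        (\<forall>i\<le>vn s1 12. \<exists>l\<le>i. l \<le> vn s2 14 \<and> span (fE s2 ` {1..l}) = span (fP s1 ` {1..i}))"
      have on: "ons (fE s2) (vn s2 14)"
        and sp: "span (fE s2 ` {1..vn s2 14}) = span (fP s ` {1..2 * j})" using s2 s1 fP1 by auto
      have c2: "consts_ok s2" by (rule consts_ok_same[OF c1 conjunct1[OF s2]]) (auto simp: Eslots_mem)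
      have "j \<le> vn s2 14"
      proof -
        let ?u = "\<lambda>i. fP s (j + i)"
        have nz: "0 \<notin> ?u ` {1..j}"
        proof
          assume "0 \<in> ?u ` {1..j}"
          then obtain i where "i \<in> {1..j}" "?u i = 0" by auto
          then show False using ons_norm[OF units, of i] by simp
        qed
        have ind: "independent (?u ` {1..j})"
          by (rule pairwise_orthogonal_independent[OF _ nz])
            (use units in \<open>auto simp: pairwise_def ons_def real_inner_class.orthogonal_def\<close>)
        have inj: "inj_on ?u {1..j}"
        proof (rule inj_onI)
          fix i k assume ik: "i \<in> {1..j}" "k \<in> {1..j}" "?u i = ?u k"
          have "inner (?u i) (?u k) = (if i = k then 1 else 0)" using units ik(1,2) by (simp only: ons_def)
          moreover have "inner (?u i) (?u k) = 1" using units ik by (simp add: ons_def)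
          ultimately show "i = k" by (auto split: if_splits)
        qed
        have "?u ` {1..j} \<subseteq> span (fE s2 ` {1..vn s2 14})"
          unfolding sp by (auto intro!: span_base)
        then have "card (?u ` {1..j}) \<le> card (fE s2 ` {1..vn s2 14})"
          using independent_span_bound[OF _ ind] by blast
        also have "\<dots> \<le> vn s2 14" using card_image_le[of "{1..vn s2 14}" "fE s2"] by simp
        finally show ?thesis using card_image[OF inj] by simp
      qed
      then have onj: "ons (fE s2) j" using on by (auto simp: ons_def)
      obtain l where l: "l \<le> j" "span (fE s2 ` {1..l}) = span (fP s ` {1..j})"
        using s2 s1 fP1 by (auto dest!: spec[of _ j])
      have "span (fE s2 ` {1..l}) \<subseteq> span (fE s2 ` {1..j})" using l(1) by (intro span_mono image_mono) auto
      then have "span (fP s ` {1..j}) \<subseteq> span (fE s2 ` {1..j})" using l(2) by simp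
      moreover have "vn s2 2 = j" "vn s2 1 = d" "fP s2 0 = fP s 0"
        using s2 s1 dd Eslots_mem(9) by (auto simp: same_def j_def fP_def)
      ultimately show "P s2" using c2 onj by (simp add: P_def)
    qed auto
  qed
  define o' where "o' = 16 * j + 16"
  define I where "I E k s' \<longleftrightarrow> consts_ok s' \<and> vn s' 2 = j \<and> vn s' 1 = d \<and> vn s' 20 = k \<and> vn s' 22 = o' \<and>
    (\<forall>i\<in>{1..j}. fE s' i = E i) \<and> vv s' o' = fP s 0 \<and> (\<forall>i\<in>{1..k}. vv s' (o' + i) = E i)" for E k s'
  have 3: "tot (blk [BNat 23 16, BNOp NTimes 22 2 23, BNOp NPlus 22 22 23, BLin (1, 22, 0) 6 sP0 sZ, BNat 20 0]) s2 5
      (\<lambda>s'. \<exists>E. ons E j \<and> span (fP s ` {1..j}) \<subseteq> span (E ` {1..j}) \<and> I E 0 s')" if P: "P s2" for s2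
  proof (rule J_ops)
    let ?s = "ops [BNat 23 16, BNOp NTimes 22 2 23, BNOp NPlus 22 22 23, BLin (1, 22, 0) 6 sP0 sZ, BNat 20 0] s2"
    have f: "vn s2 2 = j" "vr s2 6 = 1" "vv s2 4 = 0" "vn s2 1 = d" "vv s2 1 = fP s 0" "consts_ok s2"
      using P by (auto simp: P_def consts_ok_def fP_def)
    have c3: "consts_ok ?s" using f by (auto simp: consts_ok_def)
    have E3: "fE ?s i = fE s2 i" if "i \<in> {1..j}" for i
    proof -
      have "8 * i \<noteq> 16 * j + 16" using that by auto
      then show ?thesis using f by (simp add: fE_def algebra_simps)
    qed
    have "I (fE s2) 0 ?s" unfolding I_def using c3 f E3
      by (simp add: o'_def algebra_simps)
    then show "\<exists>E. ons E j \<and> span (fP s ` {1..j}) \<subseteq> span (E ` {1..j}) \<and> I E 0 ?s"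
      using P by (auto simp: P_def)
  qed auto
  have 4: "tot (WhileN 20 2 (blk [BNOp NPlus 20 20 5, BNOp NPlus 23 22 20, BLin (1, 23, 0) 6 (sE 20) sZ])) s3
      (j * (3 + 2) + 2) (\<lambda>s'. \<exists>E. ons E j \<and> span (fP s ` {1..j}) \<subseteq> span (E ` {1..j}) \<and> I E j s')"
    if ex: "\<exists>E. ons E j \<and> span (fP s ` {1..j}) \<subseteq> span (E ` {1..j}) \<and> I E 0 s3" for s3
  proof -
    obtain E where E: "ons E j" "span (fP s ` {1..j}) \<subseteq> span (E ` {1..j})" "I E 0 s3" using ex by blast
    show ?thesis
    proof (rule J_whileN[where I = "I E" and v = "\<lambda>_ _. 0" and K = j])
      fix k s' assume k: "k < j" and I: "I E k s'"
      show "tot (blk [BNOp NPlus 20 20 5, BNOp NPlus 23 22 20, BLin (1, 23, 0) 6 (sE 20) sZ]) s' 3 (I E (Suc k))"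
      proof (rule J_ops)
        define s4 where "s4 = ops [BNOp NPlus 20 20 5, BNOp NPlus 23 22 20, BLin (1, 23, 0) 6 (sE 20) sZ] s'"
        have f: "vn s' 20 = k" "vn s' 22 = o'" "vn s' 5 = 1" "vr s' 6 = 1" "vv s' 4 = 0" "vn s' 2 = j" "vn s' 1 = d"
          using I by (auto simp: I_def consts_ok_def)
        have new: "vv s' (8 * k + 8) = E (Suc k)"
        proof -
          have "fE s' (Suc k) = E (Suc k)" using I k by (simp add: I_def)
          then show ?thesis by (simp add: fE_def add.commute)
        qed
        have new2: "vv s' (8 + 8 * k) = E (Suc k)" using new by (simp add: add.commute)
        have v4: "vv s4 = (vv s')(o' + Suc k := E (Suc k))" "vn s4 20 = Suc k" "vn s4 22 = o'" "vn s4 2 = j" "vn s4 1 = d"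
          using f new new2 by (simp_all add: s4_def One_nat_def)
        have c4: "consts_ok s4"
        proof -
          have "vv s4 4 = 0" using f by (simp add: v4 o'_def)
          moreover have "vn s4 4 = vn s' 4" "vn s4 5 = vn s' 5" "vr s4 = vr s'" by (simp_all add: s4_def)
          ultimately show ?thesis using I by (simp add: I_def consts_ok_def)
        qed
        have E4: "fE s4 i = E i" if "i \<in> {1..j}" for i
        proof -
          have "8 * i \<noteq> o' + Suc k" using that k by (auto simp: o'_def)
          then show ?thesis using I that by (simp add: v4 fE_def I_def)
        qed
        have "\<forall>i\<in>{1..Suc k}. vv s4 (o' + i) = E i" using I by (auto simp: v4 I_def le_Suc_eq)
        moreover have "vv s4 o' = fP s 0" using I by (simp add: v4 I_def)
        ultimately have "I E (Suc k) s4" using c4 v4 E4 by (simp add: I_def)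
        then show "I E (Suc k) (ops [BNOp NPlus 20 20 5, BNOp NPlus 23 22 20, BLin (1, 23, 0) 6 (sE 20) sZ] s')"
          by (simp only: s4_def)
      qed auto
    next
      fix k s' assume "k \<le> j" "I E k s'" "\<not> vn s' 20 < vn s' 2"
      then have "I E j s'" by (auto simp: I_def)
      then show "(\<exists>E. ons E j \<and> span (fP s ` {1..j}) \<subseteq> span (E ` {1..j}) \<and> I E j s') \<and> (0::real) \<le> 0"
        using E by blast
    qed (use E in \<open>auto simp: I_def\<close>)
  qed
  let ?Q = "\<lambda>s'. \<exists>E. ons E j \<and>
    span (fP s ` {1..j}) \<subseteq> span (E ` {1..j}) \<and> vn s' 0 = 128 + (16 * j + 16) * d \<and>
    vv s' (16 * j + 16) = fP s 0 \<and> (\<forall>i\<in>{1..j}. vv s' (16 * j + 16 + i) = E i)"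
  have 5: "tot (blk [BNat 23 128, BNOp NTimes 0 22 1, BNOp NPlus 0 0 23]) s4 3 ?Q"
    if ex: "\<exists>E. ons E j \<and> span (fP s ` {1..j}) \<subseteq> span (E ` {1..j}) \<and> I E j s4" for s4
  proof (rule J_ops)
    obtain E where E: "ons E j" "span (fP s ` {1..j}) \<subseteq> span (E ` {1..j})" "I E j s4" using ex by blast
    show "?Q (ops [BNat 23 128, BNOp NTimes 0 22 1, BNOp NPlus 0 0 23] s4)"
      by (rule exI[of _ E]) (use E in \<open>auto simp: I_def o'_def\<close>)
  qed auto
  have "tot output_cmd s (1 + (((6 * (2 * j) + 20) * (2 * j) + 4) + (5 + ((j * (3 + 2) + 2) + 3)))) ?Q"
    unfolding output_cmd_def
    by (rule J_seq_tot[OF 1 J_seq_tot[OF 2 J_seq_tot[OF 3 J_seq_tot[OF 4 5]]]])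
  then show ?thesis by (rule J_conseq) (auto simp: algebra_simps)
qed

end

section \<open>Guessing coordinates and moving the frame\<close>

context vprog
begin

definition base :: "nat \<Rightarrow> nat \<Rightarrow> real \<Rightarrow> vst \<Rightarrow> bool" where
  "base j H x s \<longleftrightarrow> consts_ok s \<and> vn s 1 = d \<and> vn s 2 = j \<and> vn s 3 = n \<and> vn s 6 = H \<and> vn s 7 = 2 * H\<^sup>2 \<and>
     vr s 13 = 1 / H \<and> vr s 8 = x \<and> inner (vv s 7) (vv s 7) = 1 \<and> ons (\<lambda>i. fP s (j + i)) j"

lemma base_same:
  assumes "base j H x s" "same NS RS VS s s'" "{1, 2, 3, 4, 5, 6, 7} \<inter> NS = {}" "{5, 6, 7, 8, 13} \<inter> RS = {}"
    "4 \<notin> VS" "7 \<notin> VS" "\<And>i. i \<in> {1..j} \<Longrightarrow> 8 * (j + i) + 1 \<notin> VS"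
  shows "base j H x s'"
proof -
  have c: "consts_ok s'" by (rule consts_ok_same[OF _ assms(2)]) (use assms in \<open>auto simp: base_def\<close>)
  have N: "vn s' i = vn s i" if "i \<in> {1, 2, 3, 4, 5, 6, 7}" for i using that assms(2,3) by (auto simp: same_def)
  have R: "vr s' i = vr s i" if "i \<in> {5, 6, 7, 8, 13}" for i using that assms(2,4) by (auto simp: same_def)
  have V: "vv s' 7 = vv s 7" using assms by (auto simp: same_def)
  have P: "fP s' (j + i) = fP s (j + i)" if "i \<in> {1..j}" for i
    using assms(2) assms(7)[OF that] by (simp add: same_def fP_def)
  have "ons (\<lambda>i. fP s' (j + i)) j" using assms(1) P by (auto simp: base_def ons_def)
  then show ?thesis using assms(1) c N[of 1] N[of 2] N[of 3] N[of 6] N[of 7] R[of 13] R[of 8] V by (simp add: base_def)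
qed

text \<open>\<open>c\<close> is the number of increments wanted, which only the analysis knows. Of
  the toss sequences that lead there, only the one with \<open>c\<close> increments at the beginning
  and none afterwards is counted, each toss being right with probability at least
  \<open>1 / 3\<close>. \<open>G\<close> records whether the earlier guesses were right.\<close>

lemma guess_spec:
  assumes n3: "vn s 3 = n" and n5: "vn s 5 = 1" and n7: "vn s 7 = M" and c: "c \<le> M" and V: "0 \<le> V"
    and n21: "vn s 21 = 0"
  shows "J (WhileN 21 7 (coin ;; blk [BNOp NPlus 21 21 5] ;; IfN 18 3 (blk [BROp RPlus 16 16 17]))) s
    (M * 9 + 2) (\<lambda>s'. same {18, 21} {16} {} s s')
    (\<lambda>s'. if G \<and> vr s' 16 = vr s 16 + real c * vr s 17 then V else 0) (if G \<and> 2 \<le> n then (1/3) ^ M * V else 0)"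
proof -
  let ?b = "vr s 16" and ?st = "vr s 17"
  define I where "I m s' \<longleftrightarrow> same {18, 21} {16} {} s s' \<and> vn s' 21 = m" for m s'
  define w where "w m s' = (if G \<and> 2 \<le> n \<and> vr s' 16 = ?b + real (min m c) * ?st then (1/3) ^ (M - m) * V else 0)"
    for m and s' :: vst
  let ?body = "coin ;; blk [BNOp NPlus 21 21 5] ;; IfN 18 3 (blk [BROp RPlus 16 16 17])"
  have step: "J ?body s0 7 (I (Suc m)) (w (Suc m)) (w m s0)" if m: "m < M" and I: "I m s0" for m s0
  proof -
    define wa where "wa = (if G \<and> 2 \<le> n \<and> vr s0 16 + ?st = ?b + real (min (Suc m) c) * ?st
      then (1/3) ^ (M - Suc m) * V else 0)"
    define wb where "wb = (if G \<and> 2 \<le> n \<and> vr s0 16 = ?b + real (min (Suc m) c) * ?st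
      then (1/3) ^ (M - Suc m) * V else 0)"
    have f0: "vn s0 3 = n" "vn s0 5 = 1" "vn s0 21 = m" "vr s0 17 = ?st" using I n3 n5 by (auto simp: I_def same_def)
    have nn: "0 \<le> wa" "0 \<le> wb" using V by (auto simp: wa_def wb_def)
    have Mm: "(1/3::real) ^ (M - m) = (1/3) * (1/3) ^ (M - Suc m)" using m by (simp add: Suc_diff_Suc[symmetric])
    have p: "w m s0 \<le> wa / 2 \<or> (2 \<le> n \<and> w m s0 \<le> wb / 3) \<or> w m s0 \<le> 0"
    proof (cases "G \<and> 2 \<le> n \<and> vr s0 16 = ?b + real (min m c) * ?st")
      case True
      then have w: "w m s0 = (1/3) * ((1/3) ^ (M - Suc m) * V)" by (simp add: w_def Mm)
      have V0: "0 \<le> (1/3) ^ (M - Suc m) * V" using V by simp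
      show ?thesis
      proof (cases "m < c")
        case True
        then have "min (Suc m) c = Suc m" "min m c = m" by auto
        then have "wa = (1/3) ^ (M - Suc m) * V"
          using \<open>G \<and> 2 \<le> n \<and> vr s0 16 = ?b + real (min m c) * ?st\<close> by (simp add: wa_def algebra_simps)
        then show ?thesis using w V0 by simp
      next
        case False
        then have "min (Suc m) c = c" "min m c = c" by auto
        then have "wb = (1/3) ^ (M - Suc m) * V"
          using \<open>G \<and> 2 \<le> n \<and> vr s0 16 = ?b + real (min m c) * ?st\<close> by (simp add: wb_def)
        then show ?thesis using w True by simp
      qed
    qed (auto simp: w_def)
    define f1 where "f1 s' = (if vn s' 18 < vn s' 3 then wa else wb)" for s' :: vst
    have 1: "J coin s0 2 (same {18} {} {} s0) f1 (w m s0)"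
      by (rule coin_J[OF f0(1) _ _ nn p]) (auto simp: f1_def)
    have 2: "tot (blk [BNOp NPlus 21 21 5]) s1 1 (\<lambda>s'. same {18, 21} {} {} s0 s' \<and> vn s' 21 = Suc m \<and> f1 s' = f1 s1)"
      if "same {18} {} {} s0 s1" for s1
      by (rule J_ops) (use that f0 in \<open>auto simp: same_def f1_def One_nat_def\<close>)
    have 3: "J (IfN 18 3 (blk [BROp RPlus 16 16 17])) s2 (1 + 2) (I (Suc m)) (w (Suc m)) (f1 s1)"
      if s2: "same {18, 21} {} {} s0 s2 \<and> vn s2 21 = Suc m \<and> f1 s2 = f1 s1" for s1 s2
    proof (rule J_ifN)
      have sm: "same {18, 21} {16} {} s s2"
        by (rule same_trans[of "{18, 21}" "{16}" "{}" s s0]) (use I s2 in \<open>auto simp: I_def\<close>)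
      have r: "vr s2 16 = vr s0 16" "vr s2 17 = ?st" using s2 f0 by (auto simp: same_def)
      show "J (blk [BROp RPlus 16 16 17]) s2 1 (I (Suc m)) (w (Suc m)) (f1 s1)" if t: "vn s2 18 < vn s2 3"
      proof (rule J_ops)
        let ?s = "ops [BROp RPlus 16 16 17] s2"
        show "I (Suc m) ?s" using sm s2 by (auto simp: I_def same_def)
        have "f1 s1 = wa" using s2 t by (auto simp: f1_def split: if_splits)
        then show "f1 s1 \<le> w (Suc m) ?s" using r by (simp add: wa_def w_def)
      qed (auto simp: One_nat_def)
      show "I (Suc m) s2 \<and> f1 s1 \<le> w (Suc m) s2" if t: "\<not> vn s2 18 < vn s2 3"
      proof -
        have "f1 s1 = wb" using s2 t by (auto simp: f1_def split: if_splits)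
        then show ?thesis using sm s2 r by (simp add: I_def wb_def w_def)
      qed
    qed
    have 23: "J (blk [BNOp NPlus 21 21 5] ;; IfN 18 3 (blk [BROp RPlus 16 16 17])) s1 (1 + (1 + 2)) (I (Suc m)) (w (Suc m)) (f1 s1)"
      if "same {18} {} {} s0 s1" for s1
      by (rule J_seq_tot[OF 2[OF that] 3])
    have "J ?body s0 (2 + (1 + (1 + 2))) (I (Suc m)) (w (Suc m)) (w m s0)" by (rule J_seq[OF 1 23])
    then show ?thesis by (rule J_conseq) auto
  qed
  have "J (WhileN 21 7 ?body) s (M * (7 + 2) + 2) (I M) (w M) (if G \<and> 2 \<le> n then (1/3) ^ M * V else 0)"
  proof (rule J_whileN[where I = I and v = w and K = M])
    show "w 0 s = (if G \<and> 2 \<le> n then (1/3) ^ M * V else 0)" by (simp add: w_def)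
    show "I M s' \<and> w k s' \<le> w M s'" if "k \<le> M" "I k s'" "\<not> vn s' 21 < vn s' 7" for k s'
    proof -
      have "k = M" using that n7 by (auto simp: I_def same_def)
      then show ?thesis using that by simp
    qed
  qed (use step n21 n7 in \<open>auto simp: I_def same_def\<close>)
  then show ?thesis
    by (rule J_conseq) (use c V in \<open>auto simp: I_def w_def\<close>)
qed

definition Xslots :: "nat set" where "Xslots = {5, 6} \<union> range (\<lambda>i. 8 * i + 3)"

lemma Xslots_mem: "5 \<in> Xslots" "6 \<in> Xslots" "8 * i + 3 \<in> Xslots" "8 * i + 1 \<notin> Xslots" "8 * i + 2 \<notin> Xslots"
  "4 \<notin> Xslots" "7 \<notin> Xslots" "1 \<notin> Xslots" "2 \<notin> Xslots"
  unfolding Xslots_def by (auto, presburger+)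

text \<open>The coordinate reached if \<open>c i\<close> tosses are positive. The maximum is the
  \<open>L\<close> of \<open>frame_coordinates\<close>: the length of the greedy vector, or
  \<open>\<sigma>\<close> where that vector is missing.\<close>

definition guess_point :: "vst \<Rightarrow> nat \<Rightarrow> (nat \<Rightarrow> nat) \<Rightarrow> nat \<Rightarrow> real" where
  "guess_point s H c i = (let L = max (norm (fG s i)) (vr s 12) in
     inner (pts (vn s 17) - fG s 0) (fG s i) / L\<^sup>2 + vr s 12 / L * (real (c i) / H - H))"

lemma coord_spec:
  assumes b: "base j H x s" and H: "1 \<le> H" and c: "\<And>i. c i \<le> 2 * H\<^sup>2"
    and s0: "same {18, 20, 21} {10, 15, 16, 17, 18} Xslots s s0" "vn s0 20 = k" "vv s0 6 = pts (vn s 17) - fG s 0"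
    and k: "k < j" and V: "0 \<le> V"
  shows "J coord_cmd s0 (18 * H\<^sup>2 + 25)
    (\<lambda>s'. same {18, 20, 21} {10, 15, 16, 17, 18} Xslots s s' \<and> vn s' 20 = Suc k \<and> vv s' 6 = pts (vn s 17) - fG s 0 \<and>
       (\<forall>i\<in>{1..k}. fX s' i = fX s0 i))
    (\<lambda>s'. if G \<and> fX s' (Suc k) = guess_point s H c (Suc k) *\<^sub>R vv s 7 then V else 0)
    (if G \<and> 2 \<le> n then (1/3) ^ (2 * H\<^sup>2) * V else 0)"
proof -
  define g where "g = fG s (Suc k)"
  define \<sigma> where "\<sigma> = vr s 12"
  define L where "L = max (norm g) \<sigma>"
  define q where "q = pts (vn s 17) - fG s 0"
  have f: "vn s0 5 = 1" "vn s0 3 = n" "vn s0 6 = H" "vn s0 7 = 2 * H\<^sup>2" "vr s0 5 = 0" "vr s0 13 = 1 / H" "vr s0 12 = \<sigma>"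
    "vv s0 4 = 0" "vv s0 7 = vv s 7" "vr s0 6 = 1"
    using b s0(1) by (auto simp: base_def consts_ok_def same_def Xslots_mem \<sigma>_def)
  have gk: "vv s0 (8 * k + 10) = g"
  proof -
    have "vv s0 (8 * Suc k + 2) = vv s (8 * Suc k + 2)"
      using s0(1) Xslots_mem(5)[of "Suc k"] by (simp add: same_def)
    then show ?thesis by (simp add: g_def fG_def add.commute add.left_commute)
  qed
  have gk2: "vv s0 (10 + 8 * k) = g" using gk by (simp add: add.commute)
  define P where "P s' \<longleftrightarrow> same {18, 20, 21} {10, 15, 16, 17, 18} {} s0 s' \<and> vn s' 20 = Suc k" for s'
  have 1: "tot (blk [BNOp NPlus 20 20 5, BDot 10 (sG 20) (sG 20), BSqrt 15 10]) s0 3 (\<lambda>s'. P s' \<and> vr s' 15 = norm g)"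
    by (rule J_ops) (use f gk gk2 s0(2) in \<open>auto simp: P_def same_def norm_eq_sqrt_inner\<close>)
  have 2: "tot (IfR 15 12 (blk [BROp RPlus 15 12 5])) s1 (1 + 2) (\<lambda>s'. P s' \<and> vr s' 15 = L)"
    if "P s1 \<and> vr s1 15 = norm g" for s1
  proof (rule J_ifR)
    have e: "vr s1 12 = \<sigma>" "vr s1 5 = 0" using that f by (auto simp: P_def same_def)
    show "tot (blk [BROp RPlus 15 12 5]) s1 1 (\<lambda>s'. P s' \<and> vr s' 15 = L)" if "vr s1 15 < vr s1 12"
      by (rule J_ops) (use that \<open>P s1 \<and> _\<close> e in \<open>auto simp: P_def same_def L_def One_nat_def\<close>)
    show "(P s1 \<and> vr s1 15 = L) \<and> (0::real) \<le> 0" if "\<not> vr s1 15 < vr s1 12"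
      using that \<open>P s1 \<and> _\<close> e by (auto simp: L_def)
  qed
  let ?b2 = "[BDot 16 sU (sG 20), BROp RDiv 16 16 15, BROp RDiv 16 16 15, BROp RDiv 17 12 15, BROf 18 6,
       BROp RTimes 18 18 17, BROp RMinus 16 16 18, BROp RTimes 17 17 13, BNat 21 0]"
  define bv where "bv = inner q g / L / L - H * (\<sigma> / L)"
  define st where "st = \<sigma> / L * (1 / H)"
  have 3: "tot (blk ?b2) s2 9 (\<lambda>s'. P s' \<and> vr s' 16 = bv \<and> vr s' 17 = st \<and> vn s' 21 = 0)" if s2: "P s2 \<and> vr s2 15 = L" for s2
  proof (rule J_ops)
    have e: "vv s2 6 = q" "vv s2 (8 * k + 10) = g" "vv s2 (10 + 8 * k) = g" "vn s2 20 = Suc k" "vr s2 12 = \<sigma>" "vn s2 6 = H" "vr s2 13 = 1 / H"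
      using s2 f gk gk2 s0(3) by (auto simp: P_def same_def q_def)
    show "P (ops ?b2 s2) \<and> vr (ops ?b2 s2) 16 = bv \<and> vr (ops ?b2 s2) 17 = st \<and> vn (ops ?b2 s2) 21 = 0"
      using s2 e by (auto simp: P_def same_def bv_def st_def)
  qed auto
  let ?x = "guess_point s H c (Suc k)"
  have xe: "?x = bv + real (c (Suc k)) * st"
    unfolding guess_point_def Let_def bv_def st_def g_def[symmetric] \<sigma>_def[symmetric] L_def[symmetric] q_def[symmetric]
    by (simp add: power2_eq_square algebra_simps)
  have 4: "J (WhileN 21 7 (coin ;; blk [BNOp NPlus 21 21 5] ;; IfN 18 3 (blk [BROp RPlus 16 16 17]))) s3
      (2 * H\<^sup>2 * 9 + 2) P (\<lambda>s'. if G \<and> vr s' 16 = ?x then V else 0) (if G \<and> 2 \<le> n then (1/3) ^ (2 * H\<^sup>2) * V else 0)"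
    if s3: "P s3 \<and> vr s3 16 = bv \<and> vr s3 17 = st \<and> vn s3 21 = 0" for s3
  proof -
    have e: "vn s3 3 = n" "vn s3 5 = 1" "vn s3 7 = 2 * H\<^sup>2" using s3 f by (auto simp: P_def same_def)
    have "J (WhileN 21 7 (coin ;; blk [BNOp NPlus 21 21 5] ;; IfN 18 3 (blk [BROp RPlus 16 16 17]))) s3
      (2 * H\<^sup>2 * 9 + 2) (\<lambda>s'. same {18, 21} {16} {} s3 s')
      (\<lambda>s'. if G \<and> vr s' 16 = vr s3 16 + real (c (Suc k)) * vr s3 17 then V else 0)
      (if G \<and> 2 \<le> n then (1/3) ^ (2 * H\<^sup>2) * V else 0)"
      by (rule guess_spec[OF e c V]) (use s3 in auto)
    then show ?thesis
    proof (rule J_conseq)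
      fix s' assume s': "same {18, 21} {16} {} s3 s'"
      have "same {18, 20, 21} {10, 15, 16, 17, 18} {} s0 s'"
        by (rule same_trans[OF _ s', of "{18, 20, 21}" "{10, 15, 16, 17, 18}" "{}"]) (use s3 in \<open>auto simp: P_def\<close>)
      then show "P s'" using s' s3 by (auto simp: P_def same_def)
      show "(if G \<and> vr s' 16 = vr s3 16 + real (c (Suc k)) * vr s3 17 then V else 0) \<le> (if G \<and> vr s' 16 = ?x then V else 0)"
        using s3 xe by simp
    qed auto
  qed
  define Q5 where "Q5 s' \<longleftrightarrow> same {18, 20, 21} {10, 15, 16, 17, 18} Xslots s s' \<and> vn s' 20 = Suc k \<and>
    vv s' 6 = pts (vn s 17) - fG s 0 \<and> (\<forall>i\<in>{1..k}. fX s' i = fX s0 i)" for s'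
  have 5: "J (blk [BLin (sX 20) 16 sI sZ]) s4 1 Q5 (\<lambda>s'. if G \<and> fX s' (Suc k) = ?x *\<^sub>R vv s 7 then V else 0)
      (if G \<and> vr s4 16 = ?x then V else 0)" if s4: "P s4" for s4
  proof (rule J_ops)
    define s5 where "s5 = ops [BLin (sX 20) 16 sI sZ] s4"
    have vv4: "vv s4 = vv s0" "vn s4 20 = Suc k" using s4 by (auto simp: P_def same_def)
    have v5: "vv s5 = (vv s0)(8 * Suc k + 3 := vr s4 16 *\<^sub>R vv s 7)" "vn s5 = vn s4" "vr s5 = vr s4"
      using f vv4 by (simp_all add: s5_def)
    have 35: "same {18, 20, 21} {10, 15, 16, 17, 18} Xslots s0 s5"
      using s4 Xslots_mem(3)[of "Suc k"] unfolding same_def v5 P_def by auto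
    have "same {18, 20, 21} {10, 15, 16, 17, 18} Xslots s s5" by (rule same_trans[OF s0(1) 35]) auto
    moreover have "vv s5 6 = pts (vn s 17) - fG s 0" unfolding v5 using s0(3) by simp
    moreover have "\<forall>i\<in>{1..k}. fX s5 i = fX s0 i" by (auto simp: v5 fX_def)
    ultimately show "Q5 (ops [BLin (sX 20) 16 sI sZ] s4)"
      unfolding s5_def[symmetric] Q5_def v5 using vv4 by simp
    have "fX s5 (Suc k) = vr s4 16 *\<^sub>R vv s 7" by (simp add: v5 fX_def)
    then show "(if G \<and> vr s4 16 = ?x then V else 0)
        \<le> (if G \<and> fX (ops [BLin (sX 20) 16 sI sZ] s4) (Suc k) = ?x *\<^sub>R vv s 7 then V else 0)"
      unfolding s5_def[symmetric] using V by simp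
  qed (auto simp: One_nat_def)
  have "J coord_cmd s0 (3 + ((1 + 2) + (9 + ((2 * H\<^sup>2 * 9 + 2) + 1)))) Q5
    (\<lambda>s'. if G \<and> fX s' (Suc k) = ?x *\<^sub>R vv s 7 then V else 0)
    (if G \<and> 2 \<le> n then (1/3) ^ (2 * H\<^sup>2) * V else 0)"
    unfolding coord_cmd_def
    by (rule J_seq_tot[OF 1 J_seq_tot[OF 2 J_seq_tot[OF 3 J_seq[OF 4 5]]]])
  then show ?thesis unfolding Q5_def by (rule J_conseq) auto
qed

definition updated :: "nat \<Rightarrow> nat \<Rightarrow> (nat \<Rightarrow> real) \<Rightarrow> vst \<Rightarrow> vst \<Rightarrow> bool" where
  "updated j H x s s' \<longleftrightarrow> (\<forall>i\<le>j. fP s' i = fP s i + (1 / H * x i) *\<^sub>R (pts (vn s 17) - (\<Sum>i\<le>j. x i *\<^sub>R fP s i)))"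

definition Uslots :: "nat \<Rightarrow> nat set" where "Uslots j = Xslots \<union> (\<lambda>i. 8 * i + 1) ` {..j}"

text \<open>Only the guesses are random; what follows is deterministic and is described under the
  condition \<open>good\<close> that all coordinates came out as wanted. Hence the probability is
  that of \<open>2 * H\<^sup>2 * j\<close> tosses.\<close>

lemma update_spec:
  assumes b: "base j H y s" and H: "1 \<le> H" and c: "\<And>i. c i \<le> 2 * H\<^sup>2"
  shows "J update_cmd s (j * (18 * H\<^sup>2 + 40) + 17)
    (\<lambda>s'. same {18, 20, 21} {10, 15, 16, 17, 18} (Uslots j) s s')
    (\<lambda>s'. if updated j H ((guess_point s H c)(0 := 1)) s s' then 1 else 0)
    (if 2 \<le> n then (1/3) ^ (2 * H\<^sup>2 * j) else 0)"
proof -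
  define M where "M = 2 * H\<^sup>2"
  define x where "x = guess_point s H c"
  \<comment> \<open>The base point counts as frame vector 0 with coordinate 1, which makes the
    affine problem linear.\<close>
  define x' where "x' = x(0 := 1)"
  define p where "p = pts (vn s 17)"
  have f: "consts_ok s" "vn s 2 = j" "vr s 13 = 1 / H" "inner (vv s 7) (vv s 7) = 1"
    using b by (auto simp: base_def)
  define S where "S s' \<longleftrightarrow> same {18, 20, 21} {10, 15, 16, 17, 18} Xslots s s'" for s'
  define I where "I k s' \<longleftrightarrow> S s' \<and> vn s' 20 = k \<and> vv s' 6 = p - fG s 0" for k s'
  define good where "good k s' \<longleftrightarrow> (\<forall>i\<in>{1..k}. fX s' i = x i *\<^sub>R vv s 7)" for k s'
  define v where "v k s' = (if good k s' \<and> 2 \<le> n then (1/3::real) ^ (M * (j - k)) else 0)" for k s'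
  have 1: "tot (blk [BPt sU 17, BLin sU 7 sG0 sU, BNat 20 0]) s 3 (I 0)"
    by (rule J_ops) (use f in \<open>auto simp: I_def S_def same_def consts_ok_def p_def fG_def Xslots_mem\<close>)
  have 2: "J (WhileN 20 2 coord_cmd) s1 (j * (18 * H\<^sup>2 + 25 + 2) + 2) (I j) (\<lambda>s'. if good j s' then 1 else 0)
      (if 2 \<le> n then (1/3) ^ (M * j) else 0)" if I0: "I 0 s1" for s1
  proof (rule J_whileN[where I = I and v = v and K = j])
    show "v 0 s1 = (if 2 \<le> n then (1/3) ^ (M * j) else 0)" by (simp add: v_def good_def)
    fix k s0 assume k: "k < j" and I: "I k s0"
    have "J coord_cmd s0 (18 * H\<^sup>2 + 25)
      (\<lambda>s'. same {18, 20, 21} {10, 15, 16, 17, 18} Xslots s s' \<and> vn s' 20 = Suc k \<and> vv s' 6 = pts (vn s 17) - fG s 0 \<and>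
       (\<forall>i\<in>{1..k}. fX s' i = fX s0 i))
      (\<lambda>s'. if (good k s0 \<and> 2 \<le> n) \<and> fX s' (Suc k) = guess_point s H c (Suc k) *\<^sub>R vv s 7 then (1/3) ^ (M * (j - Suc k)) else 0)
      (if (good k s0 \<and> 2 \<le> n) \<and> 2 \<le> n then (1/3) ^ (2 * H\<^sup>2) * (1/3) ^ (M * (j - Suc k)) else 0)"
      by (rule coord_spec[OF b H c]) (use I k in \<open>auto simp: I_def S_def p_def\<close>)
    then show "J coord_cmd s0 (18 * H\<^sup>2 + 25) (I (Suc k)) (v (Suc k)) (v k s0)"
    proof (rule J_conseq)
      have "j - k = Suc (j - Suc k)" using k by simp
      then have "(1/3::real) ^ (M * (j - k)) = (1/3) ^ (2 * H\<^sup>2) * (1/3) ^ (M * (j - Suc k))"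
        by (simp add: M_def power_add)
      then show "v k s0 \<le> (if (good k s0 \<and> 2 \<le> n) \<and> 2 \<le> n then (1/3) ^ (2 * H\<^sup>2) * (1/3) ^ (M * (j - Suc k)) else 0)"
        by (simp add: v_def)
    qed (auto simp: I_def S_def p_def v_def good_def le_Suc_eq x_def)
  next
    fix k s' assume "k \<le> j" "I k s'" "\<not> vn s' 20 < vn s' 2"
    then have "k = j" using f by (auto simp: I_def S_def same_def)
    then show "I j s' \<and> v k s' \<le> (if good j s' then 1 else 0)" using \<open>I k s'\<close> by (auto simp: v_def)
  qed (use I0 f in \<open>auto simp: I_def S_def same_def\<close>)
  have getx: "inner (fX s' i) (vv s' 7) = x i" if "S s'" "good j s'" "i \<in> {1..j}" for s' i
    using that f(4) by (auto simp: S_def good_def same_def Xslots_mem)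
  have fP_S: "fP s' i = fP s i" if "S s'" for s' i using that Xslots_mem(4)[of i] by (simp add: S_def same_def fP_def)
  have S_same: "S s''" if "S s'" "same {20} {16} {5} s' s''" for s' s''
    unfolding S_def by (rule same_trans[OF _ that(2)]) (use that in \<open>auto simp: S_def Xslots_mem\<close>)
  have good_same: "good j s'' = good j s'" if "same NS RS VS s' s''" "\<And>i. 8 * i + 3 \<notin> VS" for s' s'' NS RS VS
    using that by (simp add: good_def same_def fX_def)
  have ne5: "8 * i + 3 \<noteq> (5::nat)" for i by presburger
  define B where "B k s' \<longleftrightarrow> S s' \<and> vn s' 20 = k \<and> (good j s' \<longrightarrow> vv s' 5 = p - fP s 0 - (\<Sum>i=1..k. x i *\<^sub>R fP s i))" for k s'
  have 3: "tot (blk [BPt sT 17, BLin sT 7 sP0 sT, BNat 20 0]) s2 3 (\<lambda>s'. B 0 s' \<and> good j s' = good j s2)" if I: "I j s2" for s2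
  proof (rule J_ops)
    define s3 where "s3 = ops [BPt sT 17, BLin sT 7 sP0 sT, BNat 20 0] s2"
    have sm: "same {20} {16} {5} s2 s3" by (auto simp: s3_def same_def)
    have e: "vr s2 7 = -1" "vn s2 17 = vn s 17" "vv s2 1 = fP s 0"
      using I f by (auto simp: I_def S_def same_def consts_ok_def fP_def Xslots_mem)
    have "S s3" by (rule S_same[OF _ sm]) (use I in \<open>simp add: I_def\<close>)
    moreover have "vn s3 20 = 0" "vv s3 5 = p - fP s 0" using e by (auto simp: s3_def p_def)
    ultimately show "B 0 (ops [BPt sT 17, BLin sT 7 sP0 sT, BNat 20 0] s2) \<and>
        good j (ops [BPt sT 17, BLin sT 7 sP0 sT, BNat 20 0] s2) = good j s2"
      unfolding s3_def[symmetric] using good_same[OF sm] ne5 by (simp add: B_def)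
  qed auto
  let ?b4 = "[BNOp NPlus 20 20 5, BDot 16 (sX 20) sI, BROp RMinus 16 5 16, BLin sT 16 (sP 20) sT]"
  have 4: "tot (WhileN 20 2 (blk ?b4)) s3 (j * (4 + 2) + 2) (\<lambda>s'. B j s' \<and> good j s' = g0)"
    if B0: "B 0 s3 \<and> good j s3 = g0" for s3 g0
  proof (rule J_whileN[where I = "\<lambda>k s'. B k s' \<and> good j s' = g0" and v = "\<lambda>_ _. 0" and K = j])
    fix k s0 assume k: "k < j" and B: "B k s0 \<and> good j s0 = g0"
    show "tot (blk ?b4) s0 4 (\<lambda>s'. B (Suc k) s' \<and> good j s' = g0)"
    proof (rule J_ops)
      define s4 where "s4 = ops ?b4 s0"
      have sm: "same {20} {16} {5} s0 s4" by (auto simp: s4_def same_def)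
      have S4: "S s4" by (rule S_same[OF _ sm]) (use B in \<open>simp add: B_def\<close>)
      have e: "vn s0 5 = 1" "vn s0 20 = k" "vr s0 5 = 0" using B f by (auto simp: B_def S_def same_def consts_ok_def)
      have g4: "good j s4 = good j s0" using good_same[OF sm] ne5 by simp
      have n20: "vn s4 20 = Suc k" using e by (simp add: s4_def)
      have "vv s4 5 = p - fP s 0 - (\<Sum>i=1..Suc k. x i *\<^sub>R fP s i)" if "good j s4"
      proof -
        have Sk: "Suc k \<in> {1..j}" using k by simp
        have g: "good j s0" using that g4 by simp
        have ix: "inner (vv s0 (8 * k + 11)) (vv s0 7) = x (Suc k)"
          using getx[OF _ g Sk] B by (simp add: B_def fX_def add.commute add.left_commute)
        have iP: "vv s0 (8 * k + 9) = fP s (Suc k)"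
          using fP_S[of s0 "Suc k"] B by (simp add: B_def fP_def add.commute add.left_commute)
        have i5: "vv s0 5 = p - fP s 0 - (\<Sum>i=1..k. x i *\<^sub>R fP s i)" using B g by (simp add: B_def)
        have n5: "8 * k + 9 \<noteq> 5" by presburger
        have "vv s0 (9 + 8 * k) = fP s (Suc k)" "inner (vv s0 (11 + 8 * k)) (vv s0 7) = x (Suc k)"
          using ix iP by (simp_all add: add.commute)
        then have "vv s4 5 = - x (Suc k) *\<^sub>R fP s (Suc k) + vv s0 5" using e ix iP by (simp add: s4_def)
        then show ?thesis using i5 by simp
      qed
      then show "B (Suc k) (ops ?b4 s0) \<and> good j (ops ?b4 s0) = g0"
        unfolding s4_def[symmetric] using S4 n20 g4 B by (simp add: B_def)
    qed auto
  next
    fix k s' assume "k \<le> j" "B k s' \<and> good j s' = g0" "\<not> vn s' 20 < vn s' 2"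
    moreover from this have "k = j" using f by (auto simp: B_def S_def same_def)
    ultimately show "(B j s' \<and> good j s' = g0) \<and> (0::real) \<le> 0" by simp
  qed (use B0 f in \<open>auto simp: B_def S_def same_def\<close>)
  define r where "r = p - (\<Sum>i\<le>j. x' i *\<^sub>R fP s i)"
  have r_eq: "r = p - fP s 0 - (\<Sum>i=1..j. x i *\<^sub>R fP s i)"
  proof -
    have "(\<Sum>i\<le>j. x' i *\<^sub>R fP s i) = x' 0 *\<^sub>R fP s 0 + (\<Sum>i=1..j. x' i *\<^sub>R fP s i)"
    proof -
      have "{..j} = insert 0 {1..j}" by auto
      then show ?thesis by simp
    qed
    also have "(\<Sum>i=1..j. x' i *\<^sub>R fP s i) = (\<Sum>i=1..j. x i *\<^sub>R fP s i)"
      by (intro sum.cong) (auto simp: x'_def)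
    finally show ?thesis by (simp add: r_def x'_def)
  qed
  define S2 where "S2 s' \<longleftrightarrow> same {18, 20, 21} {10, 15, 16, 17, 18} (Uslots j) s s'" for s'
  define C where "C k s' \<longleftrightarrow> S2 s' \<and> vn s' 20 = k \<and> (good j s' \<longrightarrow> vv s' 5 = r \<and>
    (\<forall>i\<le>j. fP s' i = (if i \<le> k then fP s i + (1 / H * x' i) *\<^sub>R r else fP s i)))" for k s'
  have S_S2: "S s' \<Longrightarrow> S2 s'" for s' unfolding S_def S2_def by (erule same_mono) (auto simp: Uslots_def)
  have U_mem: "8 * i + 1 \<in> Uslots j" if "i \<le> j" for i using that by (auto simp: Uslots_def)
  have U_no: "4 \<notin> Uslots j" "7 \<notin> Uslots j" by (auto simp: Uslots_def Xslots_mem) presburger+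
  have ne1: "8 * i + 3 \<noteq> 8 * k + (1::nat)" for i k by presburger
  have 5: "tot (blk [BLin sP0 13 sT sP0, BNat 20 0]) s4 2 (\<lambda>s'. C 0 s' \<and> good j s' = good j s4)" if B: "B j s4" for s4
  proof (rule J_ops)
    define s5 where "s5 = ops [BLin sP0 13 sT sP0, BNat 20 0] s4"
    have sm: "same {20} {} {1} s4 s5" by (auto simp: s5_def same_def)
    have "S2 s5" unfolding S2_def
      by (rule same_trans[OF _ sm, of "{18, 20, 21}" "{10, 15, 16, 17, 18}" "Uslots j"])
        (use B S_S2 U_mem[of 0] in \<open>auto simp: B_def S2_def\<close>)
    moreover have g5: "good j s5 = good j s4"
      by (rule good_same[OF sm]) simp
    moreover have "vv s5 5 = r \<and> (\<forall>i\<le>j. fP s5 i = (if i \<le> 0 then fP s i + (1 / H * x' i) *\<^sub>R r else fP s i))" if "good j s5"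
    proof -
      have B4: "vv s4 5 = r" using that g5 B by (simp add: B_def r_eq)
      have l: "vr s4 13 = 1 / H" using B f by (auto simp: B_def S_def same_def)
      have P4: "fP s4 i = fP s i" for i using fP_S B by (simp add: B_def)
      have "fP s5 0 = fP s 0 + (1 / H * x' 0) *\<^sub>R r"
        using P4[of 0] B4 l by (simp add: s5_def fP_def x'_def add.commute)
      moreover have "fP s5 i = fP s i" if "i \<noteq> 0" for i
        using P4[of i] that by (simp add: s5_def fP_def)
      moreover have "vv s5 5 = r" using B4 by (simp add: s5_def)
      ultimately show ?thesis by auto
    qed
    moreover have "vn s5 20 = 0" by (simp add: s5_def)
    ultimately show "C 0 (ops [BLin sP0 13 sT sP0, BNat 20 0] s4) \<and> good j (ops [BLin sP0 13 sT sP0, BNat 20 0] s4) = good j s4"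
      unfolding s5_def[symmetric] by (simp add: C_def)
  qed auto
  let ?b6 = "[BNOp NPlus 20 20 5, BDot 16 (sX 20) sI, BROp RTimes 16 16 13, BLin (sP 20) 16 sT (sP 20)]"
  have 6: "tot (WhileN 20 2 (blk ?b6)) s5 (j * (4 + 2) + 2) (\<lambda>s'. C j s' \<and> good j s' = g0)"
    if C0: "C 0 s5 \<and> good j s5 = g0" for s5 g0
  proof (rule J_whileN[where I = "\<lambda>k s'. C k s' \<and> good j s' = g0" and v = "\<lambda>_ _. 0" and K = j])
    fix k s0 assume k: "k < j" and C: "C k s0 \<and> good j s0 = g0"
    show "tot (blk ?b6) s0 4 (\<lambda>s'. C (Suc k) s' \<and> good j s' = g0)"
    proof (rule J_ops)
      define s6 where "s6 = ops ?b6 s0"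
      have e: "vn s0 5 = 1" "vn s0 20 = k" "vr s0 13 = 1 / H" "vv s0 7 = vv s 7"
        using C f U_no by (auto simp: C_def S2_def same_def consts_ok_def)
      have sm: "same {20} {16} {8 * Suc k + 1} s0 s6" using e by (auto simp: s6_def same_def)
      have S6: "S2 s6" unfolding S2_def
        by (rule same_trans[OF _ sm, of "{18, 20, 21}" "{10, 15, 16, 17, 18}" "Uslots j"])
          (use C k U_mem[of "Suc k"] in \<open>auto simp: C_def S2_def\<close>)
      have g6: "good j s6 = good j s0" by (rule good_same[OF sm]) (simp only: singleton_iff ne1 not_False_eq_True)
      have n20: "vn s6 20 = Suc k" using e by (simp add: s6_def)
      have "vv s6 5 = r \<and> (\<forall>i\<le>j. fP s6 i = (if i \<le> Suc k then fP s i + (1 / H * x' i) *\<^sub>R r else fP s i))" if "good j s6"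
      proof -
        have Sk: "Suc k \<in> {1..j}" using k by simp
        have g: "good j s0" using that g6 by simp
        have C5: "vv s0 5 = r" and CP: "\<And>i. i \<le> j \<Longrightarrow> fP s0 i = (if i \<le> k then fP s i + (1 / H * x' i) *\<^sub>R r else fP s i)"
          using C g by (auto simp: C_def)
        have ix: "inner (vv s0 (8 * k + 11)) (vv s0 7) = x (Suc k)"
        proof -
          have "fX s0 (Suc k) = x (Suc k) *\<^sub>R vv s 7" using g Sk by (auto simp: good_def)
          then show ?thesis using f(4) e(4) by (simp add: fX_def add.commute add.left_commute)
        qed
        have iP: "vv s0 (8 * k + 9) = fP s (Suc k)"
          using CP[of "Suc k"] k by (simp add: fP_def add.commute add.left_commute)
        have "vv s0 (9 + 8 * k) = fP s (Suc k)" "inner (vv s0 (11 + 8 * k)) (vv s0 7) = x (Suc k)"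
          using ix iP by (simp_all add: add.commute)
        then have new: "vv s6 = (vv s0)(8 * k + 9 := fP s (Suc k) + (1 / H * x' (Suc k)) *\<^sub>R r)"
          using e ix iP C5 by (simp add: s6_def x'_def add.commute)
        have n5: "8 * k + 9 \<noteq> 5" by presburger
        have "fP s6 i = (if i \<le> Suc k then fP s i + (1 / H * x' i) *\<^sub>R r else fP s i)" if "i \<le> j" for i
        proof (cases "i = Suc k")
          case True
          then show ?thesis unfolding fP_def[of s6] new by simp
        next
          case False
          then have "8 * i + 1 \<noteq> 8 * k + 9" by presburger
          then have "fP s6 i = fP s0 i" unfolding fP_def new by simp
          then show ?thesis using CP[OF that] False by auto
        qed
        moreover have "vv s6 5 = r" unfolding new using C5 n5 by simp
        ultimately show ?thesis by simp
      qed
      then show "C (Suc k) (ops ?b6 s0) \<and> good j (ops ?b6 s0) = g0"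
        unfolding s6_def[symmetric] using S6 n20 g6 C by (simp add: C_def)
    qed auto
  next
    fix k s' assume "k \<le> j" "C k s' \<and> good j s' = g0" "\<not> vn s' 20 < vn s' 2"
    moreover from this have "k = j" using f by (auto simp: C_def S2_def same_def)
    ultimately show "(C j s' \<and> good j s' = g0) \<and> (0::real) \<le> 0" by simp
  qed (use C0 f in \<open>auto simp: C_def S2_def same_def\<close>)
  have tail: "tot (blk [BPt sT 17, BLin sT 7 sP0 sT, BNat 20 0] ;; WhileN 20 2 (blk ?b4) ;;
      blk [BLin sP0 13 sT sP0, BNat 20 0] ;; WhileN 20 2 (blk ?b6)) s2
      (3 + ((j * (4 + 2) + 2) + (2 + (j * (4 + 2) + 2)))) (\<lambda>s'. C j s' \<and> good j s' = good j s2)" if I: "I j s2" for s2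
  proof (rule J_seq_tot[OF 3[OF I]], rule J_seq_tot[OF 4], assumption, rule J_seq_tot)
    fix s4 assume "B j s4 \<and> good j s4 = good j s2"
    then show "tot (blk [BLin sP0 13 sT sP0, BNat 20 0]) s4 2 (\<lambda>s'. C 0 s' \<and> good j s' = good j s2)"
      using 5[of s4] by simp
  qed (rule 6)
  have tailJ: "J (blk [BPt sT 17, BLin sT 7 sP0 sT, BNat 20 0] ;; WhileN 20 2 (blk ?b4) ;;
      blk [BLin sP0 13 sT sP0, BNat 20 0] ;; WhileN 20 2 (blk ?b6)) s2
      (3 + ((j * (4 + 2) + 2) + (2 + (j * (4 + 2) + 2)))) S2
      (\<lambda>s'. if updated j H x' s s' then 1 else 0) (if good j s2 then 1 else 0)" if I: "I j s2" for s2
  proof -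
    have "J (blk [BPt sT 17, BLin sT 7 sP0 sT, BNat 20 0] ;; WhileN 20 2 (blk ?b4) ;;
      blk [BLin sP0 13 sT sP0, BNat 20 0] ;; WhileN 20 2 (blk ?b6)) s2
      (3 + ((j * (4 + 2) + 2) + (2 + (j * (4 + 2) + 2)))) (\<lambda>s'. C j s' \<and> good j s' = good j s2)
      (\<lambda>s'. if updated j H x' s s' then 1 else 0) (if good j s2 then 1 else 0)"
      by (rule J_const[OF tail[OF I]]) (auto simp: C_def updated_def r_def p_def)
    then show ?thesis by (rule J_conseq) (auto simp: C_def)
  qed
  have "J update_cmd s (3 + ((j * (18 * H\<^sup>2 + 25 + 2) + 2) + (3 + ((j * (4 + 2) + 2) + (2 + (j * (4 + 2) + 2)))))) S2
      (\<lambda>s'. if updated j H x' s s' then 1 else 0) (if 2 \<le> n then (1/3) ^ (M * j) else 0)"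
    unfolding update_cmd_def by (rule J_seq_tot[OF 1 J_seq[OF 2 tailJ]])
  then show ?thesis unfolding S2_def x'_def x_def M_def
    by (rule J_conseq) (auto simp: algebra_simps)
qed

end

context prog
begin

text \<open>Attaches the success probability \<open>V\<close> of the remaining computation to an
  event of value 0 or 1.\<close>

lemma J_scale:
  assumes "J c s T Q f p" "0 \<le> V"
  shows "J c s T Q (\<lambda>s'. V * f s') (V * p)"
proof -
  obtain D where D: "bs sem gn gr c s D T" "\<forall>s'\<in>set_pmf D. Q s'"
    "ennreal p \<le> (\<integral>\<^sup>+ s'. ennreal (f s') \<partial>measure_pmf D)"
    using assms(1) by (auto simp: J_def)
  have "ennreal (V * p) \<le> ennreal V * ennreal p"
    using assms(2) by (simp add: ennreal_mult')
  also have "\<dots> \<le> ennreal V * (\<integral>\<^sup>+ s'. ennreal (f s') \<partial>measure_pmf D)"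
    using D(3) by (rule mult_left_mono) simp
  also have "\<dots> = (\<integral>\<^sup>+ s'. ennreal (V * f s') \<partial>measure_pmf D)"
    using assms(2) by (simp add: nn_integral_cmult[symmetric] ennreal_mult')
  finally show ?thesis using D unfolding J_def by blast
qed

end

definition scale_param :: "nat \<Rightarrow> real \<Rightarrow> nat" where
  "scale_param j \<epsilon> = 200 * 200 ^ j * nat \<lceil>1 / \<epsilon>\<rceil>"

context vprog
begin

definition unit_fv :: "nat \<Rightarrow> fvec" where "unit_fv t = mkv d ((fv_nth 0)(t := 1))"

lemma inner_unit_fv: "t < d \<Longrightarrow> t' < d \<Longrightarrow> inner (unit_fv t) (unit_fv t') = (if t = t' then 1 else 0)"
proof -
  assume t: "t < d" "t' < d"
  have "inner (unit_fv t) (unit_fv t') = (\<Sum>k<d. if k = t then (if t = t' then 1 else 0) else 0)"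
    unfolding unit_fv_def inner_mkv by (intro sum.cong) (auto simp: zero_fvec.rep_eq)
  also have "\<dots> = (if t = t' then 1 else 0)" using t by simp
  finally show ?thesis .
qed

definition started :: "nat \<Rightarrow> nat \<Rightarrow> real \<Rightarrow> vst \<Rightarrow> bool" where
  "started j H x s \<longleftrightarrow> base j H x s \<and> vn s 8 = H ^ 3 \<and> vn s 16 < n \<and> fP s 0 = pts (vn s 16) \<and>
     (\<forall>i\<in>{1..j}. fP s i = 0) \<and> (\<forall>i\<le>j. fG s i = fP s i)"

text \<open>The start point is the only random choice here, and \<open>p\<close> bounds the
  probability that it is an inlier.\<close>

lemma init_spec:
  assumes N: "vn s 0 = n" "vn s 1 = d" "vn s 2 = j" "\<And>i. 3 \<le> i \<Longrightarrow> vn s i = 0"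
    and R: "vr s 0 = \<gamma>" "vr s 1 = \<epsilon>" "vr s 2 = \<delta>" "\<And>i. 5 \<le> i \<Longrightarrow> vr s i = 0" and V: "\<And>i. vv s i = 0"
    and \<epsilon>: "0 < \<epsilon>" and d: "j \<le> d" "1 \<le> d" and I: "I \<subseteq> {..<n}" "p \<le> card I / n"
  shows "J init_cmd s (10 * j + 4 * nat \<lceil>1 / \<epsilon>\<rceil> + 30) (started j (scale_param j \<epsilon>) (2 * (\<gamma> + \<delta>)))
    (\<lambda>s'. if vn s' 16 \<in> I then 1 else 0) p"
proof -
  let ?K = "nat \<lceil>1 / \<epsilon>\<rceil>" and ?H = "scale_param j \<epsilon>"
  define C where "C s' \<longleftrightarrow> vn s' 1 = d \<and> vn s' 2 = j \<and> vn s' 3 = n \<and> vn s' 4 = 0 \<and> vn s' 5 = 1 \<and> vr s' 1 = \<epsilon> \<and>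
    vr s' 5 = 0 \<and> vr s' 6 = 1 \<and> vr s' 7 = -1 \<and> vr s' 8 = 2 * (\<gamma> + \<delta>)" for s' :: vst
  define C1 where "C1 s' \<longleftrightarrow> C s' \<and> vv s' = (\<lambda>_. 0)(7 := unit_fv 0)" for s'
  define S1 where "S1 k s' \<longleftrightarrow> C1 s' \<and> vn s' 6 = 200 * 200 ^ k \<and> vn s' 23 = 200 \<and> vn s' 20 = k \<and> vn s' 21 = 0 \<and> vr s' 14 = 0"
    for k s'
  have V0: "vv s = (\<lambda>_. 0)" using V by auto
  have 1: "tot (blk [BNOp NPlus 3 0 4, BNat 5 1, BROf 6 5, BROp RMinus 7 5 6, BROp RPlus 8 0 2,
       BROp RPlus 8 8 8, BUnit sI 4 6, BNat 6 200, BNat 23 200, BNat 20 0]) s 10 (S1 0)"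
    by (rule J_ops) (use N R V0 d in \<open>auto simp: S1_def C1_def C_def unit_fv_def\<close>)
  have 2: "tot (WhileN 20 2 (blk [BNOp NPlus 20 20 5, BNOp NTimes 6 6 23])) s1 (j * (2 + 2) + 2) (S1 j)" if S: "S1 0 s1" for s1
  proof (rule J_whileN[where I = S1 and v = "\<lambda>_ _. 0" and K = j])
    fix k s' assume "k < j" "S1 k s'"
    then show "tot (blk [BNOp NPlus 20 20 5, BNOp NTimes 6 6 23]) s' 2 (S1 (Suc k))"
      by (intro J_ops) (auto simp: S1_def C1_def C_def)
  qed (use S in \<open>auto simp: S1_def C1_def C_def\<close>)
  define S2 where "S2 k s' \<longleftrightarrow> C1 s' \<and> vn s' 6 = 200 * 200 ^ j \<and> vn s' 21 = k \<and> vr s' 14 = real k \<and> vr s' 19 = 1 / \<epsilon>" for k s'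
  have 3: "tot (blk [BROp RDiv 19 6 1]) s2 1 (S2 0)" if "S1 j s2" for s2
    by (rule J_ops) (use that in \<open>auto simp: S1_def S2_def C1_def C_def One_nat_def\<close>)
  have less: "real k < 1 / \<epsilon> \<longleftrightarrow> k < ?K" for k by (simp add: zless_nat_eq_int_zless less_ceiling_iff)
  have 4: "tot (WhileR 14 19 (blk [BNOp NPlus 21 21 5, BROf 14 21])) s3 (?K * (2 + 2) + 2) (S2 ?K)" if S: "S2 0 s3" for s3
  proof (rule J_whileR[where I = S2 and v = "\<lambda>_ _. 0" and K = ?K])
    fix k s' assume "k < ?K" "S2 k s'"
    then show "tot (blk [BNOp NPlus 21 21 5, BROf 14 21]) s' 2 (S2 (Suc k))"
      by (intro J_ops) (auto simp: S2_def C1_def C_def)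
  next
    fix k s' assume k: "k \<le> ?K" "S2 k s'" "\<not> vr s' 14 < vr s' 19"
    then have "\<not> real k < 1 / \<epsilon>" by (simp add: S2_def)
    then have "k = ?K" using less[of k] k(1) by simp
    then show "S2 ?K s' \<and> (0::real) \<le> 0" using k by simp
  next
    fix s' assume "S2 ?K s'"
    then show "\<not> vr s' 14 < vr s' 19" using less[of ?K] by (simp add: S2_def)
  qed (use S in auto)
  define D where "D s' \<longleftrightarrow> C s' \<and> vn s' 6 = ?H \<and> vn s' 7 = 2 * ?H\<^sup>2 \<and> vn s' 8 = ?H ^ 3 \<and> vr s' 13 = 1 / ?H \<and>
    vv s' 7 = unit_fv 0 \<and> vv s' 4 = 0 \<and> (\<forall>i\<le>j. fP s' i = 0 \<and> fG s' i = 0)" for s'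
  define S5 where "S5 k s' \<longleftrightarrow> D s' \<and> vn s' 20 = k \<and> (\<forall>t\<in>{1..k}. fP s' (j + t) = unit_fv (t - 1)) \<and>
     (\<forall>i>j + k. fP s' i = 0)" for k s'
  have ne7: "8 * i + 1 \<noteq> (7::nat)" "8 * i + 2 \<noteq> (7::nat)" for i by presburger+
  have 5: "tot (blk [BNOp NTimes 6 6 21, BNOp NTimes 7 6 6, BNOp NTimes 8 7 6, BNOp NPlus 7 7 7,
       BROf 13 6, BROp RDiv 13 6 13, BNat 20 0]) s4 7 (S5 0)" if S: "S2 ?K s4" for s4
  proof (rule J_ops)
    let ?b = "[BNOp NTimes 6 6 21, BNOp NTimes 7 6 6, BNOp NTimes 8 7 6, BNOp NPlus 7 7 7,
       BROf 13 6, BROp RDiv 13 6 13, BNat 20 0]"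
    define s5 where "s5 = ops ?b s4"
    have e: "vv s5 = (\<lambda>_. 0)(7 := unit_fv 0)" "vn s5 6 = ?H" "vn s5 7 = ?H * ?H + ?H * ?H" "vn s5 8 = ?H * ?H * ?H"
      "vr s5 13 = 1 / ?H" "C s5" "vn s5 20 = 0"
      using S by (auto simp: s5_def S2_def C1_def C_def scale_param_def)
    have "D s5" unfolding D_def using e ne7 by (simp add: fP_def fG_def power2_eq_square power3_eq_cube)
    moreover have "\<forall>i>j + 0. fP s5 i = 0" using e ne7 by (simp add: fP_def)
    ultimately have "S5 0 s5" using e by (simp add: S5_def)
    then show "S5 0 (ops ?b s4)" by (simp only: s5_def)
  qed auto
  let ?b6 = "[BNOp NPlus 23 20 2, BNOp NPlus 23 23 5, BUnit (sP 23) 20 6, BNOp NPlus 20 20 5]"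
  have 6: "tot (WhileN 20 2 (blk ?b6)) s5 (j * (4 + 2) + 2) (S5 j)" if S: "S5 0 s5" for s5
  proof (rule J_whileN[where I = S5 and v = "\<lambda>_ _. 0" and K = j])
    fix k s' assume k: "k < j" and S: "S5 k s'"
    show "tot (blk ?b6) s' 4 (S5 (Suc k))"
    proof (rule J_ops)
      define s6 where "s6 = ops ?b6 s'"
      have f: "vn s' 20 = k" "vn s' 2 = j" "vn s' 5 = 1" "vr s' 6 = 1" using S by (auto simp: S5_def D_def C_def)
      have z: "vv s' (8 * (j + Suc k) + 1) = 0"
      proof -
        have "fP s' (j + Suc k) = 0" using S by (simp add: S5_def)
        then show ?thesis by (simp only: fP_def)
      qed
      have kd: "k < d" using k d by simp
      have sl: "8 * (k + j + 1) + 1 = 8 * (j + Suc k) + 1" by simp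
      have "s6 = s'\<lparr>vn := (vn s')(23 := k + j + 1, 20 := k + 1), vv := (vv s')(8 * (k + j + 1) + 1 := mkv d ((fv_nth (vv s' (8 * (k + j + 1) + 1)))(k := 1)))\<rparr>"
        using f kd by (simp add: s6_def)
      then have e: "vv s6 = (vv s')(8 * (j + Suc k) + 1 := unit_fv k)" "vn s6 = (vn s')(23 := k + j + 1, 20 := k + 1)" "vr s6 = vr s'"
        unfolding sl z unit_fv_def by simp_all
      have P: "fP s6 i = (if i = j + Suc k then unit_fv k else fP s' i)" for i
        unfolding fP_def e by simp
      have G: "fG s6 i = fG s' i" for i
      proof -
        have "8 * i + 2 \<noteq> 8 * (j + Suc k) + 1" by presburger
        then show ?thesis unfolding fG_def e by simp
      qed
      have n7: "8 * (j + Suc k) + 1 \<noteq> 7" "8 * (j + Suc k) + 1 \<noteq> 4" by presburger+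
      have "D s6" using S n7 P G unfolding S5_def D_def C_def e by auto
      moreover have "fP s6 (j + t) = unit_fv (t - 1)" if "t \<in> {1..Suc k}" for t
        using S that by (auto simp: P S5_def le_Suc_eq)
      moreover have "\<forall>i>j + Suc k. fP s6 i = 0" using S by (auto simp: P S5_def)
      ultimately have "S5 (Suc k) s6" unfolding S5_def e by simp
      then show "S5 (Suc k) (ops ?b6 s')" by (simp only: s6_def)
    qed auto
  qed (use S in \<open>auto simp: S5_def D_def C_def\<close>)
  have 7: "J (Bas (BSmp 16)) s6 1 (\<lambda>s'. S5 j s' \<and> vn s' 16 < n) (\<lambda>s'. if vn s' 16 \<in> I then 1 else 0) p" if S: "S5 j s6" for s6
  proof (rule J_smp[where g = "\<lambda>i. if i \<in> I then 1 else 0"])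
    have "(\<Sum>i<n. if i \<in> I then 1 else (0::real)) = card I" using I(1) by (simp add: sum.If_cases Int_absorb1)
    then show "p \<le> (\<Sum>i<n. if i \<in> I then 1 else 0) / n" using I(2) by simp
  qed (use S in \<open>auto simp: S5_def D_def C_def fP_def fG_def\<close>)
  have 8: "J (blk [BPt sP0 16, BPt sG0 16]) s7 2 (started j ?H (2 * (\<gamma> + \<delta>))) (\<lambda>s'. if vn s' 16 \<in> I then 1 else 0)
      (if vn s7 16 \<in> I then 1 else 0)" if S: "S5 j s7 \<and> vn s7 16 < n" for s7
  proof (rule J_ops)
    define s8 where "s8 = ops [BPt sP0 16, BPt sG0 16] s7"
    have e: "vn s8 = vn s7" "vr s8 = vr s7" "vv s8 = (vv s7)(1 := pts (vn s7 16), 2 := pts (vn s7 16))"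
      by (simp_all add: s8_def numeral_2_eq_2)
    have P: "fP s8 i = (if i = 0 then pts (vn s7 16) else fP s7 i)" for i
    proof -
      have "8 * i + 1 \<noteq> (2::nat)" by presburger
      then show ?thesis by (simp add: fP_def e)
    qed
    have G: "fG s8 i = (if i = 0 then pts (vn s7 16) else fG s7 i)" for i
    proof -
      have "8 * i + 2 \<noteq> (1::nat)" by presburger
      then show ?thesis by (simp add: fG_def e)
    qed
    have on: "ons (\<lambda>i. fP s8 (j + i)) j"
      unfolding ons_def
    proof (intro ballI)
      fix i k assume ik: "i \<in> {1..j}" "k \<in> {1..j}"
      then have "fP s8 (j + i) = unit_fv (i - 1)" "fP s8 (j + k) = unit_fv (k - 1)"
        using S by (auto simp: P S5_def)
      moreover have "i - 1 < d" "k - 1 < d" "i - 1 = k - 1 \<longleftrightarrow> i = k" using ik d by auto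
      ultimately show "inner (fP s8 (j + i)) (fP s8 (j + k)) = (if i = k then 1 else 0)"
        by (simp add: inner_unit_fv)
    qed
    have i7: "inner (unit_fv 0) (unit_fv 0) = 1" using inner_unit_fv[of 0 0] d by simp
    have "base j ?H (2 * (\<gamma> + \<delta>)) s8"
      using S on i7 by (simp add: base_def consts_ok_def S5_def D_def C_def e)
    then have "started j ?H (2 * (\<gamma> + \<delta>)) s8"
      using S P G by (auto simp: started_def S5_def D_def e)
    then show "started j ?H (2 * (\<gamma> + \<delta>)) (ops [BPt sP0 16, BPt sG0 16] s7)" by (simp only: s8_def)
  qed auto
  have "J init_cmd s (10 + ((j * (2 + 2) + 2) + (1 + ((?K * (2 + 2) + 2) + (7 + ((j * (4 + 2) + 2) + (1 + 2)))))))
    (started j ?H (2 * (\<gamma> + \<delta>))) (\<lambda>s'. if vn s' 16 \<in> I then 1 else 0) p"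
    unfolding init_cmd_def
    by (rule J_seq_tot[OF 1 J_seq_tot[OF 2 J_seq_tot[OF 3 J_seq_tot[OF 4 J_seq_tot[OF 5 J_seq_tot[OF 6 J_seq[OF 7 8]]]]]]])
  then show ?thesis by (rule J_conseq) auto
qed

end

section \<open>Success probability of the phases\<close>

text \<open>\<open>h0\<close> is the largest value reached by at least \<open>\<theta>\<close> of
  the indices. It serves as threshold for \<open>Top\<close>: enough points qualify, and whichever
  of them is drawn, fewer than \<open>\<theta>\<close> points lie farther out and have to be
  discarded.\<close>

lemma quantile_exists:
  fixes h :: "nat \<Rightarrow> real" and \<theta> :: real
  assumes "finite S" "0 < \<theta>" "\<theta> \<le> card S"
  obtains h0 where "\<theta> \<le> card {i \<in> S. h0 \<le> h i}" "card {i \<in> S. h0 < h i} < \<theta>"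
proof -
  define V where "V = {x \<in> h ` S. \<theta> \<le> card {i \<in> S. x \<le> h i}}"
  have S0: "S \<noteq> {}" using assms by auto
  have fin: "finite V" unfolding V_def using assms(1) by auto
  have "Min (h ` S) \<in> V"
  proof -
    have "{i \<in> S. Min (h ` S) \<le> h i} = S" using assms(1) by auto
    then show ?thesis using assms S0 by (simp add: V_def)
  qed
  then have V0: "V \<noteq> {}" by auto
  define h0 where "h0 = Max V"
  have h0: "h0 \<in> V" unfolding h0_def using fin V0 by (rule Max_in)
  have "card {i \<in> S. h0 < h i} < \<theta>"
  proof (rule ccontr)
    assume c: "\<not> ?thesis"
    let ?B = "{i \<in> S. h0 < h i}"
    have "0 < card ?B" using assms(2) c by linarith
    then have B: "finite ?B" "?B \<noteq> {}" by (simp_all add: card_gt_0_iff del: Collect_empty_eq)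
    define h1 where "h1 = Min (h ` ?B)"
    have h1: "h1 \<in> h ` ?B" unfolding h1_def using B by (intro Min_in) auto
    have "?B \<subseteq> {i \<in> S. h1 \<le> h i}" unfolding h1_def using B by auto
    then have "card ?B \<le> card {i \<in> S. h1 \<le> h i}" using assms(1) by (intro card_mono) auto
    then have "h1 \<in> V" using c h1 by (auto simp: V_def)
    then have "h1 \<le> h0" unfolding h0_def using fin by simp
    then show False using h1 by auto
  qed
  then show ?thesis using that[of h0] h0 by (auto simp: V_def)
qed

lemma span_image_zero_tail:
  assumes "\<And>i. i \<in> {k<..j} \<Longrightarrow> f i = 0" "k \<le> (j::nat)"
  shows "span (f ` {1..j}) = span (f ` {1..k})"
proof
  have "f ` {1..j} \<subseteq> insert 0 (f ` {1..k})"
  proof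
    fix y assume "y \<in> f ` {1..j}"
    then obtain i where i: "i \<in> {1..j}" "y = f i" by auto
    then show "y \<in> insert 0 (f ` {1..k})" using assms(1)[of i] by (cases "i \<le> k") auto
  qed
  from span_mono[OF this] show "span (f ` {1..j}) \<subseteq> span (f ` {1..k})" by (simp add: span_insert_0)
  show "span (f ` {1..k}) \<subseteq> span (f ` {1..j})" using assms(2) by (intro span_mono image_mono) auto
qed

lemma frame_inv_subset: "frame_inv j w U v f l S \<Longrightarrow> S' \<subseteq> S \<Longrightarrow> frame_inv j w U v f l S'"
  unfolding frame_inv_def by blast

lemma frame_inv_cong:
  assumes "\<And>i. i \<in> {1..l} \<Longrightarrow> f i = f' i" "frame_inv j w U v f l S"
  shows "frame_inv j w U v f' l S"
proof -
  have im: "f ` {1..l} = f' ` {1..l}" using assms(1) by (intro image_cong) auto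
  show ?thesis using assms(2) unfolding frame_inv_def im by (simp add: assms(1))
qed

section \<open>Setting of the analysis and the greedy phase\<close>

locale fitting = vprog +
  fixes j :: nat and \<gamma> \<epsilon> \<delta> w :: real and U :: "fvec set" and b :: fvec and I :: "nat set" and u :: "nat \<Rightarrow> fvec"
  assumes u: "ons u j" "U = span (u ` {1..j})"
    and I: "I \<subseteq> {..<n}" "(1 - \<gamma>) * n \<le> card I" and near: "\<And>i. i \<in> I \<Longrightarrow> norm (perp U (pts i - b)) \<le> w"
    and w: "0 < w" and \<gamma>: "0 < \<gamma>" "\<gamma> < 1" and \<epsilon>: "0 < \<epsilon>" "\<epsilon> < 1" and \<delta>: "0 < \<delta>" "\<delta> < 1"
begin

abbreviation "H \<equiv> scale_param j \<epsilon>"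
abbreviation "K \<equiv> nat \<lceil>1 / (2 * (\<gamma> + \<delta>))\<rceil>"
abbreviation "bs0 \<equiv> base j H (2 * (\<gamma> + \<delta>))"

text \<open>The budget of \<open>\<delta> * n\<close> inliers has \<open>j + 3\<close> portions: one
  for each greedy vector, one for the points that are still long when the greedy phase ends, one for
  those beyond \<open>\<sigma>\<close>; the last one is the set from which the far points of the
  refinement are drawn.\<close>

definition \<delta>' :: real where "\<delta>' = \<delta> / (real j + 3)"

definition pf :: real where "pf = \<delta>' / (4 * (\<gamma> + \<delta>))"

definition hs :: "vst \<Rightarrow> nat \<Rightarrow> real" where
  "hs s i = norm (perp (span (fP s ` {1..j})) (pts i - fP s 0))"

definition approx :: "vst \<Rightarrow> bool" where
  "approx s \<longleftrightarrow> (1 - \<delta> - \<gamma>) * n \<le> card {i \<in> {..<n}. hs s i \<le> (1 + \<epsilon>) * w}"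

lemma finI: "finite I" using I(1) finite_subset by blast

lemma \<delta>'_pos: "0 < \<delta>'" "(real j + 3) * \<delta>' = \<delta>" using \<delta> by (auto simp: \<delta>'_def)

lemma pf_bounds: "0 < pf" "pf \<le> 1 / 4"
proof -
  show "0 < pf" using \<delta>'_pos \<gamma> \<delta> by (simp add: pf_def)
  have "\<delta>' \<le> \<delta>" using \<delta> by (simp add: \<delta>'_def divide_le_eq mult_le_cancel_left1)
  then have "\<delta>' \<le> \<gamma> + \<delta>" using \<gamma> by simp
  then show "pf \<le> 1 / 4" using \<gamma> \<delta> by (simp add: pf_def field_simps)
qed

text \<open>If \<open>\<gamma> + \<delta>\<close> is at least 1, nothing is required of the flat.
  Otherwise the bound below 1 is available that \<open>best_value_ge\<close> asks for.\<close>

lemma not_approx_sum: "\<not> approx s \<Longrightarrow> \<gamma> + \<delta> < 1"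
proof (rule ccontr)
  assume "\<not> approx s" "\<not> \<gamma> + \<delta> < 1"
  then have "(1 - \<delta> - \<gamma>) * n \<le> 0" by (intro mult_nonpos_nonneg) auto
  then show False using \<open>\<not> approx s\<close> by (simp add: approx_def)
qed

lemma card_sub:
  assumes "S \<subseteq> I" "card (I - S) \<le> m * \<delta>' * n"
  shows "(1 - \<gamma>) * n - m * \<delta>' * n \<le> card S"
proof -
  have "card (I - S) + card S = card I"
    using assms(1) finI by (metis card_Diff_subset card_mono finite_subset le_add_diff_inverse2)
  then have "real (card (I - S)) + card S = card I" by (metis of_nat_add)
  then show ?thesis using assms(2) I(2) by linarith
qed

definition far_ok :: "vst \<Rightarrow> vst \<Rightarrow> bool" where
  "far_ok s s' \<longleftrightarrow> same {12..19} {9, 10, 11, 14} Eslots s s' \<and> vn s' 17 < n \<and>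
     vv s' 5 = perp (span (fP s ` {1..j})) (pts (vn s' 17) - fP s 0)"

lemma far_ok_fams:
  assumes "far_ok s s'"
  shows "fP s' = fP s" "fG s' = fG s" "vn s' 8 = vn s 8" "vn s' 9 = vn s 9" "vn s' 10 = vn s 10" "vn s' 11 = vn s 11"
    "vr s' 12 = vr s 12"
proof -
  have v: "vv s' x = vv s x" if "x \<notin> Eslots" for x using assms that by (simp add: far_ok_def same_def)
  show "fP s' = fP s" by (rule ext) (simp only: fP_def v[OF Eslots_mem(3)])
  show "fG s' = fG s" by (rule ext) (simp only: fG_def v[OF Eslots_mem(4)])
qed (use assms in \<open>auto simp: far_ok_def same_def\<close>)

lemma far_ok_base: "bs0 s \<Longrightarrow> far_ok s s' \<Longrightarrow> bs0 s'"
  by (erule base_same[of _ _ _ _ "{12..19}" "{9, 10, 11, 14}" Eslots])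
    (auto simp: far_ok_def Eslots_mem simp del: distrib_left_numeral)

lemma hs_cong: "fP s' = fP s \<Longrightarrow> hs s' = hs s" "fP s' = fP s \<Longrightarrow> approx s' = approx s"
  by (auto simp: hs_def approx_def)

lemma far_tot:
  assumes "bs0 s"
  shows "tot far_cmd s (far_time j K) (far_ok s)"
proof -
  have f: "consts_ok s" "vr s 8 = 2 * (\<gamma> + \<delta>)" "vn s 2 = j" using assms by (auto simp: base_def)
  have "J far_cmd s (far_time (vn s 2) (draws s))
    (\<lambda>s'. same {12..19} {9, 10, 11, 14} Eslots s s' \<and> vn s' 17 < n \<and>
      vv s' 5 = perp (span (fP s ` {1..vn s 2})) (pts (vn s' 17) - fP s 0))
    (\<lambda>s'. if vn s' 17 \<in> {} then 1 else 0) (best_value {} {} (draws s) False 0)"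
    by (rule far_spec) (use f \<gamma> \<delta> in auto)
  then have "tot far_cmd s (far_time (vn s 2) (draws s))
    (\<lambda>s'. same {12..19} {9, 10, 11, 14} Eslots s s' \<and> vn s' 17 < n \<and>
      vv s' 5 = perp (span (fP s ` {1..vn s 2})) (pts (vn s' 17) - fP s 0))" by (rule J_tot)
  then show ?thesis by (rule J_conseq) (auto simp: far_ok_def f draws_def)
qed

text \<open>\<open>Bad\<close> consists of the outliers and the inliers already discarded, at most
  \<open>(\<gamma> + \<delta> - \<delta>') * n\<close> points. As \<open>P\<close> is upward closed,
  the points satisfying it are farther out than all other points of \<open>S\<close>.\<close>

lemma far_J:
  assumes b: "bs0 s" and na: "\<not> approx s" and S: "S \<subseteq> I" "card (I - S) \<le> (real j + 2) * \<delta>' * n"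
    and up: "\<And>x y. P x \<Longrightarrow> x \<le> y \<Longrightarrow> P y" and top: "\<delta>' * n \<le> card {i \<in> S. P (hs s i)}"
  shows "J far_cmd s (far_time j K) (far_ok s) (\<lambda>s'. if vn s' 17 \<in> {i \<in> S. P (hs s i)} then 1 else 0) pf"
proof -
  let ?Top = "{i \<in> S. P (hs s i)}" and ?Bad = "{..<n} - S"
  have f: "consts_ok s" "vr s 8 = 2 * (\<gamma> + \<delta>)" "vn s 2 = j" using b by (auto simp: base_def)
  have sm: "\<gamma> + \<delta> < 1" by (rule not_approx_sum[OF na])
  have S': "S \<subseteq> {..<n}" "finite S" using S(1) I(1) finI finite_subset by auto
  have TB: "?Top \<subseteq> {..<n}" "?Bad \<subseteq> {..<n}" "?Top \<inter> ?Bad = {}" using S' by auto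
  have "J far_cmd s (far_time (vn s 2) (draws s))
    (\<lambda>s'. same {12..19} {9, 10, 11, 14} Eslots s s' \<and> vn s' 17 < n \<and>
      vv s' 5 = perp (span (fP s ` {1..vn s 2})) (pts (vn s' 17) - fP s 0))
    (\<lambda>s'. if vn s' 17 \<in> ?Top then 1 else 0) (best_value ?Top ?Bad (draws s) False 0)"
  proof (rule far_spec[OF f(1) _ TB])
    show "0 < vr s 8" using f \<gamma> \<delta> by simp
    fix i k assume ik: "i \<in> ?Top" "k < n" "k \<notin> ?Top" "k \<notin> ?Bad"
    then have "P (hs s i)" "\<not> P (hs s k)" by auto
    then have "hs s k < hs s i" using up by (meson not_le)
    then show "norm (perp (span (fP s ` {1..vn s 2})) (pts k - fP s 0))
        < norm (perp (span (fP s ` {1..vn s 2})) (pts i - fP s 0))" by (simp add: hs_def f)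
  qed
  moreover have "pf \<le> best_value ?Top ?Bad (draws s) False 0"
  proof -
    have "real (card ?Bad) = real n - real (card S)"
      using S' card_mono[OF _ S'(1)] by (simp add: card_Diff_subset of_nat_diff)
    also have "\<dots> \<le> real n - ((1 - \<gamma>) * n - (real j + 2) * \<delta>' * n)" using card_sub[OF S] by simp
    also have "\<dots> = (\<gamma> + (real j + 2) * \<delta>') * n" by (simp add: algebra_simps)
    also have "(real j + 2) * \<delta>' = \<delta> - \<delta>'" using \<delta>'_pos(2) by (simp add: algebra_simps)
    finally have "card ?Bad \<le> (\<gamma> + \<delta> - \<delta>') * n" by (simp add: algebra_simps)
    then show ?thesis
      using best_value_ge[OF TB, of "\<gamma> + \<delta>" \<delta>' 0] sm top \<delta>'_pos \<gamma> \<delta> by (simp add: pf_def draws_def f)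
  qed
  ultimately show ?thesis
    by (elim J_conseq) (auto simp: far_ok_def f draws_def)
qed

definition greedy_state :: "vst \<Rightarrow> nat set \<Rightarrow> bool" where
  "greedy_state s S \<longleftrightarrow> vn s 9 \<le> j \<and> frame_inv j w U (fP s 0) (fP s) (vn s 9) (pts ` S) \<and> S \<subseteq> I \<and>
     card (I - S) \<le> real (vn s 9) * \<delta>' * n \<and> (\<forall>i\<in>{vn s 9<..j}. fP s i = 0) \<and> (\<forall>i\<le>j. fG s i = fP s i) \<and>
     (\<exists>i\<in>I. fP s 0 = pts i)"

definition short_state :: "vst \<Rightarrow> nat set \<Rightarrow> bool" where
  "short_state s S \<longleftrightarrow> greedy_state s S \<and> card {i \<in> S. 5 ^ Suc (vn s 9) * w < hs s i} < \<delta>' * n"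

text \<open>The states in which ending the greedy phase is the right choice.\<close>

definition decided :: "vst \<Rightarrow> bool" where "decided s \<longleftrightarrow> approx s \<or> (\<exists>S. short_state s S)"

lemma greedy_state_span: "greedy_state s S \<Longrightarrow> span (fP s ` {1..j}) = span (fP s ` {1..vn s 9})"
  by (rule span_image_zero_tail) (auto simp: greedy_state_def)

text \<open>The flat passes through the start point; if there is no other point, it is an
  approximation. So the outcome of the coin that means going on is only wanted when it is
  possible.\<close>

lemma greedy_n2:
  assumes "greedy_state s S" "\<not> approx s"
  shows "2 \<le> n"
proof (rule ccontr)
  assume "\<not> 2 \<le> n"
  then have n: "n = 1" using n1 by simp
  obtain i where i: "i \<in> I" "fP s 0 = pts i" using assms(1) by (auto simp: greedy_state_def)
  then have "i = 0" using I(1) n by auto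
  have "hs s 0 = 0" using i \<open>i = 0\<close> perp_zero[of "fP s ` {1..j}" 0] by (simp add: hs_def span_zero)
  then have "{i \<in> {..<n}. hs s i \<le> (1 + \<epsilon>) * w} = {0}" using n w \<epsilon> by auto
  then have c: "card {i \<in> {..<n}. hs s i \<le> (1 + \<epsilon>) * w} = 1" by simp
  have "(1 - \<delta> - \<gamma>) * real n \<le> 1" using n \<gamma> \<delta> by simp
  then have "approx s" unfolding approx_def c by simp
  then show False using assms(2) by simp
qed

text \<open>Discarding the points farther out than \<open>q\<close> is what keeps the coordinates
  along the new vector at most 1. This uses one portion of the budget.\<close>

lemma greedy_step_state:
  assumes g: "greedy_state s S" and q: "q \<in> S" "5 ^ Suc (vn s 9) * w < hs s q"
    and few: "card {i \<in> S. hs s q < hs s i} < \<delta>' * n"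
    and P: "\<And>i. i \<le> j \<Longrightarrow> fP s' i = (if i = Suc (vn s 9) then perp (span (fP s ` {1..j})) (pts q - fP s 0) else fP s i)"
    and G: "\<And>i. i \<le> j \<Longrightarrow> fG s' i = (if i = Suc (vn s 9) then perp (span (fP s ` {1..j})) (pts q - fP s 0) else fG s i)"
    and k: "vn s' 9 = Suc (vn s 9)"
  shows "greedy_state s' {i \<in> S. hs s i \<le> hs s q}"
proof -
  let ?k = "vn s 9" and ?S = "{i \<in> S. hs s i \<le> hs s q}"
  define r where "r = perp (span (fP s ` {1..?k})) (pts q - fP s 0)"
  have sp: "span (fP s ` {1..j}) = span (fP s ` {1..?k})" by (rule greedy_state_span[OF g])
  have SI: "S \<subseteq> I" and cS: "card (I - S) \<le> real ?k * \<delta>' * n" using g by (auto simp: greedy_state_def)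
  have n0: "norm (perp U (fP s 0 - b)) \<le> w" using g near by (auto simp: greedy_state_def)
  have nq: "norm (perp U (pts q - b)) \<le> w" using near SI q by auto
  have rq: "norm r = hs s q" by (simp add: r_def hs_def sp)
  have inv0: "frame_inv j w U (fP s 0) (fP s) ?k (pts ` S)" using g by (simp add: greedy_state_def)
  have inv: "frame_inv j w U (fP s 0) ((fP s)(Suc ?k := r)) (Suc ?k)
      {p \<in> pts ` S. norm (perp (span (fP s ` {1..?k})) (p - fP s 0)) \<le> norm r}"
    by (rule frame_inv_step[OF inv0 _ n0 nq])
      (use w q rq in \<open>auto simp: r_def[symmetric]\<close>)
  have kj: "Suc ?k \<le> j" using inv by (simp add: frame_inv_def)
  have "frame_inv j w U (fP s 0) ((fP s)(Suc ?k := r)) (Suc ?k) (pts ` ?S)"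
    by (rule frame_inv_subset[OF inv]) (auto simp: rq, simp add: hs_def sp)
  then have "frame_inv j w U (fP s 0) (fP s') (Suc ?k) (pts ` ?S)"
    by (rule frame_inv_cong[rotated]) (use P kj in \<open>auto simp: r_def sp\<close>)
  moreover have "fP s' 0 = fP s 0" using P[of 0] by simp
  moreover have "card (I - ?S) \<le> real (Suc ?k) * \<delta>' * n"
  proof -
    have "I - ?S \<subseteq> (I - S) \<union> {i \<in> S. hs s q < hs s i}" by auto
    then have "card (I - ?S) \<le> card ((I - S) \<union> {i \<in> S. hs s q < hs s i})"
      using finI SI by (intro card_mono) (auto intro: finite_subset)
    also have "\<dots> \<le> card (I - S) + card {i \<in> S. hs s q < hs s i}" by (rule card_Un_le)
    finally have "real (card (I - ?S)) \<le> card (I - S) + card {i \<in> S. hs s q < hs s i}" by linarith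
    then show ?thesis using cS few by (simp add: algebra_simps)
  qed
  ultimately show ?thesis
    using g kj P G SI unfolding greedy_state_def k by auto
qed

text \<open>A further long residual would extend the frame to \<open>j + 1\<close> vectors, against
  \<open>frame_inv_step\<close>.\<close>

lemma greedy_full_short:
  assumes g: "greedy_state s S" "vn s 9 = j"
  shows "short_state s S"
proof -
  have e: "{i \<in> S. 5 ^ Suc (vn s 9) * w < hs s i} = {}"
  proof (rule ccontr)
    assume "\<not> ?thesis"
    then obtain q where q: "q \<in> S" "5 ^ Suc (vn s 9) * w < hs s q" by auto
    have SI: "S \<subseteq> I" using g by (auto simp: greedy_state_def)
    have n0: "norm (perp U (fP s 0 - b)) \<le> w" using g near by (auto simp: greedy_state_def)
    have nq: "norm (perp U (pts q - b)) \<le> w" using near SI q by auto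
    have inv0: "frame_inv j w U (fP s 0) (fP s) (vn s 9) (pts ` S)" using g by (simp add: greedy_state_def)
    have "frame_inv j w U (fP s 0) ((fP s)(Suc (vn s 9) := perp (span (fP s ` {1..vn s 9})) (pts q - fP s 0))) (Suc (vn s 9))
      {p \<in> pts ` S. norm (perp (span (fP s ` {1..vn s 9})) (p - fP s 0)) \<le> norm (perp (span (fP s ` {1..vn s 9})) (pts q - fP s 0))}"
      by (rule frame_inv_step[OF inv0 _ n0 nq]) (use w q g in \<open>auto simp: hs_def\<close>)
    then show False using g(2) by (simp add: frame_inv_def)
  qed
  show ?thesis unfolding short_state_def e using g(1) \<delta>'_pos(1) n1 by simp
qed

text \<open>\<open>1 / 3\<close> for the coin that says to go on, \<open>pf\<close> for the far
  point. Being at most \<open>1 / 2\<close>, it also covers a round in which the coin has to say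
  stop.\<close>

definition q1 :: real where "q1 = pf / 3"

lemma q1_bounds: "0 < q1" "q1 \<le> 1 / 2" using pf_bounds by (auto simp: q1_def)

lemma coin_base: "bs0 s \<Longrightarrow> same {18} {} {} s s' \<Longrightarrow> bs0 s'"
  by (erule base_same) auto

text \<open>In each round one outcome of the coin is counted: stop if the state is decided, go on
  otherwise. While the phase runs as intended after \<open>k\<close> rounds, the value is
  \<open>q1 ^ (j - k) * A\<close>, where \<open>A\<close> stands for the success probability of the
  later phases.\<close>

lemma greedy_spec:
  assumes b: "bs0 s" and A: "0 \<le> A" and T8: "vn s 8 = H ^ 3"
    and st: "started j H (2 * (\<gamma> + \<delta>)) s"
  shows "J greedy_cmd s (j * (far_time j K + 15) + 4) (\<lambda>s'. bs0 s' \<and> vn s' 8 = H ^ 3 \<and> vn s' 9 \<le> j)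
    (\<lambda>s'. if decided s' then A else 0) (if vn s 16 \<in> I then q1 ^ j * A else 0)"
proof -
  define L where "L k s' \<longleftrightarrow> bs0 s' \<and> vn s' 8 = H ^ 3 \<and> vn s' 9 \<le> j \<and> ((vn s' 10 = j \<and> vn s' 9 = k) \<or> vn s' 10 = 0)" for k s'
  define v where "v k s' = (if vn s' 10 = j \<and> vn s' 9 = k \<and> (\<exists>S. greedy_state s' S) then q1 ^ (j - k) * A
    else if vn s' 10 = 0 \<and> decided s' then A else 0)" for k and s' :: vst
  have q1p: "q1 ^ i \<le> 1" "0 \<le> q1 ^ i" for i using q1_bounds by (auto intro: power_le_one)
  have v0: "0 \<le> v k s'" for k s' using A q1p by (simp add: v_def)
  have 1: "J (blk [BNat 9 0, BNOp NPlus 10 2 4]) s 2 (L 0) (v 0) (if vn s 16 \<in> I then q1 ^ j * A else 0)"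
  proof (rule J_ops)
    define s1 where "s1 = ops [BNat 9 0, BNOp NPlus 10 2 4] s"
    have sm: "same {9, 10} {} {} s s1" by (auto simp: s1_def same_def)
    have b1: "bs0 s1" by (rule base_same[OF b sm]) auto
    have e: "vn s1 9 = 0" "vn s1 10 = j" "vn s1 8 = H ^ 3" using b T8 by (auto simp: s1_def base_def consts_ok_def)
    have PG: "fP s1 = fP s" "fG s1 = fG s" using sm by (auto simp: same_def fP_def fG_def)
    show "L 0 (ops [BNat 9 0, BNOp NPlus 10 2 4] s)" unfolding s1_def[symmetric] using b1 e by (simp add: L_def)
    have "(if vn s 16 \<in> I then q1 ^ j * A else 0) \<le> v 0 s1"
    proof (cases "vn s 16 \<in> I")
      case True
      have "greedy_state s1 I"
        using st True frame_inv_0[OF u] by (auto simp: greedy_state_def e(1) PG started_def)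
      then have "\<exists>S. greedy_state s1 S" by blast
      then show ?thesis using True by (simp add: v_def e)
    qed (use v0[of 0 s1] in simp)
    then show "(if vn s 16 \<in> I then q1 ^ j * A else 0) \<le> v 0 (ops [BNat 9 0, BNOp NPlus 10 2 4] s)"
      by (simp only: s1_def)
  qed auto
  let ?fin = "[BNOp NPlus 9 9 5, BLin (sP 9) 6 sT sZ, BLin (sG 9) 6 sT sZ]"
  let ?body = "coin ;; IfN 18 3 (blk [BNat 10 0]) ;; IfN 9 10 (far_cmd ;; blk ?fin)"
  have fin_facts: "bs0 s2 \<and> vn s2 8 = vn s1 8 \<and> vn s2 9 = Suc (vn s1 9) \<and> vn s2 10 = vn s1 10 \<and>
      (\<forall>i\<le>j. fP s2 i = (if i = Suc (vn s1 9) then vv s1 5 else fP s1 i)) \<and>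
      (\<forall>i\<le>j. fG s2 i = (if i = Suc (vn s1 9) then vv s1 5 else fG s1 i))"
    if s2: "s2 = ops ?fin s1" and b1: "bs0 s1" and k: "vn s1 9 < j" for s1 s2
  proof -
    let ?k = "vn s1 9"
    have f: "vn s1 5 = 1" "vr s1 6 = 1" "vv s1 4 = 0" using b1 by (auto simp: base_def consts_ok_def)
    have ne: "8 * Suc ?k + 1 \<noteq> 5" "8 * Suc ?k + 1 \<noteq> 4" by presburger+
    have vv2: "vv s2 = (vv s1)(8 * Suc ?k + 1 := vv s1 5, 8 * Suc ?k + 2 := vv s1 5)"
      using f ne by (simp add: s2 add.commute)
    have n2: "vn s2 = (vn s1)(9 := Suc ?k)" "vr s2 = vr s1" using f by (simp_all add: s2 One_nat_def)
    have sm: "same {9} {} {8 * Suc ?k + 1, 8 * Suc ?k + 2} s1 s2" by (simp add: same_def vv2 n2)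
    have "bs0 s2"
    proof (rule base_same[OF b1 sm])
      show "4 \<notin> {8 * Suc ?k + 1, 8 * Suc ?k + 2}" by (simp only: insert_iff empty_iff) presburger
      show "7 \<notin> {8 * Suc ?k + 1, 8 * Suc ?k + 2}" by (simp only: insert_iff empty_iff) presburger
      fix i assume "i \<in> {1..j}"
      then have "j + i \<noteq> Suc ?k" using k by auto
      then show "8 * (j + i) + 1 \<notin> {8 * Suc ?k + 1, 8 * Suc ?k + 2}"
        by (simp only: insert_iff empty_iff) presburger
    qed auto
    moreover have "fP s2 i = (if i = Suc ?k then vv s1 5 else fP s1 i)" for i
    proof -
      have "8 * i + 1 \<noteq> 8 * Suc ?k + 2" by presburger
      then show ?thesis by (simp add: fP_def vv2)
    qed
    moreover have "fG s2 i = (if i = Suc ?k then vv s1 5 else fG s1 i)" for i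
    proof -
      have "8 * i + 2 \<noteq> 8 * Suc ?k + 1" by presburger
      then show ?thesis by (simp add: fG_def vv2)
    qed
    ultimately show ?thesis by (simp add: n2)
  qed
  have step: "J ?body s0 (far_time j K + 13) (L (Suc k)) (v (Suc k)) (v k s0)"
    if k: "k < j" and L0: "L k s0" and t0: "vn s0 9 < vn s0 10" for k s0
  proof -
    have b0: "bs0 s0" and n3: "vn s0 3 = n" and run: "vn s0 10 = j" "vn s0 9 = k" and T0: "vn s0 8 = H ^ 3"
      using L0 t0 by (auto simp: L_def base_def)
    have cong: "hs s' = hs s0" "approx s' = approx s0" "fP s' = fP s0" "fG s' = fG s0" if "same NS RS {} s0 s'" for NS RS s'
    proof -
      have "fP s' = fP s0" "fG s' = fG s0" using that by (auto simp: same_def fP_def fG_def)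
      then show "hs s' = hs s0" "approx s' = approx s0" "fP s' = fP s0" "fG s' = fG s0" using hs_cong[of s' s0] by auto
    qed
    have stop: "J (IfN 18 3 (blk [BNat 10 0]) ;; IfN 9 10 (far_cmd ;; blk ?fin)) s1 ((1 + 2) + (far_time j K + 3 + 2)) (L (Suc k)) (v (Suc k))
        (if decided s0 then A else 0)" if s1: "same {18} {} {} s0 s1" and c: "vn s1 18 < vn s1 3" for s1
    proof (rule J_seq_tot)
      show "tot (IfN 18 3 (blk [BNat 10 0])) s1 (1 + 2) (\<lambda>s'. same {18, 10} {} {} s0 s' \<and> vn s' 10 = 0)"
      proof (rule J_ifN)
        show "tot (blk [BNat 10 0]) s1 1 (\<lambda>s'. same {18, 10} {} {} s0 s' \<and> vn s' 10 = 0)"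
          by (rule J_ops) (use s1 in \<open>auto simp: same_def One_nat_def\<close>)
      qed (use c in auto)
      fix s2 assume s2: "same {18, 10} {} {} s0 s2 \<and> vn s2 10 = 0"
      have b2: "bs0 s2" by (rule base_same[OF b0 conjunct1[OF s2]]) auto
      have e: "vn s2 9 = k" "vn s2 8 = H ^ 3" using s2 run T0 by (auto simp: same_def)
      have d2: "decided s2 = decided s0"
        using cong[OF conjunct1[OF s2]] e run by (simp add: decided_def short_state_def greedy_state_def)
      show "J (IfN 9 10 (far_cmd ;; blk ?fin)) s2 (far_time j K + 3 + 2) (L (Suc k)) (v (Suc k)) (if decided s0 then A else 0)"
      proof (rule J_ifN)
        assume "\<not> vn s2 9 < vn s2 10"
        have "(if decided s0 then A else 0) \<le> v (Suc k) s2"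
          using v0[of "Suc k" s2] s2 d2 k by (auto simp: v_def)
        then show "L (Suc k) s2 \<and> (if decided s0 then A else 0) \<le> v (Suc k) s2"
          using b2 e s2 k by (simp add: L_def)
      qed (use s2 in simp)
    qed
    have go: "J (IfN 18 3 (blk [BNat 10 0]) ;; IfN 9 10 (far_cmd ;; blk ?fin)) s1 ((1 + 2) + (far_time j K + 3 + 2)) (L (Suc k)) (v (Suc k))
        (if (\<exists>S. greedy_state s0 S) \<and> \<not> decided s0 then pf * (q1 ^ (j - Suc k) * A) else 0)"
      if s1: "same {18} {} {} s0 s1" and c: "\<not> vn s1 18 < vn s1 3" for s1
    proof (rule J_seq_tot)
      show "tot (IfN 18 3 (blk [BNat 10 0])) s1 (1 + 2) (\<lambda>s'. same {18} {} {} s0 s')"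
        by (rule J_ifN) (use c s1 in auto)
      fix s2 assume s2: "same {18} {} {} s0 s2"
      have b2: "bs0 s2" by (rule coin_base[OF b0 s2])
      have e: "vn s2 9 = k" "vn s2 10 = j" "vn s2 8 = H ^ 3" using s2 run T0 by (auto simp: same_def)
      note cg = cong[OF s2]
      have tail: "tot (blk ?fin) s3 3 (\<lambda>s4. s4 = ops ?fin s3 \<and> L (Suc k) s4)" if s3: "far_ok s2 s3" for s3
      proof (rule J_ops)
        have b3: "bs0 s3" by (rule far_ok_base[OF b2 s3])
        have e3: "vn s3 9 = k" "vn s3 10 = j" "vn s3 8 = H ^ 3" using far_ok_fams[OF s3] e by auto
        define s4 where "s4 = ops ?fin s3"
        have "L (Suc k) s4" using fin_facts[OF s4_def b3] e3 k by (simp add: L_def)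
        then show "ops ?fin s3 = ops ?fin s3 \<and> L (Suc k) (ops ?fin s3)" by (simp only: s4_def simp_thms)
      qed auto
      have tailJ: "J (blk ?fin) s3 3 (L (Suc k)) (v (Suc k)) g0" if s3: "far_ok s2 s3"
        and g0: "\<And>s4. s4 = ops ?fin s3 \<Longrightarrow> g0 \<le> v (Suc k) s4" for s3 g0
      proof -
        have "J (blk ?fin) s3 3 (\<lambda>s4. s4 = ops ?fin s3 \<and> L (Suc k) s4) (v (Suc k)) g0"
          by (rule J_const[OF tail[OF s3]]) (use g0 in blast)
        then show ?thesis by (rule J_conseq) auto
      qed
      show "J (IfN 9 10 (far_cmd ;; blk ?fin)) s2 (far_time j K + 3 + 2) (L (Suc k)) (v (Suc k))
        (if (\<exists>S. greedy_state s0 S) \<and> \<not> decided s0 then pf * (q1 ^ (j - Suc k) * A) else 0)"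
      proof (rule J_ifN)
        show "J (far_cmd ;; blk ?fin) s2 (far_time j K + 3) (L (Suc k)) (v (Suc k))
          (if (\<exists>S. greedy_state s0 S) \<and> \<not> decided s0 then pf * (q1 ^ (j - Suc k) * A) else 0)"
        proof (cases "(\<exists>S. greedy_state s0 S) \<and> \<not> decided s0")
          case True
          then obtain S where S0: "greedy_state s0 S" and nd: "\<not> decided s0" by blast
          have S: "greedy_state s2 S" using S0 cg e run by (simp add: greedy_state_def)
          have na: "\<not> approx s2" using nd cg by (simp add: decided_def)
          let ?S' = "{i \<in> S. 5 ^ Suc k * w < hs s2 i}"
          have long: "\<delta>' * n \<le> card ?S'"
            using nd S0 cg run by (auto simp: decided_def short_state_def not_less)
          have SI: "S \<subseteq> I" and finS: "finite S" using S finI by (auto simp: greedy_state_def intro: finite_subset)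
          obtain h0 where h0: "\<delta>' * n \<le> card {i \<in> ?S'. h0 \<le> hs s2 i}" "card {i \<in> ?S'. h0 < hs s2 i} < \<delta>' * n"
            using quantile_exists[of ?S' "\<delta>' * n" "hs s2"] finS long \<delta>'_pos n1 by auto
          \<comment> \<open>Both conditions are upward closed: long enough for
            \<open>frame_inv_step\<close>, and so far out that fewer than
            \<open>\<delta>' * n\<close> points get lost.\<close>
          define P where "P x \<longleftrightarrow> 5 ^ Suc k * w < x \<and> h0 \<le> x" for x
          have Top: "{i \<in> S. P (hs s2 i)} = {i \<in> ?S'. h0 \<le> hs s2 i}" by (auto simp: P_def)
          have cS: "card (I - S) \<le> (real j + 2) * \<delta>' * n"
          proof -
            have "card (I - S) \<le> real k * \<delta>' * n" using S e by (simp add: greedy_state_def)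
            also have "\<dots> \<le> (real j + 2) * \<delta>' * n" using k \<delta>'_pos by (intro mult_right_mono) auto
            finally show ?thesis .
          qed
          have far: "J far_cmd s2 (far_time j K) (far_ok s2) (\<lambda>s'. if vn s' 17 \<in> {i \<in> S. P (hs s2 i)} then 1 else 0) pf"
            by (rule far_J[OF b2 na SI cS]) (use h0(1) in \<open>auto simp: P_def Top[symmetric]\<close>)
          let ?V = "q1 ^ (j - Suc k) * A"
          have V0: "0 \<le> ?V" using A q1p by simp
          have "J (far_cmd ;; blk ?fin) s2 (far_time j K + 3) (L (Suc k)) (v (Suc k)) (?V * pf)"
          proof (rule J_seq[OF J_scale[OF far V0]])
            fix s3 assume s3: "far_ok s2 s3"
            show "J (blk ?fin) s3 3 (L (Suc k)) (v (Suc k)) (?V * (if vn s3 17 \<in> {i \<in> S. P (hs s2 i)} then 1 else 0))"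
            proof (rule tailJ[OF s3])
              fix s4 assume s4: "s4 = ops ?fin s3"
              have b3: "bs0 s3" by (rule far_ok_base[OF b2 s3])
              note ff = far_ok_fams[OF s3]
              have k3: "vn s3 9 < j" using ff e k by simp
              note f4 = fin_facts[OF s4 b3 k3]
              show "?V * (if vn s3 17 \<in> {i \<in> S. P (hs s2 i)} then 1 else 0) \<le> v (Suc k) s4"
              proof (cases "vn s3 17 \<in> {i \<in> S. P (hs s2 i)}")
                case True
                let ?q = "vn s3 17"
                have q: "?q \<in> S" "5 ^ Suc (vn s2 9) * w < hs s2 ?q" "h0 \<le> hs s2 ?q" using True e by (auto simp: P_def)
                have "{i \<in> S. hs s2 ?q < hs s2 i} \<subseteq> {i \<in> ?S'. h0 < hs s2 i}" using q e by auto
                then have "card {i \<in> S. hs s2 ?q < hs s2 i} \<le> card {i \<in> ?S'. h0 < hs s2 i}"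
                  using finS by (intro card_mono) auto
                then have few: "card {i \<in> S. hs s2 ?q < hs s2 i} < \<delta>' * n" using h0(2) by linarith
                have v5: "vv s3 5 = perp (span (fP s2 ` {1..j})) (pts ?q - fP s2 0)" using s3 by (simp add: far_ok_def)
                have "greedy_state s4 {i \<in> S. hs s2 i \<le> hs s2 ?q}"
                  by (rule greedy_step_state[OF S q(1,2) few]) (use f4 ff v5 in auto)
                moreover have "vn s4 10 = j" "vn s4 9 = Suc k" using f4 ff e by auto
                ultimately show ?thesis using True by (auto simp: v_def)
              next
                case False
                then have z: "(if vn s3 17 \<in> {i \<in> S. P (hs s2 i)} then 1 else 0) = (0::real)" by (rule if_not_P)
                show ?thesis unfolding z mult_zero_right by (rule v0)
              qed
            qed
          qed
          then show ?thesis using True by (simp add: mult.commute)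
        next
          case False
          then have z: "(if (\<exists>S. greedy_state s0 S) \<and> \<not> decided s0 then pf * (q1 ^ (j - Suc k) * A) else 0) = 0" by auto
          show ?thesis unfolding z
            by (rule J_seq_tot[OF far_tot[OF b2]], rule tailJ) (use v0 in auto)
        qed
        show "L (Suc k) s2 \<and> (if (\<exists>S. greedy_state s0 S) \<and> \<not> decided s0 then pf * (q1 ^ (j - Suc k) * A) else 0) \<le> v (Suc k) s2"
          if "\<not> vn s2 9 < vn s2 10" using that e k by simp
      qed
    qed
    define wa wb where "wa = (if decided s0 then A else 0)"
      and "wb = (if (\<exists>S. greedy_state s0 S) \<and> \<not> decided s0 then pf * (q1 ^ (j - Suc k) * A) else 0)"
    have coin: "J coin s0 2 (same {18} {} {} s0) (\<lambda>s'. if vn s' 18 < vn s' 3 then wa else wb) (v k s0)"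
    proof (rule coin_J[OF n3, of wa _ wb])
      show "0 \<le> wa" "0 \<le> wb" using A pf_bounds q1p by (auto simp: wa_def wb_def)
      show "v k s0 \<le> wa / 2 \<or> (2 \<le> n \<and> v k s0 \<le> wb / 3) \<or> v k s0 \<le> 0"
      proof (cases "\<exists>S. greedy_state s0 S")
        case True
        have vk: "v k s0 = q1 ^ (j - k) * A" using True run by (simp add: v_def)
        have jk: "q1 ^ (j - k) = q1 * q1 ^ (j - Suc k)" using k by (simp add: Suc_diff_Suc[symmetric])
        show ?thesis
        proof (cases "decided s0")
          case True
          have "q1 * q1 ^ (j - Suc k) \<le> 1 / 2 * 1" using q1_bounds q1p by (intro mult_mono) auto
          then have "v k s0 \<le> 1 / 2 * A" unfolding vk jk using A by (intro mult_right_mono) auto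
          then show ?thesis using True by (simp add: wa_def)
        next
          case False
          obtain S where S: "greedy_state s0 S" using True by blast
          have "2 \<le> n" by (rule greedy_n2[OF S]) (use False in \<open>simp add: decided_def\<close>)
          moreover have "v k s0 = wb / 3" unfolding vk jk using True False by (simp add: wb_def q1_def)
          ultimately show ?thesis by simp
        qed
      next
        case False
        then have "v k s0 \<le> 0" using run k by (simp add: v_def)
        then show ?thesis by simp
      qed
    qed auto
    have "J ?body s0 (2 + ((1 + 2) + (far_time j K + 3 + 2))) (L (Suc k)) (v (Suc k)) (v k s0)"
    proof (rule J_seq[OF coin])
      fix s1 assume s1: "same {18} {} {} s0 s1"
      show "J (IfN 18 3 (blk [BNat 10 0]) ;; IfN 9 10 (far_cmd ;; blk ?fin)) s1 ((1 + 2) + (far_time j K + 3 + 2)) (L (Suc k)) (v (Suc k))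
        (if vn s1 18 < vn s1 3 then wa else wb)"
        using stop[OF s1] go[OF s1] by (cases "vn s1 18 < vn s1 3") (simp_all add: wa_def wb_def)
    qed
    then show ?thesis by (rule J_conseq) auto
  qed
  have 2: "J (WhileN 9 10 ?body) s1 (j * (far_time j K + 13 + 2) + 2) (\<lambda>s'. bs0 s' \<and> vn s' 8 = H ^ 3 \<and> vn s' 9 \<le> j)
      (\<lambda>s'. if decided s' then A else 0) (v 0 s1)" if L: "L 0 s1" for s1
  proof (rule J_whileN[where I = L and v = v and K = j, OF L refl step])
    fix k s' assume k: "k \<le> j" and L: "L k s'" and t: "\<not> vn s' 9 < vn s' 10"
    have "v k s' \<le> (if decided s' then A else 0)"
    proof (cases "vn s' 10 = j \<and> vn s' 9 = k \<and> (\<exists>S. greedy_state s' S)")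
      case True
      then obtain S where "greedy_state s' S" by blast
      \<comment> \<open>Leaving the loop without having been told to stop means that the frame is
        full.\<close>
      moreover have "vn s' 9 = j" using True t k by auto
      ultimately have d: "decided s'" using greedy_full_short by (auto simp: decided_def)
      have "q1 ^ (j - k) * A \<le> 1 * A" using q1p A by (intro mult_right_mono) auto
      then show ?thesis using True d by (simp add: v_def)
    qed (use A in \<open>auto simp: v_def\<close>)
    then show "(bs0 s' \<and> vn s' 8 = H ^ 3 \<and> vn s' 9 \<le> j) \<and> v k s' \<le> (if decided s' then A else 0)" using L by (simp add: L_def)
  qed (auto simp: L_def)
  have "J greedy_cmd s (2 + (j * (far_time j K + 13 + 2) + 2)) (\<lambda>s'. bs0 s' \<and> vn s' 8 = H ^ 3 \<and> vn s' 9 \<le> j)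
    (\<lambda>s'. if decided s' then A else 0) (if vn s 16 \<in> I then q1 ^ j * A else 0)"
    unfolding greedy_cmd_def by (rule J_seq[OF 1 2])
  then show ?thesis by (rule J_conseq) auto
qed

end

lemma scale_param_ge:
  assumes "0 < \<epsilon>"
  shows "200 * 200 ^ j \<le> real (scale_param j \<epsilon>) * \<epsilon>"
proof -
  have "1 / \<epsilon> \<le> real (nat \<lceil>1 / \<epsilon>\<rceil>)" by linarith
  then have "1 \<le> real (nat \<lceil>1 / \<epsilon>\<rceil>) * \<epsilon>" using assms by (simp only: pos_divide_le_eq)
  then have "200 * 200 ^ j * 1 \<le> 200 * 200 ^ j * (real (nat \<lceil>1 / \<epsilon>\<rceil>) * \<epsilon>)" by (intro mult_left_mono) auto
  then show ?thesis by (simp add: scale_param_def mult.assoc)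
qed

text \<open>What \<open>H\<close> has to satisfy: the grid contains the coordinates (second bound),
  its rounding error is at most \<open>\<epsilon> * w / 4\<close> (third), \<open>1 / H\<close> is
  an admissible step size (fourth), and \<open>H ^ 3\<close> rounds exhaust the initial potential
  (fifth). The base 200 comes from the fourth one: \<open>j\<close> is at most \<open>2 ^ j\<close>,
  and the square of a coordinate is at most \<open>25 * 100 ^ j\<close>.\<close>

lemma scale_param_bounds:
  fixes j :: nat
  assumes \<epsilon>: "0 < \<epsilon>" "\<epsilon> < 1"
  defines "H \<equiv> real (scale_param j \<epsilon>)"
  shows "1 \<le> H" "real j * 5 ^ j + 2 \<le> H" "4 * (real j * 5 ^ Suc j) \<le> H * \<epsilon>"
    "4 * (1 + real j * (real j * 5 ^ j + 4)\<^sup>2) \<le> H * \<epsilon>"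
    "2 * ((real j + 1) * (5 ^ Suc j)\<^sup>2) \<le> H\<^sup>2 * \<epsilon>"
proof -
  have HE: "200 * 200 ^ j \<le> H * \<epsilon>" unfolding H_def by (rule scale_param_ge[OF \<epsilon>(1)])
  have H0: "0 \<le> H" by (simp add: H_def)
  have "H * \<epsilon> \<le> H * 1" using \<epsilon> H0 by (intro mult_left_mono) auto
  then have HE1: "H * \<epsilon> \<le> H" by simp
  have pm: "(a::real) ^ j \<le> b ^ j" if "0 \<le> a" "a \<le> b" for a b using that by (rule power_mono[rotated])
  have j2: "real j \<le> 2 ^ j" using less_exp[of j] by (metis less_imp_le of_nat_le_iff of_nat_numeral of_nat_power)
  have one: "(1::real) \<le> 2 ^ j" "(1::real) \<le> 10 ^ j" "(1::real) \<le> 200 ^ j" by simp_all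
  have "real j * 5 ^ j \<le> 2 ^ j * 5 ^ j" using j2 by (intro mult_right_mono) auto
  also have "\<dots> = 10 ^ j" by (simp flip: power_mult_distrib)
  finally have j5: "real j * 5 ^ j \<le> 10 ^ j" .
  have 10: "(10::real) ^ j \<le> 200 ^ j" by (rule pm) auto
  show H1: "1 \<le> H" using HE HE1 one by linarith
  show "real j * 5 ^ j + 2 \<le> H" using j5 10 HE HE1 one by linarith
  show "4 * (real j * 5 ^ Suc j) \<le> H * \<epsilon>" using order_trans[OF j5 10] HE one unfolding power_Suc by linarith
  have "(real j * 5 ^ j + 4)\<^sup>2 \<le> (5 * 10 ^ j)\<^sup>2"
  proof (rule power_mono)
    show "real j * 5 ^ j + 4 \<le> 5 * 10 ^ j" using j5 one by linarith
  qed simp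
  also have "\<dots> = 25 * 100 ^ j" by (simp add: power_mult_distrib power2_eq_square flip: power_mult_distrib)
  finally have "real j * (real j * 5 ^ j + 4)\<^sup>2 \<le> 2 ^ j * (25 * 100 ^ j)" using j2 by (intro mult_mono) auto
  also have "\<dots> = 25 * 200 ^ j" by (simp flip: power_mult_distrib)
  finally have le: "real j * (real j * 5 ^ j + 4)\<^sup>2 \<le> 25 * 200 ^ j" .
  have "4 * (1 + z) \<le> y" if "z \<le> 25 * X" "200 * X \<le> y" "1 \<le> X" for X y z :: real using that by (simp add: distrib_left)
  from this[OF le HE one(3)] show "4 * (1 + real j * (real j * 5 ^ j + 4)\<^sup>2) \<le> H * \<epsilon>" .
  have j1: "real j + 1 \<le> 2 * 2 ^ j" using add_mono[OF j2 one(1)] by simp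
  have "(real j + 1) * (5 ^ Suc j)\<^sup>2 = 25 * ((real j + 1) * 25 ^ j)"
    by (simp add: power_mult_distrib power2_eq_square flip: power_mult_distrib)
  also have "\<dots> \<le> 25 * (2 * 2 ^ j * 25 ^ j)" using j1 by (intro mult_left_mono mult_right_mono) auto
  also have "\<dots> = 50 * 50 ^ j" by (simp flip: power_mult_distrib)
  also have "\<dots> \<le> 50 * 200 ^ j" using pm[of 50 200] by simp
  finally have "2 * ((real j + 1) * (5 ^ Suc j)\<^sup>2) \<le> H * \<epsilon>" using HE one by linarith
  also have "\<dots> \<le> H * (H * \<epsilon>)" using mult_right_mono[OF H1, of "H * \<epsilon>"] \<epsilon> H0 by simp
  finally show "2 * ((real j + 1) * (5 ^ Suc j)\<^sup>2) \<le> H\<^sup>2 * \<epsilon>" by (simp add: power2_eq_square mult.assoc)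
qed

section \<open>From the greedy frame to the refinement rounds\<close>

context fitting
begin

text \<open>Quantified over all states with the same greedy frame and the same
  \<open>\<sigma>\<close>, since a suitable guess must remain available after updates, which move
  \<open>fP\<close> only.\<close>

definition coords :: "vst \<Rightarrow> nat set \<Rightarrow> (nat \<Rightarrow> fvec) \<Rightarrow> bool" where
  "coords s S \<Psi> \<longleftrightarrow> (\<forall>s'. vn s' 17 \<in> S \<and> fG s' = fG s \<and> vr s' 12 = vr s 12 \<longrightarrow>
     (\<exists>c. (\<forall>l. c l \<le> 2 * H\<^sup>2) \<and> (\<exists>x. x = (guess_point s' H c)(0 := 1) \<and>
        norm (pts (vn s' 17) - (\<Sum>l\<le>j. x l *\<^sub>R \<Psi> l)) \<le> (1 + \<epsilon> / 4) * w \<and> 1 / H * (\<Sum>l\<le>j. (x l)\<^sup>2) \<le> \<epsilon> / 4)))"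

definition potential :: "vst \<Rightarrow> (nat \<Rightarrow> fvec) \<Rightarrow> real" where
  "potential s \<Psi> = (\<Sum>l\<le>j. (norm (fP s l - \<Psi> l))\<^sup>2)"

definition drop :: real where "drop = 1 / H * \<epsilon> / 2 * w\<^sup>2"

text \<open>\<open>m\<close> is the number of rounds left; the potential is paid for by
  \<open>m\<close> decrements of size \<open>drop\<close>.\<close>

definition round_state :: "nat \<Rightarrow> vst \<Rightarrow> bool" where
  "round_state m s \<longleftrightarrow> approx s \<or> (2 \<le> n \<and> (\<exists>S \<Psi>. S \<subseteq> I \<and> card (I - S) \<le> (real j + 2) * \<delta>' * n \<and>
     coords s S \<Psi> \<and> potential s \<Psi> \<le> real m * drop))"

lemmas num = scale_param_bounds[OF \<epsilon>, of j]

lemma drop_pos: "0 < drop" using num(1) \<epsilon> w by (simp add: drop_def)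

text \<open>Passage between the phases: the greedy frame and \<open>\<sigma>\<close> determine an
  ideal frame \<open>\<Psi>\<close> of the optimal flat that is close to the current one, because
  the errors \<open>5 ^ i * w\<close> and \<open>\<sigma>\<close> are both bounded multiples of
  \<open>w\<close>.\<close>

lemma sigma_state:
  assumes g: "greedy_state s S" and na: "\<not> approx s" and S2: "S2 \<subseteq> S" "card (I - S2) \<le> (real j + 2) * \<delta>' * n"
    and q: "q \<in> S" "hs s q \<le> 5 ^ Suc (vn s 9) * w" "\<And>i. i \<in> S2 \<Longrightarrow> hs s i \<le> hs s q"
    and s': "fP s' = fP s" "fG s' = fG s" "vr s' 12 = hs s q"
  shows "round_state (H ^ 3) s'"
proof -
  define \<sigma> where "\<sigma> = hs s q"
  define k where "k = vn s 9"
  have n2: "2 \<le> n" by (rule greedy_n2[OF g na])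
  have SI: "S \<subseteq> I" "S2 \<subseteq> I" using g S2 by (auto simp: greedy_state_def)
  have kj: "k \<le> j" and inv0: "frame_inv j w U (fP s 0) (fP s) k (pts ` S)" and f0: "\<forall>i\<in>{k<..j}. fP s i = 0"
    and G: "\<forall>i\<le>j. fG s i = fP s i" using g by (auto simp: greedy_state_def k_def)
  have n0: "norm (perp U (fP s 0 - b)) \<le> w" using g near by (auto simp: greedy_state_def)
  have hsk: "hs s i = norm (perp (span (fP s ` {1..k})) (pts i - fP s 0))" for i
    by (simp add: hs_def greedy_state_span[OF g] k_def)
  \<comment> \<open>If \<open>\<sigma>\<close> were smaller than \<open>w\<close>, the current flat
    would already be an approximation, since it covers \<open>S2\<close> within
    \<open>\<sigma>\<close>.\<close>
  have w\<sigma>: "w \<le> \<sigma>"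
  proof (rule ccontr)
    assume c: "\<not> ?thesis"
    have "S2 \<subseteq> {i \<in> {..<n}. hs s i \<le> (1 + \<epsilon>) * w}"
    proof
      fix i assume i: "i \<in> S2"
      have "hs s i \<le> w" using q(3)[OF i] c by (simp add: \<sigma>_def)
      also have "\<dots> \<le> (1 + \<epsilon>) * w" using w \<epsilon> by simp
      finally show "i \<in> {i \<in> {..<n}. hs s i \<le> (1 + \<epsilon>) * w}" using i SI I(1) by auto
    qed
    then have "card S2 \<le> card {i \<in> {..<n}. hs s i \<le> (1 + \<epsilon>) * w}" by (intro card_mono) auto
    moreover have "(1 - \<gamma>) * n - (real j + 2) * \<delta>' * n \<le> card S2" by (rule card_sub[OF SI(2) S2(2)])
    moreover have "(real j + 2) * \<delta>' * n \<le> \<delta> * n" 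
      using \<delta>'_pos by (intro mult_right_mono) (auto simp: algebra_simps)
    ultimately have "(1 - \<delta> - \<gamma>) * n \<le> card {i \<in> {..<n}. hs s i \<le> (1 + \<epsilon>) * w}"
      by (simp add: algebra_simps)
    then show False using na by (simp add: approx_def)
  qed
  have \<sigma>k: "\<sigma> \<le> 5 ^ Suc k * w" using q(2) by (simp add: \<sigma>_def k_def)
  have p5: "(5::real) ^ i * w \<le> 5 ^ Suc j * w" if "i \<le> Suc j" for i
    using that w by (intro mult_right_mono power_increasing) auto
  have \<sigma>j: "\<sigma> \<le> 5 ^ Suc j * w" using \<sigma>k p5[of "Suc k"] kj by linarith
  define L where "L i = (if fP s i = 0 then \<sigma> else norm (fP s i))" for i
  obtain g where gg: "ons g j" "span (g ` {1..j}) = U"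
    "\<And>i. i \<in> {1..k} \<Longrightarrow> norm (norm (fP s i) *\<^sub>R g i - fP s i) \<le> 5 ^ i * w"
    "\<And>p. p \<in> pts ` S2 \<Longrightarrow> \<exists>c::nat \<Rightarrow> nat. \<exists>x. (\<forall>i. c i \<le> 2 * H\<^sup>2) \<and>
       (\<forall>i. x i = inner (p - fP s 0) (fP s i) / (L i)\<^sup>2 + \<sigma> / L i * (real (c i) / H - H)) \<and>
       (\<forall>i\<in>{1..j}. \<bar>x i\<bar> \<le> real j * 5 ^ j + 4) \<and>
       norm (p - (fP s 0 - perp U (fP s 0 - b)) - (\<Sum>i=1..j. x i *\<^sub>R (L i *\<^sub>R g i))) \<le> w + j * (\<sigma> / H)"
  proof (rule frame_coordinates[of j w U "fP s 0" "fP s" k "pts ` S2" \<sigma> b L H])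
    show "frame_inv j w U (fP s 0) (fP s) k (pts ` S2)" by (rule frame_inv_subset[OF inv0]) (use S2 in auto)
    show "norm (perp (span (fP s ` {1..k})) (p - fP s 0)) \<le> \<sigma>" if "p \<in> pts ` S2" for p
      using that q(3) by (auto simp: hsk \<sigma>_def)
    show "\<sigma> \<le> norm (fP s i)" if "i \<in> {1..k}" for i
      using that inv0 q(1) by (auto simp: frame_inv_def hsk \<sigma>_def)
    show "norm (perp U (p - b)) \<le> w" if "p \<in> pts ` S2" for p using that near SI by auto
  qed (use f0 w w\<sigma> num(2) in \<open>auto simp: L_def\<close>)
  \<comment> \<open>Ideal vectors get the lengths of the greedy ones and missing directions the
    length \<open>\<sigma>\<close>, so that the distance of the two frames is of order
    \<open>w\<close>.\<close>
  define \<Psi> where "\<Psi> l = (if l = 0 then fP s 0 - perp U (fP s 0 - b) else L l *\<^sub>R g l)" for l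
  have Lmax: "max (norm (fG s' l)) (vr s' 12) = L l" if "l \<in> {1..j}" for l
  proof -
    have e: "fG s' l = fP s l" "vr s' 12 = \<sigma>" using that G s' by (auto simp: \<sigma>_def)
    show ?thesis
    proof (cases "l \<le> k")
      case True
      then have "\<sigma> \<le> norm (fP s l)" "fP s l \<noteq> 0" using that inv0 q(1) by (auto simp: frame_inv_def hsk \<sigma>_def)
      then show ?thesis by (simp add: e L_def)
    next
      case False
      then show ?thesis using that f0 w w\<sigma> by (simp add: e L_def)
    qed
  qed
  have H1: "0 < real H" using num(1) by simp
  have "coords s' S2 \<Psi>"
    unfolding coords_def
  proof (intro allI impI)
    fix t assume t: "vn t 17 \<in> S2 \<and> fG t = fG s' \<and> vr t 12 = vr s' 12"
    let ?p = "pts (vn t 17)"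
    obtain c x where cx: "\<forall>i. c i \<le> 2 * H\<^sup>2" "\<And>i. x i = inner (?p - fP s 0) (fP s i) / (L i)\<^sup>2 + \<sigma> / L i * (real (c i) / H - H)"
       "\<forall>i\<in>{1..j}. \<bar>x i\<bar> \<le> real j * 5 ^ j + 4"
       "norm (?p - (fP s 0 - perp U (fP s 0 - b)) - (\<Sum>i=1..j. x i *\<^sub>R (L i *\<^sub>R g i))) \<le> w + j * (\<sigma> / H)"
      using gg(4)[of ?p] t by blast
    define y where "y = (guess_point t H c)(0 := 1)"
    have y: "y l = x l" if "l \<in> {1..j}" for l
    proof -
      have "max (norm (fG t l)) (vr t 12) = L l" "fG t l = fP s l" "fG t 0 = fP s 0" "vr t 12 = \<sigma>"
        using Lmax[OF that] that t G s' by (auto simp: \<sigma>_def)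
      then show ?thesis using that by (simp add: y_def guess_point_def Let_def cx(2))
    qed
    have y0: "y 0 = 1" by (simp add: y_def)
    have split: "{..j} = insert 0 {1..j}" by auto
    have "(\<Sum>l\<le>j. y l *\<^sub>R \<Psi> l) = \<Psi> 0 + (\<Sum>l=1..j. x l *\<^sub>R (L l *\<^sub>R g l))"
    proof -
      have "(\<Sum>l=1..j. y l *\<^sub>R \<Psi> l) = (\<Sum>l=1..j. x l *\<^sub>R (L l *\<^sub>R g l))"
        by (rule sum.cong[OF refl]) (use y in \<open>simp add: \<Psi>_def\<close>)
      then show ?thesis unfolding split by (simp add: y0)
    qed
    then have "norm (?p - (\<Sum>l\<le>j. y l *\<^sub>R \<Psi> l)) \<le> w + j * (\<sigma> / H)"
      using cx(4) by (simp add: \<Psi>_def diff_diff_eq)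
    \<comment> \<open>The rounding error of the grid, using that \<open>\<sigma>\<close> is at most
      \<open>5 ^ Suc j * w\<close>.\<close>
    also have "\<dots> \<le> w + \<epsilon> / 4 * w"
    proof -
      have "4 * (j * \<sigma>) \<le> 4 * (j * (5 ^ Suc j * w))" using \<sigma>j by (intro mult_left_mono) auto
      also have "\<dots> = 4 * (real j * 5 ^ Suc j) * w" by simp
      also have "\<dots> \<le> H * \<epsilon> * w" using num(3) w by (intro mult_right_mono) auto
      finally show ?thesis using H1 by (simp add: field_simps)
    qed
    finally have a: "norm (?p - (\<Sum>l\<le>j. y l *\<^sub>R \<Psi> l)) \<le> (1 + \<epsilon> / 4) * w" by (simp add: algebra_simps)
    have "(\<Sum>l\<le>j. (y l)\<^sup>2) = 1 + (\<Sum>l=1..j. (x l)\<^sup>2)" 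
    proof -
      have "(\<Sum>l=1..j. (y l)\<^sup>2) = (\<Sum>l=1..j. (x l)\<^sup>2)" by (rule sum.cong[OF refl]) (use y in simp)
      then show ?thesis unfolding split by (simp add: y0)
    qed
    also have "(\<Sum>l=1..j. (x l)\<^sup>2) \<le> (\<Sum>l=1..j. (real j * 5 ^ j + 4)\<^sup>2)"
      by (intro sum_mono abs_le_square_iff[THEN iffD1]) (use cx(3) in auto)
    finally have "4 * (\<Sum>l\<le>j. (y l)\<^sup>2) \<le> H * \<epsilon>" using num(4) by simp
    then have "1 / H * (\<Sum>l\<le>j. (y l)\<^sup>2) \<le> \<epsilon> / 4" using H1 by (simp add: field_simps)
    then show "\<exists>c. (\<forall>l. c l \<le> 2 * H\<^sup>2) \<and> (\<exists>x. x = (guess_point t H c)(0 := 1) \<and>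
        norm (pts (vn t 17) - (\<Sum>l\<le>j. x l *\<^sub>R \<Psi> l)) \<le> (1 + \<epsilon> / 4) * w \<and> 1 / H * (\<Sum>l\<le>j. (x l)\<^sup>2) \<le> \<epsilon> / 4)"
      using a cx(1) y_def by blast
  qed
  moreover have "potential s' \<Psi> \<le> real (H ^ 3) * drop"
  proof -
    have "norm (fP s l - \<Psi> l) \<le> 5 ^ Suc j * w" if lj: "l \<le> j" for l
    proof -
      have "l = 0 \<or> l \<in> {1..k} \<or> (l \<in> {k<..j} \<and> l \<noteq> 0)" using lj by auto
      then consider "l = 0" | "l \<in> {1..k}" | "l \<in> {k<..j}" "l \<noteq> 0" by blast
      then show ?thesis
      proof cases
        case 1
        then have "norm (fP s l - \<Psi> l) \<le> 5 ^ 0 * w" using n0 by (simp add: \<Psi>_def)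
        also have "\<dots> \<le> 5 ^ Suc j * w" by (rule p5) simp
        finally show ?thesis .
      next
        case 2
        then have "fP s l \<noteq> 0" using inv0 by (auto simp: frame_inv_def)
        then have "norm (fP s l - \<Psi> l) \<le> 5 ^ l * w" using gg(3)[OF 2] 2 by (simp add: \<Psi>_def L_def norm_minus_commute)
        also have "\<dots> \<le> 5 ^ Suc j * w" using lj by (intro p5) simp
        finally show ?thesis .
      next
        case 3
        then have "fP s l = 0" "norm (g l) = 1" using f0 ons_norm[OF gg(1), of l] lj by auto
        then show ?thesis using 3 \<sigma>j w w\<sigma> by (simp add: \<Psi>_def L_def)
      qed
    qed
    then have "potential s' \<Psi> \<le> (\<Sum>l\<le>j. (5 ^ Suc j * w)\<^sup>2)"
      unfolding potential_def s' by (intro sum_mono power_mono) auto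
    also have "\<dots> = (real j + 1) * (5 ^ Suc j)\<^sup>2 * w\<^sup>2" by (simp add: power_mult_distrib algebra_simps)
    also have "\<dots> \<le> (H\<^sup>2 * \<epsilon> / 2) * w\<^sup>2" using num(5) by (intro mult_right_mono) auto
    also have "\<dots> = real (H ^ 3) * drop" using H1 by (simp add: drop_def power3_eq_cube power2_eq_square field_simps)
    finally show ?thesis .
  qed
  ultimately show ?thesis using n2 SI(2) S2(2) by (auto simp: round_state_def)
qed

text \<open>Two portions of the budget are spent: \<open>S1\<close> drops the points that are still
  long, which bounds \<open>\<sigma>\<close> from above, and \<open>S2\<close> drops those farther
  out than the point that defines \<open>\<sigma>\<close>.\<close>

lemma sigma_spec:
  assumes b: "bs0 s" and T8: "vn s 8 = H ^ 3" and A: "0 \<le> A" and kj: "vn s 9 \<le> j"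
  shows "J sigma_cmd s (far_time j K + 2) (\<lambda>s'. bs0 s' \<and> vn s' 8 = H ^ 3)
    (\<lambda>s'. if round_state (H ^ 3) s' then A else 0) (if decided s then pf * A else 0)"
proof -
  let ?fin = "[BDot 10 sT sT, BSqrt 12 10]"
  have fin: "same {} {10, 12} {} s1 (ops ?fin s1)" "vr (ops ?fin s1) 12 = norm (vv s1 5)" for s1
    by (simp add: same_def) (simp add: norm_eq_sqrt_inner)
  have tail: "J (blk ?fin) s1 2 (\<lambda>s'. bs0 s' \<and> vn s' 8 = H ^ 3) (\<lambda>s'. if round_state (H ^ 3) s' then A else 0) g0"
    if s1: "far_ok s s1" and g0: "\<And>s2. fP s2 = fP s \<Longrightarrow> fG s2 = fG s \<Longrightarrow> vr s2 12 = norm (vv s1 5) \<Longrightarrow>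
      g0 \<le> (if round_state (H ^ 3) s2 then A else 0)" for s1 g0
  proof (rule J_ops)
    define s2 where "s2 = ops ?fin s1"
    have sm: "same {} {10, 12} {} s1 s2" and r: "vr s2 12 = norm (vv s1 5)" unfolding s2_def by (rule fin)+
    have b2: "bs0 s2" by (rule base_same[OF far_ok_base[OF b s1] sm]) auto
    have "fP s2 = fP s1" "fG s2 = fG s1" "vn s2 8 = vn s1 8" using sm by (auto simp: same_def fP_def fG_def)
    then have e: "fP s2 = fP s" "fG s2 = fG s" "vn s2 8 = H ^ 3" using far_ok_fams[OF s1] T8 by auto
    show "bs0 (ops ?fin s1) \<and> vn (ops ?fin s1) 8 = H ^ 3" unfolding s2_def[symmetric] using b2 e by simp
    show "g0 \<le> (if round_state (H ^ 3) (ops ?fin s1) then A else 0)" unfolding s2_def[symmetric]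
      by (rule g0[OF e(1,2) r])
  qed auto
  show ?thesis
  proof (cases "approx s \<or> \<not> decided s")
    case True
    show ?thesis unfolding sigma_cmd_def
    proof (rule J_seq_tot[OF far_tot[OF b]], rule tail)
      fix s1 s2 assume "fP s2 = fP s"
      then have a: "approx s2 = approx s" by (rule hs_cong)
      have "pf * A \<le> 1 * A" using pf_bounds A by (intro mult_right_mono) auto
      then show "(if decided s then pf * A else 0) \<le> (if round_state (H ^ 3) s2 then A else 0)"
        using True A a by (auto simp: round_state_def)
    qed
  next
    case False
    then obtain S where sh: "short_state s S" and na: "\<not> approx s" by (auto simp: decided_def)
    then have g: "greedy_state s S" and few: "card {i \<in> S. 5 ^ Suc (vn s 9) * w < hs s i} < \<delta>' * n"
      by (auto simp: short_state_def)
    let ?k = "vn s 9"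
    have SI: "S \<subseteq> I" and cS: "card (I - S) \<le> real ?k * \<delta>' * n" using g by (auto simp: greedy_state_def)
    define S1 where "S1 = {i \<in> S. hs s i \<le> 5 ^ Suc ?k * w}"
    have finS: "finite S" "finite S1" "S1 \<subseteq> I" using SI finite_subset[OF SI finI] by (auto simp: S1_def)
    have card3: "real (card (I - Z)) \<le> card (I - Y) + card (Y - Z)" if "Z \<subseteq> Y" "Y \<subseteq> I" for Y Z
    proof -
      have "I - Z \<subseteq> (I - Y) \<union> (Y - Z)" by auto
      then have "card (I - Z) \<le> card ((I - Y) \<union> (Y - Z))"
        using finI that by (intro card_mono) (auto intro: finite_subset)
      also have "\<dots> \<le> card (I - Y) + card (Y - Z)" by (rule card_Un_le)
      finally show ?thesis by linarith
    qed
    have "S - S1 = {i \<in> S. 5 ^ Suc ?k * w < hs s i}" by (auto simp: S1_def)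
    then have "real (card (I - S1)) \<le> real ?k * \<delta>' * n + \<delta>' * n"
      using card3[of S1 S] SI cS few by (auto simp: S1_def)
    then have cS1: "real (card (I - S1)) \<le> (real ?k + 1) * \<delta>' * n" by (simp add: algebra_simps)
    have up: "(real ?k + m) * \<delta>' * n \<le> (real j + m) * \<delta>' * n" for m
      using kj \<delta>'_pos by (intro mult_right_mono) auto
    have cS1': "real (card (I - S1)) \<le> (real j + 1) * \<delta>' * n" using cS1 up[of 1] by linarith
    have "\<delta>' * n \<le> card S1"
    proof -
      have sm: "\<gamma> + \<delta> < 1" by (rule not_approx_sum[OF na])
      have "(1 - \<gamma>) * n - (real j + 1) * \<delta>' * n \<le> card S1" by (rule card_sub[OF finS(3) cS1'])
      moreover have "\<delta>' * n \<le> (1 - \<gamma> - (real j + 1) * \<delta>') * n"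
        using sm \<delta>'_pos by (intro mult_right_mono) (auto simp: algebra_simps)
      ultimately show ?thesis by (simp add: algebra_simps)
    qed
    then obtain h0 where h0: "\<delta>' * n \<le> card {i \<in> S1. h0 \<le> hs s i}" "card {i \<in> S1. h0 < hs s i} < \<delta>' * n"
      using quantile_exists[of S1 "\<delta>' * n" "hs s"] finS \<delta>'_pos n1 by auto
    have cS1'': "real (card (I - S1)) \<le> (real j + 2) * \<delta>' * n"
    proof -
      have "(real j + 1) * \<delta>' * n \<le> (real j + 2) * \<delta>' * n" using \<delta>'_pos by (intro mult_right_mono) auto
      then show ?thesis using cS1' by linarith
    qed
    have far: "J far_cmd s (far_time j K) (far_ok s) (\<lambda>s'. if vn s' 17 \<in> {i \<in> S1. h0 \<le> hs s i} then 1 else 0) pf"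
      by (rule far_J[OF b na finS(3) cS1'']) (use h0(1) in auto)
    have "J sigma_cmd s (far_time j K + 2) (\<lambda>s'. bs0 s' \<and> vn s' 8 = H ^ 3)
      (\<lambda>s'. if round_state (H ^ 3) s' then A else 0) (A * pf)"
      unfolding sigma_cmd_def
    proof (rule J_seq[OF J_scale[OF far A]], rule tail)
      fix s1 s2 assume s1: "far_ok s s1" and e: "fP s2 = fP s" "fG s2 = fG s" "vr s2 12 = norm (vv s1 5)"
      let ?q = "vn s1 17"
      have v5: "vr s2 12 = hs s ?q" using e s1 by (simp add: far_ok_def hs_def)
      show "A * (if ?q \<in> {i \<in> S1. h0 \<le> hs s i} then 1 else 0) \<le> (if round_state (H ^ 3) s2 then A else 0)"
      proof (cases "?q \<in> {i \<in> S1. h0 \<le> hs s i}")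
        case True
        define S2 where "S2 = {i \<in> S1. hs s i \<le> hs s ?q}"
        have "card (S1 - S2) \<le> card {i \<in> S1. h0 < hs s i}" using finS True by (intro card_mono) (auto simp: S2_def)
        then have "real (card (S1 - S2)) \<le> \<delta>' * n" using h0(2) by linarith
        then have "real (card (I - S2)) \<le> (real j + 1) * \<delta>' * n + \<delta>' * n"
          using card3[of S2 S1] finS cS1' by (auto simp: S2_def)
        then have cS2: "real (card (I - S2)) \<le> (real j + 2) * \<delta>' * n" by (simp add: algebra_simps)
        have "round_state (H ^ 3) s2"
          by (rule sigma_state[OF g na _ cS2 _ _ _ e(1,2) v5]) (use True in \<open>auto simp: S1_def S2_def\<close>)
        then show ?thesis using A by simp
      next
        case False
        then have z: "(if ?q \<in> {i \<in> S1. h0 \<le> hs s i} then 1 else 0) = (0::real)" by (rule if_not_P)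
        show ?thesis unfolding z using A by simp
      qed
    qed
    then show ?thesis using False by (simp add: mult.commute)
  qed
qed

text \<open>The distance to the flat is at most the residual for any coordinates whatsoever. So a
  point far from the flat has a long residual also for the guessed coordinates, as
  \<open>perceptron_step\<close> requires.\<close>

lemma round_drop:
  assumes c: "coords s S \<Psi>" and q: "vn s 17 \<in> S" "(1 + \<epsilon>) * w < hs s (vn s 17)"
  obtains c where "\<And>l. c l \<le> 2 * H\<^sup>2" "\<And>s'. updated j H ((guess_point s H c)(0 := 1)) s s' \<Longrightarrow> potential s' \<Psi> \<le> potential s \<Psi> - drop"
proof -
  obtain c x where cx: "\<And>l. c l \<le> 2 * H\<^sup>2" "x = (guess_point s H c)(0 := 1)"
    "norm (pts (vn s 17) - (\<Sum>l\<le>j. x l *\<^sub>R \<Psi> l)) \<le> (1 + \<epsilon> / 4) * w" "1 / H * (\<Sum>l\<le>j. (x l)\<^sup>2) \<le> \<epsilon> / 4"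
    using c q unfolding coords_def by blast
  let ?r = "pts (vn s 17) - (\<Sum>l\<le>j. x l *\<^sub>R fP s l)"
  have split: "{..j} = insert 0 {1..j}" by auto
  have "hs s (vn s 17) \<le> norm (pts (vn s 17) - fP s 0 - (\<Sum>l=1..j. x l *\<^sub>R fP s l))"
    unfolding hs_def by (rule norm_perp_le) (simp, rule span_sum, rule span_scale, rule span_base, simp)
  also have "pts (vn s 17) - fP s 0 - (\<Sum>l=1..j. x l *\<^sub>R fP s l) = ?r"
    unfolding split using cx(2) by simp
  finally have far: "(1 + \<epsilon>) * w \<le> norm ?r" using q(2) by simp
  have H1: "0 < 1 / real H" using num(1) by simp
  show ?thesis
  proof (rule that[of c, OF cx(1)])
    fix s' assume "updated j H ((guess_point s H c)(0 := 1)) s s'"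
    then have u: "fP s' l = fP s l + (1 / H * x l) *\<^sub>R ?r" if "l \<le> j" for l using that unfolding updated_def cx(2) by blast
    show "potential s' \<Psi> \<le> potential s \<Psi> - drop"
      unfolding potential_def drop_def by (rule perceptron_step[OF refl u cx(3) far \<epsilon> w H1 cx(4)])
  qed
qed

text \<open>The last portion of the budget: \<open>S\<close> lacks at most
  \<open>(j + 2) * \<delta>' * n\<close> inliers, so if the flat covers too few points,
  \<open>\<delta>' * n\<close> of the uncovered ones are in \<open>S\<close>.\<close>

lemma many_far:
  assumes na: "\<not> approx s" and S: "S \<subseteq> I" "card (I - S) \<le> (real j + 2) * \<delta>' * n"
  shows "\<delta>' * n \<le> card {i \<in> S. (1 + \<epsilon>) * w < hs s i}"
proof -
  let ?F = "{i \<in> S. (1 + \<epsilon>) * w < hs s i}" and ?N = "{i \<in> {..<n}. hs s i \<le> (1 + \<epsilon>) * w}"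
  have "S \<subseteq> ?F \<union> ?N" using S I(1) by auto
  then have "card S \<le> card (?F \<union> ?N)" using S(1) finI by (intro card_mono) (auto intro: finite_subset)
  also have "\<dots> \<le> card ?F + card ?N" by (rule card_Un_le)
  finally have "real (card S) \<le> card ?F + card ?N" by linarith
  moreover have "card ?N < (1 - \<delta> - \<gamma>) * n" using na by (simp add: approx_def)
  moreover have "(1 - \<gamma>) * n - (real j + 2) * \<delta>' * n \<le> card S" by (rule card_sub[OF S])
  moreover have "\<delta> * n = (real j + 3) * \<delta>' * n" using \<delta>'_pos by simp
  ultimately show ?thesis by (simp add: algebra_simps)
qed

text \<open>The potential is 0; one more update, carried out on paper only, would make it
  negative.\<close>

lemma round_0: "round_state 0 s \<Longrightarrow> approx s"
proof (rule ccontr)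
  assume "round_state 0 s" and na: "\<not> approx s"
  then obtain S \<Psi> where S: "S \<subseteq> I" "card (I - S) \<le> (real j + 2) * \<delta>' * n" "coords s S \<Psi>" "potential s \<Psi> \<le> 0"
    by (auto simp: round_state_def)
  have "0 < \<delta>' * n" using \<delta>'_pos n1 by simp
  then have "0 < card {i \<in> S. (1 + \<epsilon>) * w < hs s i}" using many_far[OF na S(1,2)] by linarith
  then obtain q where q: "q \<in> S" "(1 + \<epsilon>) * w < hs s q" by (metis (no_types, lifting) card_gt_0_iff ex_in_conv mem_Collect_eq)
  define s1 where "s1 = s\<lparr>vn := (vn s)(17 := q)\<rparr>"
  have e: "fP s1 = fP s" "vn s1 17 = q" "fG s1 = fG s" "vr s1 12 = vr s 12" by (auto simp: s1_def fP_def fG_def)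
  have cc: "coords s1 S \<Psi>" using S(3) e by (simp add: coords_def)
  have qs: "vn s1 17 \<in> S" using e q by simp
  have hq: "(1 + \<epsilon>) * w < hs s1 (vn s1 17)" using q hs_cong(1)[of s1 s] e by simp
  obtain c where c: "\<And>s'. updated j H ((guess_point s1 H c)(0 := 1)) s1 s' \<Longrightarrow> potential s' \<Psi> \<le> potential s1 \<Psi> - drop"
    by (rule round_drop[OF cc qs hq]) (rule that)
  define x where "x = (guess_point s1 H c)(0 := 1)"
  define \<Phi> where "\<Phi> l = fP s1 l + (1 / H * x l) *\<^sub>R (pts (vn s1 17) - (\<Sum>l\<le>j. x l *\<^sub>R fP s1 l))" for l
  \<comment> \<open>An artificial state holding the updated frame; slot \<open>8 * l + 1\<close>
    belongs to vector \<open>l\<close>, which the division by 8 recovers.\<close>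
  define s2 where "s2 = s1\<lparr>vv := \<lambda>i. \<Phi> (i div 8)\<rparr>"
  have P2: "fP s2 l = \<Phi> l" for l by (simp add: s2_def fP_def)
  have u2: "updated j H x s1 s2" unfolding updated_def P2 \<Phi>_def by simp
  have "0 \<le> potential s2 \<Psi>" unfolding potential_def by (intro sum_nonneg) auto
  also have "\<dots> \<le> potential s1 \<Psi> - drop" by (rule c) (use u2 in \<open>simp only: x_def\<close>)
  also have "potential s1 \<Psi> = potential s \<Psi>" by (simp add: potential_def e)
  finally show False using S(4) drop_pos by simp
qed

text \<open>One coin that says to go on, one far point, and \<open>2 * H\<^sup>2\<close> tosses for
  each of the \<open>j\<close> coordinates.\<close>

definition q2 :: real where "q2 = pf / 3 * (1 / 3) ^ (2 * H\<^sup>2 * j)"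

lemma q2_bounds: "0 < q2" "q2 \<le> 1 / 2"
proof -
  show "0 < q2" using pf_bounds by (simp add: q2_def)
  have "pf / 3 * (1 / 3) ^ (2 * H\<^sup>2 * j) \<le> pf / 3 * 1"
    using pf_bounds by (intro mult_left_mono power_le_one) auto
  then show "q2 \<le> 1 / 2" using pf_bounds unfolding q2_def by linarith
qed

text \<open>Again one outcome of the coin is counted per round: stop if the flat is an
  approximation, go on otherwise. A run that is never told to stop uses up the potential, and by
  \<open>round_0\<close> it ends in an approximation as well.\<close>

lemma refine_spec:
  assumes b: "bs0 s" and T8: "vn s 8 = H ^ 3"
  shows "J refine_cmd s (H ^ 3 * (far_time j K + j * (18 * H\<^sup>2 + 40) + 27) + 3) bs0
    (\<lambda>s'. if approx s' then 1 else 0) (if round_state (H ^ 3) s then q2 ^ (H ^ 3) else 0)"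
proof -
  define L where "L k s' \<longleftrightarrow> bs0 s' \<and> ((vn s' 8 = H ^ 3 \<and> vn s' 11 = k) \<or> vn s' 8 = 0)" for k s'
  define v where "v k s' = (if vn s' 8 = H ^ 3 \<and> vn s' 11 = k \<and> round_state (H ^ 3 - k) s' then q2 ^ (H ^ 3 - k)
    else if vn s' 8 = 0 \<and> approx s' then 1 else 0 :: real)" for k and s' :: vst
  have q2p: "q2 ^ i \<le> 1" "0 \<le> q2 ^ i" for i using q2_bounds by (auto intro: power_le_one)
  have H3: "0 < H ^ 3" using num(1) by simp
  have H1: "1 \<le> H" using num(1) by simp
  have v0: "0 \<le> v k s'" for k s' using q2p by (simp add: v_def)
  have rs_cong: "round_state m s' = round_state m s0" if "fP s' = fP s0" "fG s' = fG s0" "vr s' 12 = vr s0 12" for m s' s0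
    using that hs_cong(2)[OF that(1)] by (simp add: round_state_def coords_def potential_def)
  have 1: "J (blk [BNat 11 0]) s 1 (L 0) (v 0) (if round_state (H ^ 3) s then q2 ^ (H ^ 3) else 0)"
  proof (rule J_ops)
    define s1 where "s1 = ops [BNat 11 0] s"
    have sm: "same {11} {} {} s s1" by (auto simp: s1_def same_def)
    have b1: "bs0 s1" by (rule base_same[OF b sm]) auto
    have e: "vn s1 11 = 0" "vn s1 8 = H ^ 3" using T8 by (auto simp: s1_def)
    have "fP s1 = fP s" "fG s1 = fG s" "vr s1 12 = vr s 12" using sm by (auto simp: same_def fP_def fG_def)
    then have r: "round_state (H ^ 3) s1 = round_state (H ^ 3) s" by (rule rs_cong)
    show "L 0 (ops [BNat 11 0] s)" unfolding s1_def[symmetric] using b1 e by (simp add: L_def)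
    have "(if round_state (H ^ 3) s then q2 ^ (H ^ 3) else 0) \<le> v 0 s1"
      using v0[of 0 s1] e r by (auto simp: v_def)
    then show "(if round_state (H ^ 3) s then q2 ^ (H ^ 3) else 0) \<le> v 0 (ops [BNat 11 0] s)"
      by (simp only: s1_def)
  qed (auto simp: One_nat_def)
  let ?TU = "j * (18 * H\<^sup>2 + 40) + 17"
  let ?go = "blk [BNOp NPlus 11 11 5] ;; far_cmd ;; update_cmd"
  let ?body = "coin ;; IfN 18 3 (blk [BNat 8 0]) ;; IfN 11 8 ?go"
  have step: "J ?body s0 (far_time j K + ?TU + 8) (L (Suc k)) (v (Suc k)) (v k s0)"
    if k: "k < H ^ 3" and L0: "L k s0" and t0: "vn s0 11 < vn s0 8" for k s0
  proof -
    have b0: "bs0 s0" and n3: "vn s0 3 = n" and n5: "vn s0 5 = 1" and run: "vn s0 8 = H ^ 3" "vn s0 11 = k"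
      using L0 t0 by (auto simp: L_def base_def consts_ok_def)
    have cong: "approx s' = approx s0" "fP s' = fP s0" "fG s' = fG s0" "vr s' 12 = vr s0 12"
      if "same NS {} {} s0 s'" for NS s'
    proof -
      have "fP s' = fP s0" "fG s' = fG s0" using that by (auto simp: same_def fP_def fG_def)
      then show "approx s' = approx s0" "fP s' = fP s0" "fG s' = fG s0" using hs_cong(2)[of s' s0] by auto
      show "vr s' 12 = vr s0 12" using that by (simp add: same_def)
    qed
    let ?rest = "IfN 18 3 (blk [BNat 8 0]) ;; IfN 11 8 ?go"
    let ?T = "(1 + 2) + ((1 + (far_time j K + ?TU)) + 2)"
    have stop: "J ?rest s1 ?T (L (Suc k)) (v (Suc k)) (if approx s0 then 1 else 0)"
      if s1: "same {18} {} {} s0 s1" and c: "vn s1 18 < vn s1 3" for s1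
    proof (rule J_seq_tot)
      show "tot (IfN 18 3 (blk [BNat 8 0])) s1 (1 + 2) (\<lambda>s'. same {18, 8} {} {} s0 s' \<and> vn s' 8 = 0)"
      proof (rule J_ifN)
        show "tot (blk [BNat 8 0]) s1 1 (\<lambda>s'. same {18, 8} {} {} s0 s' \<and> vn s' 8 = 0)"
          by (rule J_ops) (use s1 in \<open>auto simp: same_def One_nat_def\<close>)
      qed (use c in auto)
      fix s2 assume s2: "same {18, 8} {} {} s0 s2 \<and> vn s2 8 = 0"
      have b2: "bs0 s2" by (rule base_same[OF b0 conjunct1[OF s2]]) auto
      show "J (IfN 11 8 ?go) s2 ((1 + (far_time j K + ?TU)) + 2) (L (Suc k)) (v (Suc k)) (if approx s0 then 1 else 0)"
      proof (rule J_ifN)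
        have "(if approx s0 then 1 else 0) \<le> v (Suc k) s2"
          using v0[of "Suc k" s2] s2 cong(1)[OF conjunct1[OF s2]] H3 by (auto simp: v_def)
        then show "L (Suc k) s2 \<and> (if approx s0 then 1 else 0) \<le> v (Suc k) s2"
          using b2 s2 by (simp add: L_def)
      qed (use s2 in simp)
    qed
    let ?V = "q2 ^ (H ^ 3 - Suc k)" and ?U = "(1 / 3 :: real) ^ (2 * H\<^sup>2 * j)"
    let ?W = "if round_state (H ^ 3 - k) s0 \<and> \<not> approx s0 then ?V * ?U * pf else 0"
    have go: "J ?rest s1 ?T (L (Suc k)) (v (Suc k)) ?W"
      if s1: "same {18} {} {} s0 s1" and c: "\<not> vn s1 18 < vn s1 3" for s1
    proof (rule J_seq_tot)
      show "tot (IfN 18 3 (blk [BNat 8 0])) s1 (1 + 2) (\<lambda>s'. same {18} {} {} s0 s')"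
        by (rule J_ifN) (use c s1 in auto)
      fix s2 assume s2: "same {18} {} {} s0 s2"
      have run2: "vn s2 11 < vn s2 8" using s2 run k by (simp add: same_def)
      show "J (IfN 11 8 ?go) s2 ((1 + (far_time j K + ?TU)) + 2) (L (Suc k)) (v (Suc k)) ?W"
      proof (rule J_ifN)
        show "J ?go s2 (1 + (far_time j K + ?TU)) (L (Suc k)) (v (Suc k)) ?W"
        proof (rule J_seq_tot)
          show "tot (blk [BNOp NPlus 11 11 5]) s2 1 (\<lambda>s'. same {18, 11} {} {} s0 s' \<and> vn s' 11 = Suc k)"
            by (rule J_ops) (use s2 n5 run in \<open>auto simp: same_def One_nat_def\<close>)
          fix s3 assume s3: "same {18, 11} {} {} s0 s3 \<and> vn s3 11 = Suc k"
          have b3: "bs0 s3" by (rule base_same[OF b0 conjunct1[OF s3]]) auto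
          note cg = cong[OF conjunct1[OF s3]]
          have T3: "vn s3 8 = H ^ 3" using s3 run by (simp add: same_def)
          \<comment> \<open>The alternative \<open>g0 \<le> 0\<close> is for runs in which the guess
            is already lost; only termination and the invariant are then at stake.\<close>
          have upd: "J update_cmd s4 ?TU (L (Suc k)) (v (Suc k)) g0"
            if s4: "far_ok s3 s4" and c: "\<And>l. c l \<le> 2 * H\<^sup>2"
              and g0: "g0 \<le> 0 \<or> (2 \<le> n \<and> g0 \<le> ?V * ?U \<and>
                (\<forall>s5. updated j H ((guess_point s4 H c)(0 := 1)) s4 s5 \<and> fG s5 = fG s4 \<and> vr s5 12 = vr s4 12
                   \<longrightarrow> round_state (H ^ 3 - Suc k) s5))" for s4 c g0
          proof -
            have b4: "bs0 s4" by (rule far_ok_base[OF b3 s4])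
            note ff = far_ok_fams[OF s4]
            have frame: "L (Suc k) s5 \<and> vn s5 8 = H ^ 3 \<and> vn s5 11 = Suc k \<and> fG s5 = fG s4 \<and> vr s5 12 = vr s4 12"
              if s5: "same {18, 20, 21} {10, 15, 16, 17, 18} (Uslots j) s4 s5" for s5
            proof -
              have U: "8 * i + 2 \<notin> Uslots j" for i
              proof -
                have "8 * i + 2 \<noteq> 8 * l + 1" for l by presburger
                then show ?thesis using Xslots_mem(5)[of i] by (simp only: Uslots_def Un_iff image_iff) blast
              qed
              have b5: "bs0 s5"
              proof (rule base_same[OF b4 s5])
                have "4 \<noteq> 8 * l + 1" "7 \<noteq> 8 * l + 1" for l :: nat by presburger+
                then show "4 \<notin> Uslots j" "7 \<notin> Uslots j" using Xslots_mem(6,7) by (auto simp: Uslots_def)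
                fix i assume "i \<in> {1..j}"
                then have "8 * (j + i) + 1 \<noteq> 8 * l + 1" if "l \<le> j" for l using that by auto
                then show "8 * (j + i) + 1 \<notin> Uslots j" using Xslots_mem(4)[of "j + i"]
                  by (simp only: Uslots_def Un_iff image_iff) auto
              qed auto
              have "fG s5 = fG s4" unfolding fG_def by (rule ext) (use s5 U in \<open>unfold same_def, blast\<close>)
              moreover have "vn s5 8 = vn s4 8" "vn s5 11 = vn s4 11" "vr s5 12 = vr s4 12" using s5 by (auto simp: same_def)
              ultimately show ?thesis using b5 ff T3 s3 by (simp add: L_def)
            qed
            have V0: "0 \<le> ?V" by (rule q2p)
            have "J update_cmd s4 ?TU (\<lambda>s'. same {18, 20, 21} {10, 15, 16, 17, 18} (Uslots j) s4 s')
              (\<lambda>s'. ?V * (if updated j H ((guess_point s4 H c)(0 := 1)) s4 s' then 1 else 0))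
              (?V * (if 2 \<le> n then ?U else 0))"
              by (rule J_scale[OF update_spec[OF b4 H1 c] V0])
            then have main: "J update_cmd s4 ?TU (L (Suc k)) (v (Suc k)) g0"
              if g1: "2 \<le> n \<and> g0 \<le> ?V * ?U \<and> (\<forall>s5. updated j H ((guess_point s4 H c)(0 := 1)) s4 s5 \<and> fG s5 = fG s4 \<and>
                vr s5 12 = vr s4 12 \<longrightarrow> round_state (H ^ 3 - Suc k) s5)"
            proof (rule J_conseq)
              fix s5 assume s5: "same {18, 20, 21} {10, 15, 16, 17, 18} (Uslots j) s4 s5"
              note fr = frame[OF s5]
              show "L (Suc k) s5" using fr by simp
              show "?V * (if updated j H ((guess_point s4 H c)(0 := 1)) s4 s5 then 1 else 0) \<le> v (Suc k) s5"
              proof (cases "updated j H ((guess_point s4 H c)(0 := 1)) s4 s5")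
                case True
                then have "round_state (H ^ 3 - Suc k) s5" using g1 fr by blast
                then show ?thesis using True fr by (simp add: v_def)
              qed (use v0 in simp)
            qed (use g1 in simp_all)
            show ?thesis
            proof (cases "g0 \<le> 0")
              case True
              have "tot update_cmd s4 ?TU (\<lambda>s'. same {18, 20, 21} {10, 15, 16, 17, 18} (Uslots j) s4 s')"
                by (rule J_tot[OF update_spec[OF b4 H1 c]])
              then have "tot update_cmd s4 ?TU (L (Suc k))" by (rule J_conseq) (use frame in auto)
              then show ?thesis
              proof (rule J_const)
                show "g0 \<le> v (Suc k) s'" for s' using True v0[of "Suc k" s'] by linarith
              qed
            qed (use main g0 in blast)
          qed
          show "J (far_cmd ;; update_cmd) s3 (far_time j K + ?TU) (L (Suc k)) (v (Suc k)) ?W"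
          proof (cases "round_state (H ^ 3 - k) s0 \<and> \<not> approx s0")
            case True
            have na: "\<not> approx s3" using True cg by simp
            have "round_state (H ^ 3 - k) s3" using True rs_cong[OF cg(2,3,4)] by simp
            then obtain S \<Psi> where n2: "2 \<le> n" and S: "S \<subseteq> I" "card (I - S) \<le> (real j + 2) * \<delta>' * n" "coords s3 S \<Psi>"
              "potential s3 \<Psi> \<le> real (H ^ 3 - k) * drop" using na by (auto simp: round_state_def)
            have far: "J far_cmd s3 (far_time j K) (far_ok s3) (\<lambda>s'. if vn s' 17 \<in> {i \<in> S. (1 + \<epsilon>) * w < hs s3 i} then 1 else 0) pf"
              by (rule far_J[OF b3 na S(1,2)]) (use many_far[OF na S(1,2)] in auto)
            have VU: "0 \<le> ?V * ?U" using q2p by simp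
            have "J (far_cmd ;; update_cmd) s3 (far_time j K + ?TU) (L (Suc k)) (v (Suc k)) (?V * ?U * pf)"
            proof (rule J_seq[OF J_scale[OF far VU]])
              fix s4 assume s4: "far_ok s3 s4"
              note ff = far_ok_fams[OF s4]
              show "J update_cmd s4 ?TU (L (Suc k)) (v (Suc k)) (?V * ?U * (if vn s4 17 \<in> {i \<in> S. (1 + \<epsilon>) * w < hs s3 i} then 1 else 0))"
              proof (cases "vn s4 17 \<in> {i \<in> S. (1 + \<epsilon>) * w < hs s3 i}")
                case True
                have c4: "coords s4 S \<Psi>" using S(3) ff by (simp add: coords_def)
                have qS: "vn s4 17 \<in> S" using True by simp
                have hq: "(1 + \<epsilon>) * w < hs s4 (vn s4 17)" using True hs_cong(1)[OF ff(1)] by simp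
                obtain c where c: "\<And>l. c l \<le> 2 * H\<^sup>2"
                  and dr: "\<And>s'. updated j H ((guess_point s4 H c)(0 := 1)) s4 s' \<Longrightarrow> potential s' \<Psi> \<le> potential s4 \<Psi> - drop"
                  using round_drop[OF c4 qS hq] by blast
                show ?thesis
                proof (rule upd[OF s4 c], intro disjI2 conjI allI impI)
                  show "?V * ?U * (if vn s4 17 \<in> {i \<in> S. (1 + \<epsilon>) * w < hs s3 i} then 1 else 0) \<le> ?V * ?U"
                    using True by simp
                  fix s5 assume s5: "updated j H ((guess_point s4 H c)(0 := 1)) s4 s5 \<and> fG s5 = fG s4 \<and> vr s5 12 = vr s4 12"
                  have "potential s5 \<Psi> \<le> potential s4 \<Psi> - drop"
                    using dr s5 by blast
                  also have "potential s4 \<Psi> = potential s3 \<Psi>" using ff by (simp add: potential_def)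
                  finally have "potential s5 \<Psi> \<le> real (H ^ 3 - k) * drop - drop" using S(4) by linarith
                  also have "\<dots> = (real (H ^ 3 - k) - 1) * drop" by (simp add: algebra_simps)
                  also have "real (H ^ 3 - k) - 1 = real (H ^ 3 - Suc k)" using k by (simp add: of_nat_diff)
                  finally have pot: "potential s5 \<Psi> \<le> real (H ^ 3 - Suc k) * drop" .
                  have "coords s5 S \<Psi>" using c4 s5 by (simp add: coords_def)
                  then show "round_state (H ^ 3 - Suc k) s5" using n2 S(1,2) pot by (auto simp: round_state_def)
                qed (rule n2)
              next
                case False
                then have z: "(if vn s4 17 \<in> {i \<in> S. (1 + \<epsilon>) * w < hs s3 i} then 1 else 0) = (0::real)" by (rule if_not_P)
                show ?thesis unfolding z mult_zero_right by (rule upd[OF s4, of "\<lambda>_. 0"]) simp_all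
              qed
            qed
            then show ?thesis using True by simp
          next
            case False
            then have z: "?W = 0" by (rule if_not_P)
            show ?thesis unfolding z by (rule J_seq_tot[OF far_tot[OF b3]], rule upd[of _ "\<lambda>_. 0"]) simp_all
          qed
        qed
      qed (use run2 in simp)
    qed
    define wa wb where "wa = (if approx s0 then 1 else 0 :: real)" and "wb = ?W"
    have coin: "J coin s0 2 (same {18} {} {} s0) (\<lambda>s'. if vn s' 18 < vn s' 3 then wa else wb) (v k s0)"
    proof (rule coin_J[OF n3, of wa _ wb])
      show "0 \<le> wa" "0 \<le> wb" using pf_bounds q2p by (auto simp: wa_def wb_def)
      show "v k s0 \<le> wa / 2 \<or> (2 \<le> n \<and> v k s0 \<le> wb / 3) \<or> v k s0 \<le> 0"
      proof (cases "round_state (H ^ 3 - k) s0")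
        case True
        have vk: "v k s0 = q2 ^ (H ^ 3 - k)" using True run by (simp add: v_def)
        have jk: "q2 ^ (H ^ 3 - k) = q2 * ?V" using k by (simp add: Suc_diff_Suc[symmetric])
        show ?thesis
        proof (cases "approx s0")
          case True
          have "q2 * ?V \<le> 1 / 2 * 1" using q2_bounds q2p by (intro mult_mono) auto
          then show ?thesis unfolding vk jk using True by (simp add: wa_def)
        next
          case False
          then have "2 \<le> n" using True by (auto simp: round_state_def)
          moreover have "v k s0 = wb / 3" unfolding vk jk using True False by (simp add: wb_def q2_def)
          ultimately show ?thesis by simp
        qed
      next
        case False
        then have "v k s0 \<le> 0" using run H3 by (simp add: v_def)
        then show ?thesis by simp
      qed
    qed auto
    have "J ?body s0 (2 + ?T) (L (Suc k)) (v (Suc k)) (v k s0)"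
    proof (rule J_seq[OF coin])
      fix s1 assume s1: "same {18} {} {} s0 s1"
      show "J ?rest s1 ?T (L (Suc k)) (v (Suc k)) (if vn s1 18 < vn s1 3 then wa else wb)"
      proof (cases "vn s1 18 < vn s1 3")
        case True
        then show ?thesis using stop[OF s1 True] by (simp only: if_True wa_def)
      next
        case False
        then show ?thesis using go[OF s1 False] by (simp only: if_False wb_def)
      qed
    qed
    then show ?thesis by (rule J_conseq) auto
  qed
  have 2: "J (WhileN 11 8 ?body) s1 (H ^ 3 * (far_time j K + ?TU + 8 + 2) + 2) bs0
      (\<lambda>s'. if approx s' then 1 else 0) (v 0 s1)" if L: "L 0 s1" for s1
  proof (rule J_whileN[where I = L and v = v and K = "H ^ 3", OF L refl step])
    fix k s' assume k: "k \<le> H ^ 3" and L: "L k s'" and t: "\<not> vn s' 11 < vn s' 8"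
    have "v k s' \<le> (if approx s' then 1 else 0)"
    proof (cases "vn s' 8 = H ^ 3 \<and> vn s' 11 = k \<and> round_state (H ^ 3 - k) s'")
      case True
      then have "k = H ^ 3" using t k by auto
      then have "approx s'" using True round_0 by simp
      then show ?thesis using True q2p by (simp add: v_def)
    qed (auto simp: v_def)
    then show "bs0 s' \<and> v k s' \<le> (if approx s' then 1 else 0)" using L by (simp add: L_def)
  qed (auto simp: L_def)
  have "J refine_cmd s (1 + (H ^ 3 * (far_time j K + ?TU + 8 + 2) + 2)) bs0
    (\<lambda>s'. if approx s' then 1 else 0) (if round_state (H ^ 3) s then q2 ^ (H ^ 3) else 0)"
    unfolding refine_cmd_def by (rule J_seq[OF 1 2])
  then show ?thesis by (rule J_conseq) (auto simp: algebra_simps)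
qed

end

section \<open>Running time and correctness of the whole command\<close>

definition fit_time :: "nat \<Rightarrow> real \<Rightarrow> real \<Rightarrow> real \<Rightarrow> nat" where
  "fit_time j \<epsilon> \<delta> \<gamma> = (let H = scale_param j \<epsilon>; t = vprog.far_time j (nat \<lceil>1 / (2 * (\<gamma> + \<delta>))\<rceil>) in
     (10 * j + 4 * nat \<lceil>1 / \<epsilon>\<rceil> + 30) + ((j * (t + 15) + 4) + ((t + 2) +
       ((H ^ 3 * (t + j * (18 * H\<^sup>2 + 40) + 27) + 3) + (24 * j * j + 45 * j + 17)))))"

context vprog
begin

definition out_dir :: "nat \<Rightarrow> vst \<Rightarrow> nat \<Rightarrow> fvec" where
  "out_dir j s i = vv s (16 * j + 16 + i)"

definition out_ok :: "nat \<Rightarrow> vst \<Rightarrow> bool" where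
  "out_ok j s \<longleftrightarrow> vn s 0 = 128 + (16 * j + 16) * d \<and> ons (out_dir j s) j"

definition out_covers :: "nat \<Rightarrow> real \<Rightarrow> real \<Rightarrow> vst \<Rightarrow> bool" where
  "out_covers j c r s \<longleftrightarrow>
     c \<le> card {i \<in> {..<n}. norm (perp (span (out_dir j s ` {1..j})) (pts i - out_dir j s 0)) \<le> r}"

end

context fitting
begin

lemma flat_spec:
  assumes N: "vn s 0 = n" "vn s 1 = d" "vn s 2 = j" "\<And>i. 3 \<le> i \<Longrightarrow> vn s i = 0"
    and R: "vr s 0 = \<gamma>" "vr s 1 = \<epsilon>" "vr s 2 = \<delta>" "\<And>i. 5 \<le> i \<Longrightarrow> vr s i = 0" and V: "\<And>i. vv s i = 0"
    and dj: "j \<le> d" "1 \<le> d"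
  shows "J flat_cmd s (fit_time j \<epsilon> \<delta> \<gamma>) (out_ok j)
    (\<lambda>s'. if out_covers j ((1 - \<delta> - \<gamma>) * n) ((1 + \<epsilon>) * w) s' then 1 else 0)
    ((1 - \<gamma>) * (q1 ^ j * (pf * q2 ^ (H ^ 3))))"
proof -
  let ?B = "q2 ^ (H ^ 3)"
  have B0: "0 \<le> ?B" using q2_bounds by simp
  have A0: "0 \<le> pf * ?B" using B0 pf_bounds by simp
  have Q0: "0 \<le> q1 ^ j * (pf * ?B)" using A0 q1_bounds by simp
  have pI: "1 - \<gamma> \<le> card I / n" using I(2) n1 by (simp add: pos_le_divide_eq)
  have out: "J output_cmd s4 (24 * j * j + 45 * j + 17) (out_ok j)
      (\<lambda>s'. if out_covers j ((1 - \<delta> - \<gamma>) * n) ((1 + \<epsilon>) * w) s' then 1 else 0) (if approx s4 then 1 else 0)"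
    if b4: "bs0 s4" for s4
  proof -
    have f: "consts_ok s4" "vn s4 1 = d" "vn s4 2 = j" "ons (\<lambda>i. fP s4 (j + i)) j" using b4 by (auto simp: base_def)
    have "tot output_cmd s4 (24 * j * j + 45 * j + 17) (\<lambda>s'. \<exists>E. ons E j \<and>
      span (fP s4 ` {1..j}) \<subseteq> span (E ` {1..j}) \<and> vn s' 0 = 128 + (16 * j + 16) * d \<and>
      vv s' (16 * j + 16) = fP s4 0 \<and> (\<forall>i\<in>{1..j}. vv s' (16 * j + 16 + i) = E i))" (is "tot _ _ _ ?Q")
      using output_spec[of s4] f by simp
    then have "tot output_cmd s4 (24 * j * j + 45 * j + 17) (\<lambda>s'. out_ok j s' \<and>
      (approx s4 \<longrightarrow> out_covers j ((1 - \<delta> - \<gamma>) * n) ((1 + \<epsilon>) * w) s'))"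
    proof (rule J_conseq)
      fix s' assume "?Q s'"
      then obtain E where E: "ons E j" "span (fP s4 ` {1..j}) \<subseteq> span (E ` {1..j})" "vn s' 0 = 128 + (16 * j + 16) * d"
        "vv s' (16 * j + 16) = fP s4 0" "\<forall>i\<in>{1..j}. vv s' (16 * j + 16 + i) = E i" by blast
      have o: "out_dir j s' i = E i" if "i \<in> {1..j}" for i using E(5) that unfolding out_dir_def by blast
      have o0: "out_dir j s' 0 = fP s4 0" using E(4) by (simp add: out_dir_def)
      have im: "out_dir j s' ` {1..j} = E ` {1..j}" using o by (intro image_cong) auto
      have "ons (out_dir j s') j" using E(1) o by (simp add: ons_def)
      moreover have "out_covers j ((1 - \<delta> - \<gamma>) * n) ((1 + \<epsilon>) * w) s'" if ap: "approx s4"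
      proof -
        \<comment> \<open>The output directions contain the frame directions, which can only shorten
          residuals.\<close>
        have le: "norm (perp (span (E ` {1..j})) x) \<le> norm (perp (span (fP s4 ` {1..j})) x)" for x
        proof -
          have "x - perp (span (fP s4 ` {1..j})) x \<in> span (E ` {1..j})"
            using perp_span(1)[of "fP s4 ` {1..j}" x] E(2) by auto
          from norm_perp_le[OF _ this, of x] show ?thesis by simp
        qed
        have "card {i \<in> {..<n}. hs s4 i \<le> (1 + \<epsilon>) * w} \<le>
          card {i \<in> {..<n}. norm (perp (span (E ` {1..j})) (pts i - fP s4 0)) \<le> (1 + \<epsilon>) * w}"
          by (rule card_mono) (auto simp: hs_def intro: order_trans[OF le])
        then show ?thesis using ap unfolding out_covers_def approx_def im o0 by linarith
      qed
      ultimately show "out_ok j s' \<and> (approx s4 \<longrightarrow> out_covers j ((1 - \<delta> - \<gamma>) * n) ((1 + \<epsilon>) * w) s')"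
        using E(3) by (simp add: out_ok_def)
    qed auto
    then have "J output_cmd s4 (24 * j * j + 45 * j + 17) (\<lambda>s'. out_ok j s' \<and>
      (approx s4 \<longrightarrow> out_covers j ((1 - \<delta> - \<gamma>) * n) ((1 + \<epsilon>) * w) s'))
      (\<lambda>s'. if out_covers j ((1 - \<delta> - \<gamma>) * n) ((1 + \<epsilon>) * w) s' then 1 else 0) (if approx s4 then 1 else 0)"
      by (rule J_const) auto
    then show ?thesis by (rule J_conseq) auto
  qed
  have "J init_cmd s (10 * j + 4 * nat \<lceil>1 / \<epsilon>\<rceil> + 30) (started j H (2 * (\<gamma> + \<delta>)))
    (\<lambda>s'. q1 ^ j * (pf * ?B) * (if vn s' 16 \<in> I then 1 else 0)) (q1 ^ j * (pf * ?B) * (1 - \<gamma>))"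
    by (rule J_scale[OF init_spec[OF N R V \<epsilon>(1) dj I(1) pI] Q0])
  then have init: "J init_cmd s (10 * j + 4 * nat \<lceil>1 / \<epsilon>\<rceil> + 30) (started j H (2 * (\<gamma> + \<delta>)))
    (\<lambda>s'. if vn s' 16 \<in> I then q1 ^ j * (pf * ?B) else 0) ((1 - \<gamma>) * (q1 ^ j * (pf * ?B)))"
    by (rule J_conseq) (auto simp: mult.commute)
  show ?thesis unfolding flat_cmd_def fit_time_def Let_def
  proof (rule J_seq[OF init], rule J_seq)
    fix s1 assume s1: "started j H (2 * (\<gamma> + \<delta>)) s1"
    show "J greedy_cmd s1 (j * (far_time j K + 15) + 4) (\<lambda>s'. bs0 s' \<and> vn s' 8 = H ^ 3 \<and> vn s' 9 \<le> j)
      (\<lambda>s'. if decided s' then pf * ?B else 0) (if vn s1 16 \<in> I then q1 ^ j * (pf * ?B) else 0)"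
      by (rule greedy_spec[OF _ A0 _ s1]) (use s1 in \<open>auto simp: started_def\<close>)
  next
    fix s2 assume s2: "bs0 s2 \<and> vn s2 8 = H ^ 3 \<and> vn s2 9 \<le> j"
    show "J (sigma_cmd ;; refine_cmd ;; output_cmd) s2 ((far_time j K + 2) +
       ((H ^ 3 * (far_time j K + j * (18 * H\<^sup>2 + 40) + 27) + 3) + (24 * j * j + 45 * j + 17))) (out_ok j)
      (\<lambda>s'. if out_covers j ((1 - \<delta> - \<gamma>) * n) ((1 + \<epsilon>) * w) s' then 1 else 0) (if decided s2 then pf * ?B else 0)"
    proof (rule J_seq)
      show "J sigma_cmd s2 (far_time j K + 2) (\<lambda>s'. bs0 s' \<and> vn s' 8 = H ^ 3)
        (\<lambda>s'. if round_state (H ^ 3) s' then ?B else 0) (if decided s2 then pf * ?B else 0)"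
        by (rule sigma_spec[OF _ _ B0]) (use s2 in auto)
    next
      fix s3 assume s3: "bs0 s3 \<and> vn s3 8 = H ^ 3"
      show "J (refine_cmd ;; output_cmd) s3
       ((H ^ 3 * (far_time j K + j * (18 * H\<^sup>2 + 40) + 27) + 3) + (24 * j * j + 45 * j + 17)) (out_ok j)
       (\<lambda>s'. if out_covers j ((1 - \<delta> - \<gamma>) * n) ((1 + \<epsilon>) * w) s' then 1 else 0) (if round_state (H ^ 3) s3 then ?B else 0)"
        by (rule J_seq[OF refine_spec out]) (use s3 in auto)
    qed
  qed
qed

end

section \<open>From the program to the theorem\<close>

definition fit_prog :: program where "fit_prog = compile 0 (tr flat_cmd)"

text \<open>Composition of \<open>simulation\<close> and \<open>compile_correct\<close>. Behind the
  code the machine has halted, so \<open>frag\<close> applies with \<open>t = 0\<close>.\<close>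

lemma fit_prog_run:
  fixes Q :: "vst \<Rightarrow> bool"
  assumes J: "prog.J (sem2 d pts (length ps)) vn vr flat_cmd (absm d m) T Q (\<lambda>s. if C s then 1 else 0) p"
    and d: "fst m 1 = d" "1 \<le> d" and pts: "\<And>i. pts i = mkv d (coord ps i)"
  obtains D where "run fit_prog ps (at_pc 0 m) (50 * d * T) = map_pmf (at_pc (length fit_prog)) D"
    "\<And>m'. m' \<in> set_pmf D \<Longrightarrow> Q (absm d m')" "p \<le> measure_pmf.prob D {m'. C (absm d m')}"
proof -
  interpret machine ps d .
  obtain D where D: "bs (sem2 d pts (length ps)) vn vr flat_cmd (absm d m) D T" "\<forall>s\<in>set_pmf D. Q s"
    "ennreal p \<le> (\<integral>\<^sup>+ s. ennreal (if C s then 1 else 0) \<partial>measure_pmf D)"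
    using J unfolding prog.J_def by blast
  obtain D' where D': "bs (sem0 ps) fst snd (tr flat_cmd) m D' (50 * d * T)" "map_pmf (absm d) D' = D"
    using simulation[OF D(1) okc_flat_cmd refl d pts] by blast
  have "code_at fit_prog 0 (compile 0 (tr flat_cmd))" by (simp add: code_at_def fit_prog_def)
  then have fr: "frag fit_prog ps 0 (0 + clen (tr flat_cmd)) m D' (50 * d * T)"
    by (rule compile_correct[OF D'(1) _ wfc_tr])
  have len: "length fit_prog = clen (tr flat_cmd)" by (simp add: fit_prog_def length_compile)
  have h: "halted fit_prog (at_pc (length fit_prog) m')" for m' by (simp add: halted_def at_pc_def)
  then have "halts_within fit_prog ps (at_pc (length fit_prog) m') 0" for m'
    by (simp add: halts_within_def run_0)
  then have "run fit_prog ps (at_pc 0 m) (50 * d * T + 0) = bind_pmf D' (\<lambda>m'. run fit_prog ps (at_pc (length fit_prog) m') 0)"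
    using fr unfolding frag_def len add_0 by blast
  then have r: "run fit_prog ps (at_pc 0 m) (50 * d * T) = map_pmf (at_pc (length fit_prog)) D'"
    by (simp add: run_0 map_pmf_def)
  have "ennreal p \<le> (\<integral>\<^sup>+ s. indicator {s. C s} s \<partial>measure_pmf D)"
    using D(3) by (simp add: indicator_def of_bool_def if_distrib[of ennreal] cong: if_cong)
  also have "\<dots> = ennreal (measure_pmf.prob D {s. C s})" by (simp add: measure_pmf.emeasure_eq_measure)
  finally have "p \<le> measure_pmf.prob D {s. C s}" by (simp add: ennreal_le_iff)
  also have "\<dots> = measure_pmf.prob D' {m'. C (absm d m')}" unfolding D'(2)[symmetric] by (simp add: vimage_def)
  finally show ?thesis using that[OF r] D(2) D'(2) by auto
qed

text \<open>Exponents collected from the phases: \<open>j + 4\<close> for each greedy round,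
  \<open>j + 3\<close> for the choice of \<open>\<sigma>\<close>, and
  \<open>j + 4 + 2 * H\<^sup>2 * j\<close> for each of the \<open>H ^ 3\<close> refinement
  rounds.\<close>

definition fit_exp :: "nat \<Rightarrow> real \<Rightarrow> nat" where
  "fit_exp j \<epsilon> = (let H = scale_param j \<epsilon> in j * (j + 4) + (j + 3) + H ^ 3 * (j + 4 + 2 * H\<^sup>2 * j))"

lemma linear_le_power3: "4 * (real j + 3) \<le> 3 * 3 ^ (j + 2)"
proof (induction j)
  case (Suc j)
  have "4 * (real (Suc j) + 3) \<le> 3 * (4 * (real j + 3))" by simp
  also have "\<dots> \<le> 3 * (3 * 3 ^ (j + 2))" using Suc by simp
  finally show ?case by simp
qed simp

text \<open>The base \<open>x\<close> is at most \<open>1 / 3\<close>, so constants are paid for by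
  additional powers of \<open>x\<close>: \<open>j + 2\<close> of them for the factor
  \<open>3 / (4 * (j + 3))\<close> in \<open>pf\<close>, and one for each coin.\<close>

lemma (in fitting) success_lower_bound:
  "(1 - \<gamma>) * (\<delta> / (3 * (\<gamma> + \<delta>))) ^ fit_exp j \<epsilon> \<le> (1 - \<gamma>) * (q1 ^ j * (pf * q2 ^ (H ^ 3)))"
proof -
  define x where "x = \<delta> / (3 * (\<gamma> + \<delta>))"
  have x: "0 < x" "x \<le> 1 / 3" using \<gamma> \<delta> by (auto simp: x_def field_simps)
  have x0: "0 \<le> x" using x by simp
  have pf: "x ^ (j + 3) \<le> pf"
  proof -
    have "x ^ (j + 2) \<le> (1 / 3) ^ (j + 2)" using x by (intro power_mono) auto
    also have "\<dots> \<le> 3 / (4 * (real j + 3))"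
      using linear_le_power3[of j] by (simp add: field_simps power_one_over)
    finally have "x * x ^ (j + 2) \<le> x * (3 / (4 * (real j + 3)))" using x by (intro mult_left_mono) auto
    also have "\<dots> = pf"
    proof -
      have "a / (3 * b) * (3 / (4 * c)) = a / c / (4 * b)" if "b \<noteq> 0" "c \<noteq> 0" for a b c :: real
        using that by (simp add: field_simps)
      note cancel = this
      show ?thesis unfolding x_def pf_def \<delta>'_def by (rule cancel) (use \<gamma> \<delta> in auto)
    qed
    also have "x * x ^ (j + 2) = x ^ (j + 3)" by (simp add: power_add power2_eq_square power3_eq_cube)
    finally show ?thesis .
  qed
  have pf3: "x ^ (j + 4) \<le> pf / 3"
  proof -
    have "x ^ (j + 3) * x \<le> pf * (1 / 3)" 
    proof (rule mult_mono[OF pf x(2)])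
      show "0 \<le> pf" using pf_bounds(1) by simp
    qed (rule x0)
    moreover have "x ^ (j + 4) = x ^ (j + 3) * x" using power_Suc2[of x "j + 3"] by (simp add: Suc_eq_plus1 add.assoc)
    ultimately show ?thesis by simp
  qed
  have "x ^ (2 * H\<^sup>2 * j) \<le> (1 / 3) ^ (2 * H\<^sup>2 * j)" by (rule power_mono) (use x in auto)
  then have "x ^ (j + 4) * x ^ (2 * H\<^sup>2 * j) \<le> q2"
    unfolding q2_def using pf3 x pf_bounds by (intro mult_mono) auto
  then have q2: "x ^ (j + 4 + 2 * H\<^sup>2 * j) \<le> q2" by (simp only: power_add)
  have "x ^ fit_exp j \<epsilon> = (x ^ (j + 4)) ^ j * (x ^ (j + 3) * (x ^ (j + 4 + 2 * H\<^sup>2 * j)) ^ (H ^ 3))"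
    by (simp only: fit_exp_def Let_def power_add power_mult mult.assoc mult.commute[of j] mult.commute[of "H ^ 3"])
  also have "\<dots> \<le> q1 ^ j * (pf * q2 ^ (H ^ 3))"
    using pf pf3 q2 x pf_bounds unfolding q1_def by (intro mult_mono power_mono) auto
  finally show ?thesis using \<gamma> unfolding x_def[symmetric] by (intro mult_left_mono) auto
qed

lemma card_indices:
  assumes "distinct xs"
  shows "card {i \<in> {..<length xs}. Q (xs ! i)} = card {p \<in> set xs. Q p}"
proof -
  have "{p \<in> set xs. Q p} = (!) xs ` {i \<in> {..<length xs}. Q (xs ! i)}" by (auto simp: in_set_conv_nth)
  moreover have "inj_on ((!) xs) {i \<in> {..<length xs}. Q (xs ! i)}" using assms by (intro inj_on_nth) auto
  ultimately show ?thesis by (simp add: card_image)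
qed

text \<open>\<open>F\<close>, \<open>P'\<close> and \<open>w\<close> serve to interpret the locale
  \<open>fitting\<close> only; the program and the distribution \<open>R\<close> do not refer to
  them. This independence makes the later limit in \<open>w\<close> possible.\<close>

lemma fit_prog_output:
  fixes n d j :: nat and P P' :: "rvec set" and w \<eta>\<^sub>1 \<eta>\<^sub>2 :: real
  assumes dj: "1 \<le> d" "j \<le> d" and n: "1 \<le> n" and P: "P \<subseteq> carrier_vec d" "finite P" "card P = n" "set ps = P" "distinct ps"
    and \<gamma>: "0 < \<gamma>" "\<gamma> < 1" and \<epsilon>: "0 < \<epsilon>" "\<epsilon> < 1" and \<delta>: "0 < \<delta>" "\<delta> < 1"
    and F: "is_flat d j F" "P' \<subseteq> P" "card P' = nat \<lceil>(1 - \<gamma>) * real n\<rceil>" "\<And>p. p \<in> P' \<Longrightarrow> flat_dist F p \<le> w" and w: "0 < w"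
  defines "R \<equiv> run fit_prog ps (init_state [n, d, j] [\<gamma>, \<epsilon>, \<delta>, \<eta>\<^sub>1, \<eta>\<^sub>2]) (50 * d * fit_time j \<epsilon> \<delta> \<gamma>)"
  shows "\<And>s. s \<in> set_pmf R \<Longrightarrow> halted fit_prog s \<and> is_flat d j (output_flat d j s)"
    and "(1 - \<gamma>) * (\<delta> / (3 * (\<gamma> + \<delta>))) ^ fit_exp j \<epsilon> \<le> measure_pmf.prob R
      {s. (1 - \<delta> - \<gamma>) * real n \<le> card {p \<in> P. flat_dist (output_flat d j s) p \<le> (1 + \<epsilon>) * w}}"
proof -
  obtain b u where u: "ons u j"
    and b: "\<And>p. p \<in> carrier_vec d \<Longrightarrow> norm (perp (span (u ` {1..j})) (vf p - b)) \<le> flat_dist F p"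
    using is_flat_orthonormal[OF F(1)] by blast
  have len: "length ps = n" using distinct_card[OF P(5)] P(3,4) by simp
  define pts where "pts i = mkv d (coord ps i)" for i
  have psP: "ps ! i \<in> carrier_vec d" if "i < n" for i using nth_mem[of i ps] that P(1,4) len by auto
  have pts: "pts i = vf (ps ! i)" if "i < n" for i
  proof -
    have "dim_vec (ps ! i) = d" using psP[OF that] by simp
    then show ?thesis unfolding pts_def vf_mkv[OF psP[OF that]]
      by (intro mkv_cong) (use that len in \<open>simp add: coord_def\<close>)
  qed
  define I where "I = {i \<in> {..<length ps}. ps ! i \<in> P'}"
  have cI: "card I = nat \<lceil>(1 - \<gamma>) * real n\<rceil>"
  proof -
    have "{p \<in> set ps. p \<in> P'} = P'" using F(2) P(4) by auto
    then show ?thesis unfolding I_def using card_indices[OF P(5), of "\<lambda>p. p \<in> P'"] F(3) by simp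
  qed
  interpret fitting d n pts j \<gamma> \<epsilon> \<delta> w "span (u ` {1..j})" b I u
  proof
    show "(1 - \<gamma>) * real n \<le> real (card I)" unfolding cI by linarith
    show "norm (perp (span (u ` {1..j})) (pts i - b)) \<le> w" if "i \<in> I" for i
      using that pts[of i] b[OF psP, of i] F(4)[of "ps ! i"] by (fastforce simp: I_def len)
  qed (use n u w \<gamma> \<epsilon> \<delta> in \<open>auto simp: I_def len\<close>)
  define s\<^sub>0 where "s\<^sub>0 = init_state [n, d, j] [\<gamma>, \<epsilon>, \<delta>, \<eta>\<^sub>1, \<eta>\<^sub>2]"
  define m where "m = (nmem s\<^sub>0, rmem s\<^sub>0)"
  have s0: "s\<^sub>0 = at_pc 0 m" by (simp add: m_def s\<^sub>0_def at_pc_def init_state_def)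
  have nm: "fst m i = (if i = 0 then n else if i = 1 then d else if i = 2 then j else 0)" for i
    by (auto simp: m_def s\<^sub>0_def init_state_def nth_Cons' One_nat_def)
  have rm: "snd m 0 = \<gamma>" "snd m 1 = \<epsilon>" "snd m 2 = \<delta>" "\<And>i. 5 \<le> i \<Longrightarrow> snd m i = 0"
    by (auto simp: m_def s\<^sub>0_def init_state_def nth_Cons' One_nat_def)
  have J: "J flat_cmd (absm d m) (fit_time j \<epsilon> \<delta> \<gamma>) (out_ok j)
    (\<lambda>s'. if out_covers j ((1 - \<delta> - \<gamma>) * n) ((1 + \<epsilon>) * w) s' then 1 else 0)
    ((1 - \<gamma>) * (q1 ^ j * (pf * q2 ^ (H ^ 3))))"
    by (rule flat_spec) (use dj in \<open>auto simp: absm_def nm rm mkv_zero\<close>)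
  have J': "prog.J (sem2 d pts (length ps)) vn vr flat_cmd (absm d m) (fit_time j \<epsilon> \<delta> \<gamma>) (out_ok j)
    (\<lambda>s'. if out_covers j ((1 - \<delta> - \<gamma>) * n) ((1 + \<epsilon>) * w) s' then 1 else 0)
    ((1 - \<gamma>) * (q1 ^ j * (pf * q2 ^ (H ^ 3))))" unfolding len by (rule J)
  have m1: "fst m 1 = d" by (simp add: nm)
  obtain D where D: "run fit_prog ps (at_pc 0 m) (50 * d * fit_time j \<epsilon> \<delta> \<gamma>) = map_pmf (at_pc (length fit_prog)) D"
    "\<And>m'. m' \<in> set_pmf D \<Longrightarrow> out_ok j (absm d m')"
    "(1 - \<gamma>) * (q1 ^ j * (pf * q2 ^ (H ^ 3))) \<le>
      measure_pmf.prob D {m'. out_covers j ((1 - \<delta> - \<gamma>) * n) ((1 + \<epsilon>) * w) (absm d m')}"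
    by (rule fit_prog_run[OF J' m1 dj(1) pts_def]) (rule that)
  have R: "R = map_pmf (at_pc (length fit_prog)) D" unfolding R_def using D(1) s0 by (simp add: s\<^sub>0_def)
  have out: "is_flat d j (output_flat d j (at_pc l m')) \<and> (\<forall>p\<in>carrier_vec d. flat_dist (output_flat d j (at_pc l m')) p =
      norm (perp (span (out_dir j (absm d m') ` {1..j})) (vf p - out_dir j (absm d m') 0)))"
    if m': "m' \<in> set_pmf D" for m' l
  proof -
    have ok: "fst m' 0 = 128 + (16 * j + 16) * d" "ons (out_dir j (absm d m')) j"
      using D(2)[OF m'] by (auto simp: out_ok_def absm_def)
    define v where "v i = Matrix.vec d (\<lambda>k. snd m' (fst m' 0 + i * d + k))" for i
    \<comment> \<open>The output address \<open>128 + (16 * j + 16) * d\<close> is the beginning of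
      slot \<open>16 * j + 16\<close>, so the output vectors are the slots from there on.\<close>
    have vf: "(\<lambda>i. vf (v i)) = out_dir j (absm d m')"
      by (rule ext) (simp add: v_def vf_vec out_dir_def absm_def ok(1) add_mult_distrib add.assoc)
    have e: "output_flat d j (at_pc l m') = {v 0 + w | w. w \<in> module.span class_ring (euclid d) (v ` {1..j})}"
      by (simp add: output_flat_def Let_def at_pc_def v_def[abs_def])
    have c: "v i \<in> carrier_vec d" for i by (simp add: v_def)
    have on: "ons (\<lambda>i. vf (v i)) j" unfolding vf by (rule ok)
    show ?thesis using orthonormal_is_flat[OF c on e] fun_cong[OF vf, of 0] unfolding vf by simp
  qed
  show "halted fit_prog s \<and> is_flat d j (output_flat d j s)" if "s \<in> set_pmf R" for s
  proof -
    obtain m' where m': "m' \<in> set_pmf D" "s = at_pc (length fit_prog) m'" using \<open>s \<in> set_pmf R\<close> unfolding R by auto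
    then show ?thesis using out[OF m'(1), of "length fit_prog"] by (simp add: halted_def at_pc_def)
  qed
  let ?E = "{s. (1 - \<delta> - \<gamma>) * real n \<le> card {p \<in> P. flat_dist (output_flat d j s) p \<le> (1 + \<epsilon>) * w}}"
  have "(1 - \<gamma>) * (\<delta> / (3 * (\<gamma> + \<delta>))) ^ fit_exp j \<epsilon> \<le> (1 - \<gamma>) * (q1 ^ j * (pf * q2 ^ (H ^ 3)))"
    by (rule success_lower_bound)
  also note D(3)
  also have "measure_pmf.prob D {m'. out_covers j ((1 - \<delta> - \<gamma>) * n) ((1 + \<epsilon>) * w) (absm d m')} \<le>
    measure_pmf.prob D (at_pc (length fit_prog) -` ?E)"
  proof (rule measure_pmf.finite_measure_mono_AE)
    have "at_pc (length fit_prog) m' \<in> ?E"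
      if m': "m' \<in> set_pmf D" and oc: "out_covers j ((1 - \<delta> - \<gamma>) * n) ((1 + \<epsilon>) * w) (absm d m')" for m'
    proof -
      let ?s = "at_pc (length fit_prog) m'"
      have "card {i \<in> {..<n}. norm (perp (span (out_dir j (absm d m') ` {1..j})) (pts i - out_dir j (absm d m') 0)) \<le> (1 + \<epsilon>) * w}
        = card {i \<in> {..<length ps}. flat_dist (output_flat d j ?s) (ps ! i) \<le> (1 + \<epsilon>) * w}"
        by (rule arg_cong[where f = card]) (use out[OF m', of "length fit_prog"] psP pts len in auto)
      also have "\<dots> = card {p \<in> P. flat_dist (output_flat d j ?s) p \<le> (1 + \<epsilon>) * w}"
        using card_indices[OF P(5), of "\<lambda>p. flat_dist (output_flat d j ?s) p \<le> (1 + \<epsilon>) * w"] P(4) by simp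
      finally show ?thesis using oc by (simp add: out_covers_def)
    qed
    then show "AE m' in measure_pmf D. m' \<in> {m'. out_covers j ((1 - \<delta> - \<gamma>) * n) ((1 + \<epsilon>) * w) (absm d m')} \<longrightarrow>
      m' \<in> at_pc (length fit_prog) -` ?E" by (auto simp: AE_measure_pmf_iff)
  qed auto
  also have "\<dots> = measure_pmf.prob R ?E" by (simp add: R)
  finally show "(1 - \<gamma>) * (\<delta> / (3 * (\<gamma> + \<delta>))) ^ fit_exp j \<epsilon> \<le> measure_pmf.prob R ?E" .
qed

text \<open>\<open>f\<close> has finitely many values on \<open>P\<close>, so no new point is
  covered between \<open>W\<close> and some \<open>t > W\<close>. This serves both for the limit in
  \<open>w\<close> and for the infimum in \<open>cover_width\<close>.\<close>

lemma card_le_attained: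
  fixes f :: "'a \<Rightarrow> real"
  assumes "finite P" and "\<And>w. W < w \<Longrightarrow> \<exists>w'<w. c \<le> real (card {p \<in> P. f p \<le> w'})"
  shows "c \<le> real (card {p \<in> P. f p \<le> W})"
proof -
  obtain t where t: "W < t" "\<And>p. p \<in> P \<Longrightarrow> f p < t \<Longrightarrow> f p \<le> W"
  proof (cases "{x \<in> f ` P. W < x} = {}")
    case True
    then show ?thesis using that[of "W + 1"] by fastforce
  next
    case False
    let ?M = "Min {x \<in> f ` P. W < x}"
    have fin: "finite {x \<in> f ` P. W < x}" using assms(1) by simp
    show ?thesis
    proof (rule that[of ?M])
      show "W < ?M" using Min_in[OF fin False] by blast
      show "f p \<le> W" if p: "p \<in> P" "f p < ?M" for p
      proof (rule ccontr)
        assume "\<not> f p \<le> W"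
        then have "?M \<le> f p" using p by (intro Min_le[OF fin]) auto
        then show False using p by simp
      qed
    qed
  qed
  obtain w' where w': "w' < t" "c \<le> real (card {p \<in> P. f p \<le> w'})" using assms(2)[OF t(1)] by blast
  have "card {p \<in> P. f p \<le> w'} \<le> card {p \<in> P. f p \<le> W}" using assms(1) t(2) w'(1) by (intro card_mono) auto
  then show ?thesis using w'(2) by linarith
qed

lemma replicate_pmf_hits:
  "measure_pmf.prob (replicate_pmf N D) {xs. \<exists>x\<in>set xs. x \<in> X} = 1 - (1 - measure_pmf.prob D X) ^ N"
proof -
  have "measure_pmf.prob (replicate_pmf N D) {xs. set xs \<subseteq> - X} = measure_pmf.prob D (- X) ^ N"
  proof (induction N)
    case (Suc N)
    have "ennreal (measure_pmf.prob (replicate_pmf (Suc N) D) {xs. set xs \<subseteq> - X}) =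
      emeasure (measure_pmf (replicate_pmf (Suc N) D)) {xs. set xs \<subseteq> - X}"
      by (simp add: measure_pmf.emeasure_eq_measure)
    also have "\<dots> = (\<integral>\<^sup>+x. \<integral>\<^sup>+xs. indicator (- X) x * indicator {xs. set xs \<subseteq> - X} xs \<partial>measure_pmf (replicate_pmf N D) \<partial>measure_pmf D)"
      by (auto simp: emeasure_bind_pmf indicator_def intro!: nn_integral_cong)
    also have "\<dots> = ennreal (measure_pmf.prob D (- X)) * ennreal (measure_pmf.prob (replicate_pmf N D) {xs. set xs \<subseteq> - X})"
      by (simp add: nn_integral_cmult nn_integral_multc measure_pmf.emeasure_eq_measure)
    also have "\<dots> = ennreal (measure_pmf.prob D (- X) ^ Suc N)" by (simp add: Suc ennreal_mult')
    finally show ?case by simp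
  qed simp
  moreover have "measure_pmf.prob D (- X) = 1 - measure_pmf.prob D X"
    using measure_pmf.prob_compl[of X D] by (simp add: Compl_eq_Diff_UNIV)
  moreover have "measure_pmf.prob (replicate_pmf N D) {xs. \<exists>x\<in>set xs. x \<in> X} =
    1 - measure_pmf.prob (replicate_pmf N D) {xs. set xs \<subseteq> - X}"
  proof -
    have "{xs. \<exists>x\<in>set xs. x \<in> X} = UNIV - {xs. set xs \<subseteq> - X}" by auto
    then show ?thesis using measure_pmf.prob_compl[of "{xs. set xs \<subseteq> - X}" "replicate_pmf N D"] by simp
  qed
  ultimately show ?thesis by simp
qed

text \<open>The flat chosen has a cover width no larger than that of \<open>F\<close>, hence no
  larger than the admissible radius. Since the cover width is an infimum,
  \<open>card_le_attained\<close> is needed to cover enough points at that radius itself.\<close>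

lemma best_flat_approx:
  assumes P: "finite P" and \<alpha>: "\<alpha> \<le> 1" "\<alpha> = 1 - \<delta> - \<gamma>" and W: "0 \<le> (1 + \<epsilon>) * opt_width d j P \<gamma>"
    and F: "F \<in> set Fs" "is_approx d j P \<gamma> \<epsilon> \<delta> F"
  shows "best_flat d j P \<alpha> Fs \<in> set Fs \<and> is_approx d j P \<gamma> \<epsilon> \<delta> (best_flat d j P \<alpha> Fs)"
proof -
  let ?W = "(1 + \<epsilon>) * opt_width d j P \<gamma>" and ?B = "best_flat d j P \<alpha> Fs"
  let ?S = "\<lambda>F. {w. 0 \<le> w \<and> real (card {p \<in> P. flat_dist F p \<le> w}) \<ge> \<alpha> * real (card P)}"
  have "finite {G \<in> set Fs. is_flat d j G}" "{G \<in> set Fs. is_flat d j G} \<noteq> {}"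
    using F by (auto simp: is_approx_def)
  then have "\<exists>x. is_arg_min (cover_width P \<alpha>) (\<lambda>G. G \<in> {G \<in> set Fs. is_flat d j G}) x"
    by (rule ex_is_arg_min_if_finite)
  then have "is_arg_min (cover_width P \<alpha>) (\<lambda>G. G \<in> set Fs \<and> is_flat d j G) ?B"
    unfolding best_flat_def arg_min_def by (metis (mono_tags, lifting) mem_Collect_eq someI_ex is_arg_min_def)
  then have B: "?B \<in> set Fs" "is_flat d j ?B" and le: "cover_width P \<alpha> ?B \<le> cover_width P \<alpha> F"
    using F by (auto simp: is_arg_min_linorder is_approx_def)
  have bdd: "bdd_below (?S G)" for G by (rule bdd_belowI[of _ 0]) auto
  have "cover_width P \<alpha> F \<le> ?W" unfolding cover_width_def
    by (rule cInf_lower[OF _ bdd]) (use F W \<alpha> in \<open>auto simp: is_approx_def\<close>)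
  then have le: "Inf (?S ?B) \<le> ?W" using le by (simp add: cover_width_def)
  have ne: "?S ?B \<noteq> {}"
  proof -
    define M where "M = Max (insert 0 (flat_dist ?B ` P))"
    have "{p \<in> P. flat_dist ?B p \<le> M} = P" using P by (auto simp: M_def)
    moreover have "0 \<le> M" using P by (simp add: M_def)
    moreover have "\<alpha> * real (card P) \<le> 1 * real (card P)" using \<alpha>(1) by (intro mult_right_mono) auto
    ultimately have "M \<in> ?S ?B" by simp
    then show ?thesis by blast
  qed
  have "\<alpha> * real (card P) \<le> real (card {p \<in> P. flat_dist ?B p \<le> ?W})"
  proof (rule card_le_attained[OF P])
    fix w assume "?W < w"
    then have "Inf (?S ?B) < w" using le by simp
    from cInf_lessD[OF ne this] show "\<exists>w'<w. \<alpha> * real (card P) \<le> real (card {p \<in> P. flat_dist ?B p \<le> w'})" by auto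
  qed
  then show ?thesis using B \<alpha>(2) by (simp add: is_approx_def)
qed

section \<open>The optimal width as an infimum, and the passage to it\<close>

lemma flat_dist_nonneg: "0 \<le> flat_dist F p"
proof -
  have "0 \<le> scalar_prod v v" for v :: rvec by (simp add: scalar_prod_def sum_nonneg)
  then show ?thesis by (simp add: flat_dist_def Let_def)
qed

lemma is_flat_exists:
  assumes "j \<le> d"
  shows "\<exists>F. is_flat d j F"
proof -
  define v where "v i = (unit_vec d (i - 1) :: rvec)" for i
  have c: "v i \<in> carrier_vec d" for i by (simp add: v_def)
  have "ons (\<lambda>i. vf (v i)) j"
    unfolding ons_def
  proof (intro ballI)
    fix i k assume "i \<in> {1..j}" "k \<in> {1..j}"
    then have "i - 1 < d" "k - 1 < d" "i - 1 = k - 1 \<longleftrightarrow> i = k" "k - 1 = i - 1 \<longleftrightarrow> i = k" using assms by auto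
    then show "inner (vf (v i)) (vf (v k)) = (if i = k then 1 else 0)"
      unfolding inner_vf[OF c c] by (simp add: v_def)
  qed
  from orthonormal_is_flat(1)[OF c this refl] show ?thesis by blast
qed

lemma opt_width_properties:
  fixes P :: "rvec set"
  assumes "j \<le> d" "finite P" "1 \<le> card P" "0 < \<gamma>" "\<gamma> < 1"
  shows "0 \<le> opt_width d j P \<gamma>"
    and "opt_width d j P \<gamma> < w \<Longrightarrow> \<exists>F P'. is_flat d j F \<and> P' \<subseteq> P \<and>
      card P' = nat \<lceil>(1 - \<gamma>) * real (card P)\<rceil> \<and> (\<forall>p\<in>P'. flat_dist F p \<le> w)"
proof -
  let ?m = "nat \<lceil>(1 - \<gamma>) * real (card P)\<rceil>"
  let ?S = "{Max (flat_dist F ` P') | F P'. is_flat d j F \<and> P' \<subseteq> P \<and> card P' = ?m}"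
  have "0 < (1 - \<gamma>) * real (card P)" using assms by simp
  \<comment> \<open>At least one inlier is required, so every \<open>Max\<close> in the definition
    of the optimum is over a nonempty set.\<close>
  then have m1: "1 \<le> ?m" by linarith
  have "(1 - \<gamma>) * real (card P) \<le> 1 * real (card P)" using assms by (intro mult_right_mono) auto
  then have "?m \<le> card P" by linarith
  then obtain P' where "P' \<subseteq> P" "card P' = ?m" by (rule obtain_subset_with_card_n)
  then have ne: "?S \<noteq> {}" using is_flat_exists[OF assms(1)] by blast
  have fin: "finite P'" "P' \<noteq> {}" if "P' \<subseteq> P" "card P' = ?m" for P'
    using that assms(2) m1 by (auto intro: finite_subset)
  have "0 \<le> x" if "x \<in> ?S" for x
  proof -
    obtain F P' where FP: "x = Max (flat_dist F ` P')" "P' \<subseteq> P" "card P' = ?m" using \<open>x \<in> ?S\<close> by blast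
    then have "x \<in> flat_dist F ` P'" using fin[of P'] by (simp add: Max_in)
    then show ?thesis using flat_dist_nonneg by auto
  qed
  then show "0 \<le> opt_width d j P \<gamma>" unfolding opt_width_def by (intro cInf_greatest[OF ne])
  assume "opt_width d j P \<gamma> < w"
  then have "Inf ?S < w" by (simp add: opt_width_def)
  from cInf_lessD[OF ne this] obtain F P' where FP: "is_flat d j F" "P' \<subseteq> P" "card P' = ?m" "Max (flat_dist F ` P') < w"
    by blast
  have "flat_dist F p \<le> w" if "p \<in> P'" for p
  proof -
    have "flat_dist F p \<le> Max (flat_dist F ` P')" using fin[OF FP(2,3)] that by simp
    then show ?thesis using FP(4) by simp
  qed
  then show "\<exists>F P'. is_flat d j F \<and> P' \<subseteq> P \<and> card P' = ?m \<and> (\<forall>p\<in>P'. flat_dist F p \<le> w)"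
    using FP by blast
qed

lemma fit_prog_correct:
  fixes n d j :: nat and P :: "rvec set" and \<eta>\<^sub>1 \<eta>\<^sub>2 :: real
  assumes dj: "1 \<le> d" "j \<le> d" and n: "1 \<le> n" and P: "P \<subseteq> carrier_vec d" "finite P" "card P = n" "set ps = P" "distinct ps"
    and \<gamma>: "0 < \<gamma>" "\<gamma> < 1" and \<epsilon>: "0 < \<epsilon>" "\<epsilon> < 1" and \<delta>: "0 < \<delta>" "\<delta> < 1"
  defines "s\<^sub>0 \<equiv> init_state [n, d, j] [\<gamma>, \<epsilon>, \<delta>, \<eta>\<^sub>1, \<eta>\<^sub>2]"
  shows "halts_within fit_prog ps s\<^sub>0 (50 * d * fit_time j \<epsilon> \<delta> \<gamma>)"
    and "running_time fit_prog ps s\<^sub>0 \<le> 50 * d * fit_time j \<epsilon> \<delta> \<gamma>"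
    and "(1 - \<gamma>) * (\<delta> / (3 * (\<gamma> + \<delta>))) ^ fit_exp j \<epsilon>
      \<le> measure_pmf.prob (output_pmf fit_prog d j ps s\<^sub>0) {F. is_approx d j P \<gamma> \<epsilon> \<delta> F}"
proof -
  let ?T = "50 * d * fit_time j \<epsilon> \<delta> \<gamma>" and ?W = "opt_width d j P \<gamma>"
  let ?c = "(1 - \<gamma>) * (\<delta> / (3 * (\<gamma> + \<delta>))) ^ fit_exp j \<epsilon>"
  define R where "R = run fit_prog ps s\<^sub>0 ?T"
  define E where "E r = {s. (1 - \<delta> - \<gamma>) * real n \<le> card {p \<in> P. flat_dist (output_flat d j s) p \<le> (1 + \<epsilon>) * r}}" for r
  have n': "1 \<le> card P" using n P(3) by simp
  note ow = opt_width_properties[OF dj(2) P(2) n' \<gamma>]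
  have main: "(\<forall>s\<in>set_pmf R. halted fit_prog s \<and> is_flat d j (output_flat d j s)) \<and> ?c \<le> measure_pmf.prob R (E w)"
    if w: "?W < w" for w
  proof -
    obtain F P' where FP: "is_flat d j F" "P' \<subseteq> P" "card P' = nat \<lceil>(1 - \<gamma>) * real n\<rceil>" "\<And>p. p \<in> P' \<Longrightarrow> flat_dist F p \<le> w"
      using ow(2)[OF w] P(3) by blast
    \<comment> \<open>The optimum may be 0, but the widths above it are positive, as
      \<open>fitting\<close> requires.\<close>
    have w0: "0 < w" using w ow(1) by simp
    note o = fit_prog_output[OF dj n P \<gamma> \<epsilon> \<delta> FP w0, where ?\<eta>\<^sub>1 = \<eta>\<^sub>1 and ?\<eta>\<^sub>2 = \<eta>\<^sub>2, folded s\<^sub>0_def, folded R_def]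
    show ?thesis using o unfolding E_def by blast
  qed
  have supp: "\<forall>s\<in>set_pmf R. halted fit_prog s \<and> is_flat d j (output_flat d j s)" using main[of "?W + 1"] by simp
  show h: "halts_within fit_prog ps s\<^sub>0 ?T" using supp by (simp add: halts_within_def R_def)
  show rt: "running_time fit_prog ps s\<^sub>0 \<le> ?T" unfolding running_time_def using h by (rule Least_le)
  have "halts_within fit_prog ps s\<^sub>0 (running_time fit_prog ps s\<^sub>0)" unfolding running_time_def using h by (rule LeastI)
  from run_stable[OF this rt] have out: "output_pmf fit_prog d j ps s\<^sub>0 = map_pmf (output_flat d j) R"
    by (simp add: output_pmf_def R_def)
  define A where "A k = E (?W + 1 / real (Suc k))" for k
  have mono: "E r \<subseteq> E r'" if "r \<le> r'" for r r'
  proof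
    fix s assume s: "s \<in> E r"
    have "(1 + \<epsilon>) * r \<le> (1 + \<epsilon>) * r'" using that \<epsilon> by (intro mult_left_mono) auto
    then have "card {p \<in> P. flat_dist (output_flat d j s) p \<le> (1 + \<epsilon>) * r} \<le>
      card {p \<in> P. flat_dist (output_flat d j s) p \<le> (1 + \<epsilon>) * r'}" using P(2) by (intro card_mono) auto
    then show "s \<in> E r'" using s unfolding E_def mem_Collect_eq by linarith
  qed
  \<comment> \<open>The success events shrink with the width while \<open>R\<close> stays the same,
    so continuity from above carries the bound over to their intersection.\<close>
  have "decseq A" unfolding A_def by (intro decseq_SucI mono) (simp add: frac_le)
  then have "(\<lambda>k. measure_pmf.prob R (A k)) \<longlonglongrightarrow> measure_pmf.prob R (\<Inter>k. A k)"
    by (intro measure_pmf.finite_Lim_measure_decseq) auto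
  moreover have "?c \<le> measure_pmf.prob R (A k)" for k using main[of "?W + 1 / real (Suc k)"] by (simp add: A_def)
  ultimately have "?c \<le> measure_pmf.prob R (\<Inter>k. A k)" by (intro LIMSEQ_le_const) auto
  also have "\<dots> \<le> measure_pmf.prob R (E ?W)"
  proof (rule measure_pmf.finite_measure_mono)
    show "(\<Inter>k. A k) \<subseteq> E ?W"
    proof
      fix s assume s: "s \<in> (\<Inter>k. A k)"
      have "(1 - \<delta> - \<gamma>) * real n \<le> card {p \<in> P. flat_dist (output_flat d j s) p \<le> (1 + \<epsilon>) * ?W}"
      proof (rule card_le_attained[OF P(2)])
        fix w assume w: "(1 + \<epsilon>) * ?W < w"
        define t where "t = w / (1 + \<epsilon>) - ?W"
        have "0 < t" using w \<epsilon> by (simp add: t_def pos_less_divide_eq mult.commute)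
        then obtain k where k: "1 / real (Suc k) < t" using nat_approx_posE by blast
        have "(1 + \<epsilon>) * (?W + 1 / real (Suc k)) < (1 + \<epsilon>) * (?W + t)" using k \<epsilon> by (intro mult_strict_left_mono) auto
        also have "\<dots> = w" using \<epsilon> by (simp add: t_def)
        finally show "\<exists>w'<w. (1 - \<delta> - \<gamma>) * real n \<le> card {p \<in> P. flat_dist (output_flat d j s) p \<le> w'}"
          using s unfolding A_def E_def by blast
      qed
      then show "s \<in> E ?W" by (simp add: E_def)
    qed
  qed simp
  also have "\<dots> \<le> measure_pmf.prob R (output_flat d j -` {F. is_approx d j P \<gamma> \<epsilon> \<delta> F})"
    by (rule measure_pmf.finite_measure_mono_AE)
      (use supp P(3) in \<open>auto simp: AE_measure_pmf_iff E_def is_approx_def\<close>)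
  finally show "?c \<le> measure_pmf.prob (output_pmf fit_prog d j ps s\<^sub>0) {F. is_approx d j P \<gamma> \<epsilon> \<delta> F}"
    by (simp add: out)
qed

text \<open>\<open>N\<close> is at least the inverse of the bound \<open>c\<close> for the success
  probability, so all runs fail with probability at most \<open>exp (- 1)\<close>, which is at most
  \<open>1 / 2\<close>.\<close>

lemma fit_prog_repeated:
  fixes n d j :: nat and P :: "rvec set" and \<eta>\<^sub>1 \<eta>\<^sub>2 :: real
  assumes dj: "1 \<le> d" "j \<le> d" and n: "1 \<le> n" and P: "P \<subseteq> carrier_vec d" "finite P" "card P = n" "set ps = P" "distinct ps"
    and \<gamma>: "0 < \<gamma>" "\<gamma> < 1" and \<epsilon>: "0 < \<epsilon>" "\<epsilon> < 1" and \<delta>: "0 < \<delta>" "\<delta> < 1" and \<eta>: "0 < \<eta>\<^sub>1" "\<eta>\<^sub>1 < 1"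
  defines "D \<equiv> output_pmf fit_prog d j ps (init_state [n, d, j] [\<gamma>, \<epsilon>, \<delta>, \<eta>\<^sub>1, \<eta>\<^sub>2])"
    and "N \<equiv> nat \<lceil>1 / (1 - \<gamma>) * (1 / (1 - \<eta>\<^sub>1) * (3 * (\<gamma> + \<delta>) / \<delta>)) ^ fit_exp j \<epsilon>\<rceil>"
  shows "1 / 2 \<le> measure_pmf.prob (replicate_pmf N D)
    {Fs. best_flat d j P (1 - \<delta> - \<gamma>) Fs \<in> set Fs \<and> is_approx d j P \<gamma> \<epsilon> \<delta> (best_flat d j P (1 - \<delta> - \<gamma>) Fs)}"
proof -
  define x where "x = \<delta> / (3 * (\<gamma> + \<delta>))"
  let ?g = "fit_exp j \<epsilon>" and ?X = "{F. is_approx d j P \<gamma> \<epsilon> \<delta> F}"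
  define c where "c = (1 - \<gamma>) * x ^ ?g"
  have x: "0 < x" using \<gamma> \<delta> by (simp add: x_def)
  have c0: "0 < c" using x \<gamma> by (simp add: c_def)
  have p: "c \<le> measure_pmf.prob D ?X" unfolding c_def x_def D_def by (rule fit_prog_correct(3)[OF dj n P \<gamma> \<epsilon> \<delta>])
  have N: "1 / c \<le> N"
  proof -
    have "1 / c = 1 / (1 - \<gamma>) * (1 * (3 * (\<gamma> + \<delta>) / \<delta>)) ^ ?g" by (simp add: c_def x_def power_divide)
    also have "\<dots> \<le> 1 / (1 - \<gamma>) * (1 / (1 - \<eta>\<^sub>1) * (3 * (\<gamma> + \<delta>) / \<delta>)) ^ ?g"
      using \<gamma> \<delta> \<eta> by (intro mult_left_mono power_mono mult_right_mono) auto
    also have "\<dots> \<le> N" unfolding N_def by linarith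
    finally show ?thesis .
  qed
  have c1: "c \<le> 1" using p measure_pmf.prob_le_1[of D ?X] by linarith
  have "(1 - measure_pmf.prob D ?X) ^ N \<le> (1 - c) ^ N" using p by (intro power_mono) auto
  also have "\<dots> \<le> exp (- c) ^ N" using exp_ge_add_one_self[of "- c"] c1 by (intro power_mono) auto
  also have "\<dots> = exp (- (c * N))" by (simp add: exp_of_nat_mult[symmetric] mult.commute)
  also have "\<dots> \<le> exp (- 1)" using N c0 by (simp add: field_simps)
  also have "\<dots> \<le> 1 / 2" using exp_ge_add_one_self[of 1] by (simp add: exp_minus field_simps)
  finally have "1 / 2 \<le> measure_pmf.prob (replicate_pmf N D) {Fs. \<exists>F\<in>set Fs. F \<in> ?X}"
    unfolding replicate_pmf_hits by linarith
  also have "\<dots> \<le> measure_pmf.prob (replicate_pmf N D)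
    {Fs. best_flat d j P (1 - \<delta> - \<gamma>) Fs \<in> set Fs \<and> is_approx d j P \<gamma> \<epsilon> \<delta> (best_flat d j P (1 - \<delta> - \<gamma>) Fs)}"
  proof (rule measure_pmf.finite_measure_mono)
    have W: "0 \<le> (1 + \<epsilon>) * opt_width d j P \<gamma>"
      using opt_width_properties(1)[OF dj(2) P(2) _ \<gamma>] n P(3) \<epsilon> by simp
    show "{Fs. \<exists>F\<in>set Fs. F \<in> ?X} \<subseteq>
      {Fs. best_flat d j P (1 - \<delta> - \<gamma>) Fs \<in> set Fs \<and> is_approx d j P \<gamma> \<epsilon> \<delta> (best_flat d j P (1 - \<delta> - \<gamma>) Fs)}"
      using best_flat_approx[OF P(2) _ refl W] \<gamma> \<delta> by fastforce
  qed simp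
  finally show ?thesis .
qed

section \<open>Polynomial bounds for the exponent and the running time\<close>

lemma scale_param_le:
  assumes "0 < \<epsilon>" "\<epsilon> < 1"
  shows "real (scale_param j \<epsilon>) \<le> 400 * (exp (8 * (real j)\<^sup>2) * (1 / \<epsilon> ^ max 1 j))"
proof -
  have "real (nat \<lceil>1 / \<epsilon>\<rceil>) \<le> 1 / \<epsilon> + 1" using assms by (simp add: ceiling_correct less_imp_le)
  also have "\<dots> \<le> 2 / \<epsilon>" using assms by (simp add: field_simps)
  \<comment> \<open>A factor \<open>1 / \<epsilon>\<close> is present even for \<open>j = 0\<close>,
    hence the maximum in the exponent.\<close>
  also have "\<dots> \<le> 2 / \<epsilon> ^ max 1 j"
  proof -
    have "\<epsilon> ^ max 1 j \<le> \<epsilon> ^ 1" using assms by (intro power_decreasing) auto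
    then show ?thesis using assms by (intro divide_left_mono) auto
  qed
  finally have e: "real (nat \<lceil>1 / \<epsilon>\<rceil>) \<le> 2 * (1 / \<epsilon> ^ max 1 j)" by simp
  \<comment> \<open>Origin of the constant 8: \<open>200 \<le> 2 ^ 8 \<le> exp 8\<close>, and a
    natural number is at most its square.\<close>
  have "(200::real) \<le> 2 ^ 8" by simp
  also have "\<dots> \<le> exp 1 ^ 8" using exp_ge_add_one_self[of 1] by (intro power_mono) auto
  also have "\<dots> = exp 8" by (simp add: exp_of_nat_mult[symmetric])
  finally have "(200::real) ^ j \<le> exp 8 ^ j" by (intro power_mono) auto
  also have "\<dots> = exp (8 * real j)" by (simp add: exp_of_nat_mult[symmetric] mult.commute)
  also have "\<dots> \<le> exp (8 * (real j)\<^sup>2)" by (cases "j = 0") (auto simp: power2_eq_square)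
  finally have "(200::real) ^ j \<le> exp (8 * (real j)\<^sup>2)" .
  then have "200 * 200 ^ j * real (nat \<lceil>1 / \<epsilon>\<rceil>) \<le> 200 * exp (8 * (real j)\<^sup>2) * (2 * (1 / \<epsilon> ^ max 1 j))"
    using e by (intro mult_mono) auto
  then show ?thesis by (simp add: scale_param_def mult.assoc)
qed

lemma scale_param_dominates:
  assumes "0 < \<epsilon>"
  shows "1 \<le> scale_param j \<epsilon>" "j \<le> scale_param j \<epsilon>" "nat \<lceil>1 / \<epsilon>\<rceil> \<le> scale_param j \<epsilon>"
proof -
  have "0 < 1 / \<epsilon>" using assms by simp
  then have k: "1 \<le> nat \<lceil>1 / \<epsilon>\<rceil>" by linarith
  have p: "1 \<le> (200::nat) ^ j" by simp
  have "j < 2 ^ j" by (rule less_exp)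
  also have "(2::nat) ^ j \<le> 200 ^ j" by (rule power_mono) auto
  finally have j: "j \<le> 200 ^ j" by simp
  have "200 ^ j * 1 \<le> 200 * 200 ^ j * nat \<lceil>1 / \<epsilon>\<rceil>" by (rule mult_le_mono[OF _ k]) simp
  then show "1 \<le> scale_param j \<epsilon>" "j \<le> scale_param j \<epsilon>" using p j unfolding scale_param_def by linarith+
  have "1 * nat \<lceil>1 / \<epsilon>\<rceil> \<le> 200 * 200 ^ j * nat \<lceil>1 / \<epsilon>\<rceil>" by (rule mult_le_mono1) (use p in linarith)
  then show "nat \<lceil>1 / \<epsilon>\<rceil> \<le> scale_param j \<epsilon>" by (simp add: scale_param_def)
qed

text \<open>The degree 6 is that of \<open>H ^ 3 * (2 * H\<^sup>2 * j)\<close>, with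
  \<open>j\<close> bounded by \<open>H\<close>.\<close>

lemma fit_exp_le:
  assumes "0 < \<epsilon>"
  shows "fit_exp j \<epsilon> \<le> 16 * scale_param j \<epsilon> ^ 6"
proof -
  define H where "H = scale_param j \<epsilon>"
  have H: "1 \<le> H" "j \<le> H" using scale_param_dominates[OF assms] by (auto simp: H_def)
  have pw: "H ^ k \<le> H ^ 6" if "k \<le> 6" for k using that H by (intro power_increasing) auto
  have "j * (j + 4) \<le> H * (H + 4 * H)" using H by (intro mult_le_mono) auto
  moreover have "H ^ 3 * (j + 4 + 2 * H\<^sup>2 * j) \<le> H ^ 3 * (H + 4 * H + 2 * H\<^sup>2 * H)"
    using H by (intro mult_le_mono add_le_mono) auto
  ultimately have "fit_exp j \<epsilon> \<le> H * (H + 4 * H) + 4 * H + H ^ 3 * (H + 4 * H + 2 * H\<^sup>2 * H)"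
    using H unfolding fit_exp_def Let_def H_def[symmetric] by linarith
  also have "\<dots> = 5 * H ^ 2 + 4 * H ^ 1 + 5 * H ^ 4 + 2 * H ^ 6"
    by (simp add: power_numeral_reduce algebra_simps)
  also have "\<dots> \<le> 16 * H ^ 6" using pw[of 2] pw[of 1] pw[of 4] by linarith
  finally show ?thesis by (simp add: H_def)
qed

text \<open>\<open>B\<close> bounds \<open>j\<close>, the ceiling of \<open>1 / \<epsilon>\<close>,
  \<open>H\<close> and the number of draws at once. The time is then bounded by a polynomial in
  \<open>B\<close> of degree 6, and 400 exceeds the sum of its coefficients.\<close>

lemma fit_time_le:
  assumes "0 < \<epsilon>"
  shows "fit_time j \<epsilon> \<delta> \<gamma> \<le> 400 * (scale_param j \<epsilon> * (nat \<lceil>1 / (2 * (\<gamma> + \<delta>))\<rceil> + 2)) ^ 6"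
proof -
  define H K where "H = scale_param j \<epsilon>" and "K = nat \<lceil>1 / (2 * (\<gamma> + \<delta>))\<rceil>"
  define B t where "B = H * (K + 2)" and "t = vprog.far_time j K"
  have H: "1 \<le> H" "j \<le> H" "nat \<lceil>1 / \<epsilon>\<rceil> \<le> H" using scale_param_dominates[OF assms] by (auto simp: H_def)
  have HB: "H \<le> B" unfolding B_def by simp
  have B: "1 \<le> B" "j \<le> B" "nat \<lceil>1 / \<epsilon>\<rceil> \<le> B" using H HB by auto
  have pw: "B ^ k \<le> B ^ 6" if "k \<le> 6" for k using that B by (intro power_increasing) auto
  have "1 * (K + 1) \<le> H * (K + 1)" using H by (intro mult_le_mono1) auto
  then have KB: "j + (K + 1) \<le> B" using H unfolding B_def by (simp add: algebra_simps)
  have v1: "vprog 1" by unfold_locales simp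
  have "t = (6 * j + 20) * (j + (K + 1))" by (simp add: t_def vprog.far_time_def[OF v1] algebra_simps)
  also have "\<dots> \<le> (6 * B + 20 * B) * B" using KB B by (intro mult_le_mono add_le_mono) auto
  finally have t: "t \<le> 26 * B\<^sup>2" by (simp add: power2_eq_square algebra_simps)
  have a: "j * (t + 15) \<le> B * (26 * B\<^sup>2 + 15)" using B t by (intro mult_le_mono) auto
  have "j * (18 * H\<^sup>2 + 40) \<le> B * (18 * B\<^sup>2 + 40)" using B HB by (intro mult_le_mono add_le_mono power_mono) auto
  then have b: "H ^ 3 * (t + j * (18 * H\<^sup>2 + 40) + 27) \<le> B ^ 3 * (26 * B\<^sup>2 + B * (18 * B\<^sup>2 + 40) + 27)"
    using t HB B by (intro mult_le_mono add_le_mono power_mono) auto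
  have c: "24 * j * j \<le> 24 * B * B" using B by (intro mult_le_mono) auto
  have "fit_time j \<epsilon> \<delta> \<gamma> \<le> (10 * B + 4 * B + 30) + ((B * (26 * B\<^sup>2 + 15) + 4) + ((26 * B\<^sup>2 + 2) +
       ((B ^ 3 * (26 * B\<^sup>2 + B * (18 * B\<^sup>2 + 40) + 27) + 3) + (24 * B * B + 45 * B + 17))))"
    unfolding fit_time_def Let_def H_def[symmetric] K_def[symmetric] t_def[symmetric]
    by (intro add_le_mono a b c) (use B t in auto)
  also have "\<dots> = 18 * B ^ 6 + 26 * B ^ 5 + 40 * B ^ 4 + 53 * B ^ 3 + 50 * B ^ 2 + 74 * B ^ 1 + 56 * B ^ 0"
    by (simp add: power_numeral_reduce algebra_simps)
  also have "\<dots> \<le> 400 * B ^ 6" using pw[of 5] pw[of 4] pw[of 3] pw[of 2] pw[of 1] pw[of 0] by linarith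
  finally show ?thesis by (simp add: B_def H_def K_def)
qed

text \<open>One number has to serve as factor and as exponent, so the leading constant is taken for
  both; a larger exponent does no harm because the base is at least 1.\<close>

definition fit_degree :: nat where "fit_degree = 400 * 1600 ^ 6"

lemma fit_degree_bound:
  assumes "1 \<le> Z" "y \<le> 400 * (1600 * Z) ^ 6"
  shows "y \<le> real fit_degree * Z ^ fit_degree"
proof -
  have "Z ^ 6 \<le> Z ^ fit_degree" using assms(1) by (intro power_increasing) (auto simp: fit_degree_def)
  then have "400 * 1600 ^ 6 * Z ^ 6 \<le> 400 * 1600 ^ 6 * Z ^ fit_degree" by (intro mult_left_mono) auto
  then show ?thesis using assms(2) by (simp add: fit_degree_def power_mult_distrib)
qed

lemma fit_exp_poly:
  assumes \<epsilon>: "0 < \<epsilon>" "\<epsilon> < 1"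
  shows "real (fit_exp j \<epsilon>) \<le> real fit_degree * (exp (8 * (real j)\<^sup>2) * (1 / \<epsilon> ^ max 1 j)) ^ fit_degree"
proof (rule fit_degree_bound)
  let ?Z = "exp (8 * (real j)\<^sup>2) * (1 / \<epsilon> ^ max 1 j)"
  have "\<epsilon> ^ max 1 j \<le> 1" using \<epsilon> by (intro power_le_one) auto
  then have "1 * 1 \<le> ?Z" using \<epsilon> by (intro mult_mono) auto
  then show Z: "1 \<le> ?Z" by simp
  have "real (fit_exp j \<epsilon>) \<le> real (16 * scale_param j \<epsilon> ^ 6)" using fit_exp_le[OF \<epsilon>(1)] by (rule of_nat_mono)
  also have "\<dots> = 16 * real (scale_param j \<epsilon>) ^ 6" by simp
  also have "\<dots> \<le> 400 * (1600 * ?Z) ^ 6"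
    using scale_param_le[OF \<epsilon>, of j] Z by (intro mult_mono power_mono) auto
  finally show "real (fit_exp j \<epsilon>) \<le> 400 * (1600 * ?Z) ^ 6" .
qed

lemma fit_time_poly:
  assumes \<epsilon>: "0 < \<epsilon>" "\<epsilon> < 1" and \<delta>: "0 < \<delta>" "\<delta> < 1" and \<gamma>: "0 < \<gamma>" "\<gamma> < 1"
  shows "real (fit_time j \<epsilon> \<delta> \<gamma>) \<le> real fit_degree *
    (exp (8 * (real j)\<^sup>2) * (1 / \<epsilon> ^ max 1 j) * (1 / \<delta>) * (1 / \<gamma>)) ^ fit_degree"
proof (rule fit_degree_bound)
  let ?Y = "exp (8 * (real j)\<^sup>2) * (1 / \<epsilon> ^ max 1 j)" and ?K = "nat \<lceil>1 / (2 * (\<gamma> + \<delta>))\<rceil>"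
  let ?Z = "?Y * (1 / \<delta>) * (1 / \<gamma>)"
  have "\<epsilon> ^ max 1 j \<le> 1" using \<epsilon> by (intro power_le_one) auto
  then have "1 * 1 \<le> ?Y" using \<epsilon> by (intro mult_mono) auto
  then have Y: "1 \<le> ?Y" by simp
  then have "1 * 1 * 1 \<le> ?Z" using \<epsilon> \<delta> \<gamma> by (intro mult_mono) auto
  then show Z: "1 \<le> ?Z" by simp
  have "0 < 1 / (2 * (\<gamma> + \<delta>))" using \<gamma> \<delta> by simp
  then have "real ?K \<le> 1 / (2 * (\<gamma> + \<delta>)) + 1" by linarith
  also have "1 / (2 * (\<gamma> + \<delta>)) \<le> 1 / \<delta>" using \<gamma> \<delta> by (intro divide_left_mono) auto
  finally have "real ?K + 2 \<le> 1 / \<delta> + 3" by simp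
  also have "\<dots> \<le> 4 * (1 / \<delta>)" using \<delta> by (simp add: field_simps)
  finally have K: "real ?K + 2 \<le> 4 * (1 / \<delta>)" .
  have "real (scale_param j \<epsilon>) * (real ?K + 2) \<le> (400 * ?Y) * (4 * (1 / \<delta>))"
    using scale_param_le[OF \<epsilon>, of j] K Y by (intro mult_mono) auto
  also have "\<dots> = 1600 * (?Y * (1 / \<delta>)) * 1" by simp
  also have "\<dots> \<le> 1600 * (?Y * (1 / \<delta>)) * (1 / \<gamma>)" using \<epsilon> \<gamma> \<delta> by (intro mult_left_mono) auto
  also have "\<dots> = 1600 * ?Z" by simp
  finally have B: "real (scale_param j \<epsilon>) * (real ?K + 2) \<le> 1600 * ?Z" .
  have "real (fit_time j \<epsilon> \<delta> \<gamma>) \<le> real (400 * (scale_param j \<epsilon> * (?K + 2)) ^ 6)"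
    using fit_time_le[OF \<epsilon>(1)] by (rule of_nat_mono)
  also have "\<dots> = 400 * (real (scale_param j \<epsilon>) * (real ?K + 2)) ^ 6"
    by (simp only: of_nat_mult of_nat_add of_nat_power of_nat_numeral)
  also have "\<dots> \<le> 400 * (1600 * ?Z) ^ 6" using B by (intro mult_left_mono power_mono) auto
  finally show "real (fit_time j \<epsilon> \<delta> \<gamma>) \<le> 400 * (1600 * ?Z) ^ 6" .
qed

theorem theorem14:
  shows "\<exists>(A :: program) (g :: nat \<Rightarrow> real \<Rightarrow> nat) (g' :: nat \<Rightarrow> real \<Rightarrow> real \<Rightarrow> real \<Rightarrow> nat)
      (c :: real) (K :: nat) (C\<^sub>T :: real) (C\<^sub>N :: real) (C\<^sub>\<eta> :: real) (\<rho> :: real).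
    0 < C\<^sub>N \<and> 0 < C\<^sub>\<eta> \<and> 0 < \<rho> \<and>
    (\<forall>j. \<forall>\<epsilon>\<in>{0<..<1}.
       real (g j \<epsilon>) \<le> real K * (exp (c * (real j)\<^sup>2) * (1 / \<epsilon> ^ max 1 j)) ^ K) \<and>
    (\<forall>j. \<forall>\<epsilon>\<in>{0<..<1}. \<forall>\<delta>\<in>{0<..<1}. \<forall>\<gamma>\<in>{0<..<1}.
       real (g' j \<epsilon> \<delta> \<gamma>)
         \<le> real K * (exp (c * (real j)\<^sup>2) * (1 / \<epsilon> ^ max 1 j) * (1 / \<delta>) * (1 / \<gamma>)) ^ K) \<and>
    (\<forall>(j :: nat) (d :: nat) (n :: nat) (P :: rvec set) (ps :: rvec list).
     \<forall>\<gamma>\<in>{0<..<1}. \<forall>\<epsilon>\<in>{0<..<1}. \<forall>\<delta>\<in>{0<..<1}. \<forall>\<eta>\<^sub>1\<in>{0<..<1}. \<forall>\<eta>\<^sub>2\<in>{0<..<1}.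
       1 \<le> d \<and> j \<le> d \<and> 1 \<le> n \<and> P \<subseteq> carrier_vec d \<and> finite P \<and> card P = n \<and>
       set ps = P \<and> distinct ps \<longrightarrow>
       (let s\<^sub>0 = init_state [n, d, j] [\<gamma>, \<epsilon>, \<delta>, \<eta>\<^sub>1, \<eta>\<^sub>2];
            D = output_pmf A d j ps s\<^sub>0;
            N = nat \<lceil>C\<^sub>N * (1 / (1 - \<gamma>) * (1 / (1 - \<eta>\<^sub>1) * (3 * (\<gamma> + \<delta>) / \<delta>)) ^ g j \<epsilon>)\<rceil>
        in (\<exists>t. halts_within A ps s\<^sub>0 t) \<and>
           real (running_time A ps s\<^sub>0) \<le> C\<^sub>T * 2 ^ g' j \<epsilon> \<delta> \<gamma> * real d \<and>
           measure_pmf.prob D {F. is_approx d j P \<gamma> \<epsilon> \<delta> F}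
             \<ge> (1 - \<gamma>) * ((1 - \<eta>\<^sub>1) * (1 - \<eta>\<^sub>2) * (\<delta> / (3 * (\<gamma> + \<delta>)))) ^ g j \<epsilon> \<and>
           (\<eta>\<^sub>2 \<le> C\<^sub>\<eta> / (2 ^ g j \<epsilon> * real N) \<longrightarrow>
              measure_pmf.prob (replicate_pmf N D)
                {Fs. best_flat d j P (1 - \<delta> - \<gamma>) Fs \<in> set Fs \<and>
                     is_approx d j P \<gamma> \<epsilon> \<delta> (best_flat d j P (1 - \<delta> - \<gamma>) Fs)} \<ge> \<rho>)))"
proof (intro exI conjI allI ballI impI)
  fix j :: nat and \<epsilon> :: real assume "\<epsilon> \<in> {0<..<1}"
  then show "real (fit_exp j \<epsilon>) \<le> real fit_degree * (exp (8 * (real j)\<^sup>2) * (1 / \<epsilon> ^ max 1 j)) ^ fit_degree"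
    by (intro fit_exp_poly) auto
next
  fix j :: nat and \<epsilon> \<delta> \<gamma> :: real assume "\<epsilon> \<in> {0<..<1}" "\<delta> \<in> {0<..<1}" "\<gamma> \<in> {0<..<1}"
  then show "real (fit_time j \<epsilon> \<delta> \<gamma>) \<le> real fit_degree *
    (exp (8 * (real j)\<^sup>2) * (1 / \<epsilon> ^ max 1 j) * (1 / \<delta>) * (1 / \<gamma>)) ^ fit_degree"
    by (intro fit_time_poly) auto
next
  fix j d n :: nat and P :: "rvec set" and ps :: "rvec list" and \<gamma> \<epsilon> \<delta> \<eta>\<^sub>1 \<eta>\<^sub>2 :: real
  assume "\<gamma> \<in> {0<..<1}" "\<epsilon> \<in> {0<..<1}" "\<delta> \<in> {0<..<1}" "\<eta>\<^sub>1 \<in> {0<..<1}" "\<eta>\<^sub>2 \<in> {0<..<1}"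
  then have \<gamma>: "0 < \<gamma>" "\<gamma> < 1" and \<epsilon>: "0 < \<epsilon>" "\<epsilon> < 1" and \<delta>: "0 < \<delta>" "\<delta> < 1"
    and \<eta>\<^sub>1: "0 < \<eta>\<^sub>1" "\<eta>\<^sub>1 < 1" and \<eta>\<^sub>2: "0 < \<eta>\<^sub>2" "\<eta>\<^sub>2 < 1" by auto
  assume "1 \<le> d \<and> j \<le> d \<and> 1 \<le> n \<and> P \<subseteq> carrier_vec d \<and> finite P \<and> card P = n \<and> set ps = P \<and> distinct ps"
  then have dj: "1 \<le> d" "j \<le> d" and n: "1 \<le> n"
    and P: "P \<subseteq> carrier_vec d" "finite P" "card P = n" "set ps = P" "distinct ps" by auto
  let ?s\<^sub>0 = "init_state [n, d, j] [\<gamma>, \<epsilon>, \<delta>, \<eta>\<^sub>1, \<eta>\<^sub>2]" and ?x = "\<delta> / (3 * (\<gamma> + \<delta>))"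
  let ?D = "output_pmf fit_prog d j ps ?s\<^sub>0"
  let ?N = "nat \<lceil>1 * (1 / (1 - \<gamma>) * (1 / (1 - \<eta>\<^sub>1) * (3 * (\<gamma> + \<delta>) / \<delta>)) ^ fit_exp j \<epsilon>)\<rceil>"
  note correct = fit_prog_correct[OF dj n P \<gamma> \<epsilon> \<delta>, where ?\<eta>\<^sub>1 = \<eta>\<^sub>1 and ?\<eta>\<^sub>2 = \<eta>\<^sub>2]
  have "\<exists>t. halts_within fit_prog ps ?s\<^sub>0 t" using correct(1) by blast
  \<comment> \<open>The time is \<open>d\<close> times a polynomial already;
    \<open>n < 2 ^ n\<close> brings it into the required form.\<close>
  moreover have "real (running_time fit_prog ps ?s\<^sub>0) \<le> 50 * 2 ^ fit_time j \<epsilon> \<delta> \<gamma> * real d"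
  proof -
    have "running_time fit_prog ps ?s\<^sub>0 \<le> 50 * d * 2 ^ fit_time j \<epsilon> \<delta> \<gamma>"
      using correct(2) mult_le_mono2[OF less_imp_le[OF less_exp[of "fit_time j \<epsilon> \<delta> \<gamma>"]], of "50 * d"] by linarith
    then have "real (running_time fit_prog ps ?s\<^sub>0) \<le> real (50 * d * 2 ^ fit_time j \<epsilon> \<delta> \<gamma>)" by (rule of_nat_mono)
    then show ?thesis by (simp add: mult_ac)
  qed
  moreover have "(1 - \<gamma>) * ((1 - \<eta>\<^sub>1) * (1 - \<eta>\<^sub>2) * ?x) ^ fit_exp j \<epsilon> \<le> measure_pmf.prob ?D {F. is_approx d j P \<gamma> \<epsilon> \<delta> F}"
  proof -
    have "(1 - \<eta>\<^sub>1) * (1 - \<eta>\<^sub>2) * ?x \<le> 1 * 1 * ?x"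
      using \<eta>\<^sub>1 \<eta>\<^sub>2 \<gamma> \<delta> by (intro mult_mono) auto
    then have "(1 - \<gamma>) * ((1 - \<eta>\<^sub>1) * (1 - \<eta>\<^sub>2) * ?x) ^ fit_exp j \<epsilon> \<le> (1 - \<gamma>) * ?x ^ fit_exp j \<epsilon>"
      using \<eta>\<^sub>1 \<eta>\<^sub>2 \<gamma> \<delta> by (intro mult_left_mono power_mono) auto
    then show ?thesis using correct(3) by linarith
  qed
  moreover have "1 / 2 \<le> measure_pmf.prob (replicate_pmf ?N ?D)
    {Fs. best_flat d j P (1 - \<delta> - \<gamma>) Fs \<in> set Fs \<and> is_approx d j P \<gamma> \<epsilon> \<delta> (best_flat d j P (1 - \<delta> - \<gamma>) Fs)}"
    using fit_prog_repeated[OF dj n P \<gamma> \<epsilon> \<delta> \<eta>\<^sub>1, where ?\<eta>\<^sub>2 = \<eta>\<^sub>2] by (simp only: mult_1)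
  ultimately show "let s\<^sub>0 = ?s\<^sub>0; D = output_pmf fit_prog d j ps s\<^sub>0; N = ?N
    in (\<exists>t. halts_within fit_prog ps s\<^sub>0 t) \<and>
       real (running_time fit_prog ps s\<^sub>0) \<le> 50 * 2 ^ fit_time j \<epsilon> \<delta> \<gamma> * real d \<and>
       measure_pmf.prob D {F. is_approx d j P \<gamma> \<epsilon> \<delta> F}
         \<ge> (1 - \<gamma>) * ((1 - \<eta>\<^sub>1) * (1 - \<eta>\<^sub>2) * ?x) ^ fit_exp j \<epsilon> \<and>
       (\<eta>\<^sub>2 \<le> 1 / (2 ^ fit_exp j \<epsilon> * real N) \<longrightarrow>
          measure_pmf.prob (replicate_pmf N D)
            {Fs. best_flat d j P (1 - \<delta> - \<gamma>) Fs \<in> set Fs \<and>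
                 is_approx d j P \<gamma> \<epsilon> \<delta> (best_flat d j P (1 - \<delta> - \<gamma>) Fs)} \<ge> 1 / 2)"
    unfolding Let_def by blast
qed (auto)

end
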